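(* Let $B$ be a finite left regular band and let $\Bbbk$ be a commutative ring with unit. Let $X,Y\in\Lambda(B)$. Then, as $\Bbbk$-modules, $$\operatorname{Ext}^n_{\Bbbk B}(\Bbbk_X,\Bbbk_Y)\cong\begin{cases}\widetilde H^{n-1}(\Delta(X,Y),\Bbbk), & \text{if } X<Y,\ n\ge 1,\\ \Bbbk, & \text{if } X=Y,\ n=0,\\ 0, & \text{otherwise.}\end{cases}$$
   Context: A left regular band is a monoid $B$ satisfying $x^2=x$ and $xyx=xy$ for all $x,y\in B$. For a finite left regular band $B$, $\Lambda(B)$ denotes the set of principal left ideals $Bb$ ($b\in B$) ordered by inclusion; it is a lattice whose meet is intersection. The support map $\sigma\colon B\to\Lambda(B)$, $\sigma(b)=Bb$, is a monoid homomorphism: $\sigma(ab)=\sigma(a)\cap\sigma(b)$. $B$ is partially ordered by $a\le b$ iff $ba=a$. For $X\in\Lambda(B)$ let $B_{\ge X}=\{b\in B\mid\sigma(b)\ge X\}$, a submonoid of $B$. For $X<Y$ in $\Lambda(B)$ choose $e\in B$ with $\sigma(e)=Y$; put $B[X,Y]=eB_{\ge X}=\{b\in B\mid b\le e,\ \sigma(b)\ge X\}$ (a left regular band with identity $e$, independent of the choice of $e$ up to isomorphism) and $B[X,Y)=B[X,Y]\setminus\{e\}$. $\Delta(X,Y)$ is the order complex of the poset $(B[X,Y),\le)$: the simplicial complex with vertex set $B[X,Y)$ whose simplices are the finite chains. $\Bbbk B$ is the monoid algebra; modules are left modules. $\Bbbk_X$ is the $\Bbbk B$-module with underlying $\Bbbk$-module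 $\Bbbk$ and action $b\cdot\alpha=\alpha$ if $\sigma(b)\ge X$ and $b\cdot\alpha=0$ otherwise ($b\in B$, $\alpha\in\Bbbk$). $\widetilde H^{*}$ denotes reduced cohomology. *)

theory Defs
  imports "HOL-Algebra.AbelCoset" "HOL-Algebra.Module"
begin

section \<open>Left modules\<close>

text \<open>
  The library locale \<^locale>\<open>module\<close> demands a commutative ring of scalars; monoid algebras are not
  commutative in general.  The record type \<^typ>\<open>('a, 'b) module\<close> is reused, and
  its multiplicative fields carry no meaning.
\<close>

locale left_module = R?: ring + M?: abelian_group M for M (structure) +
  assumes smult_closed [simp, intro]:
      "\<lbrakk>a \<in> carrier R; x \<in> carrier M\<rbrakk> \<Longrightarrow> a \<odot>\<^bsub>M\<^esub> x \<in> carrier M"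
    and smult_l_distr:
      "\<lbrakk>a \<in> carrier R; b \<in> carrier R; x \<in> carrier M\<rbrakk> \<Longrightarrow>
      (a \<oplus> b) \<odot>\<^bsub>M\<^esub> x = a \<odot>\<^bsub>M\<^esub> x \<oplus>\<^bsub>M\<^esub> b \<odot>\<^bsub>M\<^esub> x"
    and smult_r_distr:
      "\<lbrakk>a \<in> carrier R; x \<in> carrier M; y \<in> carrier M\<rbrakk> \<Longrightarrow>
      a \<odot>\<^bsub>M\<^esub> (x \<oplus>\<^bsub>M\<^esub> y) = a \<odot>\<^bsub>M\<^esub> x \<oplus>\<^bsub>M\<^esub> a \<odot>\<^bsub>M\<^esub> y"
    and smult_assoc1:
      "\<lbrakk>a \<in> carrier R; b \<in> carrier R; x \<in> carrier M\<rbrakk> \<Longrightarrow>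
      (a \<otimes> b) \<odot>\<^bsub>M\<^esub> x = a \<odot>\<^bsub>M\<^esub> (b \<odot>\<^bsub>M\<^esub> x)"
    and smult_one [simp]:
      "x \<in> carrier M \<Longrightarrow> \<one> \<odot>\<^bsub>M\<^esub> x = x"

text \<open>Homomorphisms are extensional, so that equality of homomorphisms is equality of functions.\<close>

definition lin_hom ::
    "('r, 's) ring_scheme \<Rightarrow> ('r, 'm) module \<Rightarrow> ('r, 'n) module \<Rightarrow> ('m \<Rightarrow> 'n) set" where
  "lin_hom R M N = {f \<in> carrier M \<rightarrow>\<^sub>E carrier N.
     (\<forall>x\<in>carrier M. \<forall>y\<in>carrier M. f (x \<oplus>\<^bsub>M\<^esub> y) = f x \<oplus>\<^bsub>N\<^esub> f y) \<and>
     (\<forall>a\<in>carrier R. \<forall>x\<in>carrier M. f (a \<odot>\<^bsub>M\<^esub> x) = a \<odot>\<^bsub>N\<^esub> f x)}"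

definition mod_iso :: "('r, 's) ring_scheme \<Rightarrow> ('r, 'm) module \<Rightarrow> ('r, 'n) module \<Rightarrow> bool" where
  "mod_iso R M N \<longleftrightarrow> (\<exists>f \<in> lin_hom R M N. bij_betw f (carrier M) (carrier N))"

definition self_module :: "('r, 's) ring_scheme \<Rightarrow> ('r, 'r) module" where
  "self_module R = \<lparr>carrier = carrier R, mult = undefined, one = undefined,
     zero = \<zero>\<^bsub>R\<^esub>, add = (\<oplus>\<^bsub>R\<^esub>), smult = (\<otimes>\<^bsub>R\<^esub>)\<rparr>"

definition free_module :: "('r, 's) ring_scheme \<Rightarrow> 'b set \<Rightarrow> ('r, 'b \<Rightarrow> 'r) module" where
  "free_module R S =
     \<lparr>carrier = {f \<in> S \<rightarrow>\<^sub>E carrier R. finite {s \<in> S. f s \<noteq> \<zero>\<^bsub>R\<^esub>}},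
      mult = undefined, one = undefined,
      zero = (\<lambda>s\<in>S. \<zero>\<^bsub>R\<^esub>), add = (\<lambda>f g. \<lambda>s\<in>S. f s \<oplus>\<^bsub>R\<^esub> g s),
      smult = (\<lambda>a f. \<lambda>s\<in>S. a \<otimes>\<^bsub>R\<^esub> f s)\<rparr>"

text \<open>
  Projective = direct summand of a free module.  Basis sets of type \<^typ>\<open>'p set\<close> suffice: a
  projective \<open>P\<close> is a summand of the free module on \<open>carrier P\<close>.
\<close>

definition projective_module :: "('r, 's) ring_scheme \<Rightarrow> ('r, 'p) module \<Rightarrow> bool" where
  "projective_module R P \<longleftrightarrow> left_module R P \<and>
     (\<exists>S :: 'p set. \<exists>i \<in> lin_hom R P (free_module R S). \<exists>\<pi> \<in> lin_hom R (free_module R S) P.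
        \<forall>x \<in> carrier P. \<pi> (i x) = x)"

definition projective_resolution ::
    "('r, 's) ring_scheme \<Rightarrow> (nat \<Rightarrow> ('r, 'p) module) \<Rightarrow> (nat \<Rightarrow> 'p \<Rightarrow> 'p) \<Rightarrow> ('p \<Rightarrow> 'm) \<Rightarrow>
     ('r, 'm) module \<Rightarrow> bool" where
  "projective_resolution R P d \<epsilon> M \<longleftrightarrow>
     left_module R M \<and>
     (\<forall>n. projective_module R (P n)) \<and>
     (\<forall>n. d n \<in> lin_hom R (P (Suc n)) (P n)) \<and>
     \<epsilon> \<in> lin_hom R (P 0) M \<and>
     \<epsilon> ` carrier (P 0) = carrier M \<and>
     d 0 ` carrier (P 1) = {x \<in> carrier (P 0). \<epsilon> x = \<zero>\<^bsub>M\<^esub>} \<and>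
     (\<forall>n. d (Suc n) ` carrier (P (Suc (Suc n)))
          = {x \<in> carrier (P (Suc n)). d n x = \<zero>\<^bsub>P n\<^esub>})"


section \<open>Cohomology and Ext\<close>

text \<open>The module \<open>Z / H\<close> for submodules \<open>H \<subseteq> Z\<close> of \<open>M\<close>.\<close>

definition subquotient :: "('k, 'm) module \<Rightarrow> 'm set \<Rightarrow> 'm set \<Rightarrow> ('k, 'm set) module" where
  "subquotient M Z H =
     \<lparr>carrier = (\<lambda>x. H +>\<^bsub>M\<^esub> x) ` Z, mult = undefined, one = undefined,
      zero = H, add = (<+>\<^bsub>M\<^esub>),
      smult = (\<lambda>a A. H <+>\<^bsub>M\<^esub> (\<lambda>x. a \<odot>\<^bsub>M\<^esub> x) ` A)\<rparr>"

text \<open>\<open>\<delta> n\<close> is the map from degree \<open>n\<close> to degree \<open>Suc n\<close>; degree \<open>-1\<close> is zero.\<close>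

definition cohomology ::
    "(nat \<Rightarrow> ('k, 'm) module) \<Rightarrow> (nat \<Rightarrow> 'm \<Rightarrow> 'm) \<Rightarrow> nat \<Rightarrow> ('k, 'm set) module" where
  "cohomology C \<delta> n = subquotient (C n)
     {x \<in> carrier (C n). \<delta> n x = \<zero>\<^bsub>C (Suc n)\<^esub>}
     (case n of 0 \<Rightarrow> {\<zero>\<^bsub>C 0\<^esub>} | Suc m \<Rightarrow> \<delta> m ` carrier (C m))"

text \<open>
  \<open>Hom\<^sub>R(M, N)\<close> as a module over the ground ring of an algebra \<open>R\<close>, where \<open>\<phi>\<close> is the structure
  map from the ground ring into the centre of \<open>R\<close>.
\<close>

definition hom_module ::
    "('r, 's) ring_scheme \<Rightarrow> ('k \<Rightarrow> 'r) \<Rightarrow> ('r, 'm) module \<Rightarrow> ('r, 'n) module \<Rightarrow>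
     ('k, 'm \<Rightarrow> 'n) module" where
  "hom_module R \<phi> M N =
     \<lparr>carrier = lin_hom R M N, mult = undefined, one = undefined,
      zero = (\<lambda>x\<in>carrier M. \<zero>\<^bsub>N\<^esub>),
      add = (\<lambda>f g. \<lambda>x\<in>carrier M. f x \<oplus>\<^bsub>N\<^esub> g x),
      smult = (\<lambda>c f. \<lambda>x\<in>carrier M. \<phi> c \<odot>\<^bsub>N\<^esub> f x)\<rparr>"

text \<open>
  \<open>Ext\<^sub>R\<^sup>n(M, N)\<close> computed from a projective resolution \<open>(P, d)\<close> of \<open>M\<close>: the cohomology of
  the complex \<open>Hom\<^sub>R(P\<^sub>n, N)\<close>.
\<close>

definition Ext ::
    "('r, 's) ring_scheme \<Rightarrow> ('k \<Rightarrow> 'r) \<Rightarrow> (nat \<Rightarrow> ('r, 'p) module) \<Rightarrow> (nat \<Rightarrow> 'p \<Rightarrow> 'p) \<Rightarrow>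
     ('r, 'n) module \<Rightarrow> nat \<Rightarrow> ('k, ('p \<Rightarrow> 'n) set) module" where
  "Ext R \<phi> P d N = cohomology (\<lambda>n. hom_module R \<phi> (P n) N)
     (\<lambda>n f. compose (carrier (P (Suc n))) f (d n))"


section \<open>Order complexes and reduced simplicial cohomology\<close>

text \<open>The empty simplex is included; it accounts for the reduced cohomology.\<close>

definition order_complex :: "'v set \<Rightarrow> ('v \<Rightarrow> 'v \<Rightarrow> bool) \<Rightarrow> 'v set set" where
  "order_complex V leq = {s. s \<subseteq> V \<and> finite s \<and> (\<forall>x\<in>s. \<forall>y\<in>s. leq x y \<or> leq y x)}"

text \<open>
  Cochains are graded by the number \<open>m\<close> of vertices, that is, by \<open>dimension + 1\<close>, so \<open>m = 0\<close> is the
  augmentation term.  The relation \<open>leq\<close> orders the vertices of every simplex; a vertex \<open>v\<close> of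
  \<open>s = {v\<^sub>0 < \<dots> < v\<^sub>m}\<close> occurs in position \<open>card {u \<in> s. u \<noteq> v \<and> leq u v}\<close>.
\<close>

definition cochains :: "('k, 's) ring_scheme \<Rightarrow> 'v set set \<Rightarrow> nat \<Rightarrow> ('k, 'v set \<Rightarrow> 'k) module" where
  "cochains K \<Delta> m =
     \<lparr>carrier = {s \<in> \<Delta>. card s = m} \<rightarrow>\<^sub>E carrier K, mult = undefined, one = undefined,
      zero = (\<lambda>s\<in>{s \<in> \<Delta>. card s = m}. \<zero>\<^bsub>K\<^esub>),
      add = (\<lambda>f g. \<lambda>s\<in>{s \<in> \<Delta>. card s = m}. f s \<oplus>\<^bsub>K\<^esub> g s),
      smult = (\<lambda>c f. \<lambda>s\<in>{s \<in> \<Delta>. card s = m}. c \<otimes>\<^bsub>K\<^esub> f s)\<rparr>"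

definition coboundary ::
    "('k, 's) ring_scheme \<Rightarrow> 'v set set \<Rightarrow> ('v \<Rightarrow> 'v \<Rightarrow> bool) \<Rightarrow> nat \<Rightarrow> ('v set \<Rightarrow> 'k) \<Rightarrow> 'v set \<Rightarrow> 'k" where
  "coboundary K \<Delta> leq m f = (\<lambda>s\<in>{s \<in> \<Delta>. card s = Suc m}.
     \<Oplus>\<^bsub>K\<^esub>v\<in>s. ((\<ominus>\<^bsub>K\<^esub> \<one>\<^bsub>K\<^esub>) [^]\<^bsub>K\<^esub> card {u \<in> s. u \<noteq> v \<and> leq u v}) \<otimes>\<^bsub>K\<^esub> f (s - {v}))"

definition reduced_cohomology ::
    "('k, 's) ring_scheme \<Rightarrow> 'v set set \<Rightarrow> ('v \<Rightarrow> 'v \<Rightarrow> bool) \<Rightarrow> nat \<Rightarrow> ('k, ('v set \<Rightarrow> 'k) set) module" where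
  "reduced_cohomology K \<Delta> leq q = cohomology (cochains K \<Delta>) (coboundary K \<Delta> leq) (Suc q)"


section \<open>Left regular bands\<close>

locale left_regular_band = monoid B for B (structure) +
  assumes idem: "x \<in> carrier B \<Longrightarrow> x \<otimes> x = x"
    and left_regular: "\<lbrakk>x \<in> carrier B; y \<in> carrier B\<rbrakk> \<Longrightarrow> x \<otimes> y \<otimes> x = x \<otimes> y"

definition lrb_support :: "('b, 's) monoid_scheme \<Rightarrow> 'b \<Rightarrow> 'b set" where
  "lrb_support B b = {x \<otimes>\<^bsub>B\<^esub> b | x. x \<in> carrier B}"

text \<open>The support lattice; its order is inclusion of sets.\<close>

definition lrb_lattice :: "('b, 's) monoid_scheme \<Rightarrow> 'b set set" where
  "lrb_lattice B = lrb_support B ` carrier B"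

definition lrb_le :: "('b, 's) monoid_scheme \<Rightarrow> 'b \<Rightarrow> 'b \<Rightarrow> bool" where
  "lrb_le B a b \<longleftrightarrow> b \<otimes>\<^bsub>B\<^esub> a = a"

definition lrb_above :: "('b, 's) monoid_scheme \<Rightarrow> 'b set \<Rightarrow> 'b set" where
  "lrb_above B X = {b \<in> carrier B. X \<subseteq> lrb_support B b}"

text \<open>
  \<open>B[X, Y)\<close> and \<open>\<Delta>(X, Y)\<close>, with \<open>Y\<close> given through a chosen \<open>e\<close> of support \<open>Y\<close>.
\<close>

definition lrb_interval :: "('b, 's) monoid_scheme \<Rightarrow> 'b set \<Rightarrow> 'b \<Rightarrow> 'b set" where
  "lrb_interval B X e = (\<lambda>b. e \<otimes>\<^bsub>B\<^esub> b) ` lrb_above B X - {e}"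

definition lrb_complex :: "('b, 's) monoid_scheme \<Rightarrow> 'b set \<Rightarrow> 'b \<Rightarrow> 'b set set" where
  "lrb_complex B X e = order_complex (lrb_interval B X e) (lrb_le B)"


section \<open>Monoid algebras\<close>

text \<open>For finite monoids only: no finiteness of support is imposed.\<close>

definition monoid_algebra ::
    "('k, 's) ring_scheme \<Rightarrow> ('b, 't) monoid_scheme \<Rightarrow> ('b \<Rightarrow> 'k) ring" where
  "monoid_algebra K B =
     \<lparr>carrier = carrier B \<rightarrow>\<^sub>E carrier K,
      mult = (\<lambda>f g. \<lambda>b\<in>carrier B.
        \<Oplus>\<^bsub>K\<^esub>p\<in>{(x, y). x \<in> carrier B \<and> y \<in> carrier B \<and> x \<otimes>\<^bsub>B\<^esub> y = b}. f (fst p) \<otimes>\<^bsub>K\<^esub> g (snd p)),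
      one = (\<lambda>b\<in>carrier B. if b = \<one>\<^bsub>B\<^esub> then \<one>\<^bsub>K\<^esub> else \<zero>\<^bsub>K\<^esub>),
      zero = (\<lambda>b\<in>carrier B. \<zero>\<^bsub>K\<^esub>),
      add = (\<lambda>f g. \<lambda>b\<in>carrier B. f b \<oplus>\<^bsub>K\<^esub> g b)\<rparr>"

definition monoid_algebra_scalar ::
    "('k, 's) ring_scheme \<Rightarrow> ('b, 't) monoid_scheme \<Rightarrow> 'k \<Rightarrow> 'b \<Rightarrow> 'k" where
  "monoid_algebra_scalar K B c = (\<lambda>b\<in>carrier B. if b = \<one>\<^bsub>B\<^esub> then c else \<zero>\<^bsub>K\<^esub>)"

text \<open>The module \<open>K\<^sub>X\<close>; the action of \<open>B\<close> is extended linearly to the monoid algebra.\<close>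

definition support_module ::
    "('k, 's) ring_scheme \<Rightarrow> ('b, 't) monoid_scheme \<Rightarrow> 'b set \<Rightarrow> ('b \<Rightarrow> 'k, 'k) module" where
  "support_module K B X =
     \<lparr>carrier = carrier K, mult = undefined, one = undefined, zero = \<zero>\<^bsub>K\<^esub>, add = (\<oplus>\<^bsub>K\<^esub>),
      smult = (\<lambda>f \<alpha>. \<Oplus>\<^bsub>K\<^esub>b\<in>carrier B. f b \<otimes>\<^bsub>K\<^esub> (if X \<subseteq> lrb_support B b then \<alpha> else \<zero>\<^bsub>K\<^esub>))\<rparr>"

section \<open>The monoid algebra and its modules \<open>K\<^sub>X\<close>\<close>

lemma (in abelian_monoid) finsum_swap:
  assumes "finite A" "finite C" "\<And>x y. x \<in> A \<Longrightarrow> y \<in> C \<Longrightarrow> f x y \<in> carrier G"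
  shows "(\<Oplus>x\<in>A. \<Oplus>y\<in>C. f x y) = (\<Oplus>y\<in>C. \<Oplus>x\<in>A. f x y)"
  using assms(1,3)
proof (induction A rule: finite_induct)
  case empty
  then show ?case by (simp add: finsum_zero)
next
  case (insert a A)
  have "(\<Oplus>x\<in>insert a A. \<Oplus>y\<in>C. f x y) = (\<Oplus>y\<in>C. f a y) \<oplus> (\<Oplus>y\<in>C. \<Oplus>x\<in>A. f x y)"
    using insert by (subst finsum_insert) (auto intro!: finsum_closed)
  also have "\<dots> = (\<Oplus>y\<in>C. f a y \<oplus> (\<Oplus>x\<in>A. f x y))"
    using insert by (subst finsum_addf) (auto intro!: finsum_closed)
  also have "\<dots> = (\<Oplus>y\<in>C. \<Oplus>x\<in>insert a A. f x y)"
    using insert by (intro finsum_cong') (auto intro!: finsum_closed)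
  finally show ?case .
qed

lemma (in abelian_monoid) finsum_zero_eqI:
  "(\<And>x. x \<in> A \<Longrightarrow> f x = \<zero>) \<Longrightarrow> (\<Oplus>x\<in>A. f x) = \<zero>"
  by (rule add.finprod_one_eqI)

lemma (in abelian_monoid) finsum_delta:
  assumes "finite A" "a \<in> A" "f a \<in> carrier G"
  shows "(\<Oplus>x\<in>A. if x = a then f x else \<zero>) = f a"
proof -
  have "(\<Oplus>x\<in>A. if a = x then f a else \<zero>) = f a"
    using assms by (intro add.finprod_singleton[where f = "\<lambda>_. f a"]) auto
  then show ?thesis by (simp add: eq_commute[of a] cong: if_cong)
qed

lemma (in abelian_monoid) finsum_if_eq:
  assumes "finite A" "\<And>x. x \<in> A \<Longrightarrow> P x \<Longrightarrow> f x \<in> carrier G"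
  shows "(\<Oplus>x\<in>{x \<in> A. P x}. f x) = (\<Oplus>x\<in>A. if P x then f x else \<zero>)"
  using assms by (intro add.finprod_mono_neutral_cong_left) auto

lemma (in abelian_monoid) finsum_Sigma_const:
  assumes "finite A" "finite C" "\<And>x y. x \<in> A \<Longrightarrow> y \<in> C \<Longrightarrow> f (x, y) \<in> carrier G"
  shows "(\<Oplus>p\<in>A \<times> C. f p) = (\<Oplus>x\<in>A. \<Oplus>y\<in>C. f (x, y))"
  using assms(1,3)
proof (induction A rule: finite_induct)
  case empty
  then show ?case by simp
next
  case (insert a A)
  have "insert a A \<times> C = Pair a ` C \<union> A \<times> C" by auto
  then have "(\<Oplus>p\<in>insert a A \<times> C. f p) = (\<Oplus>p\<in>Pair a ` C. f p) \<oplus> (\<Oplus>p\<in>A \<times> C. f p)"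
    using insert assms(2) by (simp only:, intro finsum_Un_disjoint) auto
  also have "(\<Oplus>p\<in>Pair a ` C. f p) = (\<Oplus>y\<in>C. f (a, y))"
    using insert by (intro finsum_reindex) (auto simp: inj_on_def)
  finally show ?case
    using insert by (subst finsum_insert) (auto intro!: finsum_closed)
qed

lemma monoid_algebra_mult_nested:
  assumes "cring K" "monoid B" "finite (carrier B)"
    and f: "f \<in> carrier (monoid_algebra K B)" and g: "g \<in> carrier (monoid_algebra K B)"
  shows "f \<otimes>\<^bsub>monoid_algebra K B\<^esub> g = (\<lambda>b\<in>carrier B. \<Oplus>\<^bsub>K\<^esub>x\<in>carrier B. \<Oplus>\<^bsub>K\<^esub>y\<in>carrier B.
           if x \<otimes>\<^bsub>B\<^esub> y = b then f x \<otimes>\<^bsub>K\<^esub> g y else \<zero>\<^bsub>K\<^esub>)"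
proof -
  interpret K: cring K by fact
  have fK: "f x \<in> carrier K" "g x \<in> carrier K" if "x \<in> carrier B" for x
    using f g that by (auto simp: monoid_algebra_def)
  have "(\<Oplus>\<^bsub>K\<^esub>p\<in>{(x, y). x \<in> carrier B \<and> y \<in> carrier B \<and> x \<otimes>\<^bsub>B\<^esub> y = b}. f (fst p) \<otimes>\<^bsub>K\<^esub> g (snd p))
      = (\<Oplus>\<^bsub>K\<^esub>x\<in>carrier B. \<Oplus>\<^bsub>K\<^esub>y\<in>carrier B.
           if x \<otimes>\<^bsub>B\<^esub> y = b then f x \<otimes>\<^bsub>K\<^esub> g y else \<zero>\<^bsub>K\<^esub>)" for b
  proof -
    have "{(x, y). x \<in> carrier B \<and> y \<in> carrier B \<and> x \<otimes>\<^bsub>B\<^esub> y = b}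
        = {p \<in> carrier B \<times> carrier B. fst p \<otimes>\<^bsub>B\<^esub> snd p = b}" by auto
    moreover have "(\<Oplus>\<^bsub>K\<^esub>p\<in>{p \<in> carrier B \<times> carrier B. fst p \<otimes>\<^bsub>B\<^esub> snd p = b}. f (fst p) \<otimes>\<^bsub>K\<^esub> g (snd p))
      = (\<Oplus>\<^bsub>K\<^esub>p\<in>carrier B \<times> carrier B. if fst p \<otimes>\<^bsub>B\<^esub> snd p = b then f (fst p) \<otimes>\<^bsub>K\<^esub> g (snd p) else \<zero>\<^bsub>K\<^esub>)"
      using assms(3) fK by (intro K.finsum_if_eq) auto
    ultimately show ?thesis using assms(3) fK by (simp add: K.finsum_Sigma_const cong: if_cong)
  qed
  then show ?thesis by (simp add: monoid_algebra_def)
qed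

lemma monoid_algebra_ring:
  assumes "cring K" "monoid B" "finite (carrier B)"
  shows "ring (monoid_algebra K B)"
proof -
  interpret K: cring K by fact
  interpret B: monoid B by fact
  let ?A = "monoid_algebra K B" and ?S = "carrier B"
  note nested = monoid_algebra_mult_nested[OF assms]
  have fin[simp]: "finite ?S" by fact
  have car: "f x \<in> carrier K" if "f \<in> carrier ?A" "x \<in> ?S" for f x
    using that by (auto simp: monoid_algebra_def)
  have arb: "f x = undefined" if "f \<in> carrier ?A" "x \<notin> ?S" for f x
    using that by (auto simp: monoid_algebra_def PiE_def extensional_def)
  have ab: "abelian_group ?A"
  proof (rule abelian_groupI)
    fix f assume f: "f \<in> carrier ?A"
    show "\<exists>g\<in>carrier ?A. g \<oplus>\<^bsub>?A\<^esub> f = \<zero>\<^bsub>?A\<^esub>"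
      using f car[OF f] by (intro bexI[of _ "\<lambda>b\<in>?S. \<ominus>\<^bsub>K\<^esub> f b"])
        (auto simp: monoid_algebra_def K.l_neg fun_eq_iff)
  next
    fix f assume f: "f \<in> carrier ?A"
    then show "\<zero>\<^bsub>?A\<^esub> \<oplus>\<^bsub>?A\<^esub> f = f"
      using car[OF f] arb[OF f] by (auto simp: monoid_algebra_def fun_eq_iff)
  next
    fix f g h assume "f \<in> carrier ?A" "g \<in> carrier ?A" "h \<in> carrier ?A"
    note c = this[THEN car]
    show "f \<oplus>\<^bsub>?A\<^esub> g \<oplus>\<^bsub>?A\<^esub> h = f \<oplus>\<^bsub>?A\<^esub> (g \<oplus>\<^bsub>?A\<^esub> h)"
      by (auto simp: monoid_algebra_def fun_eq_iff c K.a_assoc)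
  next
    fix f g assume "f \<in> carrier ?A" "g \<in> carrier ?A"
    note c = this[THEN car]
    show "f \<oplus>\<^bsub>?A\<^esub> g \<in> carrier ?A"
      using c by (auto simp: monoid_algebra_def)
    show "f \<oplus>\<^bsub>?A\<^esub> g = g \<oplus>\<^bsub>?A\<^esub> f"
      using c by (auto simp: monoid_algebra_def fun_eq_iff K.a_comm)
  qed (auto simp: monoid_algebra_def)
  have mc: "f \<otimes>\<^bsub>?A\<^esub> g \<in> carrier ?A" if "f \<in> carrier ?A" "g \<in> carrier ?A" for f g
  proof -
    have "(\<lambda>b\<in>?S. \<Oplus>\<^bsub>K\<^esub>x\<in>?S. \<Oplus>\<^bsub>K\<^esub>y\<in>?S. if x \<otimes>\<^bsub>B\<^esub> y = b then f x \<otimes>\<^bsub>K\<^esub> g y else \<zero>\<^bsub>K\<^esub>)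
          \<in> ?S \<rightarrow>\<^sub>E carrier K"
      using that by (auto intro!: K.finsum_closed simp: car)
    then show ?thesis using nested[OF that] by (simp add: monoid_algebra_def)
  qed
  have oc: "\<one>\<^bsub>?A\<^esub> \<in> carrier ?A" by (auto simp: monoid_algebra_def)
  have one: "\<one>\<^bsub>?A\<^esub> x = (if x = \<one>\<^bsub>B\<^esub> then \<one>\<^bsub>K\<^esub> else \<zero>\<^bsub>K\<^esub>)" if "x \<in> ?S" for x
    using that by (simp add: monoid_algebra_def)
  have ext: "f = g" if "f \<in> carrier ?A" "g \<in> carrier ?A" "\<And>x. x \<in> ?S \<Longrightarrow> f x = g x" for f g
    using that by (auto simp: monoid_algebra_def intro: PiE_ext)
  have mon: "monoid ?A"
  proof (rule monoidI)
    fix f assume f: "f \<in> carrier ?A"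
    show "\<one>\<^bsub>?A\<^esub> \<otimes>\<^bsub>?A\<^esub> f = f"
    proof (rule ext)
      fix b assume b: "b \<in> ?S"
      have "(\<one>\<^bsub>?A\<^esub> \<otimes>\<^bsub>?A\<^esub> f) b =
        (\<Oplus>\<^bsub>K\<^esub>x\<in>?S. if x = \<one>\<^bsub>B\<^esub> then \<Oplus>\<^bsub>K\<^esub>y\<in>?S. if y = b then f y else \<zero>\<^bsub>K\<^esub> else \<zero>\<^bsub>K\<^esub>)"
        unfolding nested[OF oc f] restrict_apply'[OF b] using f b
        by (intro K.finsum_cong') (auto simp: one car K.finsum_zero intro!: K.finsum_closed K.finsum_cong' K.finsum_zero_eqI)
      also have "\<dots> = (\<Oplus>\<^bsub>K\<^esub>y\<in>?S. if y = b then f y else \<zero>\<^bsub>K\<^esub>)"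
        using f by (intro K.finsum_delta) (auto simp: car intro!: K.finsum_closed)
      also have "\<dots> = f b" using f b by (intro K.finsum_delta) (auto simp: car)
      finally show "(\<one>\<^bsub>?A\<^esub> \<otimes>\<^bsub>?A\<^esub> f) b = f b" .
    qed (use f mc oc in auto)
    show "f \<otimes>\<^bsub>?A\<^esub> \<one>\<^bsub>?A\<^esub> = f"
    proof (rule ext)
      fix b assume b: "b \<in> ?S"
      have "(f \<otimes>\<^bsub>?A\<^esub> \<one>\<^bsub>?A\<^esub>) b =
        (\<Oplus>\<^bsub>K\<^esub>x\<in>?S. \<Oplus>\<^bsub>K\<^esub>y\<in>?S. if y = \<one>\<^bsub>B\<^esub> then (if x = b then f x else \<zero>\<^bsub>K\<^esub>) else \<zero>\<^bsub>K\<^esub>)"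
        unfolding nested[OF f oc] restrict_apply'[OF b] using f b
        by (intro K.finsum_cong') (auto simp: one car intro!: K.finsum_closed K.finsum_cong')
      also have "\<dots> = (\<Oplus>\<^bsub>K\<^esub>x\<in>?S. if x = b then f x else \<zero>\<^bsub>K\<^esub>)"
        using f by (intro K.finsum_cong' K.finsum_delta) (auto simp: car)
      also have "\<dots> = f b" using f b by (intro K.finsum_delta) (auto simp: car)
      finally show "(f \<otimes>\<^bsub>?A\<^esub> \<one>\<^bsub>?A\<^esub>) b = f b" .
    qed (use f mc oc in auto)
  next
    fix f g h assume f: "f \<in> carrier ?A" and g: "g \<in> carrier ?A" and h: "h \<in> carrier ?A"
    show "f \<otimes>\<^bsub>?A\<^esub> g \<otimes>\<^bsub>?A\<^esub> h = f \<otimes>\<^bsub>?A\<^esub> (g \<otimes>\<^bsub>?A\<^esub> h)"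
    proof (rule ext)
      fix b assume b: "b \<in> ?S"
      let ?t = "\<lambda>x y z. if x \<otimes>\<^bsub>B\<^esub> y \<otimes>\<^bsub>B\<^esub> z = b then f x \<otimes>\<^bsub>K\<^esub> g y \<otimes>\<^bsub>K\<^esub> h z else \<zero>\<^bsub>K\<^esub>"
      have "(f \<otimes>\<^bsub>?A\<^esub> g \<otimes>\<^bsub>?A\<^esub> h) b = (\<Oplus>\<^bsub>K\<^esub>p\<in>?S. \<Oplus>\<^bsub>K\<^esub>z\<in>?S. if p \<otimes>\<^bsub>B\<^esub> z = b
          then (\<Oplus>\<^bsub>K\<^esub>x\<in>?S. \<Oplus>\<^bsub>K\<^esub>y\<in>?S. if x \<otimes>\<^bsub>B\<^esub> y = p then f x \<otimes>\<^bsub>K\<^esub> g y else \<zero>\<^bsub>K\<^esub>) \<otimes>\<^bsub>K\<^esub> h z else \<zero>\<^bsub>K\<^esub>)"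
        unfolding nested[OF mc[OF f g] h] restrict_apply'[OF b] using f g h
        by (intro K.finsum_cong') (auto simp: nested car intro!: K.finsum_closed K.finsum_cong')
      also have "\<dots> = (\<Oplus>\<^bsub>K\<^esub>p\<in>?S. \<Oplus>\<^bsub>K\<^esub>z\<in>?S. \<Oplus>\<^bsub>K\<^esub>x\<in>?S. \<Oplus>\<^bsub>K\<^esub>y\<in>?S.
          if p = x \<otimes>\<^bsub>B\<^esub> y then ?t x y z else \<zero>\<^bsub>K\<^esub>)"
      proof (intro K.finsum_cong' refl)
        fix p z assume p: "p \<in> ?S" and z: "z \<in> ?S"
        have "(\<Oplus>\<^bsub>K\<^esub>x\<in>?S. \<Oplus>\<^bsub>K\<^esub>y\<in>?S. if x \<otimes>\<^bsub>B\<^esub> y = p then f x \<otimes>\<^bsub>K\<^esub> g y else \<zero>\<^bsub>K\<^esub>) \<otimes>\<^bsub>K\<^esub> h z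
          = (\<Oplus>\<^bsub>K\<^esub>x\<in>?S. \<Oplus>\<^bsub>K\<^esub>y\<in>?S. (if x \<otimes>\<^bsub>B\<^esub> y = p then f x \<otimes>\<^bsub>K\<^esub> g y else \<zero>\<^bsub>K\<^esub>) \<otimes>\<^bsub>K\<^esub> h z)"
          using f g h z
          by (subst K.finsum_ldistr) (auto simp: car K.finsum_ldistr intro!: K.finsum_closed K.finsum_cong')
        then show "(if p \<otimes>\<^bsub>B\<^esub> z = b
          then (\<Oplus>\<^bsub>K\<^esub>x\<in>?S. \<Oplus>\<^bsub>K\<^esub>y\<in>?S. if x \<otimes>\<^bsub>B\<^esub> y = p then f x \<otimes>\<^bsub>K\<^esub> g y else \<zero>\<^bsub>K\<^esub>) \<otimes>\<^bsub>K\<^esub> h z else \<zero>\<^bsub>K\<^esub>)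
          = (\<Oplus>\<^bsub>K\<^esub>x\<in>?S. \<Oplus>\<^bsub>K\<^esub>y\<in>?S. if p = x \<otimes>\<^bsub>B\<^esub> y then ?t x y z else \<zero>\<^bsub>K\<^esub>)"
          using f g h p z
          apply (cases "p \<otimes>\<^bsub>B\<^esub> z = b")
           apply (subst if_P, assumption)
           apply (erule trans)
           apply (intro K.finsum_cong' refl)
             apply (auto simp: car B.m_assoc K.m_assoc intro!: K.finsum_closed)[3]
          apply (subst if_not_P, assumption)
          apply (rule sym, intro K.finsum_zero_eqI)
          apply (auto simp: car B.m_assoc)
          done
      qed (use f g h in \<open>auto simp: car intro!: K.finsum_closed\<close>)
      also have "\<dots> = (\<Oplus>\<^bsub>K\<^esub>p\<in>?S. \<Oplus>\<^bsub>K\<^esub>x\<in>?S. \<Oplus>\<^bsub>K\<^esub>z\<in>?S. \<Oplus>\<^bsub>K\<^esub>y\<in>?S.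
          if p = x \<otimes>\<^bsub>B\<^esub> y then ?t x y z else \<zero>\<^bsub>K\<^esub>)"
        using f g h by - (rule K.finsum_cong'[OF refl _ K.finsum_swap]; (auto simp: car intro!: K.finsum_closed))
      also have "\<dots> = (\<Oplus>\<^bsub>K\<^esub>x\<in>?S. \<Oplus>\<^bsub>K\<^esub>p\<in>?S. \<Oplus>\<^bsub>K\<^esub>z\<in>?S. \<Oplus>\<^bsub>K\<^esub>y\<in>?S.
          if p = x \<otimes>\<^bsub>B\<^esub> y then ?t x y z else \<zero>\<^bsub>K\<^esub>)"
        using f g h by - (rule K.finsum_swap; (auto simp: car intro!: K.finsum_closed))
      also have "\<dots> = (\<Oplus>\<^bsub>K\<^esub>x\<in>?S. \<Oplus>\<^bsub>K\<^esub>z\<in>?S. \<Oplus>\<^bsub>K\<^esub>p\<in>?S. \<Oplus>\<^bsub>K\<^esub>y\<in>?S.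
          if p = x \<otimes>\<^bsub>B\<^esub> y then ?t x y z else \<zero>\<^bsub>K\<^esub>)"
        using f g h by - (rule K.finsum_cong'[OF refl _ K.finsum_swap]; (auto simp: car intro!: K.finsum_closed))
      also have "\<dots> = (\<Oplus>\<^bsub>K\<^esub>x\<in>?S. \<Oplus>\<^bsub>K\<^esub>z\<in>?S. \<Oplus>\<^bsub>K\<^esub>y\<in>?S. \<Oplus>\<^bsub>K\<^esub>p\<in>?S.
          if p = x \<otimes>\<^bsub>B\<^esub> y then ?t x y z else \<zero>\<^bsub>K\<^esub>)"
        using f g h by - (rule K.finsum_cong'[OF refl _ K.finsum_cong'[OF refl _ K.finsum_swap]]; (auto simp: car intro!: K.finsum_closed))
      also have "\<dots> = (\<Oplus>\<^bsub>K\<^esub>x\<in>?S. \<Oplus>\<^bsub>K\<^esub>z\<in>?S. \<Oplus>\<^bsub>K\<^esub>y\<in>?S. ?t x y z)"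
        using f g h by (intro K.finsum_cong' refl K.finsum_delta) (auto simp: car intro!: K.finsum_closed)
      finally have L: "(f \<otimes>\<^bsub>?A\<^esub> g \<otimes>\<^bsub>?A\<^esub> h) b = (\<Oplus>\<^bsub>K\<^esub>x\<in>?S. \<Oplus>\<^bsub>K\<^esub>z\<in>?S. \<Oplus>\<^bsub>K\<^esub>y\<in>?S. ?t x y z)" .
      have "(f \<otimes>\<^bsub>?A\<^esub> (g \<otimes>\<^bsub>?A\<^esub> h)) b = (\<Oplus>\<^bsub>K\<^esub>x\<in>?S. \<Oplus>\<^bsub>K\<^esub>q\<in>?S. if x \<otimes>\<^bsub>B\<^esub> q = b
          then f x \<otimes>\<^bsub>K\<^esub> (\<Oplus>\<^bsub>K\<^esub>y\<in>?S. \<Oplus>\<^bsub>K\<^esub>z\<in>?S. if y \<otimes>\<^bsub>B\<^esub> z = q then g y \<otimes>\<^bsub>K\<^esub> h z else \<zero>\<^bsub>K\<^esub>) else \<zero>\<^bsub>K\<^esub>)"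
        unfolding nested[OF f mc[OF g h]] restrict_apply'[OF b] using f g h
        by (intro K.finsum_cong') (auto simp: nested car intro!: K.finsum_closed K.finsum_cong')
      also have "\<dots> = (\<Oplus>\<^bsub>K\<^esub>x\<in>?S. \<Oplus>\<^bsub>K\<^esub>q\<in>?S. \<Oplus>\<^bsub>K\<^esub>y\<in>?S. \<Oplus>\<^bsub>K\<^esub>z\<in>?S.
          if q = y \<otimes>\<^bsub>B\<^esub> z then ?t x y z else \<zero>\<^bsub>K\<^esub>)"
      proof (intro K.finsum_cong' refl)
        fix x q assume x: "x \<in> ?S" and q: "q \<in> ?S"
        have "f x \<otimes>\<^bsub>K\<^esub> (\<Oplus>\<^bsub>K\<^esub>y\<in>?S. \<Oplus>\<^bsub>K\<^esub>z\<in>?S. if y \<otimes>\<^bsub>B\<^esub> z = q then g y \<otimes>\<^bsub>K\<^esub> h z else \<zero>\<^bsub>K\<^esub>)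
          = (\<Oplus>\<^bsub>K\<^esub>y\<in>?S. \<Oplus>\<^bsub>K\<^esub>z\<in>?S. f x \<otimes>\<^bsub>K\<^esub> (if y \<otimes>\<^bsub>B\<^esub> z = q then g y \<otimes>\<^bsub>K\<^esub> h z else \<zero>\<^bsub>K\<^esub>))"
          using f g h x
          by (subst K.finsum_rdistr) (auto simp: car K.finsum_rdistr intro!: K.finsum_closed K.finsum_cong')
        then show "(if x \<otimes>\<^bsub>B\<^esub> q = b
          then f x \<otimes>\<^bsub>K\<^esub> (\<Oplus>\<^bsub>K\<^esub>y\<in>?S. \<Oplus>\<^bsub>K\<^esub>z\<in>?S. if y \<otimes>\<^bsub>B\<^esub> z = q then g y \<otimes>\<^bsub>K\<^esub> h z else \<zero>\<^bsub>K\<^esub>) else \<zero>\<^bsub>K\<^esub>)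
          = (\<Oplus>\<^bsub>K\<^esub>y\<in>?S. \<Oplus>\<^bsub>K\<^esub>z\<in>?S. if q = y \<otimes>\<^bsub>B\<^esub> z then ?t x y z else \<zero>\<^bsub>K\<^esub>)"
          using f g h x q
          apply (cases "x \<otimes>\<^bsub>B\<^esub> q = b")
           apply (subst if_P, assumption)
           apply (erule trans)
           apply (intro K.finsum_cong' refl)
             apply (auto simp: car B.m_assoc K.m_assoc intro!: K.finsum_closed)[3]
          apply (subst if_not_P, assumption)
          apply (rule sym, intro K.finsum_zero_eqI)
          apply (auto simp: car B.m_assoc)
          done
      qed (use f g h in \<open>auto simp: car intro!: K.finsum_closed\<close>)
      also have "\<dots> = (\<Oplus>\<^bsub>K\<^esub>x\<in>?S. \<Oplus>\<^bsub>K\<^esub>y\<in>?S. \<Oplus>\<^bsub>K\<^esub>q\<in>?S. \<Oplus>\<^bsub>K\<^esub>z\<in>?S.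
          if q = y \<otimes>\<^bsub>B\<^esub> z then ?t x y z else \<zero>\<^bsub>K\<^esub>)"
        using f g h by - (rule K.finsum_cong'[OF refl _ K.finsum_swap]; (auto simp: car intro!: K.finsum_closed))
      also have "\<dots> = (\<Oplus>\<^bsub>K\<^esub>x\<in>?S. \<Oplus>\<^bsub>K\<^esub>y\<in>?S. \<Oplus>\<^bsub>K\<^esub>z\<in>?S. \<Oplus>\<^bsub>K\<^esub>q\<in>?S.
          if q = y \<otimes>\<^bsub>B\<^esub> z then ?t x y z else \<zero>\<^bsub>K\<^esub>)"
        using f g h by - (rule K.finsum_cong'[OF refl _ K.finsum_cong'[OF refl _ K.finsum_swap]]; (auto simp: car intro!: K.finsum_closed))
      also have "\<dots> = (\<Oplus>\<^bsub>K\<^esub>x\<in>?S. \<Oplus>\<^bsub>K\<^esub>y\<in>?S. \<Oplus>\<^bsub>K\<^esub>z\<in>?S. ?t x y z)"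
        using f g h by (intro K.finsum_cong' refl K.finsum_delta) (auto simp: car intro!: K.finsum_closed)
      also have "\<dots> = (\<Oplus>\<^bsub>K\<^esub>x\<in>?S. \<Oplus>\<^bsub>K\<^esub>z\<in>?S. \<Oplus>\<^bsub>K\<^esub>y\<in>?S. ?t x y z)"
        using f g h by - (rule K.finsum_cong'[OF refl _ K.finsum_swap]; (auto simp: car intro!: K.finsum_closed))
      finally show "(f \<otimes>\<^bsub>?A\<^esub> g \<otimes>\<^bsub>?A\<^esub> h) b = (f \<otimes>\<^bsub>?A\<^esub> (g \<otimes>\<^bsub>?A\<^esub> h)) b" using L by simp
    qed (use f g h mc in auto)
  qed (use mc oc in auto)
  have dist: "(f \<oplus>\<^bsub>?A\<^esub> g) \<otimes>\<^bsub>?A\<^esub> h = f \<otimes>\<^bsub>?A\<^esub> h \<oplus>\<^bsub>?A\<^esub> g \<otimes>\<^bsub>?A\<^esub> h"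
    "h \<otimes>\<^bsub>?A\<^esub> (f \<oplus>\<^bsub>?A\<^esub> g) = h \<otimes>\<^bsub>?A\<^esub> f \<oplus>\<^bsub>?A\<^esub> h \<otimes>\<^bsub>?A\<^esub> g"
    if f: "f \<in> carrier ?A" and g: "g \<in> carrier ?A" and h: "h \<in> carrier ?A" for f g h
  proof -
    have fg: "f \<oplus>\<^bsub>?A\<^esub> g \<in> carrier ?A"
      using ab f g by (simp add: abelian_groupE(1))
    have plus: "(u \<oplus>\<^bsub>?A\<^esub> v) x = u x \<oplus>\<^bsub>K\<^esub> v x" if "x \<in> ?S" for u v x
      using that by (simp add: monoid_algebra_def)
    show "(f \<oplus>\<^bsub>?A\<^esub> g) \<otimes>\<^bsub>?A\<^esub> h = f \<otimes>\<^bsub>?A\<^esub> h \<oplus>\<^bsub>?A\<^esub> g \<otimes>\<^bsub>?A\<^esub> h"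
    proof (rule ext)
      fix b assume b: "b \<in> ?S"
      show "((f \<oplus>\<^bsub>?A\<^esub> g) \<otimes>\<^bsub>?A\<^esub> h) b = (f \<otimes>\<^bsub>?A\<^esub> h \<oplus>\<^bsub>?A\<^esub> g \<otimes>\<^bsub>?A\<^esub> h) b"
        unfolding plus[OF b] nested[OF fg h] nested[OF f h] nested[OF g h] restrict_apply'[OF b]
        using f g h
        apply (subst K.finsum_addf[symmetric])
          apply (auto simp: car intro!: K.finsum_closed)[2]
        apply (intro K.finsum_cong' refl)
         apply (auto simp: car intro!: K.finsum_closed)[1]
        apply (subst K.finsum_addf[symmetric])
          apply (auto simp: car intro!: K.finsum_closed)[2]
        apply (intro K.finsum_cong' refl)
         apply (auto simp: car plus K.l_distr)
        done
    qed (use f g h fg mc abelian_groupE(1)[OF ab] in auto)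
    show "h \<otimes>\<^bsub>?A\<^esub> (f \<oplus>\<^bsub>?A\<^esub> g) = h \<otimes>\<^bsub>?A\<^esub> f \<oplus>\<^bsub>?A\<^esub> h \<otimes>\<^bsub>?A\<^esub> g"
    proof (rule ext)
      fix b assume b: "b \<in> ?S"
      show "(h \<otimes>\<^bsub>?A\<^esub> (f \<oplus>\<^bsub>?A\<^esub> g)) b = (h \<otimes>\<^bsub>?A\<^esub> f \<oplus>\<^bsub>?A\<^esub> h \<otimes>\<^bsub>?A\<^esub> g) b"
        unfolding plus[OF b] nested[OF h fg] nested[OF h f] nested[OF h g] restrict_apply'[OF b]
        using f g h
        apply (subst K.finsum_addf[symmetric])
          apply (auto simp: car intro!: K.finsum_closed)[2]
        apply (intro K.finsum_cong' refl)
         apply (auto simp: car intro!: K.finsum_closed)[1]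
        apply (subst K.finsum_addf[symmetric])
          apply (auto simp: car intro!: K.finsum_closed)[2]
        apply (intro K.finsum_cong' refl)
         apply (auto simp: car plus K.r_distr)
        done
    qed (use f g h fg mc abelian_groupE(1)[OF ab] in auto)
  qed
  show ?thesis
    by (rule ringI[OF ab mon dist])
qed

lemma (in left_regular_band) lrb_support_mult:
  assumes x: "x \<in> carrier B" and y: "y \<in> carrier B"
  shows "lrb_support B (x \<otimes> y) = lrb_support B x \<inter> lrb_support B y"
proof (intro equalityI subsetI)
  fix z assume "z \<in> lrb_support B (x \<otimes> y)"
  then obtain w where w: "w \<in> carrier B" "z = w \<otimes> (x \<otimes> y)"
    by (auto simp: lrb_support_def)
  have "z = (w \<otimes> x \<otimes> y) \<otimes> x"
    using w x y left_regular[OF x y] by (simp add: m_assoc)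
  moreover have "z = (w \<otimes> x) \<otimes> y"
    using w x y by (simp add: m_assoc)
  ultimately show "z \<in> lrb_support B x \<inter> lrb_support B y"
    using w x y unfolding lrb_support_def by blast
next
  fix z assume "z \<in> lrb_support B x \<inter> lrb_support B y"
  then obtain a b where ab: "a \<in> carrier B" "b \<in> carrier B" "z = a \<otimes> x" "z = b \<otimes> y"
    by (auto simp: lrb_support_def)
  have z: "z \<in> carrier B" using ab x by simp
  have "z \<otimes> x = z" using ab x by (simp add: m_assoc idem)
  moreover have "z \<otimes> y = z" using ab(2,4) y by (simp add: m_assoc idem)
  ultimately have "z = z \<otimes> (x \<otimes> y)" using z x y by (simp add: m_assoc[symmetric])
  then show "z \<in> lrb_support B (x \<otimes> y)"
    using z by (auto simp: lrb_support_def)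
qed

lemma support_module_left_module:
  assumes "cring K" "left_regular_band B" "finite (carrier B)" "X \<in> lrb_lattice B"
  shows "left_module (monoid_algebra K B) (support_module K B X)"
proof -
  interpret K: cring K by fact
  interpret B: left_regular_band B by fact
  let ?A = "monoid_algebra K B" and ?S = "carrier B" and ?M = "support_module K B X"
  interpret A: ring ?A
    by (rule monoid_algebra_ring[OF assms(1) B.monoid_axioms assms(3)])
  note nested = monoid_algebra_mult_nested[OF assms(1) B.monoid_axioms assms(3)]
  have fin[simp]: "finite ?S" by fact
  have car: "f x \<in> carrier K" if "f \<in> carrier ?A" "x \<in> ?S" for f x
    using that by (auto simp: monoid_algebra_def)
  define c where "c x = (if X \<subseteq> lrb_support B x then \<one>\<^bsub>K\<^esub> else \<zero>\<^bsub>K\<^esub>)" for x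
  have cK[simp]: "c x \<in> carrier K" for x by (simp add: c_def)
  have cm: "c (x \<otimes>\<^bsub>B\<^esub> y) = c x \<otimes>\<^bsub>K\<^esub> c y" if "x \<in> ?S" "y \<in> ?S" for x y
    using that by (auto simp: c_def B.lrb_support_mult)
  have X: "X \<subseteq> ?S" using assms(4) by (auto simp: lrb_lattice_def lrb_support_def)
  have c1: "c \<one>\<^bsub>B\<^esub> = \<one>\<^bsub>K\<^esub>"
  proof -
    have "lrb_support B \<one>\<^bsub>B\<^esub> = ?S" by (force simp: lrb_support_def)
    then show ?thesis using X by (simp add: c_def)
  qed
  have M: "carrier ?M = carrier K" "(\<oplus>\<^bsub>?M\<^esub>) = (\<oplus>\<^bsub>K\<^esub>)" "\<zero>\<^bsub>?M\<^esub> = \<zero>\<^bsub>K\<^esub>"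
    by (simp_all add: support_module_def)
  define ch where "ch f = (\<Oplus>\<^bsub>K\<^esub>b\<in>?S. f b \<otimes>\<^bsub>K\<^esub> c b)" for f
  have chK[simp]: "ch f \<in> carrier K" if "f \<in> carrier ?A" for f
    using that by (auto simp: ch_def car intro!: K.finsum_closed)
  have sm: "f \<odot>\<^bsub>?M\<^esub> \<alpha> = ch f \<otimes>\<^bsub>K\<^esub> \<alpha>" if "f \<in> carrier ?A" "\<alpha> \<in> carrier K" for f \<alpha>
  proof -
    have "ch f \<otimes>\<^bsub>K\<^esub> \<alpha> = (\<Oplus>\<^bsub>K\<^esub>b\<in>?S. f b \<otimes>\<^bsub>K\<^esub> c b \<otimes>\<^bsub>K\<^esub> \<alpha>)"
      unfolding ch_def using that by (subst K.finsum_ldistr) (auto simp: car)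
    also have "\<dots> = f \<odot>\<^bsub>?M\<^esub> \<alpha>"
      unfolding support_module_def using that
      by (auto simp: car c_def intro!: K.finsum_cong')
    finally show ?thesis by simp
  qed
  have cha: "ch (f \<oplus>\<^bsub>?A\<^esub> g) = ch f \<oplus>\<^bsub>K\<^esub> ch g" if "f \<in> carrier ?A" "g \<in> carrier ?A" for f g
    unfolding ch_def using that
    apply (subst K.finsum_addf[symmetric])
      apply (auto simp: car)[2]
    apply (intro K.finsum_cong' refl)
     apply (auto simp: car K.l_distr monoid_algebra_def)
    done
  have chm: "ch (f \<otimes>\<^bsub>?A\<^esub> g) = ch f \<otimes>\<^bsub>K\<^esub> ch g" if f: "f \<in> carrier ?A" and g: "g \<in> carrier ?A" for f g
  proof -
    let ?t = "\<lambda>x y. (f x \<otimes>\<^bsub>K\<^esub> g y) \<otimes>\<^bsub>K\<^esub> c (x \<otimes>\<^bsub>B\<^esub> y)"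
    have "ch (f \<otimes>\<^bsub>?A\<^esub> g) = (\<Oplus>\<^bsub>K\<^esub>b\<in>?S. \<Oplus>\<^bsub>K\<^esub>x\<in>?S. \<Oplus>\<^bsub>K\<^esub>y\<in>?S.
        if b = x \<otimes>\<^bsub>B\<^esub> y then ?t x y else \<zero>\<^bsub>K\<^esub>)"
      unfolding ch_def
    proof (intro K.finsum_cong' refl)
      fix b assume b: "b \<in> ?S"
      show "(f \<otimes>\<^bsub>?A\<^esub> g) b \<otimes>\<^bsub>K\<^esub> c b = (\<Oplus>\<^bsub>K\<^esub>x\<in>?S. \<Oplus>\<^bsub>K\<^esub>y\<in>?S.
        if b = x \<otimes>\<^bsub>B\<^esub> y then ?t x y else \<zero>\<^bsub>K\<^esub>)"
        unfolding nested[OF f g] restrict_apply'[OF b]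
        using f g b
        apply (subst K.finsum_ldistr)
           apply (auto simp: car intro!: K.finsum_closed)[3]
        apply (intro K.finsum_cong' refl)
         apply (auto simp: car intro!: K.finsum_closed)[1]
        apply (subst K.finsum_ldistr)
           apply (auto simp: car intro!: K.finsum_closed)[3]
        apply (intro K.finsum_cong' refl)
         apply (auto simp: car)
        done
    qed (use f g in \<open>auto simp: car intro!: K.finsum_closed\<close>)
    also have "\<dots> = (\<Oplus>\<^bsub>K\<^esub>x\<in>?S. \<Oplus>\<^bsub>K\<^esub>b\<in>?S. \<Oplus>\<^bsub>K\<^esub>y\<in>?S.
        if b = x \<otimes>\<^bsub>B\<^esub> y then ?t x y else \<zero>\<^bsub>K\<^esub>)"
      using f g by - (rule K.finsum_swap; (auto simp: car intro!: K.finsum_closed))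
    also have "\<dots> = (\<Oplus>\<^bsub>K\<^esub>x\<in>?S. \<Oplus>\<^bsub>K\<^esub>y\<in>?S. \<Oplus>\<^bsub>K\<^esub>b\<in>?S.
        if b = x \<otimes>\<^bsub>B\<^esub> y then ?t x y else \<zero>\<^bsub>K\<^esub>)"
      using f g by - (rule K.finsum_cong'[OF refl _ K.finsum_swap]; (auto simp: car intro!: K.finsum_closed))
    also have "\<dots> = (\<Oplus>\<^bsub>K\<^esub>x\<in>?S. \<Oplus>\<^bsub>K\<^esub>y\<in>?S. ?t x y)"
      using f g by (intro K.finsum_cong' refl K.finsum_delta) (auto simp: car intro!: K.finsum_closed)
    also have "\<dots> = (\<Oplus>\<^bsub>K\<^esub>x\<in>?S. (f x \<otimes>\<^bsub>K\<^esub> c x) \<otimes>\<^bsub>K\<^esub> ch g)"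
      unfolding ch_def using f g
      apply (intro K.finsum_cong' refl)
       apply (auto simp: car intro!: K.finsum_closed)[1]
      apply (subst K.finsum_rdistr)
         apply (auto simp: car)[3]
      apply (intro K.finsum_cong' refl)
       apply (auto simp: car cm K.m_ac)
      done
    also have "\<dots> = ch f \<otimes>\<^bsub>K\<^esub> ch g"
      unfolding ch_def[of f] using f g by (subst K.finsum_ldistr) (auto simp: car)
    finally show ?thesis .
  qed
  have ch1: "ch \<one>\<^bsub>?A\<^esub> = \<one>\<^bsub>K\<^esub>"
  proof -
    have "ch \<one>\<^bsub>?A\<^esub> = (\<Oplus>\<^bsub>K\<^esub>b\<in>?S. if b = \<one>\<^bsub>B\<^esub> then \<one>\<^bsub>K\<^esub> else \<zero>\<^bsub>K\<^esub>)"
      unfolding ch_def by (intro K.finsum_cong' refl) (auto simp: monoid_algebra_def c1)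
    then show ?thesis by (simp add: K.finsum_delta)
  qed
  show ?thesis
  proof (intro left_module.intro left_module_axioms.intro)
    show "abelian_group ?M"
      by (rule abelian_groupI)
        (auto simp: M K.a_ac intro: K.l_neg bexI[of _ "\<ominus>\<^bsub>K\<^esub> _"])
  qed (auto simp: A.ring_axioms M sm cha chm ch1 K.l_distr K.r_distr K.m_assoc)
qed

section \<open>Existence of projective resolutions\<close>

text \<open>
  Generators of a free resolution of a module with elements of type \<^typ>\<open>'m\<close>: generators of degree
  \<open>n + 1\<close> are syzygies of degree \<open>n\<close>, encoded as lists of generators with coefficients.
\<close>

datatype ('m, 'r) res_gen = Base 'm | Syz "(('m, 'r) res_gen \<times> 'r) list"

lemma lin_homD:
  assumes "f \<in> lin_hom R M N"
  shows "\<And>x. x \<in> carrier M \<Longrightarrow> f x \<in> carrier N"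
    and "\<And>x y. x \<in> carrier M \<Longrightarrow> y \<in> carrier M \<Longrightarrow> f (x \<oplus>\<^bsub>M\<^esub> y) = f x \<oplus>\<^bsub>N\<^esub> f y"
    and "\<And>a x. a \<in> carrier R \<Longrightarrow> x \<in> carrier M \<Longrightarrow> f (a \<odot>\<^bsub>M\<^esub> x) = a \<odot>\<^bsub>N\<^esub> f x"
  using assms by (auto simp: lin_hom_def)

context ring
begin

lemma free_module_left_module: "left_module R (free_module R S)"
proof -
  let ?F = "free_module R S"
  have car: "f s \<in> carrier R" if "f \<in> carrier ?F" "s \<in> S" for f s
    using that by (auto simp: free_module_def)
  have arb: "f s = undefined" if "f \<in> carrier ?F" "s \<notin> S" for f s
    using that by (auto simp: free_module_def PiE_def extensional_def)
  have fin: "finite {s \<in> S. f s \<noteq> \<zero>}" if "f \<in> carrier ?F" for f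
    using that by (simp add: free_module_def)
  have ab: "abelian_group ?F"
  proof (rule abelian_groupI)
    fix f assume f: "f \<in> carrier ?F"
    have "(\<lambda>s\<in>S. \<ominus> f s) \<in> carrier ?F"
      using car[OF f] fin[OF f]
      by (auto simp: free_module_def intro: finite_subset[of _ "{s \<in> S. f s \<noteq> \<zero>}"])
    moreover have "(\<lambda>s\<in>S. \<ominus> f s) \<oplus>\<^bsub>?F\<^esub> f = \<zero>\<^bsub>?F\<^esub>"
      using car[OF f] by (auto simp: free_module_def l_neg fun_eq_iff)
    ultimately show "\<exists>g\<in>carrier ?F. g \<oplus>\<^bsub>?F\<^esub> f = \<zero>\<^bsub>?F\<^esub>" by blast
    show "\<zero>\<^bsub>?F\<^esub> \<oplus>\<^bsub>?F\<^esub> f = f"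
      using car[OF f] arb[OF f] by (auto simp: free_module_def fun_eq_iff)
  next
    fix f g h assume "f \<in> carrier ?F" "g \<in> carrier ?F" "h \<in> carrier ?F"
    note c = this[THEN car]
    show "f \<oplus>\<^bsub>?F\<^esub> g \<oplus>\<^bsub>?F\<^esub> h = f \<oplus>\<^bsub>?F\<^esub> (g \<oplus>\<^bsub>?F\<^esub> h)"
      by (auto simp: free_module_def fun_eq_iff c a_assoc)
  next
    fix f g assume f: "f \<in> carrier ?F" and g: "g \<in> carrier ?F"
    note c = car[OF f] car[OF g]
    have "finite {s \<in> S. f s \<oplus> g s \<noteq> \<zero>}"
      by (rule finite_subset[OF _ finite_UnI[OF fin[OF f] fin[OF g]]]) auto
    then show "f \<oplus>\<^bsub>?F\<^esub> g \<in> carrier ?F"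
      using c by (auto simp: free_module_def cong: conj_cong)
    show "f \<oplus>\<^bsub>?F\<^esub> g = g \<oplus>\<^bsub>?F\<^esub> f"
      using c by (auto simp: free_module_def fun_eq_iff a_comm)
  qed (auto simp: free_module_def cong: conj_cong)
  show ?thesis
  proof (intro left_module.intro left_module_axioms.intro ab)
    fix a f assume a: "a \<in> carrier R" and f: "f \<in> carrier ?F"
    have "finite {s \<in> S. a \<otimes> f s \<noteq> \<zero>}"
      using a by (intro finite_subset[OF _ fin[OF f]]) auto
    then show "a \<odot>\<^bsub>?F\<^esub> f \<in> carrier ?F"
      using a car[OF f] by (auto simp: free_module_def cong: conj_cong)
  next
    fix f assume f: "f \<in> carrier ?F"
    show "\<one> \<odot>\<^bsub>?F\<^esub> f = f"
      using car[OF f] arb[OF f] by (auto simp: free_module_def fun_eq_iff)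
  next
    fix a f g assume a: "a \<in> carrier R" and f: "f \<in> carrier ?F" and g: "g \<in> carrier ?F"
    show "a \<odot>\<^bsub>?F\<^esub> (f \<oplus>\<^bsub>?F\<^esub> g) = a \<odot>\<^bsub>?F\<^esub> f \<oplus>\<^bsub>?F\<^esub> a \<odot>\<^bsub>?F\<^esub> g"
      using a car[OF f] car[OF g] by (auto simp: free_module_def fun_eq_iff r_distr)
  next
    fix a b f assume a: "a \<in> carrier R" and b: "b \<in> carrier R" and f: "f \<in> carrier ?F"
    show "(a \<oplus> b) \<odot>\<^bsub>?F\<^esub> f = a \<odot>\<^bsub>?F\<^esub> f \<oplus>\<^bsub>?F\<^esub> b \<odot>\<^bsub>?F\<^esub> f"
      using a b car[OF f] by (auto simp: free_module_def fun_eq_iff l_distr)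
    show "a \<otimes> b \<odot>\<^bsub>?F\<^esub> f = a \<odot>\<^bsub>?F\<^esub> (b \<odot>\<^bsub>?F\<^esub> f)"
      using a b car[OF f] by (auto simp: free_module_def fun_eq_iff m_assoc)
  qed (rule ring_axioms)
qed

lemma free_module_add: "f \<oplus>\<^bsub>free_module R S\<^esub> g = (\<lambda>s\<in>S. f s \<oplus> g s)"
  and free_module_smult: "a \<odot>\<^bsub>free_module R S\<^esub> g = (\<lambda>s\<in>S. a \<otimes> g s)"
  by (simp_all add: free_module_def)

lemma free_module_reindex:
  assumes "bij_betw h T S"
  shows "(\<lambda>f\<in>carrier (free_module R S). \<lambda>t\<in>T. f (h t)) \<in> lin_hom R (free_module R S) (free_module R T)"
proof -
  have ht: "h t \<in> S" if "t \<in> T" for t using that assms by (auto simp: bij_betw_def)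
  have "finite {t \<in> T. f (h t) \<noteq> \<zero>}" if "finite {s \<in> S. f s \<noteq> \<zero>}" for f
  proof -
    have "h ` {t \<in> T. f (h t) \<noteq> \<zero>} \<subseteq> {s \<in> S. f s \<noteq> \<zero>}" using ht by auto
    moreover have "inj_on h {t \<in> T. f (h t) \<noteq> \<zero>}"
      using assms by (auto simp: bij_betw_def inj_on_def)
    ultimately show ?thesis using that inj_on_finite by blast
  qed
  then have "(\<lambda>t\<in>T. f (h t)) \<in> carrier (free_module R T)" if "f \<in> carrier (free_module R S)" for f
    using that ht by (auto simp: free_module_def cong: conj_cong)
  moreover have "f \<oplus>\<^bsub>free_module R S\<^esub> g \<in> carrier (free_module R S)"
    if "f \<in> carrier (free_module R S)" "g \<in> carrier (free_module R S)" for f g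
    using free_module_left_module[of S] that
    by (meson abelian_groupE(1) left_module_def)
  moreover have "a \<odot>\<^bsub>free_module R S\<^esub> f \<in> carrier (free_module R S)"
    if "f \<in> carrier (free_module R S)" "a \<in> carrier R" for f a
    using free_module_left_module[of S] that by (meson left_module.smult_closed)
  ultimately show ?thesis
    unfolding lin_hom_def mem_Collect_eq
    apply (intro conjI ballI)
      apply (auto)[1]
    using ht by (auto simp: fun_eq_iff free_module_add free_module_smult)
qed

lemma free_module_projective:
  fixes S :: "'s set"
  shows "projective_module R (free_module R S)"
proof -
  let ?F = "free_module R S"
  interpret F: left_module R ?F by (rule free_module_left_module)
  have "\<exists>T :: ('s \<Rightarrow> 'a) set. \<exists>i \<in> lin_hom R ?F (free_module R T). \<exists>\<pi> \<in> lin_hom R (free_module R T) ?F.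
        \<forall>x \<in> carrier ?F. \<pi> (i x) = x"
  proof (cases "\<one> = \<zero>")
    case False
    define g :: "'s \<Rightarrow> 's \<Rightarrow> 'a" where "g s = (\<lambda>x. if x = s then \<one> else \<zero>)" for s
    have "inj_on g S"
    proof (rule inj_onI)
      fix s t assume "g s = g t"
      then have "g s s = g t s" by simp
      then show "s = t" using False by (auto simp: g_def split: if_splits)
    qed
    then have bg: "bij_betw g S (g ` S)" by (simp add: bij_betw_def)
    define h where "h = the_inv_into S g"
    have bh: "bij_betw h (g ` S) S" unfolding h_def by (rule bij_betw_the_inv_into[OF bg])
    have hg: "h (g s) = s" if "s \<in> S" for s
      unfolding h_def using \<open>inj_on g S\<close> that by (rule the_inv_into_f_f)
    let ?i = "\<lambda>f\<in>carrier ?F. \<lambda>t\<in>g ` S. f (h t)"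
    let ?p = "\<lambda>f\<in>carrier (free_module R (g ` S)). \<lambda>s\<in>S. f (g s)"
    have i: "?i \<in> lin_hom R ?F (free_module R (g ` S))" by (rule free_module_reindex[OF bh])
    have "?p (?i f) = f" if "f \<in> carrier ?F" for f
    proof -
      have "f \<in> extensional S" using that by (auto simp: free_module_def PiE_def)
      have "?p (?i f) = (\<lambda>s\<in>S. ?i f (g s))" using lin_homD(1)[OF i that] by (rule restrict_apply')
      also have "\<dots> = (\<lambda>s\<in>S. f s)" using that by (intro restrict_ext) (simp add: hg)
      also have "\<dots> = f" using \<open>f \<in> extensional S\<close> by (rule extensional_restrict)
      finally show ?thesis .
    qed
    then have pi: "\<forall>x \<in> carrier ?F. ?p (?i x) = x" by (rule ballI)
    show ?thesis
      by (rule exI[of _ "g ` S"], rule bexI[OF _ i], rule bexI[OF _ free_module_reindex[OF bg]], rule pi)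
  next
    case True
    then have z: "carrier R = {\<zero>}" using one_zeroD by simp
    have one: "f = \<zero>\<^bsub>?F\<^esub>" if "f \<in> carrier ?F" for f
    proof (rule ext)
      fix s show "f s = \<zero>\<^bsub>?F\<^esub> s"
        using that z by (cases "s \<in> S") (auto simp: free_module_def PiE_def extensional_def)
    qed
    let ?E = "free_module R ({} :: ('s \<Rightarrow> 'a) set)"
    have E: "carrier ?E = {\<zero>\<^bsub>?E\<^esub>}" by (auto simp: free_module_def)
    interpret E: left_module R ?E by (rule free_module_left_module)
    have FF: "carrier ?F = {\<zero>\<^bsub>?F\<^esub>}" using one F.zero_closed by blast
    have "(\<lambda>x\<in>carrier ?F. \<zero>\<^bsub>?E\<^esub>) \<in> lin_hom R ?F ?E"
      using E.smult_closed[of _ "\<zero>\<^bsub>?E\<^esub>"] E.zero_closed unfolding E by (auto simp: lin_hom_def)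
    moreover have "(\<lambda>x\<in>carrier ?E. \<zero>\<^bsub>?F\<^esub>) \<in> lin_hom R ?E ?F"
      using F.smult_closed[of _ "\<zero>\<^bsub>?F\<^esub>"] E.smult_closed E.a_closed F.zero_closed unfolding FF
      by (auto simp: lin_hom_def)
    ultimately show ?thesis using one E by (intro exI bexI) auto
  qed
  then show ?thesis
    unfolding projective_module_def using free_module_left_module by blast
qed

lemma lin_hom_kernel:
  assumes "left_module R M" "left_module R N" "f \<in> lin_hom R M N"
  shows "\<zero>\<^bsub>M\<^esub> \<in> {x \<in> carrier M. f x = \<zero>\<^bsub>N\<^esub>}"
    and "\<And>x y. x \<in> {x \<in> carrier M. f x = \<zero>\<^bsub>N\<^esub>} \<Longrightarrow> y \<in> {x \<in> carrier M. f x = \<zero>\<^bsub>N\<^esub>} \<Longrightarrow>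
          x \<oplus>\<^bsub>M\<^esub> y \<in> {x \<in> carrier M. f x = \<zero>\<^bsub>N\<^esub>}"
    and "\<And>a x. a \<in> carrier R \<Longrightarrow> x \<in> {x \<in> carrier M. f x = \<zero>\<^bsub>N\<^esub>} \<Longrightarrow>
          a \<odot>\<^bsub>M\<^esub> x \<in> {x \<in> carrier M. f x = \<zero>\<^bsub>N\<^esub>}"
proof -
  interpret M: left_module R M by fact
  interpret N: left_module R N by fact
  note f = lin_homD[OF assms(3)]
  have "f \<zero>\<^bsub>M\<^esub> \<oplus>\<^bsub>N\<^esub> f \<zero>\<^bsub>M\<^esub> = f \<zero>\<^bsub>M\<^esub>" using f(2)[of "\<zero>\<^bsub>M\<^esub>" "\<zero>\<^bsub>M\<^esub>"] by simp
  then show "\<zero>\<^bsub>M\<^esub> \<in> {x \<in> carrier M. f x = \<zero>\<^bsub>N\<^esub>}"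
    using f(1)[of "\<zero>\<^bsub>M\<^esub>"] by simp
  have s0: "a \<odot>\<^bsub>N\<^esub> \<zero>\<^bsub>N\<^esub> = \<zero>\<^bsub>N\<^esub>" if "a \<in> carrier R" for a
    using that N.smult_r_distr[of a "\<zero>\<^bsub>N\<^esub>" "\<zero>\<^bsub>N\<^esub>"] N.smult_closed[of a "\<zero>\<^bsub>N\<^esub>"]
    by simp
  show "x \<oplus>\<^bsub>M\<^esub> y \<in> {x \<in> carrier M. f x = \<zero>\<^bsub>N\<^esub>}"
    if "x \<in> {x \<in> carrier M. f x = \<zero>\<^bsub>N\<^esub>}" "y \<in> {x \<in> carrier M. f x = \<zero>\<^bsub>N\<^esub>}" for x y
    using that by (simp add: f)
  show "a \<odot>\<^bsub>M\<^esub> x \<in> {x \<in> carrier M. f x = \<zero>\<^bsub>N\<^esub>}"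
    if "a \<in> carrier R" "x \<in> {x \<in> carrier M. f x = \<zero>\<^bsub>N\<^esub>}" for a x
    using that by (simp add: f s0)
qed

text \<open>Every submodule \<open>g ` T\<close> is the image of a homomorphism from the free module on \<open>T\<close>.\<close>

lemma free_module_cover:
  assumes M: "left_module R M"
    and Z: "g ` T \<subseteq> carrier M" "\<zero>\<^bsub>M\<^esub> \<in> g ` T"
      "\<And>x y. x \<in> g ` T \<Longrightarrow> y \<in> g ` T \<Longrightarrow> x \<oplus>\<^bsub>M\<^esub> y \<in> g ` T"
      "\<And>a x. a \<in> carrier R \<Longrightarrow> x \<in> g ` T \<Longrightarrow> a \<odot>\<^bsub>M\<^esub> x \<in> g ` T"
  shows "\<exists>f \<in> lin_hom R (free_module R T) M. f ` carrier (free_module R T) = g ` T"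
proof -
  interpret M: left_module R M by fact
  let ?F = "free_module R T"
  interpret F: left_module R ?F by (rule free_module_left_module)
  have car: "f s \<in> carrier R" if "f \<in> carrier ?F" "s \<in> T" for f s
    using that by (auto simp: free_module_def)
  have fin: "finite {s \<in> T. f s \<noteq> \<zero>}" if "f \<in> carrier ?F" for f
    using that by (simp add: free_module_def)
  have g: "g t \<in> carrier M" if "t \<in> T" for t using that Z(1) by auto
  have l0: "\<zero> \<odot>\<^bsub>M\<^esub> x = \<zero>\<^bsub>M\<^esub>" if "x \<in> carrier M" for x
    using that M.smult_l_distr[of \<zero> \<zero> x] M.smult_closed[of \<zero> x] by simp
  have r0: "a \<odot>\<^bsub>M\<^esub> \<zero>\<^bsub>M\<^esub> = \<zero>\<^bsub>M\<^esub>" if "a \<in> carrier R" for a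
    using that M.smult_r_distr[of a "\<zero>\<^bsub>M\<^esub>" "\<zero>\<^bsub>M\<^esub>"] M.smult_closed[of a "\<zero>\<^bsub>M\<^esub>"]
    by simp
  define e where "e f = (\<Oplus>\<^bsub>M\<^esub>s\<in>{s \<in> T. f s \<noteq> \<zero>}. f s \<odot>\<^bsub>M\<^esub> g s)" for f
  have e: "e f = (\<Oplus>\<^bsub>M\<^esub>s\<in>A. f s \<odot>\<^bsub>M\<^esub> g s)"
    if "f \<in> carrier ?F" "finite A" "A \<subseteq> T" "{s \<in> T. f s \<noteq> \<zero>} \<subseteq> A" for f A
    unfolding e_def using that
    by (intro M.add.finprod_mono_neutral_cong_left) (auto simp: car g l0)
  have eadd: "e (x \<oplus>\<^bsub>?F\<^esub> y) = e x \<oplus>\<^bsub>M\<^esub> e y" if x: "x \<in> carrier ?F" and y: "y \<in> carrier ?F" for x y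
  proof -
    let ?A = "{s \<in> T. x s \<noteq> \<zero>} \<union> {s \<in> T. y s \<noteq> \<zero>}"
    have A: "finite ?A" "?A \<subseteq> T" using fin x y by auto
    have "e (x \<oplus>\<^bsub>?F\<^esub> y) = (\<Oplus>\<^bsub>M\<^esub>s\<in>?A. (x \<oplus>\<^bsub>?F\<^esub> y) s \<odot>\<^bsub>M\<^esub> g s)"
      by (rule e[OF F.a_closed[OF x y] A]) (auto simp: free_module_add)
    also have "\<dots> = (\<Oplus>\<^bsub>M\<^esub>s\<in>?A. x s \<odot>\<^bsub>M\<^esub> g s \<oplus>\<^bsub>M\<^esub> y s \<odot>\<^bsub>M\<^esub> g s)"
      using car[OF x] car[OF y] g
      by (intro M.finsum_cong' refl) (auto simp: free_module_add M.smult_l_distr)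
    also have "\<dots> = (\<Oplus>\<^bsub>M\<^esub>s\<in>?A. x s \<odot>\<^bsub>M\<^esub> g s) \<oplus>\<^bsub>M\<^esub> (\<Oplus>\<^bsub>M\<^esub>s\<in>?A. y s \<odot>\<^bsub>M\<^esub> g s)"
      using car[OF x] car[OF y] g by (intro M.finsum_addf) auto
    also have "\<dots> = e x \<oplus>\<^bsub>M\<^esub> e y" using e[OF x A] e[OF y A] by auto
    finally show ?thesis .
  qed
  have esm: "e (a \<odot>\<^bsub>?F\<^esub> x) = a \<odot>\<^bsub>M\<^esub> e x" if x: "x \<in> carrier ?F" and a: "a \<in> carrier R" for a x
  proof -
    let ?A = "{s \<in> T. x s \<noteq> \<zero>}"
    have A: "finite ?A" "?A \<subseteq> T" using fin x by auto
    have "e (a \<odot>\<^bsub>?F\<^esub> x) = (\<Oplus>\<^bsub>M\<^esub>s\<in>?A. (a \<odot>\<^bsub>?F\<^esub> x) s \<odot>\<^bsub>M\<^esub> g s)"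
      using a by (intro e[OF F.smult_closed[OF a x] A]) (auto simp: free_module_smult)
    also have "\<dots> = (\<Oplus>\<^bsub>M\<^esub>s\<in>?A. a \<odot>\<^bsub>M\<^esub> (x s \<odot>\<^bsub>M\<^esub> g s))"
      using car[OF x] a g
      by (intro M.finsum_cong' refl) (auto simp: free_module_smult M.smult_assoc1)
    also have "\<dots> = a \<odot>\<^bsub>M\<^esub> (\<Oplus>\<^bsub>M\<^esub>s\<in>?A. x s \<odot>\<^bsub>M\<^esub> g s)"
      using A(1) car[OF x] g a
    proof (induction rule: finite_subset_induct'[OF A(1) subset_refl])
      case 1
      then show ?case by (simp add: r0)
    next
      case (2 s S)
      then have "(\<Oplus>\<^bsub>M\<^esub>s\<in>S. x s \<odot>\<^bsub>M\<^esub> g s) \<in> carrier M" by (intro M.finsum_closed) auto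
      moreover have "s \<in> T" "S \<subseteq> T" using 2 by auto
      moreover from this have "x s \<odot>\<^bsub>M\<^esub> g s \<in> carrier M" "a \<odot>\<^bsub>M\<^esub> (x s \<odot>\<^bsub>M\<^esub> g s) \<in> carrier M"
        "(\<lambda>s. x s \<odot>\<^bsub>M\<^esub> g s) \<in> S \<rightarrow> carrier M" "(\<lambda>s. a \<odot>\<^bsub>M\<^esub> (x s \<odot>\<^bsub>M\<^esub> g s)) \<in> S \<rightarrow> carrier M"
        using 2 by auto
      ultimately show ?case using 2 a by (simp add: M.smult_r_distr)
    qed
    finally show ?thesis by (simp add: e_def)
  qed
  have eZ: "e f \<in> g ` T" if f: "f \<in> carrier ?F" for f
  proof -
    let ?A = "{s \<in> T. f s \<noteq> \<zero>}"
    show ?thesis unfolding e_def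
    proof (induction rule: finite_subset_induct'[OF fin[OF f] subset_refl])
      case 1
      then show ?case using Z(2) by simp
    next
      case (2 s S)
      then have "f s \<odot>\<^bsub>M\<^esub> g s \<in> g ` T" using Z(4) car[OF f] by auto
      moreover have "(\<lambda>s. f s \<odot>\<^bsub>M\<^esub> g s) \<in> S \<rightarrow> carrier M" using 2 car[OF f] g by auto
      moreover have "f s \<odot>\<^bsub>M\<^esub> g s \<in> carrier M" using 2 car[OF f] g by auto
      ultimately show ?case using 2 Z(3) by (subst M.finsum_insert) auto
    qed
  qed
  have "g t \<in> e ` carrier ?F" if t: "t \<in> T" for t
  proof -
    let ?d = "\<lambda>s\<in>T. if s = t then \<one> else \<zero>"
    have "finite {s \<in> T. (if s = t then \<one> else \<zero>) \<noteq> \<zero>}"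
      by (rule finite_subset[of _ "{t}"]) auto
    then have d: "?d \<in> carrier ?F" by (auto simp: free_module_def cong: conj_cong)
    have "e ?d = (\<Oplus>\<^bsub>M\<^esub>s\<in>{t}. ?d s \<odot>\<^bsub>M\<^esub> g s)"
      using t by (intro e d) auto
    also have "\<dots> = g t" using t g by (simp add: Pi_def)
    finally show ?thesis using d by (metis image_eqI)
  qed
  then have im: "e ` carrier ?F = g ` T" using eZ by auto
  have "(\<lambda>f\<in>carrier ?F. e f) \<in> lin_hom R ?F M"
    using eadd esm eZ Z(1) by (auto simp: lin_hom_def intro: F.smult_closed)
  moreover have "(\<lambda>f\<in>carrier ?F. e f) ` carrier ?F = g ` T" using im by simp
  ultimately show ?thesis by blast
qed

definition syz :: "('m, 'a) res_gen set \<Rightarrow> (('m, 'a) res_gen \<Rightarrow> 'a) \<Rightarrow> ('m, 'a) res_gen" where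
  "syz T f = Syz (SOME l. set l = {(s, f s) | s. s \<in> T \<and> f s \<noteq> \<zero>})"

lemma inj_on_syz: "inj_on (syz T) (carrier (free_module R T))"
proof (rule inj_onI)
  fix f g assume f: "f \<in> carrier (free_module R T)" and g: "g \<in> carrier (free_module R T)"
    and eq: "syz T f = syz T g"
  have *: "set (SOME l. set l = {(s, f s) | s. s \<in> T \<and> f s \<noteq> \<zero>}) = {(s, f s) | s. s \<in> T \<and> f s \<noteq> \<zero>}"
    if "f \<in> carrier (free_module R T)" for f
  proof -
    have "finite ((\<lambda>s. (s, f s)) ` {s \<in> T. f s \<noteq> \<zero>})"
      using that by (simp add: free_module_def)
    moreover have "(\<lambda>s. (s, f s)) ` {s \<in> T. f s \<noteq> \<zero>} = {(s, f s) | s. s \<in> T \<and> f s \<noteq> \<zero>}" by auto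
    ultimately have "finite {(s, f s) | s. s \<in> T \<and> f s \<noteq> \<zero>}" by (simp only:)
    then have "\<exists>l. set l = {(s, f s) | s. s \<in> T \<and> f s \<noteq> \<zero>}" by (rule finite_list)
    then show ?thesis by (rule someI_ex)
  qed
  have graph: "{(s, f s) | s. s \<in> T \<and> f s \<noteq> \<zero>} = {(s, g s) | s. s \<in> T \<and> g s \<noteq> \<zero>}"
    by (subst *[OF f, symmetric], subst *[OF g, symmetric])
      (rule arg_cong[where f = set], use eq in \<open>simp only: syz_def res_gen.inject\<close>)
  have fg: "f \<in> extensional T" "g \<in> extensional T"
    using f g by (auto simp: free_module_def PiE_def)
  have "f s = g s" if "s \<in> T" for s
  proof (cases "f s = \<zero>")
    case True
    then have "(s, g s) \<notin> {(s, f s) | s. s \<in> T \<and> f s \<noteq> \<zero>}" by auto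
    then show ?thesis using that True unfolding graph by auto
  next
    case False
    then have "(s, f s) \<in> {(s, g s) | s. s \<in> T \<and> g s \<noteq> \<zero>}" using that graph by blast
    then show ?thesis by auto
  qed
  then show "f = g" using fg by (metis extensionalityI)
qed

lemma ex_projective_resolution:
  fixes M :: "('a, 'm) module"
  assumes M: "left_module R M"
  shows "\<exists>(P :: nat \<Rightarrow> ('a, ('m, 'a) res_gen \<Rightarrow> 'a) module) d \<epsilon>. projective_resolution R P d \<epsilon> M"
proof -
  interpret M: left_module R M by fact
  define sub where "sub T Z \<longleftrightarrow> Z \<subseteq> carrier (free_module R T) \<and> \<zero>\<^bsub>free_module R T\<^esub> \<in> Z \<and>
      (\<forall>x\<in>Z. \<forall>y\<in>Z. x \<oplus>\<^bsub>free_module R T\<^esub> y \<in> Z) \<and> (\<forall>a\<in>carrier R. \<forall>x\<in>Z. a \<odot>\<^bsub>free_module R T\<^esub> x \<in> Z)"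
    for T :: "('m, 'a) res_gen set" and Z
  define nxt where "nxt d T Z T' Z' \<longleftrightarrow> d \<in> lin_hom R (free_module R T') (free_module R T) \<and>
      d ` carrier (free_module R T') = Z \<and>
      Z' = {x \<in> carrier (free_module R T'). d x = \<zero>\<^bsub>free_module R T\<^esub>}"
    for d and T :: "('m, 'a) res_gen set" and Z and T' :: "('m, 'a) res_gen set" and Z'
  have sub_ker: "sub T {x \<in> carrier (free_module R T). f x = \<zero>\<^bsub>N\<^esub>}"
    if "left_module R N" "f \<in> lin_hom R (free_module R T) N"
    for T :: "('m, 'a) res_gen set" and N :: "('a, 'n) module" and f
    unfolding sub_def using lin_hom_kernel[OF free_module_left_module that] by blast
  have step: "\<exists>T' Z'. sub T' Z' \<and> (\<exists>d. nxt d T Z T' Z')" if s: "sub T Z" for T Z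
  proof -
    let ?T' = "syz T ` Z" and ?g = "the_inv_into Z (syz T)"
    have "inj_on (syz T) Z" using inj_on_syz s by (auto simp: sub_def intro: inj_on_subset)
    then have g: "?g ` ?T' = Z" by (rule the_inv_into_onto)
    have "\<exists>f \<in> lin_hom R (free_module R ?T') (free_module R T). f ` carrier (free_module R ?T') = ?g ` ?T'"
      by (rule free_module_cover[OF free_module_left_module]) (use s in \<open>simp_all add: g sub_def\<close>)
    then obtain d where d: "d \<in> lin_hom R (free_module R ?T') (free_module R T)"
      "d ` carrier (free_module R ?T') = Z" unfolding g by blast
    then have "nxt d T Z ?T' {x \<in> carrier (free_module R ?T'). d x = \<zero>\<^bsub>free_module R T\<^esub>}"
      by (simp add: nxt_def)
    then show ?thesis using sub_ker[OF free_module_left_module d(1)] by blast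
  qed
  let ?T0 = "(Base :: 'm \<Rightarrow> ('m, 'a) res_gen) ` carrier M"
  have g: "(\<lambda>t. case t of Base x \<Rightarrow> x) ` ?T0 = carrier M" by (force simp: image_image)
  have "\<exists>f \<in> lin_hom R (free_module R ?T0) M. f ` carrier (free_module R ?T0) = (\<lambda>t. case t of Base x \<Rightarrow> x) ` ?T0"
    by (rule free_module_cover[OF M]) (simp_all only: g, auto)
  then obtain \<epsilon> where eps: "\<epsilon> \<in> lin_hom R (free_module R ?T0) M"
    "\<epsilon> ` carrier (free_module R ?T0) = carrier M" unfolding g by blast
  let ?Z0 = "{x \<in> carrier (free_module R ?T0). \<epsilon> x = \<zero>\<^bsub>M\<^esub>}"
  have "\<exists>F. \<forall>n. (sub (fst (F n)) (snd (F n)) \<and> (n = 0 \<longrightarrow> F n = (?T0, ?Z0))) \<and>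
      (\<exists>d. nxt d (fst (F n)) (snd (F n)) (fst (F (Suc n))) (snd (F (Suc n))))"
  proof (rule dependent_nat_choice)
    show "\<exists>x. sub (fst x) (snd x) \<and> (0 = (0::nat) \<longrightarrow> x = (?T0, ?Z0))"
      using sub_ker[OF M eps(1)] by (intro exI[of _ "(?T0, ?Z0)"]) simp
  next
    fix x :: "('m, 'a) res_gen set \<times> (('m, 'a) res_gen \<Rightarrow> 'a) set" and n :: nat
    assume "sub (fst x) (snd x) \<and> (n = 0 \<longrightarrow> x = (?T0, ?Z0))"
    then obtain T' Z' where "sub T' Z'" "\<exists>d. nxt d (fst x) (snd x) T' Z'" using step by blast
    then show "\<exists>y. (sub (fst y) (snd y) \<and> (Suc n = 0 \<longrightarrow> y = (?T0, ?Z0))) \<and>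
        (\<exists>d. nxt d (fst x) (snd x) (fst y) (snd y))"
      by (intro exI[of _ "(T', Z')"]) simp
  qed
  then obtain F where F: "F 0 = (?T0, ?Z0)"
    "\<And>n. \<exists>d. nxt d (fst (F n)) (snd (F n)) (fst (F (Suc n))) (snd (F (Suc n)))" by metis
  then obtain d where d: "\<And>n. nxt (d n) (fst (F n)) (snd (F n)) (fst (F (Suc n))) (snd (F (Suc n)))"
    by metis
  have "projective_resolution R (\<lambda>n. free_module R (fst (F n))) d \<epsilon> M"
    unfolding projective_resolution_def
  proof (intro conjI allI)
    show "d 0 ` carrier (free_module R (fst (F 1))) = {x \<in> carrier (free_module R (fst (F 0))). \<epsilon> x = \<zero>\<^bsub>M\<^esub>}"
      using d[of 0] F(1) by (simp add: nxt_def)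
    show "d (Suc n) ` carrier (free_module R (fst (F (Suc (Suc n)))))
       = {x \<in> carrier (free_module R (fst (F (Suc n)))). d n x = \<zero>\<^bsub>free_module R (fst (F n))\<^esub>}" for n
      using d[of "Suc n"] d[of n] by (simp add: nxt_def)
    show "d n \<in> lin_hom R (free_module R (fst (F (Suc n)))) (free_module R (fst (F n)))" for n
      using d[of n] by (simp add: nxt_def)
  qed (use M eps F(1) free_module_projective in auto)
  then show ?thesis by blast
qed

end

text \<open>Hence the modules \<open>K\<^sub>X\<close> have projective resolutions over the monoid algebra.\<close>

lemma support_module_projective_resolution:
  fixes K :: "'k ring" and B :: "'b monoid"
  assumes "cring K" "left_regular_band B" "finite (carrier B)" "X \<in> lrb_lattice B"
  shows "\<exists>(P :: nat \<Rightarrow> ('b \<Rightarrow> 'k, ('k, 'b \<Rightarrow> 'k) res_gen \<Rightarrow> 'b \<Rightarrow> 'k) module) d \<epsilon>.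
    projective_resolution (monoid_algebra K B) P d \<epsilon> (support_module K B X)"
proof -
  have "monoid B" using assms(2) by (simp add: left_regular_band_def)
  then interpret ring "monoid_algebra K B" by (rule monoid_algebra_ring[OF assms(1) _ assms(3)])
  show ?thesis
    using ex_projective_resolution[OF support_module_left_module[OF assms]] .
qed

end

theory Submission
  imports Defs
begin

text \<open>
  Let \<open>L = B\<^sub>\<ge>\<^sub>X\<close> and let \<open>C\<^sub>m\<close> be the free \<open>K\<close>-module on the chains with \<open>m\<close> elements of the poset \<open>L\<close>, with
  \<open>b \<in> B\<close> acting by left multiplication, and by zero on the chains that leave \<open>L\<close> or shrink. Since \<open>1\<close> is
  the largest element of \<open>L\<close>, the augmented chain complex \<open>\<dots> \<rightarrow> C\<^sub>2 \<rightarrow> C\<^sub>1 \<rightarrow> C\<^sub>0 = K\<^sub>X\<close> is exact. The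
  stabilizer of a chain consists of the elements above its largest element; together with Saliola's
  idempotents of \<open>K B\<close> this makes \<open>C\<^sub>m\<close> projective for \<open>m \<ge> 1\<close>. So Ext may be computed from this
  resolution. A homomorphism from \<open>C\<^sub>n\<^sub>+\<^sub>1\<close> to \<open>K\<^sub>Y\<close> is determined by its values on the chains in \<open>e B\<^sub>\<ge>\<^sub>X\<close>
  with largest element \<open>e\<close>, which are arbitrary; removing \<open>e\<close> turns these chains into the simplices of
  \<open>\<Delta>(X, Y)\<close> with \<open>n\<close> vertices, and the differential into the simplicial coboundary.
\<close>

section \<open>Linear maps\<close>

text \<open>The scalars form an arbitrary commutative ring, so projectivity of \<open>C m\<close>
  cannot come from semisimplicity or from averaging. It is obtained by splitting surjections onto
  \<open>C m\<close>: preimages of the chains can only be chosen arbitrarily, and the decomposition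
  of one into the \<open>eta Z\<close> makes such a choice equivariant. The splitting needs a
  largest element and so excludes the empty chain; this is why the resolution starts at
  \<open>C 1\<close>. A chain that shrinks under \<open>b\<close> has to be sent to zero, since
  \<open>C m\<close> is spanned by chains with exactly \<open>m\<close> elements. The price is that
  compatibility of the boundary with \<open>B\<close> requires a cancellation of signs.
  \<open>Ext\<close> is taken for an arbitrary given resolution, whose elements may have another
  type than combinations of chains, so the comparison of resolutions is proved across types. Except
  when \<open>X\<close> is not below \<open>Y\<close>, all cases of the theorem are read off from
  one isomorphism, valid for every \<open>X \<subseteq> Y\<close> and in every degree.\<close>

definition lin_map ::
    "('r, 's) ring_scheme \<Rightarrow> ('r, 'm) module \<Rightarrow> ('r, 'n) module \<Rightarrow> ('m \<Rightarrow> 'n) \<Rightarrow> bool" where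
  "lin_map R M N f \<longleftrightarrow>
     (\<forall>x\<in>carrier M. f x \<in> carrier N) \<and>
     (\<forall>x\<in>carrier M. \<forall>y\<in>carrier M. f (x \<oplus>\<^bsub>M\<^esub> y) = f x \<oplus>\<^bsub>N\<^esub> f y) \<and>
     (\<forall>a\<in>carrier R. \<forall>x\<in>carrier M. f (a \<odot>\<^bsub>M\<^esub> x) = a \<odot>\<^bsub>N\<^esub> f x)"

lemma lin_mapI:
  assumes "\<And>x. x \<in> carrier M \<Longrightarrow> f x \<in> carrier N"
    and "\<And>x y. x \<in> carrier M \<Longrightarrow> y \<in> carrier M \<Longrightarrow> f (x \<oplus>\<^bsub>M\<^esub> y) = f x \<oplus>\<^bsub>N\<^esub> f y"
    and "\<And>a x. a \<in> carrier R \<Longrightarrow> x \<in> carrier M \<Longrightarrow> f (a \<odot>\<^bsub>M\<^esub> x) = a \<odot>\<^bsub>N\<^esub> f x"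
  shows "lin_map R M N f"
  using assms by (auto simp: lin_map_def)

lemma lin_mapD:
  assumes "lin_map R M N f"
  shows lin_map_closed: "\<And>x. x \<in> carrier M \<Longrightarrow> f x \<in> carrier N"
    and lin_map_add: "\<And>x y. x \<in> carrier M \<Longrightarrow> y \<in> carrier M \<Longrightarrow> f (x \<oplus>\<^bsub>M\<^esub> y) = f x \<oplus>\<^bsub>N\<^esub> f y"
    and lin_map_smult: "\<And>a x. a \<in> carrier R \<Longrightarrow> x \<in> carrier M \<Longrightarrow> f (a \<odot>\<^bsub>M\<^esub> x) = a \<odot>\<^bsub>N\<^esub> f x"
  using assms by (auto simp: lin_map_def)

lemma lin_hom_iff: "f \<in> lin_hom R M N \<longleftrightarrow> lin_map R M N f \<and> f \<in> extensional (carrier M)"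
  by (auto simp: lin_hom_def lin_map_def PiE_def Pi_def)

lemma lin_hom_lin_map: "f \<in> lin_hom R M N \<Longrightarrow> lin_map R M N f"
  by (simp add: lin_hom_iff)

lemma lin_map_id: "lin_map R M M (\<lambda>x. x)"
  by (simp add: lin_map_def)

lemma lin_map_comp:
  assumes "lin_map R M N f" "lin_map R N L g"
  shows "lin_map R M L (\<lambda>x. g (f x))"
  using assms by (simp add: lin_map_def)

lemma (in left_module) smult_l_null: "x \<in> carrier M \<Longrightarrow> \<zero> \<odot>\<^bsub>M\<^esub> x = \<zero>\<^bsub>M\<^esub>"
  using smult_l_distr[of \<zero> \<zero> x] smult_closed[of \<zero> x] by simp

lemma (in left_module) smult_r_null: "a \<in> carrier R \<Longrightarrow> a \<odot>\<^bsub>M\<^esub> \<zero>\<^bsub>M\<^esub> = \<zero>\<^bsub>M\<^esub>"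
  using smult_r_distr[of a "\<zero>\<^bsub>M\<^esub>" "\<zero>\<^bsub>M\<^esub>"] smult_closed[of a "\<zero>\<^bsub>M\<^esub>"] by simp

lemma (in left_module) smult_r_minus:
  assumes "a \<in> carrier R" "x \<in> carrier M"
  shows "a \<odot>\<^bsub>M\<^esub> (\<ominus>\<^bsub>M\<^esub> x) = \<ominus>\<^bsub>M\<^esub> (a \<odot>\<^bsub>M\<^esub> x)"
proof -
  have "a \<odot>\<^bsub>M\<^esub> (\<ominus>\<^bsub>M\<^esub> x) \<oplus>\<^bsub>M\<^esub> a \<odot>\<^bsub>M\<^esub> x = \<zero>\<^bsub>M\<^esub>"
    using assms by (simp add: smult_r_distr[symmetric] M.l_neg smult_r_null)
  then show ?thesis using assms by (simp add: M.minus_equality)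
qed

lemma (in left_module) smult_l_minus:
  assumes "a \<in> carrier R" "x \<in> carrier M"
  shows "(\<ominus> a) \<odot>\<^bsub>M\<^esub> x = \<ominus>\<^bsub>M\<^esub> (a \<odot>\<^bsub>M\<^esub> x)"
proof -
  have "(\<ominus> a) \<odot>\<^bsub>M\<^esub> x \<oplus>\<^bsub>M\<^esub> a \<odot>\<^bsub>M\<^esub> x = \<zero>\<^bsub>M\<^esub>"
    using assms by (simp add: smult_l_distr[symmetric] R.l_neg smult_l_null)
  then show ?thesis using assms by (simp add: M.minus_equality)
qed

lemma (in left_module) smult_finsum:
  assumes "a \<in> carrier R" "f \<in> S \<rightarrow> carrier M"
  shows "a \<odot>\<^bsub>M\<^esub> (\<Oplus>\<^bsub>M\<^esub>s\<in>S. f s) = (\<Oplus>\<^bsub>M\<^esub>s\<in>S. a \<odot>\<^bsub>M\<^esub> f s)"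
  using assms(2)
proof (induction S rule: infinite_finite_induct)
  case (insert s S)
  then show ?case using assms(1) by (auto simp: smult_r_distr Pi_def M.finsum_closed)
qed (use assms(1) in \<open>simp_all add: smult_r_null M.finsum_infinite\<close>)

lemma (in left_module) finsum_smult:
  assumes "f \<in> S \<rightarrow> carrier R" "x \<in> carrier M"
  shows "(\<Oplus>s\<in>S. f s) \<odot>\<^bsub>M\<^esub> x = (\<Oplus>\<^bsub>M\<^esub>s\<in>S. f s \<odot>\<^bsub>M\<^esub> x)"
  using assms(1)
proof (induction S rule: infinite_finite_induct)
  case (insert s S)
  then show ?case using assms(2) by (auto simp: smult_l_distr Pi_def R.finsum_closed)
qed (use assms(2) in \<open>simp_all add: smult_l_null M.finsum_infinite R.finsum_infinite\<close>)

locale lin_map_pair = M: left_module R M + N: left_module R N for R (structure) and M N +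
  fixes f
  assumes lin: "lin_map R M N f"
begin

lemma map_zero: "f \<zero>\<^bsub>M\<^esub> = \<zero>\<^bsub>N\<^esub>"
proof -
  have "f \<zero>\<^bsub>M\<^esub> \<oplus>\<^bsub>N\<^esub> f \<zero>\<^bsub>M\<^esub> = f \<zero>\<^bsub>M\<^esub>" using lin_map_add[OF lin, of "\<zero>\<^bsub>M\<^esub>" "\<zero>\<^bsub>M\<^esub>"] by simp
  then show ?thesis using lin_map_closed[OF lin, of "\<zero>\<^bsub>M\<^esub>"] by simp
qed

lemma map_minus: "x \<in> carrier M \<Longrightarrow> f (\<ominus>\<^bsub>M\<^esub> x) = \<ominus>\<^bsub>N\<^esub> f x"
  using lin_map_add[OF lin, of "\<ominus>\<^bsub>M\<^esub> x" x] lin_map_closed[OF lin]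
  by (intro N.minus_equality[symmetric]) (auto simp: M.l_neg map_zero)

lemma map_diff: "x \<in> carrier M \<Longrightarrow> y \<in> carrier M \<Longrightarrow> f (x \<ominus>\<^bsub>M\<^esub> y) = f x \<ominus>\<^bsub>N\<^esub> f y"
  by (simp add: M.minus_eq N.minus_eq lin_map_add[OF lin] map_minus)

lemma map_finsum:
  assumes "g \<in> S \<rightarrow> carrier M"
  shows "f (\<Oplus>\<^bsub>M\<^esub>s\<in>S. g s) = (\<Oplus>\<^bsub>N\<^esub>s\<in>S. f (g s))"
  using assms
proof (induction S rule: infinite_finite_induct)
  case (insert s S)
  then show ?case using lin_mapD[OF lin] by (auto simp: Pi_def M.finsum_closed)
qed (simp_all add: map_zero N.finsum_infinite M.finsum_infinite)

end

lemma lin_map_pairI: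
  "left_module R M \<Longrightarrow> left_module R N \<Longrightarrow> lin_map R M N f \<Longrightarrow> lin_map_pair R M N f"
  by (simp add: lin_map_pair_def lin_map_pair_axioms_def)

lemmas lin_map_zero = lin_map_pair.map_zero[OF lin_map_pairI]
  and lin_map_diff = lin_map_pair.map_diff[OF lin_map_pairI]
  and lin_map_finsum = lin_map_pair.map_finsum[OF lin_map_pairI]

text \<open>Composites and pointwise sums written as plain abstractions are not extensional, so
  constructions are carried out with \<open>lin_map\<close>; this is the way back to
  \<open>lin_hom\<close>.\<close>

lemma lin_map_restrict:
  assumes "left_module R M" "lin_map R M N f"
  shows "restrict f (carrier M) \<in> lin_hom R M N"
proof -
  interpret left_module R M by fact
  show ?thesis using assms(2) by (simp add: lin_hom_iff lin_map_def)
qed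

lemma lin_map_sum:
  assumes "left_module R M" "left_module R N" "lin_map R M N f" "lin_map R M N g"
  shows "lin_map R M N (\<lambda>x. f x \<oplus>\<^bsub>N\<^esub> g x)"
proof -
  interpret M: left_module R M by fact
  interpret N: left_module R N by fact
  show ?thesis
    using lin_mapD[OF assms(3)] lin_mapD[OF assms(4)]
    by (intro lin_mapI) (auto simp: N.a_ac N.smult_r_distr)
qed

lemma lin_map_minus:
  assumes "left_module R M" "left_module R N" "lin_map R M N f" "lin_map R M N g"
  shows "lin_map R M N (\<lambda>x. f x \<ominus>\<^bsub>N\<^esub> g x)"
proof -
  interpret M: left_module R M by fact
  interpret N: left_module R N by fact
  show ?thesis
    using lin_mapD[OF assms(3)] lin_mapD[OF assms(4)]
    by (intro lin_mapI) (auto simp: N.a_ac N.smult_r_distr N.smult_r_minus N.minus_eq N.minus_add)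
qed

section \<open>Projective modules\<close>

context ring
begin

text \<open>The standard basis vector at \<open>t\<close>, and the zero vector for \<open>t\<close>
  outside \<open>S\<close>.\<close>

definition unit_fun :: "'s set \<Rightarrow> 's \<Rightarrow> 's \<Rightarrow> 'a" where
  "unit_fun S t = (\<lambda>s\<in>S. if s = t then \<one> else \<zero>)"

lemma unit_fun_closed: "unit_fun S t \<in> carrier (free_module R S)"
proof -
  have "finite {s \<in> S. (if s = t then \<one> else \<zero>) \<noteq> \<zero>}"
    by (rule finite_subset[of _ "{t}"]) auto
  then show ?thesis by (auto simp: free_module_def unit_fun_def cong: conj_cong)
qed

lemma free_module_finsum_apply:
  assumes "g \<in> T \<rightarrow> carrier (free_module R S)" "finite T" "s \<in> S"
  shows "(\<Oplus>\<^bsub>free_module R S\<^esub>t\<in>T. g t) s = (\<Oplus>t\<in>T. g t s)"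
  using assms(2,1)
proof (induction T rule: finite_induct)
  case empty
  interpret F: left_module R "free_module R S" by (rule free_module_left_module)
  have "\<zero>\<^bsub>free_module R S\<^esub> s = \<zero>" using assms(3) by (simp add: free_module_def)
  then show ?case by simp
next
  case (insert t T)
  interpret F: left_module R "free_module R S" by (rule free_module_left_module)
  have "g u s \<in> carrier R" if "u \<in> insert t T" for u
    using insert.prems that assms(3) by (auto simp: free_module_def)
  then show ?case using insert assms(3) by (auto simp: free_module_add Pi_def)
qed

lemma free_module_expand:
  assumes "f \<in> carrier (free_module R S)"
  shows "f = (\<Oplus>\<^bsub>free_module R S\<^esub>t\<in>{s\<in>S. f s \<noteq> \<zero>}. f t \<odot>\<^bsub>free_module R S\<^esub> unit_fun S t)"
    (is "f = ?g")
proof -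
  interpret F: left_module R "free_module R S" by (rule free_module_left_module)
  have f: "f s \<in> carrier R" if "s \<in> S" for s using assms that by (auto simp: free_module_def)
  have fin: "finite {s\<in>S. f s \<noteq> \<zero>}" using assms by (simp add: free_module_def)
  have cl: "(\<lambda>t. f t \<odot>\<^bsub>free_module R S\<^esub> unit_fun S t) \<in> {s\<in>S. f s \<noteq> \<zero>} \<rightarrow> carrier (free_module R S)"
    using f unit_fun_closed by (auto intro!: F.smult_closed)
  have "?g \<in> carrier (free_module R S)" by (rule F.finsum_closed[OF cl])
  then have ext: "?g \<in> extensional S" "f \<in> extensional S"
    using assms by (auto simp: free_module_def PiE_def)
  show ?thesis
  proof (rule extensionalityI[OF ext(2) ext(1)])
    fix s assume s: "s \<in> S"
    have "?g s = (\<Oplus>t\<in>{s\<in>S. f s \<noteq> \<zero>}. if t = s then f t else \<zero>)"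
      using s f unfolding free_module_finsum_apply[OF cl fin s]
      by (intro finsum_cong') (auto simp: free_module_smult unit_fun_def)
    also have "\<dots> = f s"
    proof (cases "f s = \<zero>")
      case True
      then show ?thesis by (auto intro!: finsum_zero_eqI)
    next
      case False
      then show ?thesis using s f fin by (intro finsum_delta) auto
    qed
    finally show "f s = ?g s" by simp
  qed
qed

text \<open>The existence half of the universal property of the free module: the basis vector of
  \<open>t\<close> goes to \<open>g t\<close>.\<close>

lemma free_module_extend:
  assumes M: "left_module R M" and g: "\<And>t. t \<in> T \<Longrightarrow> g t \<in> carrier M"
  shows "lin_map R (free_module R T) M (\<lambda>f. \<Oplus>\<^bsub>M\<^esub>s\<in>{s \<in> T. f s \<noteq> \<zero>}. f s \<odot>\<^bsub>M\<^esub> g s)"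
proof -
  interpret M: left_module R M by fact
  let ?F = "free_module R T"
  interpret F: left_module R ?F by (rule free_module_left_module)
  have car: "f s \<in> carrier R" if "f \<in> carrier ?F" "s \<in> T" for f s
    using that by (auto simp: free_module_def)
  have fin: "finite {s \<in> T. f s \<noteq> \<zero>}" if "f \<in> carrier ?F" for f
    using that by (simp add: free_module_def)
  define e where "e f = (\<Oplus>\<^bsub>M\<^esub>s\<in>{s \<in> T. f s \<noteq> \<zero>}. f s \<odot>\<^bsub>M\<^esub> g s)" for f
  \<comment> \<open>Vanishing coefficients contribute nothing, so the sum may run over any finite
    superset of the support; this gives \<open>x\<close>, \<open>y\<close> and their sum a common
    index set.\<close>
  have e: "e f = (\<Oplus>\<^bsub>M\<^esub>s\<in>A. f s \<odot>\<^bsub>M\<^esub> g s)"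
    if "f \<in> carrier ?F" "finite A" "A \<subseteq> T" "{s \<in> T. f s \<noteq> \<zero>} \<subseteq> A" for f A
    unfolding e_def using that
    by (intro M.add.finprod_mono_neutral_cong_left) (auto simp: car g M.smult_l_null)
  have "lin_map R ?F M e"
  proof (rule lin_mapI)
    fix x assume x: "x \<in> carrier ?F"
    show "e x \<in> carrier M" unfolding e_def by (intro M.finsum_closed) (use car[OF x] g in auto)
    fix a assume a: "a \<in> carrier R"
    have "e (a \<odot>\<^bsub>?F\<^esub> x) = (\<Oplus>\<^bsub>M\<^esub>s\<in>{s \<in> T. x s \<noteq> \<zero>}. (a \<odot>\<^bsub>?F\<^esub> x) s \<odot>\<^bsub>M\<^esub> g s)"
      using a fin[OF x] F.smult_closed[OF a x] by (intro e) (auto simp: free_module_smult)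
    also have "\<dots> = (\<Oplus>\<^bsub>M\<^esub>s\<in>{s \<in> T. x s \<noteq> \<zero>}. a \<odot>\<^bsub>M\<^esub> (x s \<odot>\<^bsub>M\<^esub> g s))"
      using car[OF x] a g
      by (intro M.finsum_cong' refl) (auto simp: free_module_smult M.smult_assoc1)
    also have "\<dots> = a \<odot>\<^bsub>M\<^esub> e x"
      unfolding e_def using car[OF x] a g by (intro M.smult_finsum[symmetric]) auto
    finally show "e (a \<odot>\<^bsub>?F\<^esub> x) = a \<odot>\<^bsub>M\<^esub> e x" .
  next
    fix x y assume x: "x \<in> carrier ?F" and y: "y \<in> carrier ?F"
    let ?A = "{s \<in> T. x s \<noteq> \<zero>} \<union> {s \<in> T. y s \<noteq> \<zero>}"
    have A: "finite ?A" "?A \<subseteq> T" using fin x y by auto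
    have "e (x \<oplus>\<^bsub>?F\<^esub> y) = (\<Oplus>\<^bsub>M\<^esub>s\<in>?A. (x \<oplus>\<^bsub>?F\<^esub> y) s \<odot>\<^bsub>M\<^esub> g s)"
      by (rule e[OF F.a_closed[OF x y] A]) (auto simp: free_module_add)
    also have "\<dots> = (\<Oplus>\<^bsub>M\<^esub>s\<in>?A. x s \<odot>\<^bsub>M\<^esub> g s \<oplus>\<^bsub>M\<^esub> y s \<odot>\<^bsub>M\<^esub> g s)"
      using car[OF x] car[OF y] g
      by (intro M.finsum_cong' refl) (auto simp: free_module_add M.smult_l_distr)
    also have "\<dots> = (\<Oplus>\<^bsub>M\<^esub>s\<in>?A. x s \<odot>\<^bsub>M\<^esub> g s) \<oplus>\<^bsub>M\<^esub> (\<Oplus>\<^bsub>M\<^esub>s\<in>?A. y s \<odot>\<^bsub>M\<^esub> g s)"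
      using car[OF x] car[OF y] g by (intro M.finsum_addf) auto
    also have "\<dots> = e x \<oplus>\<^bsub>M\<^esub> e y" using e[OF x A] e[OF y A] by auto
    finally show "e (x \<oplus>\<^bsub>?F\<^esub> y) = e x \<oplus>\<^bsub>M\<^esub> e y" .
  qed
  then show ?thesis by (simp add: e_def[abs_def])
qed

text \<open>Surjectivity of \<open>g\<close> is replaced by a condition on images, since a
  differential maps onto a kernel only; that kernel need not be turned into a module of its own. The
  lift sends the basis vectors of the ambient free module to chosen preimages and is precomposed
  with the embedding \<open>i\<close>.\<close>

lemma projective_lift:
  fixes P :: "('a, 'p) module"
  assumes P: "projective_module R P" and M: "left_module R M" and N: "left_module R N"
    and f: "lin_map R P N f" and g: "lin_map R M N g"
    and sub: "\<And>x. x \<in> carrier P \<Longrightarrow> f x \<in> g ` carrier M"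
  shows "\<exists>h. lin_map R P M h \<and> (\<forall>x\<in>carrier P. g (h x) = f x)"
proof -
  interpret M: left_module R M by fact
  interpret N: left_module R N by fact
  obtain S :: "'p set" and i \<pi> where hom: "i \<in> lin_hom R P (free_module R S)"
    "\<pi> \<in> lin_hom R (free_module R S) P" and id: "\<And>x. x \<in> carrier P \<Longrightarrow> \<pi> (i x) = x"
    using P unfolding projective_module_def by (elim conjE exE bexE) (rule that, auto)
  note i = hom(1)[THEN lin_hom_lin_map] and pi = hom(2)[THEN lin_hom_lin_map]
  let ?F = "free_module R S"
  note F = free_module_left_module[of S]
  interpret F: left_module R ?F by (rule F)
  define m where "m s = (SOME y. y \<in> carrier M \<and> g y = f (\<pi> (unit_fun S s)))" for s
  have m: "m s \<in> carrier M \<and> g (m s) = f (\<pi> (unit_fun S s))" for s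
  proof -
    have "f (\<pi> (unit_fun S s)) \<in> g ` carrier M"
      by (rule sub[OF lin_map_closed[OF pi unit_fun_closed]])
    then obtain y where "y \<in> carrier M \<and> g y = f (\<pi> (unit_fun S s))" by (metis imageE)
    then show ?thesis unfolding m_def by (rule someI)
  qed
  define e where "e f = (\<Oplus>\<^bsub>M\<^esub>s\<in>{s \<in> S. f s \<noteq> \<zero>}. f s \<odot>\<^bsub>M\<^esub> m s)" for f
  have e: "lin_map R ?F M e"
    unfolding e_def using free_module_extend[OF M, of S m] m by simp
  have fpi: "lin_map R ?F N (\<lambda>x. f (\<pi> x))" by (rule lin_map_comp[OF pi f])
  have ge: "g (e x) = f (\<pi> x)" if x: "x \<in> carrier ?F" for x
  proof -
    let ?A = "{s \<in> S. x s \<noteq> \<zero>}"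
    have car: "x s \<in> carrier R" if "s \<in> S" for s using that x by (auto simp: free_module_def)
    have "g (e x) = (\<Oplus>\<^bsub>N\<^esub>s\<in>?A. g (x s \<odot>\<^bsub>M\<^esub> m s))"
      unfolding e_def by (rule lin_map_finsum[OF M N g]) (use m car in auto)
    also have "\<dots> = (\<Oplus>\<^bsub>N\<^esub>s\<in>?A. f (\<pi> (x s \<odot>\<^bsub>?F\<^esub> unit_fun S s)))"
    proof (intro N.finsum_cong' refl)
      fix s assume s: "s \<in> ?A"
      then have "x s \<in> carrier R" using car by simp
      then show "g (x s \<odot>\<^bsub>M\<^esub> m s) = f (\<pi> (x s \<odot>\<^bsub>?F\<^esub> unit_fun S s))"
        using m lin_map_smult[OF g] lin_map_smult[OF fpi] unit_fun_closed by metis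
    qed (use car unit_fun_closed lin_map_closed[OF fpi] in \<open>auto intro!: lin_map_closed[OF fpi] F.smult_closed\<close>)
    also have "\<dots> = f (\<pi> (\<Oplus>\<^bsub>?F\<^esub>s\<in>?A. x s \<odot>\<^bsub>?F\<^esub> unit_fun S s))"
      by (rule lin_map_finsum[OF F N fpi, symmetric]) (use car unit_fun_closed in \<open>auto intro!: F.smult_closed\<close>)
    also have "\<dots> = f (\<pi> x)" using free_module_expand[OF x] by simp
    finally show ?thesis .
  qed
  show ?thesis
  proof (intro exI conjI ballI)
    show "lin_map R P M (\<lambda>x. e (i x))" by (rule lin_map_comp[OF i e])
    show "g (e (i x)) = f x" if "x \<in> carrier P" for x
      using ge[OF lin_map_closed[OF i that]] id[OF that] by simp
  qed
qed

text \<open>It suffices to split the canonical cover of \<open>Q\<close> by the free module on its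
  own elements. Therefore \<open>lift\<close> speaks about modules of that one element type; an
  assumption could not range over all types anyway.\<close>

lemma projective_moduleI:
  fixes Q :: "('a, 'q) module"
  assumes Q: "left_module R Q"
    and lift: "\<And>(M :: ('a, 'q \<Rightarrow> 'a) module) g. left_module R M \<Longrightarrow> lin_map R M Q g \<Longrightarrow>
      g ` carrier M = carrier Q \<Longrightarrow> \<exists>h. lin_map R Q M h \<and> (\<forall>x\<in>carrier Q. g (h x) = x)"
  shows "projective_module R Q"
proof -
  interpret Q: left_module R Q by fact
  let ?F = "free_module R (carrier Q)"
  have "\<exists>f \<in> lin_hom R ?F Q. f ` carrier ?F = (\<lambda>x. x) ` carrier Q"
    by (rule free_module_cover[OF Q]) auto
  then obtain \<pi> where pi: "\<pi> \<in> lin_hom R ?F Q" "\<pi> ` carrier ?F = carrier Q" by auto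
  from lift[OF free_module_left_module lin_hom_lin_map[OF pi(1)] pi(2)] obtain h
    where h: "lin_map R Q ?F h" "\<And>x. x \<in> carrier Q \<Longrightarrow> \<pi> (h x) = x" by blast
  show ?thesis
    unfolding projective_module_def
    using Q pi(1) lin_map_restrict[OF Q h(1)] h(2)
    by (intro conjI exI[of _ "carrier Q"] bexI[of _ "restrict h (carrier Q)"] bexI[of _ \<pi>]) simp_all
qed

end

section \<open>Comparison of projective resolutions\<close>

lemma projective_resolutionD:
  assumes "projective_resolution R P d \<epsilon> M"
  shows "left_module R M"
    and "projective_module R (P n)" "left_module R (P n)"
    and "lin_map R (P (Suc n)) (P n) (d n)"
    and "lin_map R (P 0) M \<epsilon>"
    and "\<epsilon> ` carrier (P 0) = carrier M"
    and "d 0 ` carrier (P (Suc 0)) = {x \<in> carrier (P 0). \<epsilon> x = \<zero>\<^bsub>M\<^esub>}"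
    and "d (Suc n) ` carrier (P (Suc (Suc n))) = {x \<in> carrier (P (Suc n)). d n x = \<zero>\<^bsub>P n\<^esub>}"
    and "x \<in> carrier (P (Suc 0)) \<Longrightarrow> \<epsilon> (d 0 x) = \<zero>\<^bsub>M\<^esub>"
    and "y \<in> carrier (P (Suc (Suc n))) \<Longrightarrow> d n (d (Suc n) y) = \<zero>\<^bsub>P n\<^esub>"
proof -
  note r = assms[unfolded projective_resolution_def lin_hom_iff]
  show "left_module R M" "projective_module R (P n)" "lin_map R (P (Suc n)) (P n) (d n)"
    "lin_map R (P 0) M \<epsilon>" "\<epsilon> ` carrier (P 0) = carrier M"
    and d0: "d 0 ` carrier (P (Suc 0)) = {x \<in> carrier (P 0). \<epsilon> x = \<zero>\<^bsub>M\<^esub>}"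
    and dS: "d (Suc n) ` carrier (P (Suc (Suc n))) = {x \<in> carrier (P (Suc n)). d n x = \<zero>\<^bsub>P n\<^esub>}"
    using r by auto
  then show "left_module R (P n)" by (simp add: projective_module_def)
  show "\<epsilon> (d 0 x) = \<zero>\<^bsub>M\<^esub>" if "x \<in> carrier (P (Suc 0))"
    using imageI[OF that, of "d 0"] unfolding d0 by simp
  show "d n (d (Suc n) y) = \<zero>\<^bsub>P n\<^esub>" if "y \<in> carrier (P (Suc (Suc n)))"
    using imageI[OF that, of "d (Suc n)"] unfolding dS by simp
qed

context ring
begin

lemma resolution_chain_map:
  fixes P :: "nat \<Rightarrow> ('a, 'p) module" and Q :: "nat \<Rightarrow> ('a, 'q) module"
  assumes P: "projective_resolution R P d \<epsilon> M" and Q: "projective_resolution R Q d' \<epsilon>' M"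
  shows "\<exists>\<theta>. (\<forall>n. lin_map R (P n) (Q n) (\<theta> n)) \<and> (\<forall>x\<in>carrier (P 0). \<epsilon>' (\<theta> 0 x) = \<epsilon> x) \<and>
    (\<forall>n. \<forall>x\<in>carrier (P (Suc n)). d' n (\<theta> (Suc n) x) = \<theta> n (d n x))"
proof -
  note p = projective_resolutionD[OF P] and q = projective_resolutionD[OF Q]
  \<comment> \<open>The last conjunct is the premise of \<open>projective_lift\<close> in degree
    \<open>Suc n\<close>; carrying it along lets each choice depend on the preceding map
    only.\<close>
  define I where "I n \<theta> \<longleftrightarrow> lin_map R (P n) (Q n) \<theta> \<and>
    (n = 0 \<longrightarrow> (\<forall>x\<in>carrier (P 0). \<epsilon>' (\<theta> x) = \<epsilon> x)) \<and>
    (\<forall>x\<in>carrier (P (Suc n)). \<theta> (d n x) \<in> d' n ` carrier (Q (Suc n)))" for n \<theta>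
  have "\<exists>\<theta>. \<forall>n. I n (\<theta> n) \<and> (\<forall>x\<in>carrier (P (Suc n)). d' n (\<theta> (Suc n) x) = \<theta> n (d n x))"
  proof (rule dependent_nat_choice)
    obtain t where t: "lin_map R (P 0) (Q 0) t" "\<And>x. x \<in> carrier (P 0) \<Longrightarrow> \<epsilon>' (t x) = \<epsilon> x"
      using projective_lift[OF p(2) q(3) p(1) p(5) q(5)] lin_map_closed[OF p(5)] q(6) by blast
    have "t (d 0 x) \<in> d' 0 ` carrier (Q (Suc 0))" if x: "x \<in> carrier (P (Suc 0))" for x
      using lin_map_closed[OF t(1)] t(2) lin_map_closed[OF p(4) x] p(9)[OF x] by (simp add: q(7))
    then show "\<exists>t. I 0 t" using t by (auto simp: I_def)
  next
    fix t n assume t: "I n t"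
    then have lt: "lin_map R (P n) (Q n) t" by (simp add: I_def)
    obtain u where u: "lin_map R (P (Suc n)) (Q (Suc n)) u"
      "\<And>x. x \<in> carrier (P (Suc n)) \<Longrightarrow> d' n (u x) = t (d n x)"
      using projective_lift[OF p(2) q(3) q(3) lin_map_comp[OF p(4) lt] q(4)] t
      unfolding I_def by blast
    have "u (d (Suc n) x) \<in> d' (Suc n) ` carrier (Q (Suc (Suc n)))"
      if x: "x \<in> carrier (P (Suc (Suc n)))" for x
      using lin_map_closed[OF u(1)] u(2) lin_map_closed[OF p(4) x] p(10)[OF x]
        lin_map_zero[OF p(3) q(3) lt] by (simp add: q(8))
    then show "\<exists>u. I (Suc n) u \<and> (\<forall>x\<in>carrier (P (Suc n)). d' n (u x) = t (d n x))"
      using u by (auto simp: I_def)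
  qed
  then obtain \<theta> where I: "\<And>n. I n (\<theta> n)"
    and comm: "\<And>n. \<forall>x\<in>carrier (P (Suc n)). d' n (\<theta> (Suc n) x) = \<theta> n (d n x)" by blast
  show ?thesis
    using I[of 0] I comm by (intro exI[of _ \<theta>]) (simp add: I_def)
qed

lemma resolution_homotopy:
  fixes P :: "nat \<Rightarrow> ('a, 'p) module" and Q :: "nat \<Rightarrow> ('a, 'q) module"
  assumes P: "projective_resolution R P d \<epsilon> M" and Q: "projective_resolution R Q d' \<epsilon>' M"
    and a: "\<And>n. lin_map R (P n) (Q n) (\<alpha> n)" and b: "\<And>n. lin_map R (P n) (Q n) (\<beta> n)"
    and eps: "\<And>x. x \<in> carrier (P 0) \<Longrightarrow> \<epsilon>' (\<alpha> 0 x) = \<epsilon>' (\<beta> 0 x)"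
    and da: "\<And>n x. x \<in> carrier (P (Suc n)) \<Longrightarrow> d' n (\<alpha> (Suc n) x) = \<alpha> n (d n x)"
    and db: "\<And>n x. x \<in> carrier (P (Suc n)) \<Longrightarrow> d' n (\<beta> (Suc n) x) = \<beta> n (d n x)"
  shows "\<exists>h. (\<forall>n. lin_map R (P n) (Q (Suc n)) (h n)) \<and>
    (\<forall>x\<in>carrier (P 0). d' 0 (h 0 x) = \<alpha> 0 x \<ominus>\<^bsub>Q 0\<^esub> \<beta> 0 x) \<and>
    (\<forall>n. \<forall>x\<in>carrier (P (Suc n)). d' (Suc n) (h (Suc n) x) =
       \<alpha> (Suc n) x \<ominus>\<^bsub>Q (Suc n)\<^esub> \<beta> (Suc n) x \<ominus>\<^bsub>Q (Suc n)\<^esub> h n (d n x))"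
proof -
  note p = projective_resolutionD[OF P] and q = projective_resolutionD[OF Q]
  \<comment> \<open>The last conjunct makes \<open>\<alpha> - \<beta> - h d\<close> in degree
    \<open>Suc n\<close> a cycle for \<open>d' n\<close>, so that by exactness it lifts through
    \<open>d' (Suc n)\<close>.\<close>
  define I where "I n h \<longleftrightarrow> lin_map R (P n) (Q (Suc n)) h \<and>
    (n = 0 \<longrightarrow> (\<forall>x\<in>carrier (P 0). d' 0 (h x) = \<alpha> 0 x \<ominus>\<^bsub>Q 0\<^esub> \<beta> 0 x)) \<and>
    (\<forall>x\<in>carrier (P (Suc n)). d' n (h (d n x)) = \<alpha> n (d n x) \<ominus>\<^bsub>Q n\<^esub> \<beta> n (d n x))" for n h
  have ab: "lin_map R (P n) (Q n) (\<lambda>x. \<alpha> n x \<ominus>\<^bsub>Q n\<^esub> \<beta> n x)" for n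
    by (rule lin_map_minus[OF p(3) q(3) a b])
  have "\<exists>h. \<forall>n. I n (h n) \<and> (\<forall>x\<in>carrier (P (Suc n)). d' (Suc n) (h (Suc n) x) =
       \<alpha> (Suc n) x \<ominus>\<^bsub>Q (Suc n)\<^esub> \<beta> (Suc n) x \<ominus>\<^bsub>Q (Suc n)\<^esub> h n (d n x))"
  proof (rule dependent_nat_choice)
    have "\<alpha> 0 x \<ominus>\<^bsub>Q 0\<^esub> \<beta> 0 x \<in> d' 0 ` carrier (Q (Suc 0))" if x: "x \<in> carrier (P 0)" for x
    proof -
      interpret M: left_module R M by (rule p(1))
      have "\<epsilon>' (\<alpha> 0 x \<ominus>\<^bsub>Q 0\<^esub> \<beta> 0 x) = \<epsilon>' (\<alpha> 0 x) \<ominus>\<^bsub>M\<^esub> \<epsilon>' (\<beta> 0 x)"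
        by (rule lin_map_diff[OF q(3,1,5)]) (use x lin_map_closed[OF a] lin_map_closed[OF b] in auto)
      also have "\<dots> = \<zero>\<^bsub>M\<^esub>"
        using eps[OF x] lin_map_closed[OF q(5) lin_map_closed[OF b x]] by (simp add: M.r_neg M.minus_eq)
      finally show ?thesis using lin_map_closed[OF ab x] by (simp add: q(7))
    qed
    then obtain h where h: "lin_map R (P 0) (Q (Suc 0)) h"
      "\<And>x. x \<in> carrier (P 0) \<Longrightarrow> d' 0 (h x) = \<alpha> 0 x \<ominus>\<^bsub>Q 0\<^esub> \<beta> 0 x"
      using projective_lift[OF p(2) q(3) q(3) ab q(4)] by blast
    then show "\<exists>h. I 0 h" using lin_map_closed[OF p(4)] by (auto simp: I_def)
  next
    fix h n assume h: "I n h"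
    then have lh: "lin_map R (P n) (Q (Suc n)) h" by (simp add: I_def)
    note ca = lin_map_closed[OF a] and cb = lin_map_closed[OF b] and cd = lin_map_closed[OF p(4)]
    interpret Qs: left_module R "Q (Suc n)" by (rule q(3))
    interpret Qss: left_module R "Q (Suc (Suc n))" by (rule q(3))
    interpret Qn: left_module R "Q n" by (rule q(3))
    let ?f = "\<lambda>x. \<alpha> (Suc n) x \<ominus>\<^bsub>Q (Suc n)\<^esub> \<beta> (Suc n) x \<ominus>\<^bsub>Q (Suc n)\<^esub> h (d n x)"
    have f: "lin_map R (P (Suc n)) (Q (Suc n)) ?f"
      by (rule lin_map_minus[OF p(3) q(3) ab lin_map_comp[OF p(4) lh]])
    have "?f x \<in> d' (Suc n) ` carrier (Q (Suc (Suc n)))" if x: "x \<in> carrier (P (Suc n))" for x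
    proof -
      have "d' n (?f x) = (\<alpha> n (d n x) \<ominus>\<^bsub>Q n\<^esub> \<beta> n (d n x)) \<ominus>\<^bsub>Q n\<^esub> d' n (h (d n x))"
        using x ca cb lin_map_closed[OF lh] cd
        by (simp add: lin_map_diff[OF q(3) q(3) q(4)] da db)
      also have "\<dots> = \<zero>\<^bsub>Q n\<^esub>"
        using h x lin_map_closed[OF ab cd[OF x]] by (auto simp: I_def Qn.r_neg Qn.minus_eq)
      finally show ?thesis using lin_map_closed[OF f x] by (simp add: q(8))
    qed
    then obtain u where u: "lin_map R (P (Suc n)) (Q (Suc (Suc n))) u"
      "\<And>x. x \<in> carrier (P (Suc n)) \<Longrightarrow> d' (Suc n) (u x) = ?f x"
      using projective_lift[OF p(2) q(3) q(3) f q(4)] by blast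
    have "d' (Suc n) (u (d (Suc n) x)) = \<alpha> (Suc n) (d (Suc n) x) \<ominus>\<^bsub>Q (Suc n)\<^esub> \<beta> (Suc n) (d (Suc n) x)"
      if x: "x \<in> carrier (P (Suc (Suc n)))" for x
      using u(2)[OF cd[OF x]] p(10)[OF x] lin_map_zero[OF p(3) q(3) lh] ca[OF cd[OF x]] cb[OF cd[OF x]]
      by (simp add: Qs.minus_eq)
    then show "\<exists>u. I (Suc n) u \<and> (\<forall>x\<in>carrier (P (Suc n)). d' (Suc n) (u x) = ?f x)"
      using u by (auto simp: I_def)
  qed
  then obtain h where I: "\<And>n. I n (h n)"
    and comm: "\<And>n. \<forall>x\<in>carrier (P (Suc n)). d' (Suc n) (h (Suc n) x) =
       \<alpha> (Suc n) x \<ominus>\<^bsub>Q (Suc n)\<^esub> \<beta> (Suc n) x \<ominus>\<^bsub>Q (Suc n)\<^esub> h n (d n x)" by blast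
  show ?thesis
    using I[of 0] I comm by (intro exI[of _ h]) (simp add: I_def)
qed

end

section \<open>Cohomology and the independence of Ext of the resolution\<close>

definition is_submodule :: "('k, 's) ring_scheme \<Rightarrow> ('k, 'm) module \<Rightarrow> 'm set \<Rightarrow> bool" where
  "is_submodule K M Z \<longleftrightarrow> Z \<subseteq> carrier M \<and> \<zero>\<^bsub>M\<^esub> \<in> Z \<and> (\<forall>x\<in>Z. \<forall>y\<in>Z. x \<oplus>\<^bsub>M\<^esub> y \<in> Z) \<and>
     (\<forall>a\<in>carrier K. \<forall>x\<in>Z. a \<odot>\<^bsub>M\<^esub> x \<in> Z)"

lemma is_submodule_kernel:
  assumes "left_module K M" "left_module K N" "lin_map K M N f"
  shows "is_submodule K M {x \<in> carrier M. f x = \<zero>\<^bsub>N\<^esub>}"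
proof -
  interpret M: left_module K M by fact
  interpret N: left_module K N by fact
  show ?thesis unfolding is_submodule_def
    by (auto simp: lin_map_zero[OF assms] lin_map_add[OF assms(3)] lin_map_smult[OF assms(3)] N.smult_r_null)
qed

lemma is_submodule_image:
  assumes "left_module K M" "left_module K N" "lin_map K M N f"
  shows "is_submodule K N (f ` carrier M)"
proof -
  interpret M: left_module K M by fact
  interpret N: left_module K N by fact
  have "\<zero>\<^bsub>N\<^esub> \<in> f ` carrier M"
    using imageI[OF M.zero_closed, of f] unfolding lin_map_zero[OF assms] .
  moreover have "x \<oplus>\<^bsub>N\<^esub> y \<in> f ` carrier M" if "x \<in> f ` carrier M" "y \<in> f ` carrier M" for x y
    using that by (auto simp: lin_map_add[OF assms(3), symmetric])
  moreover have "a \<odot>\<^bsub>N\<^esub> x \<in> f ` carrier M" if "x \<in> f ` carrier M" "a \<in> carrier K" for x a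
    using that by (auto simp: lin_map_smult[OF assms(3), symmetric])
  ultimately show ?thesis unfolding is_submodule_def
    using lin_map_closed[OF assms(3)] by blast
qed

lemma is_submodule_zero: "left_module K M \<Longrightarrow> is_submodule K M {\<zero>\<^bsub>M\<^esub>}"
proof -
  assume "left_module K M"
  then interpret M: left_module K M .
  show ?thesis by (simp add: is_submodule_def M.smult_r_null)
qed

lemma is_submodule_diff:
  assumes "left_module K M" "is_submodule K M Z" "x \<in> Z" "y \<in> Z"
  shows "x \<ominus>\<^bsub>M\<^esub> y \<in> Z"
proof -
  interpret M: left_module K M by fact
  have "y \<in> carrier M" and "x \<oplus>\<^bsub>M\<^esub> (\<ominus>\<^bsub>K\<^esub> \<one>\<^bsub>K\<^esub>) \<odot>\<^bsub>M\<^esub> y \<in> Z"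
    using assms by (auto simp: is_submodule_def)
  then show ?thesis by (simp add: M.smult_l_minus M.minus_eq)
qed

lemma is_submodule_abelian_subgroup:
  assumes "left_module K M" "is_submodule K M H"
  shows "abelian_subgroup H M"
proof -
  interpret M: left_module K M by fact
  have "\<ominus>\<^bsub>M\<^esub> x \<in> H" if "x \<in> H" for x
  proof -
    have x: "x \<in> carrier M" and "(\<ominus>\<^bsub>K\<^esub> \<one>\<^bsub>K\<^esub>) \<odot>\<^bsub>M\<^esub> x \<in> H" using assms(2) that by (auto simp: is_submodule_def)
    then show ?thesis by (simp add: M.smult_l_minus)
  qed
  then have "additive_subgroup H M"
    using assms(2) by (intro additive_subgroup.intro M.add.subgroupI)
      (auto simp: is_submodule_def a_inv_def[symmetric])
  then show ?thesis by (intro abelian_subgroupI3 M.abelian_group_axioms)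
qed

text \<open>The elementwise multiple of a coset need not be a coset (for \<open>a\<close> zero it is
  a single point); adding \<open>H\<close>, as \<open>subquotient\<close> does, completes
  it.\<close>

lemma smult_coset:
  assumes M: "left_module K M" and H: "is_submodule K M H" and a: "a \<in> carrier K" and x: "x \<in> carrier M"
  shows "H <+>\<^bsub>M\<^esub> (\<lambda>x. a \<odot>\<^bsub>M\<^esub> x) ` (H +>\<^bsub>M\<^esub> x) = H +>\<^bsub>M\<^esub> (a \<odot>\<^bsub>M\<^esub> x)"
proof -
  interpret M: left_module K M by (rule M)
  interpret H: abelian_subgroup H M by (rule is_submodule_abelian_subgroup[OF M H])
  have HM: "h \<in> carrier M" "a \<odot>\<^bsub>M\<^esub> h \<in> H" if "h \<in> H" for h
    using H that a by (auto simp: is_submodule_def)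
  have HH: "h \<oplus>\<^bsub>M\<^esub> k \<in> H" if "h \<in> H" "k \<in> H" for h k
    using H that a by (auto simp: is_submodule_def)
  show ?thesis
  proof (intro equalityI subsetI)
    fix z assume "z \<in> H <+>\<^bsub>M\<^esub> (\<lambda>x. a \<odot>\<^bsub>M\<^esub> x) ` (H +>\<^bsub>M\<^esub> x)"
    then obtain h k where hk: "h \<in> H" "k \<in> H" "z = h \<oplus>\<^bsub>M\<^esub> (a \<odot>\<^bsub>M\<^esub> (k \<oplus>\<^bsub>M\<^esub> x))"
      by (auto simp: set_add_def' a_r_coset_def')
    then have "z = (h \<oplus>\<^bsub>M\<^esub> a \<odot>\<^bsub>M\<^esub> k) \<oplus>\<^bsub>M\<^esub> a \<odot>\<^bsub>M\<^esub> x"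
      using HM a x by (simp add: M.smult_r_distr M.a_assoc)
    then show "z \<in> H +>\<^bsub>M\<^esub> (a \<odot>\<^bsub>M\<^esub> x)" using HH HM hk by (auto simp: a_r_coset_def')
  next
    fix z assume "z \<in> H +>\<^bsub>M\<^esub> (a \<odot>\<^bsub>M\<^esub> x)"
    then obtain h where "h \<in> H" "z = h \<oplus>\<^bsub>M\<^esub> (a \<odot>\<^bsub>M\<^esub> x)" by (auto simp: a_r_coset_def')
    moreover have "x \<in> H +>\<^bsub>M\<^esub> x" using x by (rule H.a_rcos_self)
    ultimately show "z \<in> H <+>\<^bsub>M\<^esub> (\<lambda>x. a \<odot>\<^bsub>M\<^esub> x) ` (H +>\<^bsub>M\<^esub> x)"
      by (auto simp: set_add_def')
  qed
qed

text \<open>Surjectivity is asked modulo \<open>H'\<close> only, and injectivity modulo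
  \<open>H\<close>, so \<open>f\<close> may be one degree of a homotopy equivalence.\<close>

lemma subquotient_iso:
  assumes M: "left_module K M" and M': "left_module K M'"
    and Z: "is_submodule K M Z" and H: "is_submodule K M H" "H \<subseteq> Z"
    and Z': "is_submodule K M' Z'" and H': "is_submodule K M' H'" "H' \<subseteq> Z'"
    and add: "\<And>x y. x \<in> Z \<Longrightarrow> y \<in> Z \<Longrightarrow> f (x \<oplus>\<^bsub>M\<^esub> y) = f x \<oplus>\<^bsub>M'\<^esub> f y"
    and smult: "\<And>a x. a \<in> carrier K \<Longrightarrow> x \<in> Z \<Longrightarrow> f (a \<odot>\<^bsub>M\<^esub> x) = a \<odot>\<^bsub>M'\<^esub> f x"
    and fZ: "\<And>x. x \<in> Z \<Longrightarrow> f x \<in> Z'" and fH: "\<And>x. x \<in> H \<Longrightarrow> f x \<in> H'"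
    and inj: "\<And>x. x \<in> Z \<Longrightarrow> f x \<in> H' \<Longrightarrow> x \<in> H"
    and surj: "\<And>z. z \<in> Z' \<Longrightarrow> \<exists>x\<in>Z. \<exists>y\<in>H'. z = y \<oplus>\<^bsub>M'\<^esub> f x"
  shows "mod_iso K (subquotient M Z H) (subquotient M' Z' H')"
proof -
  interpret M: left_module K M by fact
  interpret M': left_module K M' by fact
  interpret H: abelian_subgroup H M by (rule is_submodule_abelian_subgroup[OF M H(1)])
  interpret H': abelian_subgroup H' M' by (rule is_submodule_abelian_subgroup[OF M' H'(1)])
  let ?c = "\<lambda>x. H +>\<^bsub>M\<^esub> x" and ?c' = "\<lambda>x. H' +>\<^bsub>M'\<^esub> x"
  have ZM: "x \<in> carrier M" if "x \<in> Z" for x using Z that by (auto simp: is_submodule_def)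
  have ZM': "x \<in> carrier M'" if "x \<in> Z'" for x using Z' that by (auto simp: is_submodule_def)
  have Zc: "x \<oplus>\<^bsub>M\<^esub> y \<in> Z" if "x \<in> Z" "y \<in> Z" for x y
    using Z that by (auto simp: is_submodule_def)
  have Zs: "a \<odot>\<^bsub>M\<^esub> x \<in> Z" if "x \<in> Z" "a \<in> carrier K" for x a
    using Z that by (auto simp: is_submodule_def)
  have Zm: "x \<ominus>\<^bsub>M\<^esub> y \<in> Z" if "x \<in> Z" "y \<in> Z" for x y
    by (rule is_submodule_diff[OF M Z that])
  have fm: "f (x \<ominus>\<^bsub>M\<^esub> y) = f x \<ominus>\<^bsub>M'\<^esub> f y" if x: "x \<in> Z" and y: "y \<in> Z" for x y
  proof -
    have "f x = f (x \<ominus>\<^bsub>M\<^esub> y) \<oplus>\<^bsub>M'\<^esub> f y"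
      using add[OF Zm[OF x y] y] ZM x y by (simp add: M.minus_eq M.a_assoc M.l_neg)
    then show ?thesis using fZ[OF Zm[OF x y]] fZ[OF y] ZM'
      by (simp add: M'.minus_eq M'.a_assoc M'.r_neg)
  qed
  have eq: "?c x = ?c y \<longleftrightarrow> x \<ominus>\<^bsub>M\<^esub> y \<in> H" if "x \<in> Z" "y \<in> Z" for x y
    using H.a_rcos_module_imp H.a_rcos_module_rev H.a_rcos_self H.a_repr_independence' ZM that
    by (metis M.minus_eq)
  have eq': "?c' x = ?c' y \<longleftrightarrow> x \<ominus>\<^bsub>M'\<^esub> y \<in> H'" if "x \<in> Z'" "y \<in> Z'" for x y
    using H'.a_rcos_module_imp H'.a_rcos_module_rev H'.a_rcos_self H'.a_repr_independence' ZM' that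
    by (metis M'.minus_eq)
  \<comment> \<open>One equivalence for two purposes: from left to right it makes the induced map
    well defined, from right to left injective.\<close>
  have well: "?c x = ?c y \<longleftrightarrow> ?c' (f x) = ?c' (f y)" if "x \<in> Z" "y \<in> Z" for x y
    unfolding eq[OF that] eq'[OF fZ[OF that(1)] fZ[OF that(2)]] fm[OF that, symmetric]
    using fH inj Zm[OF that] by blast
  define F where "F = (\<lambda>A\<in>?c ` Z. ?c' (f (SOME x. x \<in> Z \<and> ?c x = A)))"
  have F: "F (?c x) = ?c' (f x)" if x: "x \<in> Z" for x
  proof -
    let ?x = "SOME y. y \<in> Z \<and> ?c y = ?c x"
    have "?x \<in> Z \<and> ?c ?x = ?c x" by (rule someI[of _ x]) (simp add: x)
    then show ?thesis using well[of ?x x] x by (simp add: F_def)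
  qed
  have lin: "F \<in> lin_hom K (subquotient M Z H) (subquotient M' Z' H')"
  proof -
    have "F \<in> extensional (?c ` Z)" by (simp add: F_def)
    moreover have "F (?c x <+>\<^bsub>M\<^esub> ?c y) = F (?c x) <+>\<^bsub>M'\<^esub> F (?c y)" if "x \<in> Z" "y \<in> Z" for x y
      using that ZM ZM' fZ by (simp add: H.a_rcos_sum H'.a_rcos_sum F Zc add)
    moreover have "F (H <+>\<^bsub>M\<^esub> (\<lambda>x. a \<odot>\<^bsub>M\<^esub> x) ` ?c x) = H' <+>\<^bsub>M'\<^esub> (\<lambda>x. a \<odot>\<^bsub>M'\<^esub> x) ` F (?c x)"
      if "x \<in> Z" "a \<in> carrier K" for x a
      using that ZM ZM' fZ by (simp add: smult_coset[OF M H(1)] smult_coset[OF M' H'(1)] F Zs smult)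
    ultimately show ?thesis
      using F fZ by (auto simp: lin_hom_def subquotient_def PiE_def)
  qed
  have "inj_on F (?c ` Z)"
  proof (rule inj_onI)
    fix A A' assume A: "A \<in> ?c ` Z" "A' \<in> ?c ` Z" and FA: "F A = F A'"
    from A obtain x y where xy: "x \<in> Z" "A = ?c x" "y \<in> Z" "A' = ?c y" by blast
    then have "?c' (f x) = ?c' (f y)" using FA F by simp
    then show "A = A'" using well[OF xy(1,3)] xy by simp
  qed
  moreover have "F ` ?c ` Z = ?c' ` Z'"
  proof (intro equalityI subsetI)
    fix A assume "A \<in> F ` ?c ` Z"
    then show "A \<in> ?c' ` Z'" using F fZ by auto
  next
    fix A assume "A \<in> ?c' ` Z'"
    then obtain z where z: "z \<in> Z'" "A = ?c' z" by auto
    from surj[OF z(1)] obtain x y where xy: "x \<in> Z" "y \<in> H'" "z = y \<oplus>\<^bsub>M'\<^esub> f x" by blast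
    then have "z \<in> ?c' (f x)" by (auto simp: a_r_coset_def')
    then have "?c' (f x) = ?c' z" using H'.a_repr_independence' fZ ZM' xy(1) by blast
    then show "A \<in> F ` ?c ` Z" using F xy(1) z(2) by force
  qed
  ultimately show ?thesis
    using lin unfolding mod_iso_def bij_betw_def by (intro bexI[of _ F]) (auto simp: subquotient_def)
qed

text \<open>\<open>mod_iso\<close> does not assert that its arguments are modules, so closure of
  \<open>M\<close> under its operations is supplied separately; without it \<open>compose\<close>
  would say nothing at a sum or a multiple.\<close>

lemma mod_iso_trans:
  assumes "mod_iso K M N" "mod_iso K N L"
    and "\<And>x y. x \<in> carrier M \<Longrightarrow> y \<in> carrier M \<Longrightarrow> x \<oplus>\<^bsub>M\<^esub> y \<in> carrier M"
    and "\<And>a x. a \<in> carrier K \<Longrightarrow> x \<in> carrier M \<Longrightarrow> a \<odot>\<^bsub>M\<^esub> x \<in> carrier M"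
  shows "mod_iso K M L"
proof -
  from assms(1,2) obtain f g where f: "f \<in> lin_hom K M N" "bij_betw f (carrier M) (carrier N)"
    and g: "g \<in> lin_hom K N L" "bij_betw g (carrier N) (carrier L)" by (auto simp: mod_iso_def)
  have "compose (carrier M) g f \<in> lin_hom K M L"
    using lin_homD[OF f(1)] lin_homD[OF g(1)] assms(3,4)
    by (auto simp: lin_hom_def compose_def)
  moreover have "bij_betw (compose (carrier M) g f) (carrier M) (carrier L)"
    by (rule bij_betw_cong[THEN iffD1, OF _ bij_betw_trans[OF f(2) g(2)]]) (simp add: compose_eq)
  ultimately show ?thesis by (auto simp: mod_iso_def)
qed

section \<open>Cochain complexes and their cohomology modules\<close>

locale cochain_complex =
  fixes K :: "('k, 's) ring_scheme" and C :: "nat \<Rightarrow> ('k, 'm) module" and \<delta> :: "nat \<Rightarrow> 'm \<Rightarrow> 'm"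
  assumes module: "left_module K (C n)"
    and lin: "lin_map K (C n) (C (Suc n)) (\<delta> n)"
    and square_zero: "x \<in> carrier (C n) \<Longrightarrow> \<delta> (Suc n) (\<delta> n x) = \<zero>\<^bsub>C (Suc (Suc n))\<^esub>"
begin

definition cocycles :: "nat \<Rightarrow> 'm set" where
  "cocycles n = {x \<in> carrier (C n). \<delta> n x = \<zero>\<^bsub>C (Suc n)\<^esub>}"

definition coboundaries :: "nat \<Rightarrow> 'm set" where
  "coboundaries n = (case n of 0 \<Rightarrow> {\<zero>\<^bsub>C 0\<^esub>} | Suc m \<Rightarrow> \<delta> m ` carrier (C m))"

lemma cohomology_eq: "cohomology C \<delta> n = subquotient (C n) (cocycles n) (coboundaries n)"
  by (simp add: cohomology_def cocycles_def coboundaries_def)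

lemma cocycles_submodule: "is_submodule K (C n) (cocycles n)"
  unfolding cocycles_def by (rule is_submodule_kernel[OF module module lin])

lemma coboundaries_submodule: "is_submodule K (C n) (coboundaries n)"
  unfolding coboundaries_def
  by (auto split: nat.split intro: is_submodule_image[OF module module lin] is_submodule_zero[OF module])

lemma coboundaries_subset: "coboundaries n \<subseteq> cocycles n"
  using lin_map_closed[OF lin] lin_map_zero[OF module module lin]
    abelian_groupE(2)[OF left_module.axioms(2)[OF module]]
  by (auto simp: coboundaries_def cocycles_def square_zero split: nat.splits)

end

text \<open>The conditions are elementwise and concern degree \<open>n\<close> alone. This suits
  both applications: a homotopy equivalence, which is onto only up to coboundaries, and an
  isomorphism of complexes.\<close>

lemma cohomology_iso:
  assumes "cochain_complex K C \<delta>" "cochain_complex K C' \<delta>'"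
    and "lin_map K (C n) (C' n) f"
    and "\<And>x. x \<in> cochain_complex.cocycles C \<delta> n \<Longrightarrow> f x \<in> cochain_complex.cocycles C' \<delta>' n"
    and "\<And>x. x \<in> cochain_complex.coboundaries C \<delta> n \<Longrightarrow> f x \<in> cochain_complex.coboundaries C' \<delta>' n"
    and "\<And>x. x \<in> cochain_complex.cocycles C \<delta> n \<Longrightarrow> f x \<in> cochain_complex.coboundaries C' \<delta>' n \<Longrightarrow>
      x \<in> cochain_complex.coboundaries C \<delta> n"
    and "\<And>z. z \<in> cochain_complex.cocycles C' \<delta>' n \<Longrightarrow>
      \<exists>x\<in>cochain_complex.cocycles C \<delta> n. \<exists>y\<in>cochain_complex.coboundaries C' \<delta>' n. z = y \<oplus>\<^bsub>C' n\<^esub> f x"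
  shows "mod_iso K (cohomology C \<delta> n) (cohomology C' \<delta>' n)"
proof -
  interpret C: cochain_complex K C \<delta> by fact
  interpret C': cochain_complex K C' \<delta>' by fact
  show ?thesis
    unfolding C.cohomology_eq C'.cohomology_eq
  proof (rule subquotient_iso[OF C.module C'.module C.cocycles_submodule C.coboundaries_submodule
          C.coboundaries_subset C'.cocycles_submodule C'.coboundaries_submodule C'.coboundaries_subset,
          where f = f])
    fix x assume x: "x \<in> C.cocycles n"
    then have xc: "x \<in> carrier (C n)" by (simp add: C.cocycles_def)
    show "f x \<in> C'.cocycles n" by (rule assms(4)[OF x])
    show "f (a \<odot>\<^bsub>C n\<^esub> x) = a \<odot>\<^bsub>C' n\<^esub> f x" if "a \<in> carrier K" for a
      by (rule lin_map_smult[OF assms(3) that xc])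
    show "f (x \<oplus>\<^bsub>C n\<^esub> y) = f x \<oplus>\<^bsub>C' n\<^esub> f y" if "y \<in> C.cocycles n" for y
      using that by (intro lin_map_add[OF assms(3) xc]) (simp add: C.cocycles_def)
    show "x \<in> C.coboundaries n" if "f x \<in> C'.coboundaries n" by (rule assms(6)[OF x that])
  qed (fact assms(5) assms(7))+
qed

lemma (in cochain_complex) cohomology_closed:
  shows "x \<in> carrier (cohomology C \<delta> n) \<Longrightarrow> y \<in> carrier (cohomology C \<delta> n) \<Longrightarrow>
      x \<oplus>\<^bsub>cohomology C \<delta> n\<^esub> y \<in> carrier (cohomology C \<delta> n)"
    and "a \<in> carrier K \<Longrightarrow> x \<in> carrier (cohomology C \<delta> n) \<Longrightarrow>
      a \<odot>\<^bsub>cohomology C \<delta> n\<^esub> x \<in> carrier (cohomology C \<delta> n)"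
    and "\<zero>\<^bsub>cohomology C \<delta> n\<^esub> \<in> carrier (cohomology C \<delta> n)"
proof -
  let ?H = "coboundaries n" and ?Z = "cocycles n" and ?M = "C n"
  interpret M: left_module K ?M by (rule module)
  interpret H: abelian_subgroup ?H ?M
    by (rule is_submodule_abelian_subgroup[OF module coboundaries_submodule])
  have Z: "x \<in> carrier ?M" "x \<oplus>\<^bsub>?M\<^esub> y \<in> ?Z" if "x \<in> ?Z" "y \<in> ?Z" for x y
    using cocycles_submodule[of n] that by (auto simp: is_submodule_def)
  have Zs: "a \<odot>\<^bsub>?M\<^esub> x \<in> ?Z" if "x \<in> ?Z" "a \<in> carrier K" for x a
    using cocycles_submodule[of n] that by (auto simp: is_submodule_def)
  show "x \<in> carrier (cohomology C \<delta> n) \<Longrightarrow> y \<in> carrier (cohomology C \<delta> n) \<Longrightarrow>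
      x \<oplus>\<^bsub>cohomology C \<delta> n\<^esub> y \<in> carrier (cohomology C \<delta> n)"
    unfolding cohomology_eq subquotient_def using Z by (auto simp: H.a_rcos_sum)
  show "a \<in> carrier K \<Longrightarrow> x \<in> carrier (cohomology C \<delta> n) \<Longrightarrow>
      a \<odot>\<^bsub>cohomology C \<delta> n\<^esub> x \<in> carrier (cohomology C \<delta> n)"
    unfolding cohomology_eq subquotient_def using Z Zs
    by (auto simp: smult_coset[OF module coboundaries_submodule])
  have "\<zero>\<^bsub>?M\<^esub> \<in> ?Z" using cocycles_submodule[of n] by (simp add: is_submodule_def)
  moreover have "?H +>\<^bsub>?M\<^esub> \<zero>\<^bsub>?M\<^esub> = ?H"
    using coboundaries_submodule[of n] M.a_coset_add_zero by (simp add: is_submodule_def)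
  ultimately show "\<zero>\<^bsub>cohomology C \<delta> n\<^esub> \<in> carrier (cohomology C \<delta> n)"
    unfolding cohomology_eq subquotient_def by force
qed

section \<open>Hom modules over a central ground ring\<close>

lemma hom_module_simps:
  "carrier (hom_module R \<phi> M N) = lin_hom R M N"
  "\<zero>\<^bsub>hom_module R \<phi> M N\<^esub> = (\<lambda>x\<in>carrier M. \<zero>\<^bsub>N\<^esub>)"
  "f \<oplus>\<^bsub>hom_module R \<phi> M N\<^esub> g = (\<lambda>x\<in>carrier M. f x \<oplus>\<^bsub>N\<^esub> g x)"
  "c \<odot>\<^bsub>hom_module R \<phi> M N\<^esub> f = (\<lambda>x\<in>carrier M. \<phi> c \<odot>\<^bsub>N\<^esub> f x)"
  by (simp_all add: hom_module_def)

text \<open>Centrality of the image of \<open>\<phi>\<close> is what keeps a scalar multiple of an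
  \<open>R\<close>-linear map \<open>R\<close>-linear.\<close>

locale central_algebra = K: ring K + R: ring R for K :: "'k ring" and R :: "'r ring" +
  fixes \<phi>
  assumes hom: "\<phi> \<in> ring_hom K R"
    and central: "c \<in> carrier K \<Longrightarrow> a \<in> carrier R \<Longrightarrow> \<phi> c \<otimes>\<^bsub>R\<^esub> a = a \<otimes>\<^bsub>R\<^esub> \<phi> c"
begin

lemma hom_module_left_module:
  assumes M: "left_module R M" and N: "left_module R N"
  shows "left_module K (hom_module R \<phi> M N)"
proof -
  interpret M: left_module R M by fact
  interpret N: left_module R N by fact
  have pc: "\<phi> c \<in> carrier R" if "c \<in> carrier K" for c using ring_hom_closed[OF hom that] .
  have eqI: "f = g" if "f \<in> extensional (carrier M)" "g \<in> extensional (carrier M)"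
    "\<And>x. x \<in> carrier M \<Longrightarrow> f x = g x" for f g :: "'a \<Rightarrow> 'b"
    using that by (rule extensionalityI)
  have cl: "f x \<in> carrier N" if "f \<in> lin_hom R M N" "x \<in> carrier M" for f x
    using lin_homD(1)[OF that] .
  have ex: "f \<in> extensional (carrier M)" if "f \<in> lin_hom R M N" for f
    using that by (simp add: lin_hom_iff)
  have zl: "lin_map R M N (\<lambda>x. \<zero>\<^bsub>N\<^esub>)" by (rule lin_mapI) (simp_all add: N.smult_r_null)
  show ?thesis
  proof (intro left_module.intro left_module_axioms.intro abelian_groupI)
    fix f assume f: "f \<in> carrier (hom_module R \<phi> M N)"
    then have f': "f \<in> lin_hom R M N" by (simp add: hom_module_simps)
    have "restrict (\<lambda>x. \<zero>\<^bsub>N\<^esub> \<ominus>\<^bsub>N\<^esub> f x) (carrier M) \<in> lin_hom R M N"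
      by (rule lin_map_restrict[OF M lin_map_minus[OF M N zl lin_hom_lin_map[OF f']]])
    then show "\<exists>g\<in>carrier (hom_module R \<phi> M N). g \<oplus>\<^bsub>hom_module R \<phi> M N\<^esub> f = \<zero>\<^bsub>hom_module R \<phi> M N\<^esub>"
      using cl[OF f'] by (intro bexI) (auto simp: hom_module_simps N.minus_eq N.l_neg fun_eq_iff)
    show "\<zero>\<^bsub>hom_module R \<phi> M N\<^esub> \<oplus>\<^bsub>hom_module R \<phi> M N\<^esub> f = f"
      using cl[OF f'] ex[OF f'] by (intro eqI) (auto simp: hom_module_simps)
    show "\<one>\<^bsub>K\<^esub> \<odot>\<^bsub>hom_module R \<phi> M N\<^esub> f = f"
      using cl[OF f'] ex[OF f'] ring_hom_one[OF hom] by (intro eqI) (auto simp: hom_module_simps)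
    fix c assume c: "c \<in> carrier K"
    have "lin_map R M N (\<lambda>x. \<phi> c \<odot>\<^bsub>N\<^esub> f x)"
      using pc[OF c] cl[OF f'] lin_homD[OF f'] central[OF c]
      by (intro lin_mapI) (auto simp: N.smult_r_distr N.smult_assoc1[symmetric])
    from lin_map_restrict[OF M this] show "c \<odot>\<^bsub>hom_module R \<phi> M N\<^esub> f \<in> carrier (hom_module R \<phi> M N)"
      by (simp add: hom_module_simps)
  next
    fix f g assume "f \<in> carrier (hom_module R \<phi> M N)" "g \<in> carrier (hom_module R \<phi> M N)"
    then have f: "f \<in> lin_hom R M N" and g: "g \<in> lin_hom R M N" by (simp_all add: hom_module_simps)
    from lin_map_restrict[OF M lin_map_sum[OF M N lin_hom_lin_map[OF f] lin_hom_lin_map[OF g]]]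
    show "f \<oplus>\<^bsub>hom_module R \<phi> M N\<^esub> g \<in> carrier (hom_module R \<phi> M N)" by (simp add: hom_module_simps)
    show "f \<oplus>\<^bsub>hom_module R \<phi> M N\<^esub> g = g \<oplus>\<^bsub>hom_module R \<phi> M N\<^esub> f"
      using cl[OF f] cl[OF g] by (auto simp: hom_module_simps fun_eq_iff N.a_comm)
    fix c assume c: "c \<in> carrier K"
    show "c \<odot>\<^bsub>hom_module R \<phi> M N\<^esub> (f \<oplus>\<^bsub>hom_module R \<phi> M N\<^esub> g) =
        c \<odot>\<^bsub>hom_module R \<phi> M N\<^esub> f \<oplus>\<^bsub>hom_module R \<phi> M N\<^esub> c \<odot>\<^bsub>hom_module R \<phi> M N\<^esub> g"
      using cl[OF f] cl[OF g] pc[OF c] by (auto simp: hom_module_simps fun_eq_iff N.smult_r_distr)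
  next
    fix f g h assume "f \<in> carrier (hom_module R \<phi> M N)" "g \<in> carrier (hom_module R \<phi> M N)"
      "h \<in> carrier (hom_module R \<phi> M N)"
    then show "f \<oplus>\<^bsub>hom_module R \<phi> M N\<^esub> g \<oplus>\<^bsub>hom_module R \<phi> M N\<^esub> h =
        f \<oplus>\<^bsub>hom_module R \<phi> M N\<^esub> (g \<oplus>\<^bsub>hom_module R \<phi> M N\<^esub> h)"
      using cl by (auto simp: hom_module_simps fun_eq_iff N.a_assoc)
  next
    fix f b c assume "f \<in> carrier (hom_module R \<phi> M N)" and bc: "b \<in> carrier K" "c \<in> carrier K"
    then have f: "f \<in> lin_hom R M N" by (simp add: hom_module_simps)
    show "(b \<oplus>\<^bsub>K\<^esub> c) \<odot>\<^bsub>hom_module R \<phi> M N\<^esub> f =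
        b \<odot>\<^bsub>hom_module R \<phi> M N\<^esub> f \<oplus>\<^bsub>hom_module R \<phi> M N\<^esub> c \<odot>\<^bsub>hom_module R \<phi> M N\<^esub> f"
      using cl[OF f] pc bc ring_hom_add[OF hom bc]
      by (auto simp: hom_module_simps fun_eq_iff N.smult_l_distr)
    show "b \<otimes>\<^bsub>K\<^esub> c \<odot>\<^bsub>hom_module R \<phi> M N\<^esub> f =
        b \<odot>\<^bsub>hom_module R \<phi> M N\<^esub> (c \<odot>\<^bsub>hom_module R \<phi> M N\<^esub> f)"
      using cl[OF f] pc bc ring_hom_mult[OF hom bc]
      by (auto simp: hom_module_simps fun_eq_iff N.smult_assoc1)
  next
    show "\<zero>\<^bsub>hom_module R \<phi> M N\<^esub> \<in> carrier (hom_module R \<phi> M N)"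
      using lin_map_restrict[OF M zl] by (simp add: hom_module_simps)
  qed (rule K.ring_axioms)
qed

lemma hom_module_precompose:
  assumes M: "left_module R M" and M': "left_module R M'" and N: "left_module R N" and g: "lin_map R M M' g"
  shows "lin_map K (hom_module R \<phi> M' N) (hom_module R \<phi> M N) (\<lambda>f. compose (carrier M) f g)"
proof -
  interpret M: left_module R M by fact
  interpret M': left_module R M' by fact
  show ?thesis
  proof (rule lin_mapI)
    fix f assume "f \<in> carrier (hom_module R \<phi> M' N)"
    then have "lin_map R M N (\<lambda>x. f (g x))"
      by (intro lin_map_comp[OF g] lin_hom_lin_map) (simp add: hom_module_simps)
    from lin_map_restrict[OF M this] show "compose (carrier M) f g \<in> carrier (hom_module R \<phi> M N)"
      by (simp add: hom_module_simps compose_def)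
  qed (auto simp: hom_module_simps compose_def fun_eq_iff lin_map_closed[OF g])
qed

lemma Ext_complex:
  assumes P: "projective_resolution R P d \<epsilon> M" and N: "left_module R N"
  shows "cochain_complex K (\<lambda>n. hom_module R \<phi> (P n) N) (\<lambda>n f. compose (carrier (P (Suc n))) f (d n))"
proof (rule cochain_complex.intro)
  note p = projective_resolutionD[OF P]
  show "left_module K (hom_module R \<phi> (P n) N)" for n by (rule hom_module_left_module[OF p(3) N])
  show "lin_map K (hom_module R \<phi> (P n) N) (hom_module R \<phi> (P (Suc n)) N)
      (\<lambda>f. compose (carrier (P (Suc n))) f (d n))" for n
    by (rule hom_module_precompose[OF p(3) p(3) N p(4)])
  show "compose (carrier (P (Suc (Suc n)))) (compose (carrier (P (Suc n))) f (d n)) (d (Suc n)) =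
      \<zero>\<^bsub>hom_module R \<phi> (P (Suc (Suc n))) N\<^esub>" if "f \<in> carrier (hom_module R \<phi> (P n) N)" for f n
  proof -
    have "lin_map R (P n) N f" using that by (simp add: hom_module_simps lin_hom_iff)
    from lin_map_zero[OF p(3) N this] show ?thesis
      by (simp add: hom_module_simps compose_def p(10) lin_map_closed[OF p(4)] cong: restrict_cong)
  qed
qed

end

lemma (in abelian_group) minus_eq_zeroD:
  assumes "x \<ominus> y = \<zero>" "x \<in> carrier G" "y \<in> carrier G"
  shows "x = y"
  using assms by (metis minus_eq minus_equality minus_minus a_inv_closed)

context central_algebra
begin

text \<open>Comparison maps \<open>\<theta>\<close> and \<open>\<tau>\<close> in both directions are
  mutually inverse up to homotopies \<open>h\<close> on \<open>P\<close> and \<open>k\<close> on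
  \<open>Q\<close>. Precomposition with \<open>\<theta>\<close> induces the isomorphism:
  \<open>h\<close> yields injectivity on classes, \<open>k\<close> surjectivity.\<close>

lemma Ext_resolution_independent:
  fixes P :: "nat \<Rightarrow> ('r, 'p) module" and Q :: "nat \<Rightarrow> ('r, 'q) module" and N :: "('r, 'n) module"
  assumes P: "projective_resolution R P d \<epsilon> M" and Q: "projective_resolution R Q d' \<epsilon>' M"
    and N: "left_module R N"
  shows "mod_iso K (Ext R \<phi> P d N n) (Ext R \<phi> Q d' N n)"
proof -
  note p = projective_resolutionD[OF P] and q = projective_resolutionD[OF Q]
  interpret N: left_module R N by (rule N)
  interpret CP: cochain_complex K "\<lambda>n. hom_module R \<phi> (P n) N" "\<lambda>n f. compose (carrier (P (Suc n))) f (d n)"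
    by (rule Ext_complex[OF P N])
  interpret CQ: cochain_complex K "\<lambda>n. hom_module R \<phi> (Q n) N" "\<lambda>n f. compose (carrier (Q (Suc n))) f (d' n)"
    by (rule Ext_complex[OF Q N])
  obtain \<theta> where th: "\<And>n. lin_map R (Q n) (P n) (\<theta> n)" "\<And>x. x \<in> carrier (Q 0) \<Longrightarrow> \<epsilon> (\<theta> 0 x) = \<epsilon>' x"
    "\<And>n x. x \<in> carrier (Q (Suc n)) \<Longrightarrow> d n (\<theta> (Suc n) x) = \<theta> n (d' n x)"
    using R.resolution_chain_map[OF Q P] by blast
  obtain \<tau> where ta: "\<And>n. lin_map R (P n) (Q n) (\<tau> n)" "\<And>x. x \<in> carrier (P 0) \<Longrightarrow> \<epsilon>' (\<tau> 0 x) = \<epsilon> x"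
    "\<And>n x. x \<in> carrier (P (Suc n)) \<Longrightarrow> d' n (\<tau> (Suc n) x) = \<tau> n (d n x)"
    using R.resolution_chain_map[OF P Q] by blast
  note thc = lin_map_closed[OF th(1)] and tac = lin_map_closed[OF ta(1)]
    and dc = lin_map_closed[OF p(4)] and d'c = lin_map_closed[OF q(4)]
  have "\<exists>h. (\<forall>n. lin_map R (P n) (P (Suc n)) (h n)) \<and>
    (\<forall>x\<in>carrier (P 0). d 0 (h 0 x) = \<theta> 0 (\<tau> 0 x) \<ominus>\<^bsub>P 0\<^esub> x) \<and>
    (\<forall>n. \<forall>x\<in>carrier (P (Suc n)). d (Suc n) (h (Suc n) x) =
       \<theta> (Suc n) (\<tau> (Suc n) x) \<ominus>\<^bsub>P (Suc n)\<^esub> x \<ominus>\<^bsub>P (Suc n)\<^esub> h n (d n x))"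
    by (rule R.resolution_homotopy[OF P P lin_map_comp[OF ta(1) th(1)] lin_map_id])
      (simp_all add: th(2,3) ta(2,3) tac)
  then obtain h where h: "\<And>n. lin_map R (P n) (P (Suc n)) (h n)"
    "\<And>x. x \<in> carrier (P 0) \<Longrightarrow> d 0 (h 0 x) = \<theta> 0 (\<tau> 0 x) \<ominus>\<^bsub>P 0\<^esub> x"
    "\<And>n x. x \<in> carrier (P (Suc n)) \<Longrightarrow> d (Suc n) (h (Suc n) x) =
       \<theta> (Suc n) (\<tau> (Suc n) x) \<ominus>\<^bsub>P (Suc n)\<^esub> x \<ominus>\<^bsub>P (Suc n)\<^esub> h n (d n x)" by blast
  have "\<exists>h. (\<forall>n. lin_map R (Q n) (Q (Suc n)) (h n)) \<and>
    (\<forall>x\<in>carrier (Q 0). d' 0 (h 0 x) = \<tau> 0 (\<theta> 0 x) \<ominus>\<^bsub>Q 0\<^esub> x) \<and>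
    (\<forall>n. \<forall>x\<in>carrier (Q (Suc n)). d' (Suc n) (h (Suc n) x) =
       \<tau> (Suc n) (\<theta> (Suc n) x) \<ominus>\<^bsub>Q (Suc n)\<^esub> x \<ominus>\<^bsub>Q (Suc n)\<^esub> h n (d' n x))"
    by (rule R.resolution_homotopy[OF Q Q lin_map_comp[OF th(1) ta(1)] lin_map_id])
      (simp_all add: th(2,3) ta(2,3) thc)
  then obtain k where k: "\<And>n. lin_map R (Q n) (Q (Suc n)) (k n)"
    "\<And>x. x \<in> carrier (Q 0) \<Longrightarrow> d' 0 (k 0 x) = \<tau> 0 (\<theta> 0 x) \<ominus>\<^bsub>Q 0\<^esub> x"
    "\<And>n x. x \<in> carrier (Q (Suc n)) \<Longrightarrow> d' (Suc n) (k (Suc n) x) =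
       \<tau> (Suc n) (\<theta> (Suc n) x) \<ominus>\<^bsub>Q (Suc n)\<^esub> x \<ominus>\<^bsub>Q (Suc n)\<^esub> k n (d' n x)" by blast
  note hc = lin_map_closed[OF h(1)] and kc = lin_map_closed[OF k(1)]
  have ZP: "z \<in> CP.cocycles n \<longleftrightarrow> z \<in> lin_hom R (P n) N \<and> (\<forall>x\<in>carrier (P (Suc n)). z (d n x) = \<zero>\<^bsub>N\<^esub>)" for z n
    unfolding CP.cocycles_def by (auto simp: hom_module_simps compose_def fun_eq_iff)
  have ZQ: "z \<in> CQ.cocycles n \<longleftrightarrow> z \<in> lin_hom R (Q n) N \<and> (\<forall>x\<in>carrier (Q (Suc n)). z (d' n x) = \<zero>\<^bsub>N\<^esub>)" for z n
    unfolding CQ.cocycles_def by (auto simp: hom_module_simps compose_def fun_eq_iff)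
  have ext: "z = w" if "z \<in> lin_hom R L N" "w \<in> lin_hom R L N" "\<And>x. x \<in> carrier L \<Longrightarrow> z x = w x"
    for z w and L :: "('r, 'l) module"
    using that unfolding lin_hom_iff by (metis extensionalityI)
  have solve: "z = w \<ominus>\<^bsub>N\<^esub> v" if "(w \<ominus>\<^bsub>N\<^esub> z) \<ominus>\<^bsub>N\<^esub> v = \<zero>\<^bsub>N\<^esub>"
    "z \<in> carrier N" "w \<in> carrier N" "v \<in> carrier N" for z w v
    using that by (metis N.add.inv_solve_right N.add.m_comm N.add.r_cancel_one' N.add.inv_closed
        N.minus_eq N.add.m_assoc N.r_neg N.l_zero N.add.m_closed N.r_zero N.minus_minus N.minus_equality)
  show ?thesis unfolding Ext_def
  proof (rule cohomology_iso[where f = "\<lambda>f. compose (carrier (Q n)) f (\<theta> n)"])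
    show "lin_map K (hom_module R \<phi> (P n) N) (hom_module R \<phi> (Q n) N) (\<lambda>f. compose (carrier (Q n)) f (\<theta> n))"
      by (rule hom_module_precompose[OF q(3) p(3) N th(1)])
  next
    fix z assume z: "z \<in> CP.cocycles n"
    then have "compose (carrier (Q n)) z (\<theta> n) \<in> lin_hom R (Q n) N"
      using lin_map_closed[OF hom_module_precompose[OF q(3) p(3) N th(1)]] by (simp add: ZP hom_module_simps)
    then show "compose (carrier (Q n)) z (\<theta> n) \<in> CQ.cocycles n"
      using z unfolding ZP ZQ by (simp add: compose_def d'c th(3)[symmetric] thc)
  next
    fix z assume z: "z \<in> CP.coboundaries n"
    show "compose (carrier (Q n)) z (\<theta> n) \<in> CQ.coboundaries n"
    proof (cases n)
      case 0
      then show ?thesis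
        using z unfolding CP.coboundaries_def CQ.coboundaries_def
        by (simp add: hom_module_simps compose_def thc cong: restrict_cong)
    next
      case (Suc m)
      then obtain w where w: "w \<in> lin_hom R (P m) N" "z = compose (carrier (P n)) w (d m)"
        using z unfolding CP.coboundaries_def by (auto simp: hom_module_simps)
      have "compose (carrier (Q n)) z (\<theta> n) = compose (carrier (Q n)) (compose (carrier (Q m)) w (\<theta> m)) (d' m)"
        unfolding w(2) Suc by (simp add: compose_def d'c thc th(3) cong: restrict_cong)
      moreover have "compose (carrier (Q m)) w (\<theta> m) \<in> lin_hom R (Q m) N"
        using lin_map_closed[OF hom_module_precompose[OF q(3) p(3) N th(1)]] w(1) by (simp add: hom_module_simps)
      ultimately show ?thesis
        unfolding CQ.coboundaries_def Suc by (auto simp: hom_module_simps)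
    qed
  next
    fix z assume z: "z \<in> CP.cocycles n" and "compose (carrier (Q n)) z (\<theta> n) \<in> CQ.coboundaries n"
    then have b: "compose (carrier (Q n)) z (\<theta> n) \<in> CQ.coboundaries n" by simp
    have zl: "z \<in> lin_hom R (P n) N" and z0: "\<And>x. x \<in> carrier (P (Suc n)) \<Longrightarrow> z (d n x) = \<zero>\<^bsub>N\<^esub>"
      using z by (auto simp: ZP)
    note zlin = lin_hom_lin_map[OF zl]
    interpret Pn: left_module R "P n" by (rule p(3))
    show "z \<in> CP.coboundaries n"
    proof (cases n)
      case 0
      \<comment> \<open>In degree zero the only coboundary is zero, and \<open>d 0 (h 0 x)\<close>
        has no second homotopy term; so vanishing of \<open>z\<close> after \<open>\<theta>\<close>
        forces \<open>z\<close> itself to vanish.\<close>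
      have "z x = \<zero>\<^bsub>N\<^esub>" if x: "x \<in> carrier (P n)" for x
      proof -
        have "compose (carrier (Q n)) z (\<theta> n) (\<tau> n x) = \<zero>\<^bsub>N\<^esub>"
          using b tac x unfolding CQ.coboundaries_def 0 by (simp add: hom_module_simps)
        then have "z (\<theta> n (\<tau> n x)) = \<zero>\<^bsub>N\<^esub>" using tac x by (simp add: compose_def)
        moreover have "z (\<theta> n (\<tau> n x) \<ominus>\<^bsub>P n\<^esub> x) = \<zero>\<^bsub>N\<^esub>"
          using z0[OF hc[OF x]] h(2) x unfolding 0 by simp
        ultimately have "\<zero>\<^bsub>N\<^esub> \<ominus>\<^bsub>N\<^esub> z x = \<zero>\<^bsub>N\<^esub>"
          using x lin_map_diff[OF p(3) N zlin thc[OF tac[OF x]] x] by simp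
        then show ?thesis
          using N.minus_eq_zeroD lin_map_closed[OF zlin x] by force
      qed
      then have "z = (\<lambda>x\<in>carrier (P n). \<zero>\<^bsub>N\<^esub>)"
        using zl unfolding lin_hom_iff by (intro extensionalityI[of z "carrier (P n)"]) auto
      then show ?thesis unfolding CP.coboundaries_def 0 by (simp add: hom_module_simps)
    next
      case (Suc m)
      then obtain w where w: "w \<in> lin_hom R (Q m) N"
        "compose (carrier (Q n)) z (\<theta> n) = compose (carrier (Q n)) w (d' m)"
        using b unfolding CQ.coboundaries_def by (auto simp: hom_module_simps)
      note wlin = lin_hom_lin_map[OF w(1)]
      have zm: "lin_map R (P (Suc m)) N z" using zlin Suc by simp
      \<comment> \<open>Applying the cocycle \<open>z\<close> to \<open>d n (h n x)\<close> gives
        \<open>z = z \<theta> \<tau> - z h d\<close>, and \<open>z \<theta> = w d'\<close> turns the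
        first term into \<open>w \<tau> d\<close>. Hence \<open>w \<tau> - z h\<close> is a
        primitive of \<open>z\<close>.\<close>
      let ?v = "\<lambda>y. w (\<tau> m y) \<ominus>\<^bsub>N\<^esub> z (h m y)"
      have v: "lin_map R (P m) N ?v"
        by (rule lin_map_minus[OF p(3) N lin_map_comp[OF ta(1) wlin] lin_map_comp[OF h(1) zm]])
      have "z x = ?v (d m x)" if x: "x \<in> carrier (P n)" for x
      proof -
        have x': "x \<in> carrier (P (Suc m))" using x Suc by simp
        interpret Ps: left_module R "P (Suc m)" by (rule p(3))
        have "z (d n (h n x)) = \<zero>\<^bsub>N\<^esub>" by (rule z0[OF hc[OF x]])
        then have "z (\<theta> n (\<tau> n x) \<ominus>\<^bsub>P n\<^esub> x \<ominus>\<^bsub>P n\<^esub> h m (d m x)) = \<zero>\<^bsub>N\<^esub>"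
          using h(3)[OF x'] by (simp add: Suc)
        then have "(z (\<theta> n (\<tau> n x)) \<ominus>\<^bsub>N\<^esub> z x) \<ominus>\<^bsub>N\<^esub> z (h m (d m x)) = \<zero>\<^bsub>N\<^esub>"
          using x' thc[OF tac[OF x']] hc[OF dc[OF x']]
          by (simp add: Suc lin_map_diff[OF p(3) N zm])
        then have "z x = z (\<theta> n (\<tau> n x)) \<ominus>\<^bsub>N\<^esub> z (h m (d m x))"
          using x' thc[OF tac[OF x']] hc[OF dc[OF x']] lin_map_closed[OF zm]
          by (intro solve) (simp_all add: Suc)
        also have "z (\<theta> n (\<tau> n x)) = w (d' m (\<tau> n x))"
          using fun_cong[OF w(2), of "\<tau> n x"] tac[OF x] by (simp add: compose_def)
        also have "d' m (\<tau> n x) = \<tau> m (d m x)" using ta(3)[OF x'] by (simp add: Suc)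
        finally show ?thesis .
      qed
      then have "z = compose (carrier (P n)) (restrict ?v (carrier (P m))) (d m)"
        using zl dc[of _ m] unfolding lin_hom_iff Suc
        by (intro extensionalityI[of z "carrier (P (Suc m))"]) (auto simp: compose_def)
      then show ?thesis
        using lin_map_restrict[OF p(3) v] unfolding CP.coboundaries_def Suc
        by (auto simp: hom_module_simps)
    qed
  next
    fix z assume z: "z \<in> CQ.cocycles n"
    have zl: "z \<in> lin_hom R (Q n) N" and z0: "\<And>x. x \<in> carrier (Q (Suc n)) \<Longrightarrow> z (d' n x) = \<zero>\<^bsub>N\<^esub>"
      using z by (auto simp: ZQ)
    note zlin = lin_hom_lin_map[OF zl]
    interpret Qn: left_module R "Q n" by (rule q(3))
    \<comment> \<open>The class of \<open>z\<close> comes from \<open>z \<tau>\<close>: in positive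
      degree \<open>z - z \<tau> \<theta>\<close> is the coboundary of \<open>- z k\<close>, and in
      degree zero it vanishes.\<close>
    let ?x = "compose (carrier (P n)) z (\<tau> n)"
    have "?x \<in> lin_hom R (P n) N"
      using lin_map_closed[OF hom_module_precompose[OF p(3) q(3) N ta(1)]] zl by (simp add: hom_module_simps)
    then have x: "?x \<in> CP.cocycles n"
      using z0 unfolding ZP by (simp add: compose_def dc ta(3)[symmetric] tac)
    have "\<exists>y\<in>CQ.coboundaries n. z = y \<oplus>\<^bsub>hom_module R \<phi> (Q n) N\<^esub> compose (carrier (Q n)) ?x (\<theta> n)"
    proof (cases n)
      case 0
      have "z u = z (\<tau> n (\<theta> n u))" if u: "u \<in> carrier (Q n)" for u
      proof -
        have "z (\<tau> n (\<theta> n u) \<ominus>\<^bsub>Q n\<^esub> u) = \<zero>\<^bsub>N\<^esub>"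
          using z0[OF kc[OF u]] k(2) u unfolding 0 by simp
        then have "z (\<tau> n (\<theta> n u)) \<ominus>\<^bsub>N\<^esub> z u = \<zero>\<^bsub>N\<^esub>"
          using lin_map_diff[OF q(3) N zlin tac[OF thc[OF u]] u] by simp
        then show ?thesis
          using N.minus_eq_zeroD lin_map_closed[OF zlin] u tac[OF thc[OF u]] by metis
      qed
      then have "z = (\<lambda>x\<in>carrier (Q n). \<zero>\<^bsub>N\<^esub>) \<oplus>\<^bsub>hom_module R \<phi> (Q n) N\<^esub> compose (carrier (Q n)) ?x (\<theta> n)"
        using zl thc[of _ n] tac[of _ n] lin_map_closed[OF zlin] unfolding lin_hom_iff
        by (intro extensionalityI[of z "carrier (Q n)"]) (auto simp: compose_def hom_module_simps)
      then show ?thesis unfolding CQ.coboundaries_def 0 by (auto simp: hom_module_simps)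
    next
      case (Suc m)
      have zm: "lin_map R (Q (Suc m)) N z" using zlin Suc by simp
      have zero: "lin_map R (Q m) N (\<lambda>x. \<zero>\<^bsub>N\<^esub>)" by (rule lin_mapI) (simp_all add: N.smult_r_null)
      let ?v = "\<lambda>y. \<zero>\<^bsub>N\<^esub> \<ominus>\<^bsub>N\<^esub> z (k m y)"
      have v: "lin_map R (Q m) N ?v"
        by (rule lin_map_minus[OF q(3) N zero lin_map_comp[OF k(1) zm]])
      have "z u = ?v (d' m u) \<oplus>\<^bsub>N\<^esub> z (\<tau> n (\<theta> n u))" if u: "u \<in> carrier (Q n)" for u
      proof -
        have u': "u \<in> carrier (Q (Suc m))" using u Suc by simp
        interpret Qs: left_module R "Q (Suc m)" by (rule q(3))
        have "z (d' n (k n u)) = \<zero>\<^bsub>N\<^esub>" by (rule z0[OF kc[OF u]])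
        then have "z (\<tau> n (\<theta> n u) \<ominus>\<^bsub>Q n\<^esub> u \<ominus>\<^bsub>Q n\<^esub> k m (d' m u)) = \<zero>\<^bsub>N\<^esub>"
          using k(3)[OF u'] by (simp add: Suc)
        then have "(z (\<tau> n (\<theta> n u)) \<ominus>\<^bsub>N\<^esub> z u) \<ominus>\<^bsub>N\<^esub> z (k m (d' m u)) = \<zero>\<^bsub>N\<^esub>"
          using u' tac[OF thc[OF u']] kc[OF d'c[OF u']]
          by (simp add: Suc lin_map_diff[OF q(3) N zm])
        then have "z u = z (\<tau> n (\<theta> n u)) \<ominus>\<^bsub>N\<^esub> z (k m (d' m u))"
          using u' tac[OF thc[OF u']] kc[OF d'c[OF u']] lin_map_closed[OF zm]
          by (intro solve) (simp_all add: Suc)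
        then show ?thesis
          using lin_map_closed[OF zm kc[OF d'c[OF u']]] lin_map_closed[OF zm tac[OF thc[OF u']]]
          by (simp add: Suc N.minus_eq N.a_comm)
      qed
      then have "z = compose (carrier (Q n)) (restrict ?v (carrier (Q m))) (d' m)
          \<oplus>\<^bsub>hom_module R \<phi> (Q n) N\<^esub> compose (carrier (Q n)) ?x (\<theta> n)"
        using zl d'c[of _ m] thc unfolding lin_hom_iff Suc
        by (intro extensionalityI[of z "carrier (Q (Suc m))"]) (auto simp: compose_def hom_module_simps)
      moreover have "compose (carrier (Q n)) (restrict ?v (carrier (Q m))) (d' m) \<in> CQ.coboundaries n"
        using lin_map_restrict[OF q(3) v] unfolding CQ.coboundaries_def Suc
        by (auto simp: hom_module_simps)
      ultimately show ?thesis by blast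
    qed
    then show "\<exists>x\<in>CP.cocycles n. \<exists>y\<in>CQ.coboundaries n.
        z = y \<oplus>\<^bsub>hom_module R \<phi> (Q n) N\<^esub> compose (carrier (Q n)) x (\<theta> n)"
      using x by blast
  qed (use CP.cochain_complex_axioms CQ.cochain_complex_axioms in auto)
qed

end

section \<open>Modules over the monoid algebra\<close>

locale finite_monoid_algebra = K: cring K + B: monoid B for K :: "'k ring" and B :: "'b monoid" +
  assumes finite_B: "finite (carrier B)"
begin

abbreviation A where "A \<equiv> monoid_algebra K B"

abbreviation scal where "scal \<equiv> monoid_algebra_scalar K B"

definition bas :: "'b \<Rightarrow> 'b \<Rightarrow> 'k" where
  "bas b = (\<lambda>x\<in>carrier B. if x = b then \<one>\<^bsub>K\<^esub> else \<zero>\<^bsub>K\<^esub>)"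

sublocale A: ring A
  by (rule monoid_algebra_ring[OF K.cring_axioms B.monoid_axioms finite_B])

lemmas mult_nested = monoid_algebra_mult_nested[OF K.cring_axioms B.monoid_axioms finite_B]

lemma A_simps:
  "carrier A = carrier B \<rightarrow>\<^sub>E carrier K"
  "\<zero>\<^bsub>A\<^esub> = (\<lambda>b\<in>carrier B. \<zero>\<^bsub>K\<^esub>)"
  "f \<oplus>\<^bsub>A\<^esub> g = (\<lambda>b\<in>carrier B. f b \<oplus>\<^bsub>K\<^esub> g b)"
  by (simp_all add: monoid_algebra_def)

lemma A_apply: "f \<in> carrier A \<Longrightarrow> b \<in> carrier B \<Longrightarrow> f b \<in> carrier K"
  by (auto simp: A_simps)

lemma A_eqI: "f \<in> carrier A \<Longrightarrow> g \<in> carrier A \<Longrightarrow> (\<And>b. b \<in> carrier B \<Longrightarrow> f b = g b) \<Longrightarrow> f = g"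
  by (auto simp: A_simps intro: PiE_ext)

lemma bas_closed [simp, intro]: "bas b \<in> carrier A"
  by (auto simp: A_simps bas_def)

lemma scal_closed [simp, intro]: "c \<in> carrier K \<Longrightarrow> scal c \<in> carrier A"
  by (auto simp: A_simps monoid_algebra_scalar_def)

lemma scal_one: "scal \<one>\<^bsub>K\<^esub> = \<one>\<^bsub>A\<^esub>" and bas_one: "bas \<one>\<^bsub>B\<^esub> = \<one>\<^bsub>A\<^esub>"
  by (simp_all add: monoid_algebra_scalar_def bas_def monoid_algebra_def)

lemma scal_mult_left:
  assumes c: "c \<in> carrier K" and f: "f \<in> carrier A"
  shows "scal c \<otimes>\<^bsub>A\<^esub> f = (\<lambda>b\<in>carrier B. c \<otimes>\<^bsub>K\<^esub> f b)"
  unfolding mult_nested[OF scal_closed[OF c] f]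
proof (rule restrict_ext)
  fix b assume b: "b \<in> carrier B"
  have "(\<Oplus>\<^bsub>K\<^esub>x\<in>carrier B. \<Oplus>\<^bsub>K\<^esub>y\<in>carrier B. if x \<otimes>\<^bsub>B\<^esub> y = b then scal c x \<otimes>\<^bsub>K\<^esub> f y else \<zero>\<^bsub>K\<^esub>)
      = (\<Oplus>\<^bsub>K\<^esub>x\<in>carrier B. if x = \<one>\<^bsub>B\<^esub> then \<Oplus>\<^bsub>K\<^esub>y\<in>carrier B. if y = b then c \<otimes>\<^bsub>K\<^esub> f y else \<zero>\<^bsub>K\<^esub> else \<zero>\<^bsub>K\<^esub>)"
    using c f by (intro K.finsum_cong')
      (auto simp: monoid_algebra_scalar_def A_apply intro!: K.finsum_closed K.finsum_cong' K.finsum_zero_eqI)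
  also have "\<dots> = (\<Oplus>\<^bsub>K\<^esub>y\<in>carrier B. if y = b then c \<otimes>\<^bsub>K\<^esub> f y else \<zero>\<^bsub>K\<^esub>)"
    using c f finite_B by (intro K.finsum_delta) (auto simp: A_apply intro!: K.finsum_closed)
  also have "\<dots> = c \<otimes>\<^bsub>K\<^esub> f b" using c f b finite_B by (intro K.finsum_delta) (auto simp: A_apply)
  finally show "(\<Oplus>\<^bsub>K\<^esub>x\<in>carrier B. \<Oplus>\<^bsub>K\<^esub>y\<in>carrier B. if x \<otimes>\<^bsub>B\<^esub> y = b then scal c x \<otimes>\<^bsub>K\<^esub> f y else \<zero>\<^bsub>K\<^esub>)
      = c \<otimes>\<^bsub>K\<^esub> f b" .
qed

lemma scal_mult_right:
  assumes c: "c \<in> carrier K" and f: "f \<in> carrier A"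
  shows "f \<otimes>\<^bsub>A\<^esub> scal c = (\<lambda>b\<in>carrier B. c \<otimes>\<^bsub>K\<^esub> f b)"
  unfolding mult_nested[OF f scal_closed[OF c]]
proof (rule restrict_ext)
  fix b assume b: "b \<in> carrier B"
  have "(\<Oplus>\<^bsub>K\<^esub>x\<in>carrier B. \<Oplus>\<^bsub>K\<^esub>y\<in>carrier B. if x \<otimes>\<^bsub>B\<^esub> y = b then f x \<otimes>\<^bsub>K\<^esub> scal c y else \<zero>\<^bsub>K\<^esub>)
      = (\<Oplus>\<^bsub>K\<^esub>x\<in>carrier B. \<Oplus>\<^bsub>K\<^esub>y\<in>carrier B. if y = \<one>\<^bsub>B\<^esub> then (if x = b then c \<otimes>\<^bsub>K\<^esub> f x else \<zero>\<^bsub>K\<^esub>) else \<zero>\<^bsub>K\<^esub>)"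
    using c f by (intro K.finsum_cong')
      (auto simp: monoid_algebra_scalar_def A_apply K.m_comm intro!: K.finsum_closed K.finsum_cong')
  also have "\<dots> = (\<Oplus>\<^bsub>K\<^esub>x\<in>carrier B. if x = b then c \<otimes>\<^bsub>K\<^esub> f x else \<zero>\<^bsub>K\<^esub>)"
    using c f finite_B by (intro K.finsum_cong' K.finsum_delta) (auto simp: A_apply)
  also have "\<dots> = c \<otimes>\<^bsub>K\<^esub> f b" using c f b finite_B by (intro K.finsum_delta) (auto simp: A_apply)
  finally show "(\<Oplus>\<^bsub>K\<^esub>x\<in>carrier B. \<Oplus>\<^bsub>K\<^esub>y\<in>carrier B. if x \<otimes>\<^bsub>B\<^esub> y = b then f x \<otimes>\<^bsub>K\<^esub> scal c y else \<zero>\<^bsub>K\<^esub>)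
      = c \<otimes>\<^bsub>K\<^esub> f b" .
qed

lemma bas_mult:
  assumes a: "a \<in> carrier B" and b: "b \<in> carrier B"
  shows "bas a \<otimes>\<^bsub>A\<^esub> bas b = bas (a \<otimes>\<^bsub>B\<^esub> b)"
  unfolding mult_nested[OF bas_closed bas_closed] unfolding bas_def[of "a \<otimes>\<^bsub>B\<^esub> b"]
proof (rule restrict_ext)
  fix x assume x: "x \<in> carrier B"
  have "(\<Oplus>\<^bsub>K\<^esub>p\<in>carrier B. \<Oplus>\<^bsub>K\<^esub>q\<in>carrier B. if p \<otimes>\<^bsub>B\<^esub> q = x then bas a p \<otimes>\<^bsub>K\<^esub> bas b q else \<zero>\<^bsub>K\<^esub>)
      = (\<Oplus>\<^bsub>K\<^esub>p\<in>carrier B. if p = a then \<Oplus>\<^bsub>K\<^esub>q\<in>carrier B. if q = b then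
            (if x = a \<otimes>\<^bsub>B\<^esub> b then \<one>\<^bsub>K\<^esub> else \<zero>\<^bsub>K\<^esub>) else \<zero>\<^bsub>K\<^esub> else \<zero>\<^bsub>K\<^esub>)"
    using a b by (intro K.finsum_cong') (auto simp: bas_def intro!: K.finsum_closed K.finsum_cong' K.finsum_zero_eqI)
  also have "\<dots> = (\<Oplus>\<^bsub>K\<^esub>q\<in>carrier B. if q = b then (if x = a \<otimes>\<^bsub>B\<^esub> b then \<one>\<^bsub>K\<^esub> else \<zero>\<^bsub>K\<^esub>) else \<zero>\<^bsub>K\<^esub>)"
    using a finite_B by (intro K.finsum_delta) (auto intro!: K.finsum_closed)
  also have "\<dots> = (if x = a \<otimes>\<^bsub>B\<^esub> b then \<one>\<^bsub>K\<^esub> else \<zero>\<^bsub>K\<^esub>)"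
    using b finite_B by (intro K.finsum_delta) auto
  finally show "(\<Oplus>\<^bsub>K\<^esub>p\<in>carrier B. \<Oplus>\<^bsub>K\<^esub>q\<in>carrier B. if p \<otimes>\<^bsub>B\<^esub> q = x then bas a p \<otimes>\<^bsub>K\<^esub> bas b q else \<zero>\<^bsub>K\<^esub>)
      = (if x = a \<otimes>\<^bsub>B\<^esub> b then \<one>\<^bsub>K\<^esub> else \<zero>\<^bsub>K\<^esub>)" .
qed

sublocale central: central_algebra K A scal
proof unfold_locales
  show "scal \<in> ring_hom K A"
  proof (rule ring_hom_memI)
    fix c d assume c: "c \<in> carrier K" and d: "d \<in> carrier K"
    show "scal (c \<otimes>\<^bsub>K\<^esub> d) = scal c \<otimes>\<^bsub>A\<^esub> scal d"
      unfolding scal_mult_left[OF c scal_closed[OF d]]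
      using c d by (auto simp: monoid_algebra_scalar_def fun_eq_iff)
    show "scal (c \<oplus>\<^bsub>K\<^esub> d) = scal c \<oplus>\<^bsub>A\<^esub> scal d"
      using c d by (auto simp: A_simps monoid_algebra_scalar_def fun_eq_iff)
  qed (simp_all add: scal_one)
  show "scal c \<otimes>\<^bsub>A\<^esub> a = a \<otimes>\<^bsub>A\<^esub> scal c" if "c \<in> carrier K" "a \<in> carrier A" for c a
    using that by (simp add: scal_mult_left scal_mult_right)
qed

lemma A_finsum_apply:
  assumes "finite T" "g \<in> T \<rightarrow> carrier A" "b \<in> carrier B"
  shows "(\<Oplus>\<^bsub>A\<^esub>t\<in>T. g t) b = (\<Oplus>\<^bsub>K\<^esub>t\<in>T. g t b)"
  using assms(1,2)
proof (induction T rule: finite_induct)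
  case empty
  have "\<zero>\<^bsub>A\<^esub> b = \<zero>\<^bsub>K\<^esub>" using assms(3) by (simp add: A_simps)
  then show ?case by simp
next
  case (insert t T)
  have "g u b \<in> carrier K" if "u \<in> insert t T" for u
    using insert.prems that assms(3) A_apply by blast
  moreover have "(u \<oplus>\<^bsub>A\<^esub> v) b = u b \<oplus>\<^bsub>K\<^esub> v b" for u v using assms(3) by (simp add: A_simps)
  ultimately show ?case using insert assms(3) by (auto simp: Pi_def)
qed

lemma bas_apply: "x \<in> carrier B \<Longrightarrow> bas b x = (if x = b then \<one>\<^bsub>K\<^esub> else \<zero>\<^bsub>K\<^esub>)"
  by (simp add: bas_def)

lemma A_expand:
  assumes f: "f \<in> carrier A"
  shows "f = (\<Oplus>\<^bsub>A\<^esub>b\<in>carrier B. scal (f b) \<otimes>\<^bsub>A\<^esub> bas b)"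
proof (rule A_eqI[OF f])
  have cl: "(\<lambda>b. scal (f b) \<otimes>\<^bsub>A\<^esub> bas b) \<in> carrier B \<rightarrow> carrier A" using A_apply[OF f] by auto
  then show "(\<Oplus>\<^bsub>A\<^esub>b\<in>carrier B. scal (f b) \<otimes>\<^bsub>A\<^esub> bas b) \<in> carrier A" by (rule A.finsum_closed)
  fix x assume x: "x \<in> carrier B"
  have "(\<Oplus>\<^bsub>A\<^esub>b\<in>carrier B. scal (f b) \<otimes>\<^bsub>A\<^esub> bas b) x = (\<Oplus>\<^bsub>K\<^esub>b\<in>carrier B. if b = x then f b else \<zero>\<^bsub>K\<^esub>)"
    unfolding A_finsum_apply[OF finite_B cl x] using x A_apply[OF f]
    by (intro K.finsum_cong') (auto simp: scal_mult_left[OF _ bas_closed] bas_apply)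
  also have "\<dots> = f x" using x A_apply[OF f] finite_B by (intro K.finsum_delta) auto
  finally show "f x = (\<Oplus>\<^bsub>A\<^esub>b\<in>carrier B. scal (f b) \<otimes>\<^bsub>A\<^esub> bas b) x" by simp
qed

lemma smult_expand:
  assumes M: "left_module A M" and f: "f \<in> carrier A" and x: "x \<in> carrier M"
  shows "f \<odot>\<^bsub>M\<^esub> x = (\<Oplus>\<^bsub>M\<^esub>b\<in>carrier B. scal (f b) \<odot>\<^bsub>M\<^esub> (bas b \<odot>\<^bsub>M\<^esub> x))"
proof -
  interpret M: left_module A M by (rule M)
  have cl: "(\<lambda>b. scal (f b) \<otimes>\<^bsub>A\<^esub> bas b) \<in> carrier B \<rightarrow> carrier A" using A_apply[OF f] by auto
  have "f \<odot>\<^bsub>M\<^esub> x = (\<Oplus>\<^bsub>A\<^esub>b\<in>carrier B. scal (f b) \<otimes>\<^bsub>A\<^esub> bas b) \<odot>\<^bsub>M\<^esub> x"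
    using A_expand[OF f] by simp
  also have "\<dots> = (\<Oplus>\<^bsub>M\<^esub>b\<in>carrier B. (scal (f b) \<otimes>\<^bsub>A\<^esub> bas b) \<odot>\<^bsub>M\<^esub> x)"
    by (rule M.finsum_smult[OF cl x])
  also have "\<dots> = (\<Oplus>\<^bsub>M\<^esub>b\<in>carrier B. scal (f b) \<odot>\<^bsub>M\<^esub> (bas b \<odot>\<^bsub>M\<^esub> x))"
    using x A_apply[OF f] by (intro M.finsum_cong') (auto simp: M.smult_assoc1)
  finally show ?thesis .
qed

text \<open>The algebra is additively spanned by the products of some \<open>scal c\<close> with
  some \<open>bas b\<close>, so linearity of an additive map can be tested on scalars and on
  elements of \<open>B\<close> separately.\<close>

lemma lin_map_basI:
  assumes M: "left_module A M" and N: "left_module A N"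
    and cl: "\<And>x. x \<in> carrier M \<Longrightarrow> f x \<in> carrier N"
    and add: "\<And>x y. x \<in> carrier M \<Longrightarrow> y \<in> carrier M \<Longrightarrow> f (x \<oplus>\<^bsub>M\<^esub> y) = f x \<oplus>\<^bsub>N\<^esub> f y"
    and scal: "\<And>c x. c \<in> carrier K \<Longrightarrow> x \<in> carrier M \<Longrightarrow> f (scal c \<odot>\<^bsub>M\<^esub> x) = scal c \<odot>\<^bsub>N\<^esub> f x"
    and bas: "\<And>b x. b \<in> carrier B \<Longrightarrow> x \<in> carrier M \<Longrightarrow> f (bas b \<odot>\<^bsub>M\<^esub> x) = bas b \<odot>\<^bsub>N\<^esub> f x"
  shows "lin_map A M N f"
proof (rule lin_mapI[OF cl add])
  interpret M: left_module A M by (rule M)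
  interpret N: left_module A N by (rule N)
  have f0: "f \<zero>\<^bsub>M\<^esub> = \<zero>\<^bsub>N\<^esub>"
    using scal[of "\<zero>\<^bsub>K\<^esub>" "\<zero>\<^bsub>M\<^esub>"] add[of "\<zero>\<^bsub>M\<^esub>" "\<zero>\<^bsub>M\<^esub>"] cl[of "\<zero>\<^bsub>M\<^esub>"] by simp
  have fs: "f (\<Oplus>\<^bsub>M\<^esub>b\<in>S. g b) = (\<Oplus>\<^bsub>N\<^esub>b\<in>S. f (g b))" if "finite S" "g \<in> S \<rightarrow> carrier M" for S g
    using that by (induction S rule: finite_induct) (auto simp: f0 Pi_def add cl)
  fix a x assume a: "a \<in> carrier A" and x: "x \<in> carrier M"
  have "f (a \<odot>\<^bsub>M\<^esub> x) = (\<Oplus>\<^bsub>N\<^esub>b\<in>carrier B. f (scal (a b) \<odot>\<^bsub>M\<^esub> (bas b \<odot>\<^bsub>M\<^esub> x)))"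
    unfolding smult_expand[OF M a x] using x A_apply[OF a] by (intro fs finite_B) auto
  also have "\<dots> = (\<Oplus>\<^bsub>N\<^esub>b\<in>carrier B. scal (a b) \<odot>\<^bsub>N\<^esub> (bas b \<odot>\<^bsub>N\<^esub> f x))"
    using x A_apply[OF a] cl by (intro N.finsum_cong') (auto simp: scal bas)
  also have "\<dots> = a \<odot>\<^bsub>N\<^esub> f x" by (rule smult_expand[OF N a cl[OF x], symmetric])
  finally show "f (a \<odot>\<^bsub>M\<^esub> x) = a \<odot>\<^bsub>N\<^esub> f x" .
qed

section \<open>Modules obtained from linear representations of the monoid\<close>

text \<open>The action of \<open>B\<close> on a \<open>K\<close>-module, extended linearly to the
  algebra, just as in \<open>support_module\<close>; over a finite monoid the sum may run over all
  of \<open>B\<close>.\<close>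

definition rep_module :: "('k, 'v) module \<Rightarrow> ('b \<Rightarrow> 'v \<Rightarrow> 'v) \<Rightarrow> ('b \<Rightarrow> 'k, 'v) module" where
  "rep_module V \<rho> = \<lparr>carrier = carrier V, mult = undefined, one = undefined, zero = \<zero>\<^bsub>V\<^esub>, add = (\<oplus>\<^bsub>V\<^esub>),
     smult = (\<lambda>f v. \<Oplus>\<^bsub>V\<^esub>b\<in>carrier B. f b \<odot>\<^bsub>V\<^esub> \<rho> b v)\<rparr>"

lemma rep_module_simps:
  "carrier (rep_module V \<rho>) = carrier V" "\<zero>\<^bsub>rep_module V \<rho>\<^esub> = \<zero>\<^bsub>V\<^esub>"
  "x \<oplus>\<^bsub>rep_module V \<rho>\<^esub> y = x \<oplus>\<^bsub>V\<^esub> y"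
  "f \<odot>\<^bsub>rep_module V \<rho>\<^esub> x = (\<Oplus>\<^bsub>V\<^esub>b\<in>carrier B. f b \<odot>\<^bsub>V\<^esub> \<rho> b x)"
  by (simp_all add: rep_module_def)

context
  fixes V :: "('k, 'v) module" and \<rho> :: "'b \<Rightarrow> 'v \<Rightarrow> 'v"
  assumes V: "left_module K V"
    and rho: "\<And>b. b \<in> carrier B \<Longrightarrow> lin_map K V V (\<rho> b)"
    and rho_one: "\<And>v. v \<in> carrier V \<Longrightarrow> \<rho> \<one>\<^bsub>B\<^esub> v = v"
    and rho_mult: "\<And>a b v. a \<in> carrier B \<Longrightarrow> b \<in> carrier B \<Longrightarrow> v \<in> carrier V \<Longrightarrow>
      \<rho> (a \<otimes>\<^bsub>B\<^esub> b) v = \<rho> a (\<rho> b v)"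
begin

interpretation V: left_module K V by (rule V)

lemma rep_bas: assumes "b \<in> carrier B" "v \<in> carrier V" shows "bas b \<odot>\<^bsub>rep_module V \<rho>\<^esub> v = \<rho> b v"
proof -
  have "(\<Oplus>\<^bsub>V\<^esub>x\<in>carrier B. bas b x \<odot>\<^bsub>V\<^esub> \<rho> x v) = (\<Oplus>\<^bsub>V\<^esub>x\<in>carrier B. if x = b then \<rho> x v else \<zero>\<^bsub>V\<^esub>)"
    using assms lin_map_closed[OF rho] by (intro V.M.finsum_cong') (auto simp: bas_def V.smult_l_null)
  also have "\<dots> = \<rho> b v" using assms lin_map_closed[OF rho] finite_B by (intro V.M.finsum_delta) auto
  finally show ?thesis by (simp add: rep_module_simps)
qed

lemma rep_scal: assumes "c \<in> carrier K" "v \<in> carrier V" shows "scal c \<odot>\<^bsub>rep_module V \<rho>\<^esub> v = c \<odot>\<^bsub>V\<^esub> v"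
proof -
  have "(\<Oplus>\<^bsub>V\<^esub>x\<in>carrier B. scal c x \<odot>\<^bsub>V\<^esub> \<rho> x v) = (\<Oplus>\<^bsub>V\<^esub>x\<in>carrier B. if x = \<one>\<^bsub>B\<^esub> then c \<odot>\<^bsub>V\<^esub> \<rho> x v else \<zero>\<^bsub>V\<^esub>)"
    using assms lin_map_closed[OF rho]
    by (intro V.M.finsum_cong') (auto simp: monoid_algebra_scalar_def V.smult_l_null)
  also have "\<dots> = c \<odot>\<^bsub>V\<^esub> \<rho> \<one>\<^bsub>B\<^esub> v" using assms lin_map_closed[OF rho] finite_B by (intro V.M.finsum_delta) auto
  finally show ?thesis using assms by (simp add: rep_module_simps rho_one)
qed

lemma rep_module_left_module: "left_module A (rep_module V \<rho>)"
proof -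
  let ?R = "rep_module V \<rho>" and ?S = "carrier B"
  note rc = lin_map_closed[OF rho]
  have ab: "abelian_group ?R"
  proof (rule abelian_groupI)
    fix x assume "x \<in> carrier ?R"
    then show "\<exists>y\<in>carrier ?R. y \<oplus>\<^bsub>?R\<^esub> x = \<zero>\<^bsub>?R\<^esub>"
      by (intro bexI[of _ "\<ominus>\<^bsub>V\<^esub> x"]) (auto simp: rep_module_simps V.M.l_neg)
  qed (auto simp: rep_module_simps V.M.a_ac)
  have cl: "a \<odot>\<^bsub>?R\<^esub> x \<in> carrier V" if "a \<in> carrier A" "x \<in> carrier V" for a x
    using that rc by (auto simp: rep_module_simps A_apply intro!: V.M.finsum_closed)
  show ?thesis
  proof (intro left_module.intro left_module_axioms.intro ab A.ring_axioms)
    show "a \<odot>\<^bsub>?R\<^esub> x \<in> carrier ?R" if "a \<in> carrier A" "x \<in> carrier ?R" for a x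
      using cl that by (simp add: rep_module_simps)
    show "\<one>\<^bsub>A\<^esub> \<odot>\<^bsub>?R\<^esub> x = x" if "x \<in> carrier ?R" for x
      using rep_bas[of "\<one>\<^bsub>B\<^esub>" x] that by (simp add: bas_one rho_one rep_module_simps(1))
    show "(a \<oplus>\<^bsub>A\<^esub> b) \<odot>\<^bsub>?R\<^esub> x = a \<odot>\<^bsub>?R\<^esub> x \<oplus>\<^bsub>?R\<^esub> b \<odot>\<^bsub>?R\<^esub> x"
      if a: "a \<in> carrier A" and b: "b \<in> carrier A" and x: "x \<in> carrier ?R" for a b x
    proof -
      have "(\<Oplus>\<^bsub>V\<^esub>u\<in>?S. (a \<oplus>\<^bsub>A\<^esub> b) u \<odot>\<^bsub>V\<^esub> \<rho> u x) = (\<Oplus>\<^bsub>V\<^esub>u\<in>?S. a u \<odot>\<^bsub>V\<^esub> \<rho> u x \<oplus>\<^bsub>V\<^esub> b u \<odot>\<^bsub>V\<^esub> \<rho> u x)"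
        using x rc A_apply[OF a] A_apply[OF b] unfolding rep_module_simps
        by (intro V.M.finsum_cong') (auto simp: A_simps(3) V.smult_l_distr)
      also have "\<dots> = (\<Oplus>\<^bsub>V\<^esub>u\<in>?S. a u \<odot>\<^bsub>V\<^esub> \<rho> u x) \<oplus>\<^bsub>V\<^esub> (\<Oplus>\<^bsub>V\<^esub>u\<in>?S. b u \<odot>\<^bsub>V\<^esub> \<rho> u x)"
        using x rc A_apply[OF a] A_apply[OF b] unfolding rep_module_simps
        by (intro V.M.finsum_addf) auto
      finally show ?thesis unfolding rep_module_simps .
    qed
    show "a \<odot>\<^bsub>?R\<^esub> (x \<oplus>\<^bsub>?R\<^esub> y) = a \<odot>\<^bsub>?R\<^esub> x \<oplus>\<^bsub>?R\<^esub> a \<odot>\<^bsub>?R\<^esub> y"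
      if a: "a \<in> carrier A" and x: "x \<in> carrier ?R" and y: "y \<in> carrier ?R" for a x y
    proof -
      have "(\<Oplus>\<^bsub>V\<^esub>u\<in>?S. a u \<odot>\<^bsub>V\<^esub> \<rho> u (x \<oplus>\<^bsub>V\<^esub> y)) = (\<Oplus>\<^bsub>V\<^esub>u\<in>?S. a u \<odot>\<^bsub>V\<^esub> \<rho> u x \<oplus>\<^bsub>V\<^esub> a u \<odot>\<^bsub>V\<^esub> \<rho> u y)"
        using x y rc A_apply[OF a] unfolding rep_module_simps
        by (intro V.M.finsum_cong') (auto simp: lin_map_add[OF rho] V.smult_r_distr)
      also have "\<dots> = (\<Oplus>\<^bsub>V\<^esub>u\<in>?S. a u \<odot>\<^bsub>V\<^esub> \<rho> u x) \<oplus>\<^bsub>V\<^esub> (\<Oplus>\<^bsub>V\<^esub>u\<in>?S. a u \<odot>\<^bsub>V\<^esub> \<rho> u y)"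
        using x y rc A_apply[OF a] unfolding rep_module_simps
        by (intro V.M.finsum_addf) auto
      finally show ?thesis unfolding rep_module_simps .
    qed
    show "(f \<otimes>\<^bsub>A\<^esub> g) \<odot>\<^bsub>?R\<^esub> v = f \<odot>\<^bsub>?R\<^esub> (g \<odot>\<^bsub>?R\<^esub> v)"
      if f: "f \<in> carrier A" and g: "g \<in> carrier A" and x: "v \<in> carrier ?R" for f g v
    proof -
      have v: "v \<in> carrier V" using x by (simp add: rep_module_simps)
      note fK = A_apply[OF f] and gK = A_apply[OF g]
      let ?t = "\<lambda>x y. (f x \<otimes>\<^bsub>K\<^esub> g y) \<odot>\<^bsub>V\<^esub> \<rho> (x \<otimes>\<^bsub>B\<^esub> y) v"
      have tc: "?t x y \<in> carrier V" if "x \<in> ?S" "y \<in> ?S" for x y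
        using that fK gK rc v by auto
      \<comment> \<open>The product in the algebra is written with an outer sum over
        \<open>b\<close> and the indicator of \<open>b\<close> being the product of \<open>x\<close>
        and \<open>y\<close>; once that sum has been moved innermost, \<open>finsum_delta\<close>
        removes it.\<close>
      have "(f \<otimes>\<^bsub>A\<^esub> g) \<odot>\<^bsub>?R\<^esub> v = (\<Oplus>\<^bsub>V\<^esub>b\<in>?S. \<Oplus>\<^bsub>V\<^esub>x\<in>?S. \<Oplus>\<^bsub>V\<^esub>y\<in>?S. if b = x \<otimes>\<^bsub>B\<^esub> y then ?t x y else \<zero>\<^bsub>V\<^esub>)"
        unfolding rep_module_simps
      proof (intro V.M.finsum_cong' refl)
        fix b assume b: "b \<in> ?S"
        have "(f \<otimes>\<^bsub>A\<^esub> g) b \<odot>\<^bsub>V\<^esub> \<rho> b v =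
          (\<Oplus>\<^bsub>V\<^esub>x\<in>?S. (\<Oplus>\<^bsub>K\<^esub>y\<in>?S. if x \<otimes>\<^bsub>B\<^esub> y = b then f x \<otimes>\<^bsub>K\<^esub> g y else \<zero>\<^bsub>K\<^esub>) \<odot>\<^bsub>V\<^esub> \<rho> b v)"
          unfolding mult_nested[OF f g] restrict_apply'[OF b]
          using b rc v fK gK by (intro V.finsum_smult) (auto intro!: K.finsum_closed)
        also have "\<dots> = (\<Oplus>\<^bsub>V\<^esub>x\<in>?S. \<Oplus>\<^bsub>V\<^esub>y\<in>?S. (if x \<otimes>\<^bsub>B\<^esub> y = b then f x \<otimes>\<^bsub>K\<^esub> g y else \<zero>\<^bsub>K\<^esub>) \<odot>\<^bsub>V\<^esub> \<rho> b v)"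
          using b rc v fK gK by (intro V.M.finsum_cong' V.finsum_smult) (auto intro!: V.M.finsum_closed)
        also have "\<dots> = (\<Oplus>\<^bsub>V\<^esub>x\<in>?S. \<Oplus>\<^bsub>V\<^esub>y\<in>?S. if b = x \<otimes>\<^bsub>B\<^esub> y then ?t x y else \<zero>\<^bsub>V\<^esub>)"
          using b rc v fK gK
          by (intro V.M.finsum_cong' refl) (auto intro!: V.M.finsum_closed V.smult_l_null)
        finally show "(f \<otimes>\<^bsub>A\<^esub> g) b \<odot>\<^bsub>V\<^esub> \<rho> b v = \<dots>" .
      qed (use tc in \<open>auto intro!: V.M.finsum_closed\<close>)
      also have "\<dots> = (\<Oplus>\<^bsub>V\<^esub>x\<in>?S. \<Oplus>\<^bsub>V\<^esub>b\<in>?S. \<Oplus>\<^bsub>V\<^esub>y\<in>?S. if b = x \<otimes>\<^bsub>B\<^esub> y then ?t x y else \<zero>\<^bsub>V\<^esub>)"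
        by (rule V.M.finsum_swap) (use tc finite_B in \<open>auto intro!: V.M.finsum_closed\<close>)
      also have "\<dots> = (\<Oplus>\<^bsub>V\<^esub>x\<in>?S. \<Oplus>\<^bsub>V\<^esub>y\<in>?S. \<Oplus>\<^bsub>V\<^esub>b\<in>?S. if b = x \<otimes>\<^bsub>B\<^esub> y then ?t x y else \<zero>\<^bsub>V\<^esub>)"
        by (rule V.M.finsum_cong'[OF refl _ V.M.finsum_swap])
          (use tc finite_B in \<open>auto intro!: V.M.finsum_closed\<close>)
      also have "\<dots> = (\<Oplus>\<^bsub>V\<^esub>x\<in>?S. \<Oplus>\<^bsub>V\<^esub>y\<in>?S. ?t x y)"
        using tc finite_B
        by (intro V.M.finsum_cong' refl V.M.finsum_delta) (auto intro!: V.M.finsum_closed)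
      also have "\<dots> = (\<Oplus>\<^bsub>V\<^esub>x\<in>?S. f x \<odot>\<^bsub>V\<^esub> \<rho> x (\<Oplus>\<^bsub>V\<^esub>y\<in>?S. g y \<odot>\<^bsub>V\<^esub> \<rho> y v))"
      proof (intro V.M.finsum_cong' refl)
        fix x assume x: "x \<in> ?S"
        have "\<rho> x (\<Oplus>\<^bsub>V\<^esub>y\<in>?S. g y \<odot>\<^bsub>V\<^esub> \<rho> y v) = (\<Oplus>\<^bsub>V\<^esub>y\<in>?S. \<rho> x (g y \<odot>\<^bsub>V\<^esub> \<rho> y v))"
          by (rule lin_map_finsum[OF V V rho[OF x]]) (use gK rc v in auto)
        also have "f x \<odot>\<^bsub>V\<^esub> \<dots> = (\<Oplus>\<^bsub>V\<^esub>y\<in>?S. f x \<odot>\<^bsub>V\<^esub> \<rho> x (g y \<odot>\<^bsub>V\<^esub> \<rho> y v))"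
          by (rule V.smult_finsum) (use x fK gK rc v in auto)
        also have "\<dots> = (\<Oplus>\<^bsub>V\<^esub>y\<in>?S. ?t x y)"
          using x fK gK rc v tc
          by (intro V.M.finsum_cong' refl) (auto simp: lin_map_smult[OF rho] rho_mult V.smult_assoc1)
        finally show "(\<Oplus>\<^bsub>V\<^esub>y\<in>?S. ?t x y) = f x \<odot>\<^bsub>V\<^esub> \<rho> x (\<Oplus>\<^bsub>V\<^esub>y\<in>?S. g y \<odot>\<^bsub>V\<^esub> \<rho> y v)" by simp
      qed (use fK gK rc v in \<open>auto intro!: V.smult_closed rc V.M.finsum_closed\<close>)
      finally show ?thesis by (simp add: rep_module_simps)
    qed
  qed
qed

end

end

section \<open>Left regular bands\<close>

context left_regular_band
begin

lemma support_subset_carrier: "b \<in> carrier B \<Longrightarrow> lrb_support B b \<subseteq> carrier B"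
  by (auto simp: lrb_support_def)

lemma support_one: "lrb_support B \<one> = carrier B"
  by (force simp: lrb_support_def)

text \<open>As \<open>b\<close> is idempotent, its support consists of the elements fixed by right
  multiplication with \<open>b\<close>. Inclusions of supports are used below in this equational
  form: an element absorbs on the right whatever has larger support.\<close>

lemma support_le_iff:
  assumes "a \<in> carrier B" "b \<in> carrier B"
  shows "lrb_support B a \<subseteq> lrb_support B b \<longleftrightarrow> a \<otimes> b = a"
proof
  assume "lrb_support B a \<subseteq> lrb_support B b"
  moreover have "a \<in> lrb_support B a"
    unfolding lrb_support_def using assms(1) by (intro CollectI exI[of _ \<one>]) simp
  ultimately obtain x where x: "x \<in> carrier B" "a = x \<otimes> b" by (auto simp: lrb_support_def)
  have "a \<otimes> b = x \<otimes> (b \<otimes> b)" using x assms(2) by (simp add: m_assoc)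
  then show "a \<otimes> b = a" using x assms(2) by (simp add: idem)
next
  assume "a \<otimes> b = a"
  then show "lrb_support B a \<subseteq> lrb_support B b" using lrb_support_mult[OF assms] by auto
qed

lemma lrb_le_refl: "a \<in> carrier B \<Longrightarrow> lrb_le B a a"
  by (simp add: lrb_le_def idem)

lemma lrb_le_trans:
  "a \<in> carrier B \<Longrightarrow> b \<in> carrier B \<Longrightarrow> c \<in> carrier B \<Longrightarrow> lrb_le B a b \<Longrightarrow> lrb_le B b c \<Longrightarrow> lrb_le B a c"
  unfolding lrb_le_def by (metis m_assoc)

lemma lrb_le_antisym:
  "a \<in> carrier B \<Longrightarrow> b \<in> carrier B \<Longrightarrow> lrb_le B a b \<Longrightarrow> lrb_le B b a \<Longrightarrow> a = b"
  unfolding lrb_le_def by (metis left_regular)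

text \<open>Left regularity cancels the second \<open>c\<close> in \<open>c b c a\<close>. Hence
  left multiplication maps chains to chains, which is the source of the action on the order
  complex.\<close>

lemma lrb_le_mult_left:
  assumes "a \<in> carrier B" "b \<in> carrier B" "c \<in> carrier B" "lrb_le B a b"
  shows "lrb_le B (c \<otimes> a) (c \<otimes> b)"
proof -
  have "(c \<otimes> b) \<otimes> (c \<otimes> a) = (c \<otimes> b \<otimes> c) \<otimes> a" using assms(1-3) by (simp add: m_assoc)
  also have "\<dots> = c \<otimes> (b \<otimes> a)" using assms(1-3) left_regular by (simp add: m_assoc)
  finally show ?thesis using assms(4) by (simp add: lrb_le_def)
qed

end

section \<open>Decomposition of one in the algebra, indexed by the support lattice\<close>

locale lrb_algebra = finite_monoid_algebra K B + left_regular_band B for K :: "'k ring" and B :: "'b monoid"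
begin

abbreviation supp where "supp \<equiv> lrb_support B"
abbreviation \<Lambda> where "\<Lambda> \<equiv> lrb_lattice B"

lemma lattice_subset: "Z \<in> \<Lambda> \<Longrightarrow> Z \<subseteq> carrier B"
  using support_subset_carrier by (auto simp: lrb_lattice_def)

lemma finite_lattice: "finite \<Lambda>"
  by (simp add: lrb_lattice_def finite_B)

lemma finite_lattice_elem: "Z \<in> \<Lambda> \<Longrightarrow> finite Z"
  using lattice_subset finite_B finite_subset by blast

definition sec :: "'b set \<Rightarrow> 'b" where
  "sec Z = (SOME e. e \<in> carrier B \<and> supp e = Z)"

lemma sec: assumes "Z \<in> \<Lambda>" shows "sec Z \<in> carrier B" "supp (sec Z) = Z"
proof -
  have "\<exists>e. e \<in> carrier B \<and> supp e = Z" using assms by (auto simp: lrb_lattice_def)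
  then have "sec Z \<in> carrier B \<and> supp (sec Z) = Z" unfolding sec_def by (rule someI_ex)
  then show "sec Z \<in> carrier B" "supp (sec Z) = Z" by auto
qed

text \<open>
  Saliola's recursion \<open>\<eta>\<^sub>Z = e\<^sub>Z - \<Sum>\<^sub>W\<^sub><\<^sub>Z e\<^sub>Z \<eta>\<^sub>W\<close> for a complete system of orthogonal
  idempotents, written with a guard under the sum so that the recursion equation holds for every \<open>Z\<close>.
\<close>

definition eta :: "'b set \<Rightarrow> 'b \<Rightarrow> 'k" where
  "eta = wfrec finite_psubset (\<lambda>g Z. bas (sec Z) \<ominus>\<^bsub>A\<^esub>
     (\<Oplus>\<^bsub>A\<^esub>W\<in>{W \<in> \<Lambda>. W \<subset> Z}. bas (sec Z) \<otimes>\<^bsub>A\<^esub> (if W \<subset> Z \<and> finite Z then g W else \<zero>\<^bsub>A\<^esub>)))"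

lemma eta_rec: "eta Z = bas (sec Z) \<ominus>\<^bsub>A\<^esub>
  (\<Oplus>\<^bsub>A\<^esub>W\<in>{W \<in> \<Lambda>. W \<subset> Z}. bas (sec Z) \<otimes>\<^bsub>A\<^esub> (if W \<subset> Z \<and> finite Z then eta W else \<zero>\<^bsub>A\<^esub>))"
  by (subst eta_def, subst wfrec[OF wf_finite_psubset], fold eta_def)
    (simp add: cut_def finite_psubset_def cong: if_cong)

lemma eta_closed: "Z \<in> \<Lambda> \<Longrightarrow> eta Z \<in> carrier A"
proof (induction "card Z" arbitrary: Z rule: less_induct)
  case less
  have "eta W \<in> carrier A" if "W \<in> \<Lambda>" "W \<subset> Z" for W
    using less.hyps[OF psubset_card_mono[OF finite_lattice_elem[OF less.prems] that(2)] that(1)] .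
  then show ?case
    by (subst eta_rec) (auto intro!: A.minus_closed A.finsum_closed A.m_closed)
qed

lemma eta_eq:
  assumes "Z \<in> \<Lambda>"
  shows "eta Z = bas (sec Z) \<ominus>\<^bsub>A\<^esub> bas (sec Z) \<otimes>\<^bsub>A\<^esub> (\<Oplus>\<^bsub>A\<^esub>W\<in>{W \<in> \<Lambda>. W \<subset> Z}. eta W)"
proof -
  have "(\<Oplus>\<^bsub>A\<^esub>W\<in>{W \<in> \<Lambda>. W \<subset> Z}. bas (sec Z) \<otimes>\<^bsub>A\<^esub> (if W \<subset> Z \<and> finite Z then eta W else \<zero>\<^bsub>A\<^esub>))
      = (\<Oplus>\<^bsub>A\<^esub>W\<in>{W \<in> \<Lambda>. W \<subset> Z}. bas (sec Z) \<otimes>\<^bsub>A\<^esub> eta W)"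
    using finite_lattice_elem[OF assms] eta_closed by (intro A.finsum_cong') auto
  also have "\<dots> = bas (sec Z) \<otimes>\<^bsub>A\<^esub> (\<Oplus>\<^bsub>A\<^esub>W\<in>{W \<in> \<Lambda>. W \<subset> Z}. eta W)"
    using finite_lattice eta_closed by (intro A.finsum_rdistr[symmetric]) auto
  finally show ?thesis by (subst eta_rec) simp
qed

text \<open>\<open>sec Z\<close> absorbs \<open>b\<close>, and every \<open>W\<close> below
  \<open>Z\<close> is below the support of \<open>b\<close> too, so the recursion carries the
  absorption over to \<open>eta Z\<close> by induction.\<close>

lemma eta_mult_right:
  assumes "Z \<in> \<Lambda>" "b \<in> carrier B" "Z \<subseteq> supp b"
  shows "eta Z \<otimes>\<^bsub>A\<^esub> bas b = eta Z"
  using assms(1,3)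
proof (induction "card Z" arbitrary: Z rule: less_induct)
  case (less Z)
  note s = sec[OF less.prems(1)]
  have IH: "eta W \<otimes>\<^bsub>A\<^esub> bas b = eta W" if "W \<in> \<Lambda>" "W \<subset> Z" for W
    using less.hyps[OF psubset_card_mono[OF finite_lattice_elem[OF less.prems(1)] that(2)] that(1)]
      that less.prems(2) by blast
  let ?S = "\<Oplus>\<^bsub>A\<^esub>W\<in>{W \<in> \<Lambda>. W \<subset> Z}. eta W"
  have S: "?S \<in> carrier A" using eta_closed by auto
  have "sec Z \<otimes>\<^bsub>B\<^esub> b = sec Z" using support_le_iff[OF s(1) assms(2)] less.prems(2) s(2) by simp
  then have 1: "bas (sec Z) \<otimes>\<^bsub>A\<^esub> bas b = bas (sec Z)" using bas_mult[OF s(1) assms(2)] by simp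
  have "?S \<otimes>\<^bsub>A\<^esub> bas b = (\<Oplus>\<^bsub>A\<^esub>W\<in>{W \<in> \<Lambda>. W \<subset> Z}. eta W \<otimes>\<^bsub>A\<^esub> bas b)"
    using finite_lattice eta_closed by (intro A.finsum_ldistr) auto
  also have "\<dots> = ?S" using IH eta_closed by (intro A.finsum_cong') auto
  finally have 2: "?S \<otimes>\<^bsub>A\<^esub> bas b = ?S" .
  show ?case
    unfolding eta_eq[OF less.prems(1)]
    using S 1 2 by (simp add: A.minus_eq A.l_distr A.l_minus A.m_assoc)
qed

text \<open>Telescoping: with \<open>V\<close> the support of \<open>y\<close>, the element
  \<open>sec V\<close> is absorbed by \<open>y\<close>, so multiplying the recursion for
  \<open>eta V\<close> by \<open>y\<close> leaves \<open>y\<close> minus \<open>y\<close> times the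
  sum over the smaller \<open>W\<close>.\<close>

lemma bas_mult_eta_sum:
  assumes y: "y \<in> carrier B"
  shows "bas y \<otimes>\<^bsub>A\<^esub> (\<Oplus>\<^bsub>A\<^esub>W\<in>{W \<in> \<Lambda>. W \<subseteq> supp y}. eta W) = bas y"
proof -
  let ?V = "supp y"
  have V: "?V \<in> \<Lambda>" using y by (simp add: lrb_lattice_def)
  let ?S = "\<Oplus>\<^bsub>A\<^esub>W\<in>{W \<in> \<Lambda>. W \<subset> ?V}. eta W"
  have S: "?S \<in> carrier A" using eta_closed by auto
  have "{W \<in> \<Lambda>. W \<subseteq> ?V} = insert ?V {W \<in> \<Lambda>. W \<subset> ?V}" using V by auto
  then have eq: "(\<Oplus>\<^bsub>A\<^esub>W\<in>{W \<in> \<Lambda>. W \<subseteq> supp y}. eta W) = eta ?V \<oplus>\<^bsub>A\<^esub> ?S"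
    using eta_closed V finite_lattice by (simp only:) (subst A.finsum_insert, auto)
  have "y \<otimes>\<^bsub>B\<^esub> sec ?V = y" using support_le_iff[OF y sec(1)[OF V]] sec(2)[OF V] by simp
  then have ye: "bas y \<otimes>\<^bsub>A\<^esub> bas (sec ?V) = bas y" using bas_mult[OF y sec(1)[OF V]] by simp
  have "bas y \<otimes>\<^bsub>A\<^esub> eta ?V = bas y \<ominus>\<^bsub>A\<^esub> bas y \<otimes>\<^bsub>A\<^esub> ?S"
    unfolding eta_eq[OF V] using S
    by (simp add: A.minus_eq A.r_distr A.r_minus A.m_assoc[symmetric] ye)
  then show ?thesis unfolding eq using S eta_closed[OF V]
    by (simp add: A.r_distr A.minus_eq A.a_assoc A.l_neg)
qed

text \<open>The support of \<open>?y\<close> is the meet of \<open>Z\<close> with the support of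
  \<open>c\<close>, strictly below \<open>Z\<close>. Multiplying the recursion by \<open>c\<close>
  gives \<open>?y\<close> minus \<open>?y\<close> times the sum over all
  \<open>W \<subset> Z\<close>. By induction only the \<open>W \<subseteq> supp ?y\<close> survive,
  and for them \<open>bas_mult_eta_sum\<close> returns \<open>?y\<close>, so the difference is
  zero.\<close>

lemma eta_annihilated:
  assumes "Z \<in> \<Lambda>" "c \<in> carrier B" "\<not> Z \<subseteq> supp c"
  shows "bas c \<otimes>\<^bsub>A\<^esub> eta Z = \<zero>\<^bsub>A\<^esub>"
  using assms
proof (induction "card Z" arbitrary: Z c rule: less_induct)
  case (less Z c)
  note s = sec[OF less.prems(1)]
  let ?y = "c \<otimes>\<^bsub>B\<^esub> sec Z"
  have y: "?y \<in> carrier B" using s less.prems(2) by simp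
  have sy: "supp ?y = supp c \<inter> Z" using lrb_support_mult[OF less.prems(2) s(1)] s(2) by simp
  have IH: "bas ?y \<otimes>\<^bsub>A\<^esub> eta W = \<zero>\<^bsub>A\<^esub>" if "W \<in> \<Lambda>" "W \<subset> Z" "\<not> W \<subseteq> supp ?y" for W
    using less.hyps[OF psubset_card_mono[OF finite_lattice_elem[OF less.prems(1)] that(2)] that(1) y that(3)] .
  let ?S = "\<Oplus>\<^bsub>A\<^esub>W\<in>{W \<in> \<Lambda>. W \<subset> Z}. eta W"
  have S: "?S \<in> carrier A" using eta_closed by auto
  have "bas ?y \<otimes>\<^bsub>A\<^esub> ?S = (\<Oplus>\<^bsub>A\<^esub>W\<in>{W \<in> \<Lambda>. W \<subset> Z}. bas ?y \<otimes>\<^bsub>A\<^esub> eta W)"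
    using finite_lattice eta_closed by (intro A.finsum_rdistr) auto
  also have "\<dots> = (\<Oplus>\<^bsub>A\<^esub>W\<in>{W \<in> \<Lambda>. W \<subseteq> supp ?y}. bas ?y \<otimes>\<^bsub>A\<^esub> eta W)"
    using finite_lattice eta_closed IH less.prems(3) sy
    by (intro A.add.finprod_mono_neutral_cong_right) auto
  also have "\<dots> = bas ?y \<otimes>\<^bsub>A\<^esub> (\<Oplus>\<^bsub>A\<^esub>W\<in>{W \<in> \<Lambda>. W \<subseteq> supp ?y}. eta W)"
    using finite_lattice eta_closed by (intro A.finsum_rdistr[symmetric]) auto
  also have "\<dots> = bas ?y" by (rule bas_mult_eta_sum[OF y])
  finally have yS: "bas ?y \<otimes>\<^bsub>A\<^esub> ?S = bas ?y" .
  show ?case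
    unfolding eta_eq[OF less.prems(1)]
    using S yS bas_mult[OF less.prems(2) s(1)]
    by (simp add: A.minus_eq A.r_distr A.r_minus A.m_assoc[symmetric] A.r_neg)
qed

text \<open>This is \<open>bas_mult_eta_sum\<close> at the identity, whose support is the top of the
  lattice.\<close>

lemma eta_sum: "(\<Oplus>\<^bsub>A\<^esub>Z\<in>\<Lambda>. eta Z) = \<one>\<^bsub>A\<^esub>"
proof -
  have "{W \<in> \<Lambda>. W \<subseteq> supp \<one>\<^bsub>B\<^esub>} = \<Lambda>" using lattice_subset by (auto simp: support_one)
  moreover have "(\<Oplus>\<^bsub>A\<^esub>Z\<in>\<Lambda>. eta Z) \<in> carrier A" using eta_closed by auto
  ultimately show ?thesis using bas_mult_eta_sum[of "\<one>\<^bsub>B\<^esub>"] by (simp add: bas_one)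
qed

end

section \<open>Cochain modules\<close>

lemma cochains_simps:
  "carrier (cochains K \<Delta> m) = {s \<in> \<Delta>. card s = m} \<rightarrow>\<^sub>E carrier K"
  "\<zero>\<^bsub>cochains K \<Delta> m\<^esub> = (\<lambda>s\<in>{s \<in> \<Delta>. card s = m}. \<zero>\<^bsub>K\<^esub>)"
  "f \<oplus>\<^bsub>cochains K \<Delta> m\<^esub> g = (\<lambda>s\<in>{s \<in> \<Delta>. card s = m}. f s \<oplus>\<^bsub>K\<^esub> g s)"
  "c \<odot>\<^bsub>cochains K \<Delta> m\<^esub> f = (\<lambda>s\<in>{s \<in> \<Delta>. card s = m}. c \<otimes>\<^bsub>K\<^esub> f s)"
  by (simp_all add: cochains_def)

context cring
begin

lemma cochains_apply: "f \<in> carrier (cochains R \<Delta> m) \<Longrightarrow> s \<in> \<Delta> \<Longrightarrow> card s = m \<Longrightarrow> f s \<in> carrier R"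
  by (auto simp: cochains_simps)

lemma cochains_eqI:
  assumes "f \<in> carrier (cochains R \<Delta> m)" "g \<in> carrier (cochains R \<Delta> m)"
    "\<And>s. s \<in> \<Delta> \<Longrightarrow> card s = m \<Longrightarrow> f s = g s"
  shows "f = g"
  by (rule PiE_ext[OF assms(1,2)[unfolded cochains_simps]]) (simp add: assms(3))

lemma cochains_left_module: "left_module R (cochains R \<Delta> m)"
proof -
  let ?C = "cochains R \<Delta> m"
  note c = cochains_apply[of _ \<Delta> m]
  have arb: "f s = undefined" if "f \<in> carrier ?C" "\<not> (s \<in> \<Delta> \<and> card s = m)" for f s
    using that by (auto simp: cochains_simps PiE_def extensional_def)
  have ab: "abelian_group ?C"
  proof (rule abelian_groupI)
    fix f assume f: "f \<in> carrier ?C"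
    show "\<exists>g\<in>carrier ?C. g \<oplus>\<^bsub>?C\<^esub> f = \<zero>\<^bsub>?C\<^esub>"
      using c[OF f] by (intro bexI[of _ "\<lambda>s\<in>{s \<in> \<Delta>. card s = m}. \<ominus> f s"])
        (auto simp: cochains_simps l_neg fun_eq_iff)
    show "\<zero>\<^bsub>?C\<^esub> \<oplus>\<^bsub>?C\<^esub> f = f"
      using c[OF f] arb[OF f] by (auto simp: cochains_simps fun_eq_iff)
  qed (auto simp: cochains_simps fun_eq_iff a_ac Pi_def PiE_def)
  show ?thesis
  proof (intro left_module.intro left_module_axioms.intro ab ring_axioms)
    fix f assume f: "f \<in> carrier ?C"
    show "\<one> \<odot>\<^bsub>?C\<^esub> f = f" using c[OF f] arb[OF f] by (auto simp: cochains_simps fun_eq_iff)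
  qed (auto simp: cochains_simps fun_eq_iff l_distr r_distr m_assoc Pi_def PiE_def)
qed

lemma cochains_finsum_apply:
  assumes "finite T" "g \<in> T \<rightarrow> carrier (cochains R \<Delta> m)" "s \<in> \<Delta>" "card s = m"
  shows "(\<Oplus>\<^bsub>cochains R \<Delta> m\<^esub>t\<in>T. g t) s = (\<Oplus>t\<in>T. g t s)"
  using assms(1,2)
proof (induction T rule: finite_induct)
  case empty
  interpret C: left_module R "cochains R \<Delta> m" by (rule cochains_left_module)
  have "\<zero>\<^bsub>cochains R \<Delta> m\<^esub> s = \<zero>" using assms(3,4) by (simp add: cochains_simps)
  then show ?case by simp
next
  case (insert t T)
  interpret C: left_module R "cochains R \<Delta> m" by (rule cochains_left_module)
  have "g u s \<in> carrier R" if "u \<in> insert t T" for u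
    using insert.prems that assms(3,4) cochains_apply by blast
  moreover have "(u \<oplus>\<^bsub>cochains R \<Delta> m\<^esub> v) s = u s \<oplus> v s" for u v
    using assms(3,4) by (simp add: cochains_simps)
  ultimately show ?case using insert by (auto simp: Pi_def)
qed

end

section \<open>The resolution by chains\<close>

locale chain_resolution = lrb_algebra K B for K :: "'k ring" and B :: "'b monoid" +
  fixes X :: "'b set"
  assumes X: "X \<in> lrb_lattice B"
begin

abbreviation le where "le \<equiv> lrb_le B"

definition L :: "'b set" where "L = lrb_above B X"

definition \<Delta> :: "'b set set" where "\<Delta> = order_complex L le"

abbreviation chains :: "nat \<Rightarrow> 'b set set" where "chains m \<equiv> {s \<in> \<Delta>. card s = m}"

definition act :: "'b \<Rightarrow> 'b set \<Rightarrow> 'b set" where "act b s = (\<lambda>a. b \<otimes>\<^bsub>B\<^esub> a) ` s"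

lemma L_iff: "b \<in> L \<longleftrightarrow> b \<in> carrier B \<and> X \<subseteq> supp b"
  by (simp add: L_def lrb_above_def)

lemma L_carrier: "b \<in> L \<Longrightarrow> b \<in> carrier B"
  by (simp add: L_iff)

lemma finite_L: "finite L"
  using finite_B by (rule rev_finite_subset) (auto simp: L_iff)

lemma one_L: "\<one>\<^bsub>B\<^esub> \<in> L"
  using lattice_subset[OF X] by (simp add: L_iff support_one)

text \<open>Supports multiply to intersections, so \<open>L\<close> is a submonoid whose complement
  is an ideal; letting the complement act by zero is therefore consistent.\<close>

lemma L_mult_iff: "a \<in> carrier B \<Longrightarrow> b \<in> carrier B \<Longrightarrow> a \<otimes>\<^bsub>B\<^esub> b \<in> L \<longleftrightarrow> a \<in> L \<and> b \<in> L"
  by (auto simp: L_iff lrb_support_mult)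

lemma Delta_iff: "s \<in> \<Delta> \<longleftrightarrow> s \<subseteq> L \<and> (\<forall>x\<in>s. \<forall>y\<in>s. le x y \<or> le y x)"
  unfolding \<Delta>_def order_complex_def using finite_L finite_subset by auto

lemma Delta_finite: "s \<in> \<Delta> \<Longrightarrow> finite s"
  by (auto simp: \<Delta>_def order_complex_def)

lemma Delta_sub: "s \<in> \<Delta> \<Longrightarrow> a \<in> s \<Longrightarrow> a \<in> L"
  by (auto simp: Delta_iff)

lemma Delta_carrier: "s \<in> \<Delta> \<Longrightarrow> a \<in> s \<Longrightarrow> a \<in> carrier B"
  by (auto simp: Delta_iff L_iff)

lemma Delta_subset: "s \<in> \<Delta> \<Longrightarrow> t \<subseteq> s \<Longrightarrow> t \<in> \<Delta>"
  by (auto simp: Delta_iff)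

lemma finite_Delta: "finite \<Delta>"
  by (rule finite_subset[of _ "Pow L"]) (auto simp: Delta_iff finite_L)

lemma finite_chains: "finite (chains m)"
  using finite_Delta by simp

lemma act_one: "s \<in> \<Delta> \<Longrightarrow> act \<one>\<^bsub>B\<^esub> s = s"
  using Delta_carrier by (force simp: act_def image_iff)

lemma act_mult: "a \<in> carrier B \<Longrightarrow> b \<in> carrier B \<Longrightarrow> s \<in> \<Delta> \<Longrightarrow> act (a \<otimes>\<^bsub>B\<^esub> b) s = act a (act b s)"
  unfolding act_def image_image using Delta_carrier by (intro image_cong) (auto simp: B.m_assoc)

lemma act_Delta: "b \<in> L \<Longrightarrow> s \<in> \<Delta> \<Longrightarrow> act b s \<in> \<Delta>"
  unfolding Delta_iff act_def using L_mult_iff lrb_le_mult_left L_carrier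
  by (auto simp: image_iff subset_iff) metis

lemma act_card: "s \<in> \<Delta> \<Longrightarrow> card (act b s) \<le> card s"
  unfolding act_def by (rule card_image_le[OF Delta_finite])

text \<open>The number of elements of a chain can only drop under the action and never recovers, so
  a product preserves it exactly when both steps do. This makes \<open>\<rho>\<close> multiplicative
  although shrinking chains are sent to zero.\<close>

lemma act_act_chains:
  assumes "a \<in> L" "b \<in> L" "s \<in> chains m"
  shows "act (a \<otimes>\<^bsub>B\<^esub> b) s \<in> chains m \<longleftrightarrow> act b s \<in> chains m \<and> act a (act b s) \<in> chains m"
proof -
  have "act b s \<in> \<Delta>" using act_Delta assms by auto
  then have "card (act a (act b s)) \<le> card (act b s)" "card (act b s) \<le> m"
    using act_card assms(3) by auto
  moreover have "act a (act b s) \<in> \<Delta>" using act_Delta assms(1) \<open>act b s \<in> \<Delta>\<close> by auto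
  ultimately show ?thesis
    using assms \<open>act b s \<in> \<Delta>\<close> by (auto simp: act_mult L_carrier)
qed

section \<open>The modules spanned by chains\<close>

abbreviation V where "V \<equiv> cochains K \<Delta>"

text \<open>Push-forward of coefficients along \<open>act b\<close>: an element of
  \<open>V m\<close>, formally a cochain, is read as a linear combination of chains. As
  \<open>t\<close> ranges over chains with \<open>m\<close> elements, those that shrink drop
  out.\<close>

definition \<rho> :: "nat \<Rightarrow> 'b \<Rightarrow> ('b set \<Rightarrow> 'k) \<Rightarrow> ('b set \<Rightarrow> 'k)" where
  "\<rho> m b q = (\<lambda>t\<in>chains m. if b \<in> L then \<Oplus>\<^bsub>K\<^esub>s\<in>chains m. if act b s = t then q s else \<zero>\<^bsub>K\<^esub> else \<zero>\<^bsub>K\<^esub>)"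

definition C :: "nat \<Rightarrow> ('b \<Rightarrow> 'k, 'b set \<Rightarrow> 'k) module" where
  "C m = rep_module (V m) (\<rho> m)"

lemma V_apply: "q \<in> carrier (V m) \<Longrightarrow> s \<in> chains m \<Longrightarrow> q s \<in> carrier K"
  using K.cochains_apply by auto

lemma rho_lin: "lin_map K (V m) (V m) (\<rho> m b)"
proof (rule lin_mapI)
  fix q assume q: "q \<in> carrier (V m)"
  note qK = V_apply[OF q]
  show "\<rho> m b q \<in> carrier (V m)"
    using qK by (auto simp: cochains_simps \<rho>_def intro!: K.finsum_closed)
  show "\<rho> m b (a \<odot>\<^bsub>V m\<^esub> q) = a \<odot>\<^bsub>V m\<^esub> \<rho> m b q" if a: "a \<in> carrier K" for a
  proof -
    have *: "(\<Oplus>\<^bsub>K\<^esub>s\<in>chains m. if act b s = t then (a \<odot>\<^bsub>V m\<^esub> q) s else \<zero>\<^bsub>K\<^esub>) =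
        a \<otimes>\<^bsub>K\<^esub> (\<Oplus>\<^bsub>K\<^esub>s\<in>chains m. if act b s = t then q s else \<zero>\<^bsub>K\<^esub>)" for t
      using a qK finite_chains
      by (subst K.finsum_rdistr) (auto intro!: K.finsum_cong' simp: cochains_simps)
    show ?thesis unfolding \<rho>_def * using a by (auto simp: cochains_simps(4) fun_eq_iff)
  qed
next
  fix p q assume p: "p \<in> carrier (V m)" and q: "q \<in> carrier (V m)"
  note pK = V_apply[OF p] and qK = V_apply[OF q]
  have 1: "(\<Oplus>\<^bsub>K\<^esub>s\<in>chains m. if act b s = t then (p \<oplus>\<^bsub>V m\<^esub> q) s else \<zero>\<^bsub>K\<^esub>) =
      (\<Oplus>\<^bsub>K\<^esub>s\<in>chains m. (if act b s = t then p s else \<zero>\<^bsub>K\<^esub>) \<oplus>\<^bsub>K\<^esub> (if act b s = t then q s else \<zero>\<^bsub>K\<^esub>))" for t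
    using pK qK by (intro K.finsum_cong') (auto simp: cochains_simps)
  have 2: "(\<Oplus>\<^bsub>K\<^esub>s\<in>chains m. (if act b s = t then p s else \<zero>\<^bsub>K\<^esub>) \<oplus>\<^bsub>K\<^esub> (if act b s = t then q s else \<zero>\<^bsub>K\<^esub>)) =
      (\<Oplus>\<^bsub>K\<^esub>s\<in>chains m. if act b s = t then p s else \<zero>\<^bsub>K\<^esub>) \<oplus>\<^bsub>K\<^esub>
      (\<Oplus>\<^bsub>K\<^esub>s\<in>chains m. if act b s = t then q s else \<zero>\<^bsub>K\<^esub>)" for t
    using pK qK by (intro K.finsum_addf) auto
  show "\<rho> m b (p \<oplus>\<^bsub>V m\<^esub> q) = \<rho> m b p \<oplus>\<^bsub>V m\<^esub> \<rho> m b q"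
    unfolding \<rho>_def 1 2 by (auto simp: cochains_simps(3) fun_eq_iff)
qed

lemma rho_one: assumes q: "q \<in> carrier (V m)" shows "\<rho> m \<one>\<^bsub>B\<^esub> q = q"
proof (rule K.cochains_eqI[OF lin_map_closed[OF rho_lin q] q])
  fix t assume t: "t \<in> \<Delta>" "card t = m"
  have "(\<Oplus>\<^bsub>K\<^esub>s\<in>chains m. if act \<one>\<^bsub>B\<^esub> s = t then q s else \<zero>\<^bsub>K\<^esub>) = (\<Oplus>\<^bsub>K\<^esub>s\<in>chains m. if s = t then q s else \<zero>\<^bsub>K\<^esub>)"
    using V_apply[OF q] by (intro K.finsum_cong') (auto simp: act_one)
  also have "\<dots> = q t" using t V_apply[OF q] finite_chains by (intro K.finsum_delta) auto
  finally show "\<rho> m \<one>\<^bsub>B\<^esub> q t = q t" using t one_L by (simp add: \<rho>_def)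
qed

lemma rho_mult:
  assumes a: "a \<in> carrier B" and b: "b \<in> carrier B" and q: "q \<in> carrier (V m)"
  shows "\<rho> m (a \<otimes>\<^bsub>B\<^esub> b) q = \<rho> m a (\<rho> m b q)"
proof (rule K.cochains_eqI)
  show "\<rho> m (a \<otimes>\<^bsub>B\<^esub> b) q \<in> carrier (V m)" "\<rho> m a (\<rho> m b q) \<in> carrier (V m)"
    using lin_map_closed[OF rho_lin] q by auto
  fix t assume t: "t \<in> \<Delta>" "card t = m"
  note qK = V_apply[OF q]
  show "\<rho> m (a \<otimes>\<^bsub>B\<^esub> b) q t = \<rho> m a (\<rho> m b q) t"
  proof (cases "a \<in> L \<and> b \<in> L")
    case False
    have b0: "\<rho> m b q s = \<zero>\<^bsub>K\<^esub>" if "b \<notin> L" "s \<in> chains m" for s using that by (simp add: \<rho>_def)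
    have "\<rho> m a (\<rho> m b q) t = \<zero>\<^bsub>K\<^esub>"
    proof (cases "a \<in> L")
      case True
      then have "b \<notin> L" using False by simp
      have "(\<Oplus>\<^bsub>K\<^esub>s\<in>chains m. if act a s = t then \<rho> m b q s else \<zero>\<^bsub>K\<^esub>) = \<zero>\<^bsub>K\<^esub>"
        using b0[OF \<open>b \<notin> L\<close>] by (intro K.finsum_zero_eqI) simp
      then show ?thesis using t True by (simp add: \<rho>_def[of m a])
    qed (use t in \<open>simp add: \<rho>_def[of m a]\<close>)
    moreover have "\<rho> m (a \<otimes>\<^bsub>B\<^esub> b) q t = \<zero>\<^bsub>K\<^esub>"
    proof -
      have "a \<otimes>\<^bsub>B\<^esub> b \<notin> L" using False L_mult_iff[OF a b] by blast
      then show ?thesis using t by (simp add: \<rho>_def)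
    qed
    ultimately show ?thesis by simp
  next
    case True
    have "\<rho> m a (\<rho> m b q) t = (\<Oplus>\<^bsub>K\<^esub>s\<in>chains m. if act a s = t then \<rho> m b q s else \<zero>\<^bsub>K\<^esub>)"
      using t True by (simp add: \<rho>_def[of m a])
    \<comment> \<open>Each \<open>r\<close> contributes through the single intermediate chain
      \<open>s = act b r\<close>; once the sums are exchanged, the inner one is a delta.\<close>
    also have "\<dots> = (\<Oplus>\<^bsub>K\<^esub>s\<in>chains m. \<Oplus>\<^bsub>K\<^esub>r\<in>chains m. if s = act b r then (if act a s = t then q r else \<zero>\<^bsub>K\<^esub>) else \<zero>\<^bsub>K\<^esub>)"
    proof (intro K.finsum_cong' refl)
      fix s assume s: "s \<in> chains m"
      show "(if act a s = t then \<rho> m b q s else \<zero>\<^bsub>K\<^esub>)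
          = (\<Oplus>\<^bsub>K\<^esub>r\<in>chains m. if s = act b r then (if act a s = t then q r else \<zero>\<^bsub>K\<^esub>) else \<zero>\<^bsub>K\<^esub>)"
      proof (cases "act a s = t")
        case True
        then show ?thesis using s \<open>a \<in> L \<and> b \<in> L\<close> qK
          by (auto simp: \<rho>_def intro!: K.finsum_cong')
      next
        case False
        then show ?thesis by (simp only: if_False, intro K.finsum_zero_eqI[symmetric]) simp
      qed
    qed (use qK in \<open>auto intro!: K.finsum_closed\<close>)
    also have "\<dots> = (\<Oplus>\<^bsub>K\<^esub>r\<in>chains m. \<Oplus>\<^bsub>K\<^esub>s\<in>chains m. if s = act b r then (if act a s = t then q r else \<zero>\<^bsub>K\<^esub>) else \<zero>\<^bsub>K\<^esub>)"
      by (rule K.finsum_swap) (use qK finite_chains in auto)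
    also have "\<dots> = (\<Oplus>\<^bsub>K\<^esub>r\<in>chains m. if act (a \<otimes>\<^bsub>B\<^esub> b) r = t then q r else \<zero>\<^bsub>K\<^esub>)"
    proof (intro K.finsum_cong' refl)
      fix r assume r: "r \<in> chains m"
      have *: "act (a \<otimes>\<^bsub>B\<^esub> b) r = act a (act b r)" using act_mult[OF a b] r by auto
      show "(\<Oplus>\<^bsub>K\<^esub>s\<in>chains m. if s = act b r then (if act a s = t then q r else \<zero>\<^bsub>K\<^esub>) else \<zero>\<^bsub>K\<^esub>)
          = (if act (a \<otimes>\<^bsub>B\<^esub> b) r = t then q r else \<zero>\<^bsub>K\<^esub>)"
      proof (cases "act b r \<in> chains m")
        case True
        then have "(\<Oplus>\<^bsub>K\<^esub>s\<in>chains m. if s = act b r then (if act a s = t then q r else \<zero>\<^bsub>K\<^esub>) else \<zero>\<^bsub>K\<^esub>)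
          = (if act a (act b r) = t then q r else \<zero>\<^bsub>K\<^esub>)"
          using qK[OF r] finite_chains by (intro K.finsum_delta) auto
        then show ?thesis using * by simp
      next
        case False
        \<comment> \<open>Once \<open>b\<close> has shrunk \<open>r\<close>, no further action
          restores \<open>m\<close> elements, so \<open>r\<close> is missing on both sides.\<close>
        then have "act (a \<otimes>\<^bsub>B\<^esub> b) r \<noteq> t"
          using act_act_chains[of a b r m] \<open>a \<in> L \<and> b \<in> L\<close> r t by blast
        moreover have "s \<noteq> act b r" if "s \<in> chains m" for s using False that by blast
        then have "(\<Oplus>\<^bsub>K\<^esub>s\<in>chains m. if s = act b r then (if act a s = t then q r else \<zero>\<^bsub>K\<^esub>) else \<zero>\<^bsub>K\<^esub>) = \<zero>\<^bsub>K\<^esub>"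
          by (intro K.finsum_zero_eqI) (simp only: if_False)
        ultimately show ?thesis by (simp only: if_False)
      qed
    qed (use qK in auto)
    also have "\<dots> = \<rho> m (a \<otimes>\<^bsub>B\<^esub> b) q t" using t True a b by (simp add: \<rho>_def L_mult_iff)
    finally show ?thesis by simp
  qed
qed

lemma C_left_module: "left_module A (C m)"
  unfolding C_def by (intro rep_module_left_module K.cochains_left_module rho_lin rho_one rho_mult)

lemma C_bas: "b \<in> carrier B \<Longrightarrow> q \<in> carrier (V m) \<Longrightarrow> bas b \<odot>\<^bsub>C m\<^esub> q = \<rho> m b q"
  unfolding C_def by (intro rep_bas K.cochains_left_module rho_lin rho_one rho_mult)

lemma C_scal: "c \<in> carrier K \<Longrightarrow> q \<in> carrier (V m) \<Longrightarrow> scal c \<odot>\<^bsub>C m\<^esub> q = c \<odot>\<^bsub>V m\<^esub> q"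
  unfolding C_def by (intro rep_scal K.cochains_left_module rho_lin rho_one rho_mult)

lemma C_simps: "carrier (C m) = carrier (V m)" "\<zero>\<^bsub>C m\<^esub> = \<zero>\<^bsub>V m\<^esub>" "(\<oplus>\<^bsub>C m\<^esub>) = (\<oplus>\<^bsub>V m\<^esub>)"
  by (simp_all add: C_def rep_module_def)

lemma C_finsum: "finsum (C m) f S = finsum (V m) f S"
  by (simp add: finsum_def finprod_def C_simps)

text \<open>Delta function: the basis element of \<open>C m\<close> that belongs to the chain
  \<open>s\<close>.\<close>

definition dl :: "nat \<Rightarrow> 'b set \<Rightarrow> 'b set \<Rightarrow> 'k" where
  "dl m s = (\<lambda>t\<in>chains m. if t = s then \<one>\<^bsub>K\<^esub> else \<zero>\<^bsub>K\<^esub>)"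

lemma dl_closed: "dl m s \<in> carrier (C m)"
  by (auto simp: C_simps cochains_simps dl_def)

lemma dl_apply: "t \<in> \<Delta> \<Longrightarrow> card t = m \<Longrightarrow> dl m s t = (if t = s then \<one>\<^bsub>K\<^esub> else \<zero>\<^bsub>K\<^esub>)"
  by (simp add: dl_def)

lemma C_apply: "q \<in> carrier (C m) \<Longrightarrow> s \<in> \<Delta> \<Longrightarrow> card s = m \<Longrightarrow> q s \<in> carrier K"
  using V_apply by (simp add: C_simps)

lemma C_expand:
  assumes q: "q \<in> carrier (C m)"
  shows "q = (\<Oplus>\<^bsub>C m\<^esub>s\<in>chains m. scal (q s) \<odot>\<^bsub>C m\<^esub> dl m s)"
proof -
  interpret C: left_module A "C m" by (rule C_left_module)
  have qK: "q s \<in> carrier K" if "s \<in> chains m" for s using C_apply[OF q] that by auto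
  have cl: "(\<lambda>s. scal (q s) \<odot>\<^bsub>C m\<^esub> dl m s) \<in> chains m \<rightarrow> carrier (C m)"
    using qK dl_closed by (auto intro!: C.smult_closed)
  have cl': "(\<lambda>s. scal (q s) \<odot>\<^bsub>C m\<^esub> dl m s) \<in> chains m \<rightarrow> carrier (V m)" using cl by (simp add: C_simps)
  show ?thesis
  proof (rule K.cochains_eqI)
    show "q \<in> carrier (V m)" using q by (simp add: C_simps)
    show "(\<Oplus>\<^bsub>C m\<^esub>s\<in>chains m. scal (q s) \<odot>\<^bsub>C m\<^esub> dl m s) \<in> carrier (V m)"
      using C.finsum_closed[OF cl] by (simp add: C_simps)
    fix t assume t: "t \<in> \<Delta>" "card t = m"
    have "(\<Oplus>\<^bsub>C m\<^esub>s\<in>chains m. scal (q s) \<odot>\<^bsub>C m\<^esub> dl m s) t = (\<Oplus>\<^bsub>K\<^esub>s\<in>chains m. (scal (q s) \<odot>\<^bsub>C m\<^esub> dl m s) t)"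
      unfolding C_finsum by (rule K.cochains_finsum_apply[OF finite_chains cl' t])
    also have "\<dots> = (\<Oplus>\<^bsub>K\<^esub>s\<in>chains m. if s = t then q s else \<zero>\<^bsub>K\<^esub>)"
    proof (intro K.finsum_cong' refl)
      fix s assume s: "s \<in> chains m"
      have "dl m s \<in> carrier (V m)" using dl_closed by (simp add: C_simps)
      then show "(scal (q s) \<odot>\<^bsub>C m\<^esub> dl m s) t = (if s = t then q s else \<zero>\<^bsub>K\<^esub>)"
        using t qK[OF s] by (auto simp: C_scal[OF qK[OF s]] cochains_simps dl_def)
    qed (use qK in auto)
    also have "\<dots> = q t" using t qK finite_chains by (intro K.finsum_delta) auto
    finally show "q t = (\<Oplus>\<^bsub>C m\<^esub>s\<in>chains m. scal (q s) \<odot>\<^bsub>C m\<^esub> dl m s) t" by simp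
  qed
qed

lemma C_hom_eqI:
  assumes M: "left_module A M" and f: "lin_map A (C m) M f" and g: "lin_map A (C m) M g"
    and eq: "\<And>s. s \<in> \<Delta> \<Longrightarrow> card s = m \<Longrightarrow> f (dl m s) = g (dl m s)" and q: "q \<in> carrier (C m)"
  shows "f q = g q"
proof -
  interpret C: left_module A "C m" by (rule C_left_module)
  interpret M: left_module A M by (rule M)
  have qK: "q s \<in> carrier K" if "s \<in> chains m" for s using C_apply[OF q] that by auto
  have cl: "(\<lambda>s. scal (q s) \<odot>\<^bsub>C m\<^esub> dl m s) \<in> chains m \<rightarrow> carrier (C m)"
    using qK dl_closed by (auto intro!: C.smult_closed)
  have *: "h q = (\<Oplus>\<^bsub>M\<^esub>s\<in>chains m. scal (q s) \<odot>\<^bsub>M\<^esub> h (dl m s))" if h: "lin_map A (C m) M h" for h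
  proof -
    have "h q = h (\<Oplus>\<^bsub>C m\<^esub>s\<in>chains m. scal (q s) \<odot>\<^bsub>C m\<^esub> dl m s)" using C_expand[OF q] by simp
    also have "\<dots> = (\<Oplus>\<^bsub>M\<^esub>s\<in>chains m. h (scal (q s) \<odot>\<^bsub>C m\<^esub> dl m s))"
      by (rule lin_map_finsum[OF C_left_module M h cl])
    also have "\<dots> = (\<Oplus>\<^bsub>M\<^esub>s\<in>chains m. scal (q s) \<odot>\<^bsub>M\<^esub> h (dl m s))"
      using qK lin_map_closed[OF h dl_closed] dl_closed
      by (intro M.finsum_cong') (auto simp: lin_map_smult[OF h])
    finally show ?thesis .
  qed
  show ?thesis
    unfolding *[OF f] *[OF g]
    using qK lin_map_closed[OF g dl_closed] by (intro M.finsum_cong') (auto simp: eq)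
qed

lemma bas_dl:
  assumes b: "b \<in> carrier B" and s: "s \<in> chains m"
  shows "bas b \<odot>\<^bsub>C m\<^esub> dl m s = (if b \<in> L \<and> card (act b s) = m then dl m (act b s) else \<zero>\<^bsub>C m\<^esub>)"
proof -
  have d: "dl m s \<in> carrier (V m)" using dl_closed by (simp add: C_simps)
  have "\<rho> m b (dl m s) t = (if b \<in> L \<and> card (act b s) = m then dl m (act b s) else \<zero>\<^bsub>C m\<^esub>) t"
    if t: "t \<in> \<Delta>" "card t = m" for t
  proof (cases "b \<in> L")
    case True
    have "(\<Oplus>\<^bsub>K\<^esub>r\<in>chains m. if act b r = t then dl m s r else \<zero>\<^bsub>K\<^esub>)
        = (\<Oplus>\<^bsub>K\<^esub>r\<in>chains m. if r = s then (if act b r = t then \<one>\<^bsub>K\<^esub> else \<zero>\<^bsub>K\<^esub>) else \<zero>\<^bsub>K\<^esub>)"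
      by (intro K.finsum_cong') (auto simp: dl_apply)
    also have "\<dots> = (if act b s = t then \<one>\<^bsub>K\<^esub> else \<zero>\<^bsub>K\<^esub>)"
      using s finite_chains by (intro K.finsum_delta) auto
    finally show ?thesis using t True s act_Delta by (auto simp: \<rho>_def dl_apply C_simps cochains_simps)
  next
    case False
    then show ?thesis using t by (simp add: \<rho>_def C_simps cochains_simps)
  qed
  moreover have "(if b \<in> L \<and> card (act b s) = m then dl m (act b s) else \<zero>\<^bsub>C m\<^esub>) \<in> carrier (V m)"
    using dl_closed by (auto simp: C_simps cochains_simps)
  ultimately show ?thesis
    using K.cochains_eqI[OF lin_map_closed[OF rho_lin d]] by (simp add: C_bas[OF b d])
qed

text \<open>
  \<open>C m\<close> is spanned by the chains with \<open>m\<close> elements; \<open>b\<close> acts by zero on a chain that leaves \<open>L\<close> or shrinks,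
  so a homomorphism out of \<open>C m\<close> is an equivariant family that vanishes there.
\<close>

definition chain_ext :: "nat \<Rightarrow> ('b \<Rightarrow> 'k, 'm) module \<Rightarrow> ('b set \<Rightarrow> 'm) \<Rightarrow> ('b set \<Rightarrow> 'k) \<Rightarrow> 'm" where
  "chain_ext m M \<phi> q = (\<Oplus>\<^bsub>M\<^esub>s\<in>chains m. scal (q s) \<odot>\<^bsub>M\<^esub> \<phi> s)"

lemma chain_ext_dl:
  assumes M: "left_module A M" and phi: "\<And>s. s \<in> chains m \<Longrightarrow> \<phi> s \<in> carrier M" and s: "s \<in> chains m"
  shows "chain_ext m M \<phi> (dl m s) = \<phi> s"
proof -
  interpret M: left_module A M by (rule M)
  have sz: "scal \<zero>\<^bsub>K\<^esub> = \<zero>\<^bsub>A\<^esub>" by (simp add: monoid_algebra_scalar_def A_simps cong: if_cong)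
  have "chain_ext m M \<phi> (dl m s) = (\<Oplus>\<^bsub>M\<^esub>r\<in>chains m. if r = s then \<phi> r else \<zero>\<^bsub>M\<^esub>)"
    unfolding chain_ext_def using phi
    by (intro M.finsum_cong') (auto simp: dl_apply sz scal_one M.smult_l_null)
  also have "\<dots> = \<phi> s" using s phi finite_chains by (intro M.finsum_delta) auto
  finally show ?thesis .
qed

lemma chain_ext_lin:
  assumes M: "left_module A M" and phi: "\<And>s. s \<in> chains m \<Longrightarrow> \<phi> s \<in> carrier M"
    and equi: "\<And>b s. b \<in> carrier B \<Longrightarrow> s \<in> chains m \<Longrightarrow>
      bas b \<odot>\<^bsub>M\<^esub> \<phi> s = (if b \<in> L \<and> card (act b s) = m then \<phi> (act b s) else \<zero>\<^bsub>M\<^esub>)"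
  shows "lin_map A (C m) M (chain_ext m M \<phi>)"
proof -
  interpret C: left_module A "C m" by (rule C_left_module)
  interpret M: left_module A M by (rule M)
  have qK: "q s \<in> carrier K" if "q \<in> carrier (C m)" "s \<in> chains m" for q s using C_apply that by auto
  have sadd: "scal (c \<oplus>\<^bsub>K\<^esub> d) = scal c \<oplus>\<^bsub>A\<^esub> scal d" if "c \<in> carrier K" "d \<in> carrier K" for c d
    by (rule ring_hom_add[OF central.hom that])
  have smul: "scal (c \<otimes>\<^bsub>K\<^esub> d) = scal c \<otimes>\<^bsub>A\<^esub> scal d" if "c \<in> carrier K" "d \<in> carrier K" for c d
    by (rule ring_hom_mult[OF central.hom that])
  have sz: "scal \<zero>\<^bsub>K\<^esub> = \<zero>\<^bsub>A\<^esub>" by (simp add: monoid_algebra_scalar_def A_simps cong: if_cong)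
  have add: "chain_ext m M \<phi> (p \<oplus>\<^bsub>C m\<^esub> q) = chain_ext m M \<phi> p \<oplus>\<^bsub>M\<^esub> chain_ext m M \<phi> q"
    if p: "p \<in> carrier (C m)" and q: "q \<in> carrier (C m)" for p q
  proof -
    have "chain_ext m M \<phi> (p \<oplus>\<^bsub>C m\<^esub> q) = (\<Oplus>\<^bsub>M\<^esub>s\<in>chains m. scal (p s) \<odot>\<^bsub>M\<^esub> \<phi> s \<oplus>\<^bsub>M\<^esub> scal (q s) \<odot>\<^bsub>M\<^esub> \<phi> s)"
      unfolding chain_ext_def using qK[OF p] qK[OF q] phi
      by (intro M.finsum_cong') (auto simp: C_simps cochains_simps sadd M.smult_l_distr)
    also have "\<dots> = chain_ext m M \<phi> p \<oplus>\<^bsub>M\<^esub> chain_ext m M \<phi> q"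
      unfolding chain_ext_def using qK[OF p] qK[OF q] phi by (intro M.finsum_addf) auto
    finally show ?thesis .
  qed
  have sca: "chain_ext m M \<phi> (scal c \<odot>\<^bsub>C m\<^esub> q) = scal c \<odot>\<^bsub>M\<^esub> chain_ext m M \<phi> q"
    if c: "c \<in> carrier K" and q: "q \<in> carrier (C m)" for c q
  proof -
    have qV: "q \<in> carrier (V m)" using q by (simp add: C_simps)
    have "chain_ext m M \<phi> (scal c \<odot>\<^bsub>C m\<^esub> q) = (\<Oplus>\<^bsub>M\<^esub>s\<in>chains m. scal c \<odot>\<^bsub>M\<^esub> (scal (q s) \<odot>\<^bsub>M\<^esub> \<phi> s))"
      unfolding chain_ext_def C_scal[OF c qV] using qK[OF q] phi c
      by (intro M.finsum_cong') (auto simp: cochains_simps smul M.smult_assoc1)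
    also have "\<dots> = scal c \<odot>\<^bsub>M\<^esub> chain_ext m M \<phi> q"
      unfolding chain_ext_def using qK[OF q] phi c by (intro M.smult_finsum[symmetric]) auto
    finally show ?thesis .
  qed
  show ?thesis
  proof (rule lin_map_basI[OF C_left_module M])
    show "chain_ext m M \<phi> (p \<oplus>\<^bsub>C m\<^esub> q) = chain_ext m M \<phi> p \<oplus>\<^bsub>M\<^esub> chain_ext m M \<phi> q"
      if "p \<in> carrier (C m)" "q \<in> carrier (C m)" for p q by (rule add[OF that])
    show "chain_ext m M \<phi> (scal c \<odot>\<^bsub>C m\<^esub> q) = scal c \<odot>\<^bsub>M\<^esub> chain_ext m M \<phi> q"
      if "c \<in> carrier K" "q \<in> carrier (C m)" for c q by (rule sca[OF that])
    show "chain_ext m M \<phi> q \<in> carrier M" if "q \<in> carrier (C m)" for q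
      unfolding chain_ext_def using qK[OF that] phi by (intro M.finsum_closed) auto
    fix b q assume b: "b \<in> carrier B" and q: "q \<in> carrier (C m)"
    have qV: "q \<in> carrier (V m)" using q by (simp add: C_simps)
    let ?t = "\<lambda>s. if b \<in> L then scal (q s) \<odot>\<^bsub>M\<^esub> \<phi> (act b s) else \<zero>\<^bsub>M\<^esub>"
    \<comment> \<open>The coefficient of \<open>t\<close> in \<open>b q\<close> collects the
      \<open>q s\<close> over the fibre \<open>act b s = t\<close>. After the sums are exchanged,
      each \<open>s\<close> determines its \<open>t\<close>, and \<open>equi\<close> applies chain
      by chain.\<close>
    have "chain_ext m M \<phi> (bas b \<odot>\<^bsub>C m\<^esub> q) = (\<Oplus>\<^bsub>M\<^esub>t\<in>chains m. \<Oplus>\<^bsub>M\<^esub>s\<in>chains m. if t = act b s then ?t s else \<zero>\<^bsub>M\<^esub>)"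
      unfolding chain_ext_def C_bas[OF b qV]
    proof (intro M.finsum_cong' refl)
      fix t assume t: "t \<in> chains m"
      have scs: "scal (\<Oplus>\<^bsub>K\<^esub>s\<in>S. g s) = (\<Oplus>\<^bsub>A\<^esub>s\<in>S. scal (g s))" if "finite S" "g \<in> S \<rightarrow> carrier K" for S and g :: "'b set \<Rightarrow> 'k"
        using that by (induction S rule: finite_induct) (auto simp: sz sadd Pi_def)
      show "scal (\<rho> m b q t) \<odot>\<^bsub>M\<^esub> \<phi> t = (\<Oplus>\<^bsub>M\<^esub>s\<in>chains m. if t = act b s then ?t s else \<zero>\<^bsub>M\<^esub>)"
      proof (cases "b \<in> L")
        case True
        have *: "scal (\<rho> m b q t) = (\<Oplus>\<^bsub>A\<^esub>s\<in>chains m. scal (if act b s = t then q s else \<zero>\<^bsub>K\<^esub>))"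
          using t True qK[OF q] finite_chains by (simp add: \<rho>_def) (intro scs; auto)
        have "scal (\<rho> m b q t) \<odot>\<^bsub>M\<^esub> \<phi> t = (\<Oplus>\<^bsub>M\<^esub>s\<in>chains m. scal (if act b s = t then q s else \<zero>\<^bsub>K\<^esub>) \<odot>\<^bsub>M\<^esub> \<phi> t)"
          unfolding * using t qK[OF q] phi by (intro M.finsum_smult) auto
        also have "\<dots> = (\<Oplus>\<^bsub>M\<^esub>s\<in>chains m. if t = act b s then ?t s else \<zero>\<^bsub>M\<^esub>)"
          using t qK[OF q] phi True by (intro M.finsum_cong') (auto simp: sz M.smult_l_null)
        finally show ?thesis .
      next
        case False
        then have "scal (\<rho> m b q t) = \<zero>\<^bsub>A\<^esub>" using t by (simp add: \<rho>_def sz)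
        then show ?thesis using False t phi by (auto simp: M.smult_l_null intro!: M.finsum_zero_eqI[symmetric])
      qed
    qed (use qK[OF q] phi in \<open>auto intro!: M.finsum_closed\<close>)
    also have "\<dots> = (\<Oplus>\<^bsub>M\<^esub>s\<in>chains m. \<Oplus>\<^bsub>M\<^esub>t\<in>chains m. if t = act b s then ?t s else \<zero>\<^bsub>M\<^esub>)"
      using qK[OF q] phi by (intro M.finsum_swap finite_chains) (auto simp: finite_chains)
    also have "\<dots> = (\<Oplus>\<^bsub>M\<^esub>s\<in>chains m. bas b \<odot>\<^bsub>M\<^esub> (scal (q s) \<odot>\<^bsub>M\<^esub> \<phi> s))"
    proof (intro M.finsum_cong' refl)
      fix s assume s: "s \<in> chains m"
      note qs = qK[OF q s]
      have "bas b \<odot>\<^bsub>M\<^esub> (scal (q s) \<odot>\<^bsub>M\<^esub> \<phi> s) = scal (q s) \<odot>\<^bsub>M\<^esub> (bas b \<odot>\<^bsub>M\<^esub> \<phi> s)"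
        using s phi qs central.central[OF qs bas_closed] by (simp add: M.smult_assoc1[symmetric])
      also have "\<dots> = (if b \<in> L \<and> card (act b s) = m then scal (q s) \<odot>\<^bsub>M\<^esub> \<phi> (act b s) else \<zero>\<^bsub>M\<^esub>)"
        using qs by (simp add: equi[OF b s] M.smult_r_null)
      also have "\<dots> = (\<Oplus>\<^bsub>M\<^esub>t\<in>chains m. if t = act b s then ?t s else \<zero>\<^bsub>M\<^esub>)"
      proof (cases "b \<in> L \<and> act b s \<in> chains m")
        case True
        then have "?t s \<in> carrier M" using phi qs by auto
        then have "(\<Oplus>\<^bsub>M\<^esub>t\<in>chains m. if t = act b s then ?t s else \<zero>\<^bsub>M\<^esub>) = ?t s"
          using True finite_chains by (intro M.finsum_delta) auto
        then show ?thesis using True by simp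
      next
        case False
        then have "(\<Oplus>\<^bsub>M\<^esub>t\<in>chains m. if t = act b s then ?t s else \<zero>\<^bsub>M\<^esub>) = \<zero>\<^bsub>M\<^esub>"
          by (intro M.finsum_zero_eqI) auto
        moreover have "\<not> (b \<in> L \<and> card (act b s) = m)" using False act_Delta s by auto
        ultimately show ?thesis by (simp only: if_False)
      qed
      finally show "(\<Oplus>\<^bsub>M\<^esub>t\<in>chains m. if t = act b s then ?t s else \<zero>\<^bsub>M\<^esub>) = bas b \<odot>\<^bsub>M\<^esub> (scal (q s) \<odot>\<^bsub>M\<^esub> \<phi> s)"
        by simp
    qed (use qK[OF q] phi in \<open>auto intro!: M.smult_closed\<close>)
    also have "\<dots> = bas b \<odot>\<^bsub>M\<^esub> chain_ext m M \<phi> q"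
      unfolding chain_ext_def using qK[OF q] phi by (intro M.smult_finsum[symmetric]) auto
    finally show "chain_ext m M \<phi> (bas b \<odot>\<^bsub>C m\<^esub> q) = bas b \<odot>\<^bsub>M\<^esub> chain_ext m M \<phi> q" .
  qed
qed

end

section \<open>Projectivity of the chain modules\<close>

context chain_resolution
begin

lemma top_exists: "s \<in> \<Delta> \<Longrightarrow> s \<noteq> {} \<Longrightarrow> \<exists>a. a \<in> s \<and> (\<forall>u\<in>s. le u a)"
proof -
  assume s: "s \<in> \<Delta>" "s \<noteq> {}"
  from Delta_finite[OF s(1)] s(2) s(1) show ?thesis
  proof (induction rule: finite_ne_induct)
    case (singleton x)
    then show ?case using lrb_le_refl Delta_carrier by blast
  next
    case (insert x F)
    have F: "F \<in> \<Delta>" using insert.prems Delta_subset by blast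
    then obtain a where a: "a \<in> F" "\<And>u. u \<in> F \<Longrightarrow> le u a" using insert.IH by blast
    have car: "u \<in> carrier B" if "u \<in> insert x F" for u using Delta_carrier[OF insert.prems that] .
    have "le x a \<or> le a x" using insert.prems a(1) by (auto simp: Delta_iff)
    then show ?case
    proof
      assume "le x a"
      then show ?thesis using a by blast
    next
      assume ax: "le a x"
      have "le u x" if "u \<in> F" for u
        using lrb_le_trans[of u a x] car a that ax by blast
      then show ?thesis using lrb_le_refl car by blast
    qed
  qed
qed

definition top :: "'b set \<Rightarrow> 'b" where
  "top s = (SOME a. a \<in> s \<and> (\<forall>u\<in>s. le u a))"

lemma top: assumes "s \<in> \<Delta>" "s \<noteq> {}" shows "top s \<in> s" "u \<in> s \<Longrightarrow> le u (top s)"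
  using someI_ex[OF top_exists[OF assms]] by (auto simp: top_def)

lemma top_eqI: assumes "s \<in> \<Delta>" "a \<in> s" "\<And>u. u \<in> s \<Longrightarrow> le u a" shows "top s = a"
proof -
  have "top s \<in> s" "le a (top s)" using top assms(1,2) by blast+
  then show ?thesis using assms Delta_carrier lrb_le_antisym by blast
qed

text \<open>Every element below the largest one is fixed by it from the left. So a nonempty chain is
  fixed by an element of \<open>L\<close>, which later also determines how homomorphisms treat the
  chain.\<close>

lemma act_top: assumes "s \<in> \<Delta>" "s \<noteq> {}" shows "act (top s) s = s"
proof -
  have "top s \<otimes>\<^bsub>B\<^esub> u = u" if "u \<in> s" for u using top(2)[OF assms that] by (simp add: lrb_le_def)
  then show ?thesis by (simp add: act_def)
qed

lemma top_act: assumes "b \<in> L" "s \<in> \<Delta>" "s \<noteq> {}" shows "top (act b s) = b \<otimes>\<^bsub>B\<^esub> top s"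
proof (rule top_eqI[OF act_Delta[OF assms(1,2)]])
  show "b \<otimes>\<^bsub>B\<^esub> top s \<in> act b s" using top(1)[OF assms(2,3)] by (simp add: act_def)
  show "le u (b \<otimes>\<^bsub>B\<^esub> top s)" if "u \<in> act b s" for u
  proof -
    obtain v where v: "v \<in> s" "u = b \<otimes>\<^bsub>B\<^esub> v" using \<open>u \<in> act b s\<close> by (auto simp: act_def)
    show ?thesis unfolding v(2)
      by (rule lrb_le_mult_left[OF Delta_carrier[OF assms(2) v(1)] Delta_carrier[OF assms(2) top(1)[OF assms(2,3)]]
            L_carrier[OF assms(1)] top(2)[OF assms(2,3) v(1)]])
  qed
qed

text \<open>
  The section sends a chain \<open>s\<close> with largest element \<open>a\<close> to \<open>\<Sum>\<^sub>Z a \<eta>\<^sub>Z \<mu>(e\<^sub>Z s)\<close>, where \<open>\<mu>\<close> chooses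
  preimages. The sum only involves \<open>Z\<close> below the support of \<open>a\<close>, and if moreover \<open>Z \<subseteq> \<sigma>(b)\<close> then
  \<open>e\<^sub>Z b = e\<^sub>Z\<close>; this gives equivariance.
\<close>

lemma C_section:
  fixes M :: "('b \<Rightarrow> 'k, 'm) module"
  assumes m: "m \<ge> 1" and M: "left_module A M" and g: "lin_map A M (C m) g" and onto: "g ` carrier M = carrier (C m)"
  shows "\<exists>h. lin_map A (C m) M h \<and> (\<forall>x\<in>carrier (C m). g (h x) = x)"
proof -
  interpret C: left_module A "C m" by (rule C_left_module)
  interpret M: left_module A M by (rule M)
  define \<mu> where "\<mu> s = (SOME x. x \<in> carrier M \<and> g x = dl m s)" for s
  have mu: "\<mu> s \<in> carrier M" "g (\<mu> s) = dl m s" for s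
  proof -
    have "dl m s \<in> g ` carrier M" using onto dl_closed by simp
    then obtain x where "x \<in> carrier M \<and> g x = dl m s" by (metis imageE)
    then have "\<mu> s \<in> carrier M \<and> g (\<mu> s) = dl m s" unfolding \<mu>_def by (rule someI)
    then show "\<mu> s \<in> carrier M" "g (\<mu> s) = dl m s" by auto
  qed
  \<comment> \<open>A preimage of \<open>b\<close> times \<open>s\<close> that sees \<open>s\<close>
    only through \<open>act b s\<close>; where \<open>b\<close> kills the chain, the zero preimage
    is taken instead of an arbitrary one.\<close>
  define \<nu> where "\<nu> b s = (if b \<in> L \<and> card (act b s) = m then \<mu> (act b s) else \<zero>\<^bsub>M\<^esub>)" for b s
  have nu: "\<nu> b s \<in> carrier M" for b s using mu by (simp add: \<nu>_def)
  have g_nu: "g (\<nu> b s) = bas b \<odot>\<^bsub>C m\<^esub> dl m s" if "b \<in> carrier B" "s \<in> chains m" for b s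
    using mu lin_map_zero[OF M C_left_module g] by (simp add: \<nu>_def bas_dl[OF that])
  define \<phi> where "\<phi> s = (\<Oplus>\<^bsub>M\<^esub>Z\<in>\<Lambda>. (bas (top s) \<otimes>\<^bsub>A\<^esub> eta Z) \<odot>\<^bsub>M\<^esub> \<nu> (sec Z) s)" for s
  have tc: "(bas b \<otimes>\<^bsub>A\<^esub> eta Z) \<odot>\<^bsub>M\<^esub> \<nu> c s \<in> carrier M" if "Z \<in> \<Lambda>" for b c s Z
    using nu eta_closed[OF that] by simp
  have phi: "\<phi> s \<in> carrier M" for s
    unfolding \<phi>_def using tc by (intro M.finsum_closed) auto
  have ne: "s \<noteq> {}" if "s \<in> chains m" for s using that m by auto
  have equi: "bas b \<odot>\<^bsub>M\<^esub> \<phi> s = (if b \<in> L \<and> card (act b s) = m then \<phi> (act b s) else \<zero>\<^bsub>M\<^esub>)"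
    if b: "b \<in> carrier B" and s: "s \<in> chains m" for b s
  proof -
    have sD: "s \<in> \<Delta>" using s by simp
    have t: "top s \<in> carrier B" using top(1)[OF sD ne[OF s]] Delta_carrier[OF sD] by blast
    let ?a = "b \<otimes>\<^bsub>B\<^esub> top s"
    have a: "?a \<in> carrier B" using b t by simp
    have sa: "supp ?a \<subseteq> supp b" using lrb_support_mult[OF b t] by simp
    have "bas b \<odot>\<^bsub>M\<^esub> \<phi> s = (\<Oplus>\<^bsub>M\<^esub>Z\<in>\<Lambda>. bas b \<odot>\<^bsub>M\<^esub> ((bas (top s) \<otimes>\<^bsub>A\<^esub> eta Z) \<odot>\<^bsub>M\<^esub> \<nu> (sec Z) s))"
      unfolding \<phi>_def using tc by (intro M.smult_finsum) auto
    also have "\<dots> = (\<Oplus>\<^bsub>M\<^esub>Z\<in>\<Lambda>. (bas ?a \<otimes>\<^bsub>A\<^esub> eta Z) \<odot>\<^bsub>M\<^esub> \<nu> (sec Z) s)"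
      using tc nu eta_closed
      by (intro M.finsum_cong') (auto simp: M.smult_assoc1[symmetric] A.m_assoc[symmetric] bas_mult[OF b t])
    finally have lhs: "bas b \<odot>\<^bsub>M\<^esub> \<phi> s = (\<Oplus>\<^bsub>M\<^esub>Z\<in>\<Lambda>. (bas ?a \<otimes>\<^bsub>A\<^esub> eta Z) \<odot>\<^bsub>M\<^esub> \<nu> (sec Z) s)" .
    have kill: "(bas ?a \<otimes>\<^bsub>A\<^esub> eta Z) \<odot>\<^bsub>M\<^esub> \<nu> c r = \<zero>\<^bsub>M\<^esub>" if "Z \<in> \<Lambda>" "\<not> Z \<subseteq> supp ?a" for Z c r
      using eta_annihilated[OF that(1) a that(2)] nu by (simp add: M.smult_l_null)
    have sec_b: "sec Z \<otimes>\<^bsub>B\<^esub> b = sec Z" if "Z \<in> \<Lambda>" "Z \<subseteq> supp ?a" for Z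
      using support_le_iff[OF sec(1)[OF that(1)] b] sec(2)[OF that(1)] that(2) sa by auto
    show ?thesis
    proof (cases "b \<in> L \<and> card (act b s) = m")
      case True
      have bt: "top (act b s) = ?a" using top_act True sD ne[OF s] by blast
      have "(bas ?a \<otimes>\<^bsub>A\<^esub> eta Z) \<odot>\<^bsub>M\<^esub> \<nu> (sec Z) s = (bas ?a \<otimes>\<^bsub>A\<^esub> eta Z) \<odot>\<^bsub>M\<^esub> \<nu> (sec Z) (act b s)" if Z: "Z \<in> \<Lambda>" for Z
      proof (cases "Z \<subseteq> supp ?a")
        case True
        have "act (sec Z) s = act (sec Z) (act b s)"
          using act_mult[OF sec(1)[OF Z] b sD] sec_b[OF Z True] by simp
        then show ?thesis by (simp add: \<nu>_def)
      qed (simp add: kill[OF Z])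
      then have "bas b \<odot>\<^bsub>M\<^esub> \<phi> s = \<phi> (act b s)"
        unfolding lhs unfolding \<phi>_def bt using tc by (intro M.finsum_cong') auto
      then show ?thesis using True by simp
    next
      case False
      have "(bas ?a \<otimes>\<^bsub>A\<^esub> eta Z) \<odot>\<^bsub>M\<^esub> \<nu> (sec Z) s = \<zero>\<^bsub>M\<^esub>" if Z: "Z \<in> \<Lambda>" for Z
      proof (cases "Z \<subseteq> supp ?a")
        case True
        \<comment> \<open>Since \<open>sec Z\<close> absorbs \<open>b\<close>, its action factors
          through that of \<open>b\<close>: if \<open>b\<close> kills the chain, so does
          \<open>sec Z\<close>.\<close>
        have "\<not> (sec Z \<in> L \<and> card (act (sec Z) s) = m)"
        proof
          assume z: "sec Z \<in> L \<and> card (act (sec Z) s) = m"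
          then have bL: "b \<in> L" using L_mult_iff[OF sec(1)[OF Z] b] sec_b[OF Z True] by simp
          have "card (act (sec Z) (act b s)) = m"
            using act_mult[OF sec(1)[OF Z] b sD] sec_b[OF Z True] z by simp
          moreover have "card (act (sec Z) (act b s)) \<le> card (act b s)" "card (act b s) \<le> card s"
            using act_card act_Delta[OF bL sD] sD by auto
          ultimately have "card (act b s) = m" using s by simp
          then show False using False bL by simp
        qed
        then have "\<nu> (sec Z) s = \<zero>\<^bsub>M\<^esub>" unfolding \<nu>_def by (simp only: if_False)
        then show ?thesis using eta_closed[OF Z] by (simp add: M.smult_r_null)
      qed (simp add: kill[OF Z])
      then have "bas b \<odot>\<^bsub>M\<^esub> \<phi> s = \<zero>\<^bsub>M\<^esub>" unfolding lhs by (intro M.finsum_zero_eqI)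
      then show ?thesis using False by (simp only: if_False)
    qed
  qed
  let ?h = "chain_ext m M \<phi>"
  have h: "lin_map A (C m) M ?h" using chain_ext_lin[OF M phi equi] .
  have "g (?h x) = x" if x: "x \<in> carrier (C m)" for x
  proof (rule C_hom_eqI[OF C_left_module lin_map_comp[OF h g] lin_map_id _ x])
    fix s assume "s \<in> \<Delta>" "card s = m"
    then have s: "s \<in> chains m" and sD: "s \<in> \<Delta>" by auto
    have t: "top s \<in> L" using top(1)[OF sD ne[OF s]] Delta_sub[OF sD] by blast
    \<comment> \<open>\<open>g\<close> turns \<open>\<nu> (sec Z) s\<close> into
      \<open>sec Z\<close> times the chain, and \<open>eta Z\<close> absorbs \<open>sec Z\<close>.
      The \<open>eta Z\<close> sum to one, and what is left is the largest element acting on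
      \<open>s\<close>, which fixes it.\<close>
    have "g (?h (dl m s)) = g (\<phi> s)" using chain_ext_dl[OF M phi s] by simp
    also have "\<dots> = (\<Oplus>\<^bsub>C m\<^esub>Z\<in>\<Lambda>. g ((bas (top s) \<otimes>\<^bsub>A\<^esub> eta Z) \<odot>\<^bsub>M\<^esub> \<nu> (sec Z) s))"
      unfolding \<phi>_def using tc by (intro lin_map_finsum[OF M C_left_module g]) auto
    also have "\<dots> = (\<Oplus>\<^bsub>C m\<^esub>Z\<in>\<Lambda>. (bas (top s) \<otimes>\<^bsub>A\<^esub> eta Z) \<odot>\<^bsub>C m\<^esub> dl m s)"
    proof (intro C.finsum_cong' refl)
      fix Z assume Z: "Z \<in> \<Lambda>"
      have "g ((bas (top s) \<otimes>\<^bsub>A\<^esub> eta Z) \<odot>\<^bsub>M\<^esub> \<nu> (sec Z) s)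
          = (bas (top s) \<otimes>\<^bsub>A\<^esub> eta Z) \<odot>\<^bsub>C m\<^esub> (bas (sec Z) \<odot>\<^bsub>C m\<^esub> dl m s)"
        using eta_closed[OF Z] nu by (simp add: lin_map_smult[OF g] g_nu[OF sec(1)[OF Z] s])
      also have "\<dots> = (bas (top s) \<otimes>\<^bsub>A\<^esub> (eta Z \<otimes>\<^bsub>A\<^esub> bas (sec Z))) \<odot>\<^bsub>C m\<^esub> dl m s"
        using eta_closed[OF Z] dl_closed by (simp add: C.smult_assoc1[symmetric] A.m_assoc)
      also have "\<dots> = (bas (top s) \<otimes>\<^bsub>A\<^esub> eta Z) \<odot>\<^bsub>C m\<^esub> dl m s"
        using eta_mult_right[OF Z sec(1)[OF Z]] sec(2)[OF Z] by simp
      finally show "g ((bas (top s) \<otimes>\<^bsub>A\<^esub> eta Z) \<odot>\<^bsub>M\<^esub> \<nu> (sec Z) s) = (bas (top s) \<otimes>\<^bsub>A\<^esub> eta Z) \<odot>\<^bsub>C m\<^esub> dl m s" .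
    qed (use eta_closed dl_closed in \<open>auto intro!: C.smult_closed\<close>)
    also have "\<dots> = (\<Oplus>\<^bsub>A\<^esub>Z\<in>\<Lambda>. bas (top s) \<otimes>\<^bsub>A\<^esub> eta Z) \<odot>\<^bsub>C m\<^esub> dl m s"
      using eta_closed dl_closed by (intro C.finsum_smult[symmetric]) auto
    also have "(\<Oplus>\<^bsub>A\<^esub>Z\<in>\<Lambda>. bas (top s) \<otimes>\<^bsub>A\<^esub> eta Z) = bas (top s) \<otimes>\<^bsub>A\<^esub> (\<Oplus>\<^bsub>A\<^esub>Z\<in>\<Lambda>. eta Z)"
      using eta_closed finite_lattice by (intro A.finsum_rdistr[symmetric]) auto
    also have "\<dots> \<odot>\<^bsub>C m\<^esub> dl m s = bas (top s) \<odot>\<^bsub>C m\<^esub> dl m s" by (simp add: eta_sum)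
    also have "\<dots> = dl m s" using bas_dl[OF L_carrier[OF t] s] act_top[OF sD ne[OF s]] t s by simp
    finally show "g (?h (dl m s)) = dl m s" .
  qed
  then show ?thesis using h by blast
qed

lemma C_projective: "projective_module A (C (Suc m))"
  by (rule A.projective_moduleI[OF C_left_module], rule C_section) simp_all

section \<open>The boundary operator\<close>

definition sgn :: "nat \<Rightarrow> 'k" where "sgn n = (\<ominus>\<^bsub>K\<^esub> \<one>\<^bsub>K\<^esub>) [^]\<^bsub>K\<^esub> n"

lemma sgn_closed [simp, intro]: "sgn n \<in> carrier K"
  by (simp add: sgn_def)

lemma sgn_zero: "sgn 0 = \<one>\<^bsub>K\<^esub>"
  by (simp add: sgn_def)

lemma sgn_Suc: "sgn (Suc n) = \<ominus>\<^bsub>K\<^esub> sgn n"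
  by (simp add: sgn_def K.r_minus)

lemma sgn_square: "sgn n \<otimes>\<^bsub>K\<^esub> sgn n = \<one>\<^bsub>K\<^esub>"
  by (induction n) (simp_all add: sgn_zero sgn_Suc K.l_minus K.r_minus)

definition pos :: "'b \<Rightarrow> 'b set \<Rightarrow> nat" where
  "pos v s = card {u \<in> s. u \<noteq> v \<and> le u v}"

text \<open>\<open>bd m\<close> leads from chains with \<open>m + 1\<close> elements to chains with
  \<open>m\<close>. In particular \<open>bd 0\<close> is the augmentation, sending every one-element
  chain to the empty one.\<close>

definition bd :: "nat \<Rightarrow> ('b set \<Rightarrow> 'k) \<Rightarrow> 'b set \<Rightarrow> 'k" where
  "bd m = chain_ext (Suc m) (C m) (\<lambda>s. \<Oplus>\<^bsub>C m\<^esub>v\<in>s. scal (sgn (pos v s)) \<odot>\<^bsub>C m\<^esub> dl m (s - {v}))"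

lemma bd_face_closed: "(\<Oplus>\<^bsub>C m\<^esub>v\<in>s. scal (sgn (pos v s)) \<odot>\<^bsub>C m\<^esub> dl m (s - {v})) \<in> carrier (C m)"
proof -
  interpret C: left_module A "C m" by (rule C_left_module)
  show ?thesis by (intro C.finsum_closed) (auto intro!: C.smult_closed dl_closed)
qed

text \<open>Left multiplication is monotone, and being injective on a chain it also reflects the
  order there, so positions are kept.\<close>

lemma pos_act:
  assumes b: "b \<in> L" and s: "s \<in> \<Delta>" and inj: "inj_on (\<lambda>a. b \<otimes>\<^bsub>B\<^esub> a) s" and v: "v \<in> s"
  shows "pos (b \<otimes>\<^bsub>B\<^esub> v) (act b s) = pos v s"
proof -
  note car = Delta_carrier[OF s] and bc = L_carrier[OF b]
  have "le (b \<otimes>\<^bsub>B\<^esub> u) (b \<otimes>\<^bsub>B\<^esub> v) \<longleftrightarrow> le u v" if u: "u \<in> s" for u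
  proof
    assume l: "le (b \<otimes>\<^bsub>B\<^esub> u) (b \<otimes>\<^bsub>B\<^esub> v)"
    show "le u v"
    proof (rule ccontr)
      assume n: "\<not> le u v"
      then have "le v u" using s u v by (auto simp: Delta_iff)
      then have "le (b \<otimes>\<^bsub>B\<^esub> v) (b \<otimes>\<^bsub>B\<^esub> u)" using lrb_le_mult_left car bc u v by blast
      then have "b \<otimes>\<^bsub>B\<^esub> u = b \<otimes>\<^bsub>B\<^esub> v" using lrb_le_antisym l car bc u v by blast
      then have "u = v" using inj u v by (auto dest: inj_onD)
      then show False using n lrb_le_refl car v by blast
    qed
  qed (use lrb_le_mult_left car bc u v in blast)
  then have "{w \<in> act b s. w \<noteq> b \<otimes>\<^bsub>B\<^esub> v \<and> le w (b \<otimes>\<^bsub>B\<^esub> v)} = (\<lambda>a. b \<otimes>\<^bsub>B\<^esub> a) ` {u \<in> s. u \<noteq> v \<and> le u v}"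
    using inj v by (auto simp: act_def dest: inj_onD)
  moreover have "inj_on (\<lambda>a. b \<otimes>\<^bsub>B\<^esub> a) {u \<in> s. u \<noteq> v \<and> le u v}" by (rule inj_on_subset[OF inj]) auto
  ultimately show ?thesis by (simp add: pos_def card_image)
qed

text \<open>
  When \<open>b\<close> collapses a chain by one element, the two faces omitting one of the identified elements have
  the same image and, by this lemma, opposite signs; all other faces are killed.
\<close>

lemma bd_collapse:
  assumes b: "b \<in> L" and s: "s \<in> \<Delta>" "card s = Suc m"
    and pq: "p \<in> s" "q \<in> s" "p \<noteq> q" "b \<otimes>\<^bsub>B\<^esub> p = b \<otimes>\<^bsub>B\<^esub> q" "le p q" and c: "card (act b s) = m"
  shows "pos q s = Suc (pos p s)"
proof -
  note car = Delta_carrier[OF s(1)] and bc = L_carrier[OF b]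
  \<comment> \<open>The point is that \<open>p\<close> and \<open>q\<close> are neighbours in
    \<open>s\<close>: an element between them would have the same image, and the chain would shrink
    by at least two.\<close>
  have "{u \<in> s. u \<noteq> q \<and> le u q} = insert p {u \<in> s. u \<noteq> p \<and> le u p}"
  proof (intro equalityI subsetI)
    fix u assume "u \<in> {u \<in> s. u \<noteq> q \<and> le u q}"
    then have u: "u \<in> s" "u \<noteq> q" "le u q" by auto
    show "u \<in> insert p {u \<in> s. u \<noteq> p \<and> le u p}"
    proof (rule ccontr)
      assume "\<not> ?thesis"
      then have up: "u \<noteq> p" "\<not> le u p" using u by auto
      then have "le p u" using s(1) u(1) pq(1) by (auto simp: Delta_iff)
      then have "le (b \<otimes>\<^bsub>B\<^esub> p) (b \<otimes>\<^bsub>B\<^esub> u)" "le (b \<otimes>\<^bsub>B\<^esub> u) (b \<otimes>\<^bsub>B\<^esub> q)"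
        using lrb_le_mult_left car bc u pq by blast+
      then have bu: "b \<otimes>\<^bsub>B\<^esub> u = b \<otimes>\<^bsub>B\<^esub> q"
        using lrb_le_antisym[of "b \<otimes>\<^bsub>B\<^esub> u" "b \<otimes>\<^bsub>B\<^esub> q"] pq(4) car bc u(1) pq(2) by simp
      have "act b s = act b (s - {p, u})"
      proof
        show "act b s \<subseteq> act b (s - {p, u})"
        proof
          fix w assume "w \<in> act b s"
          then obtain a where a: "a \<in> s" "w = b \<otimes>\<^bsub>B\<^esub> a" by (auto simp: act_def)
          show "w \<in> act b (s - {p, u})"
          proof (cases "a = p \<or> a = u")
            case True
            then have "w = b \<otimes>\<^bsub>B\<^esub> q" using a bu pq(4) by auto
            then show ?thesis unfolding act_def using pq(2,3) u(2) by blast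
          qed (use a in \<open>auto simp: act_def\<close>)
        qed
      qed (auto simp: act_def)
      then have "card (act b s) \<le> card (s - {p, u})"
        using act_card[OF Delta_subset[OF s(1)]] by (metis Diff_subset)
      also have "card (s - {p, u}) = card s - 2"
        using Delta_finite[OF s(1)] pq(1) u(1) up(1) by (simp add: card_Diff_subset)
      finally show False using c s(2) card_mono[OF Delta_finite[OF s(1)], of "{p, u}"] pq(1) u(1) up(1) by simp
    qed
  next
    fix u assume "u \<in> insert p {u \<in> s. u \<noteq> p \<and> le u p}"
    then have u: "u \<in> s" "le u p" using pq(1) lrb_le_refl car by auto
    then have "le u q" using lrb_le_trans pq car by blast
    moreover have "u \<noteq> q" using u pq lrb_le_antisym car by blast
    ultimately show "u \<in> {u \<in> s. u \<noteq> q \<and> le u q}" using u by simp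
  qed
  then show ?thesis using Delta_finite[OF s(1)] by (simp add: pos_def)
qed

end

text \<open>The diagonal is treated on its own because antisymmetry there would only give
  \<open>2 F v v = 0\<close>, which is too weak when two is a zero divisor. The lemma serves to show
  that the boundary squares to zero.\<close>

lemma (in abelian_group) finsum_antisymmetric:
  assumes "finite S" and cl: "\<And>v w. v \<in> S \<Longrightarrow> w \<in> S \<Longrightarrow> F v w \<in> carrier G"
    and diag: "\<And>v. v \<in> S \<Longrightarrow> F v v = \<zero>" and anti: "\<And>v w. v \<in> S \<Longrightarrow> w \<in> S \<Longrightarrow> v \<noteq> w \<Longrightarrow> F v w = \<ominus> F w v"
  shows "(\<Oplus>v\<in>S. \<Oplus>w\<in>S. F v w) = \<zero>"
  using assms
proof (induction S rule: finite_induct)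
  case empty
  show ?case by simp
next
  case (insert a S)
  have c: "F v w \<in> carrier G" if "v \<in> insert a S" "w \<in> insert a S" for v w using insert.prems(1) that .
  have IH: "(\<Oplus>v\<in>S. \<Oplus>w\<in>S. F v w) = \<zero>"     by (rule insert.IH[OF insert.prems]) blast+
  have S2: "(\<Oplus>w\<in>S. F v w) \<in> carrier G" if "v \<in> insert a S" for v
    using c that by (intro finsum_closed) auto
  have "(\<Oplus>v\<in>insert a S. \<Oplus>w\<in>insert a S. F v w) = (\<Oplus>v\<in>insert a S. F v a \<oplus> (\<Oplus>w\<in>S. F v w))"
    using insert.hyps c S2 by (intro finsum_cong') (auto simp: finsum_insert Pi_def)
  also have "\<dots> = (F a a \<oplus> (\<Oplus>w\<in>S. F a w)) \<oplus> (\<Oplus>v\<in>S. F v a \<oplus> (\<Oplus>w\<in>S. F v w))"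
    using insert.hyps c S2 by (intro finsum_insert) auto
  also have "(\<Oplus>v\<in>S. F v a \<oplus> (\<Oplus>w\<in>S. F v w)) = (\<Oplus>v\<in>S. F v a) \<oplus> (\<Oplus>v\<in>S. \<Oplus>w\<in>S. F v w)"
    using c S2 by (intro finsum_addf) auto
  also have "(F a a \<oplus> (\<Oplus>w\<in>S. F a w)) \<oplus> ((\<Oplus>v\<in>S. F v a) \<oplus> (\<Oplus>v\<in>S. \<Oplus>w\<in>S. F v w))
      = (\<Oplus>w\<in>S. F a w) \<oplus> (\<Oplus>v\<in>S. F v a)"
    using insert.prems(2)[of a] IH S2[of a] c by (simp add: finsum_closed Pi_def)
  also have "\<dots> = (\<Oplus>w\<in>S. F a w \<oplus> F w a)" using c by (intro finsum_addf[symmetric]) auto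
  also have "\<dots> = \<zero>"
  proof (intro finsum_zero_eqI)
    fix w assume "w \<in> S"
    then have "F a w = \<ominus> F w a" and "F w a \<in> carrier G"
      using insert.prems(3)[of a w] insert.hyps(2) c[of w a] by blast+
    then show "F a w \<oplus> F w a = \<zero>" by (simp add: l_neg)
  qed
  finally show ?case .
qed

lemma (in finite_monoid_algebra) scal_minus:
  assumes c: "c \<in> carrier K"
  shows "scal (\<ominus>\<^bsub>K\<^esub> c) = \<ominus>\<^bsub>A\<^esub> scal c"
proof -
  have "scal (\<ominus>\<^bsub>K\<^esub> c) \<oplus>\<^bsub>A\<^esub> scal c = scal \<zero>\<^bsub>K\<^esub>"
    using ring_hom_add[OF central.hom, of "\<ominus>\<^bsub>K\<^esub> c" c] c by (simp add: K.l_neg)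
  also have "\<dots> = \<zero>\<^bsub>A\<^esub>" by (simp add: monoid_algebra_scalar_def A_simps cong: if_cong)
  finally show ?thesis using c by (intro A.minus_equality[symmetric]) auto
qed

context chain_resolution
begin

lemma face_chain: "s \<in> chains (Suc m) \<Longrightarrow> v \<in> s \<Longrightarrow> s - {v} \<in> chains m"
  using Delta_subset[of s "s - {v}"] Delta_finite[of s] by auto

text \<open>By \<open>chain_ext_lin\<close> it remains to compare \<open>b\<close> applied to the
  faces of \<open>s\<close> with the faces of \<open>act b s\<close>. Either \<open>b\<close> is
  outside \<open>L\<close>, or it is injective on \<open>s\<close> and respects positions, or it
  shrinks \<open>s\<close>, and then the face terms must cancel.\<close>

lemma bd_lin: "lin_map A (C (Suc m)) (C m) (bd m)"
  unfolding bd_def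
proof (rule chain_ext_lin[OF C_left_module])
  interpret C: left_module A "C m" by (rule C_left_module)
  let ?\<phi> = "\<lambda>s. \<Oplus>\<^bsub>C m\<^esub>v\<in>s. scal (sgn (pos v s)) \<odot>\<^bsub>C m\<^esub> dl m (s - {v})"
  show "?\<phi> s \<in> carrier (C m)" for s by (rule bd_face_closed)
  fix b s assume b: "b \<in> carrier B" and s: "s \<in> chains (Suc m)"
  then have sD: "s \<in> \<Delta>" and sc: "card s = Suc m" and fs: "finite s" using Delta_finite by auto
  let ?d = "\<lambda>v. if b \<in> L \<and> card (act b (s - {v})) = m then dl m (act b (s - {v})) else \<zero>\<^bsub>C m\<^esub>"
  let ?F = "\<lambda>v. scal (sgn (pos v s)) \<odot>\<^bsub>C m\<^esub> ?d v"
  have dc: "?d v \<in> carrier (C m)" for v using dl_closed by auto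
  have Fc: "?F v \<in> carrier (C m)" for v using dc[of v] by (intro C.smult_closed) auto
  have "bas b \<odot>\<^bsub>C m\<^esub> ?\<phi> s = (\<Oplus>\<^bsub>C m\<^esub>v\<in>s. bas b \<odot>\<^bsub>C m\<^esub> (scal (sgn (pos v s)) \<odot>\<^bsub>C m\<^esub> dl m (s - {v})))"
    by (rule C.smult_finsum) (auto intro!: C.smult_closed dl_closed)
  also have "\<dots> = (\<Oplus>\<^bsub>C m\<^esub>v\<in>s. ?F v)"
  proof (intro C.finsum_cong' refl)
    fix v assume v: "v \<in> s"
    have "bas b \<odot>\<^bsub>C m\<^esub> (scal (sgn (pos v s)) \<odot>\<^bsub>C m\<^esub> dl m (s - {v}))
        = scal (sgn (pos v s)) \<odot>\<^bsub>C m\<^esub> (bas b \<odot>\<^bsub>C m\<^esub> dl m (s - {v}))"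
      using central.central[OF sgn_closed bas_closed] dl_closed by (simp add: C.smult_assoc1[symmetric])
    then show "bas b \<odot>\<^bsub>C m\<^esub> (scal (sgn (pos v s)) \<odot>\<^bsub>C m\<^esub> dl m (s - {v})) = ?F v"
      by (simp only: bas_dl[OF b face_chain[OF s v]])
  qed (use Fc in auto)
  finally have lhs: "bas b \<odot>\<^bsub>C m\<^esub> ?\<phi> s = (\<Oplus>\<^bsub>C m\<^esub>v\<in>s. ?F v)" .
  consider "b \<notin> L" | "b \<in> L" "card (act b s) = Suc m" | "b \<in> L" "card (act b s) \<noteq> Suc m" by blast
  then show "bas b \<odot>\<^bsub>C m\<^esub> ?\<phi> s = (if b \<in> L \<and> card (act b s) = Suc m then ?\<phi> (act b s) else \<zero>\<^bsub>C m\<^esub>)"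
  proof cases
    case 1
    then show ?thesis unfolding lhs by (simp add: C.smult_r_null)
  next
    case 2
    have inj: "inj_on (\<lambda>a. b \<otimes>\<^bsub>B\<^esub> a) s"
      using 2(2) sc fs by (intro eq_card_imp_inj_on) (auto simp: act_def)
    have "?\<phi> (act b s) = (\<Oplus>\<^bsub>C m\<^esub>v\<in>s. scal (sgn (pos (b \<otimes>\<^bsub>B\<^esub> v) (act b s))) \<odot>\<^bsub>C m\<^esub> dl m (act b s - {b \<otimes>\<^bsub>B\<^esub> v}))"
      unfolding act_def[of b s] using inj
      by (intro C.finsum_reindex) (auto intro!: C.smult_closed dl_closed)
    also have "\<dots> = (\<Oplus>\<^bsub>C m\<^esub>v\<in>s. ?F v)"
    proof (intro C.finsum_cong' refl)
      fix v assume v: "v \<in> s"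
      have e: "act b s - {b \<otimes>\<^bsub>B\<^esub> v} = act b (s - {v})"
        using inj v by (auto simp: act_def dest: inj_onD)
      have "card (act b (s - {v})) = card (s - {v})"
        unfolding act_def by (rule card_image[OF inj_on_subset[OF inj]]) auto
      then have "card (act b (s - {v})) = m" using face_chain[OF s v] by simp
      then show "scal (sgn (pos (b \<otimes>\<^bsub>B\<^esub> v) (act b s))) \<odot>\<^bsub>C m\<^esub> dl m (act b s - {b \<otimes>\<^bsub>B\<^esub> v}) = ?F v"
        using 2(1) pos_act[OF 2(1) sD inj v] e by simp
    qed (use Fc in auto)
    finally show ?thesis using 2 lhs by simp
  next
    case 3
    have "\<not> inj_on (\<lambda>a. b \<otimes>\<^bsub>B\<^esub> a) s"
      using 3(2) sc card_image[of "\<lambda>a. b \<otimes>\<^bsub>B\<^esub> a" s] unfolding act_def by argo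
    then obtain p0 q0 where pq0: "p0 \<in> s" "q0 \<in> s" "p0 \<noteq> q0" "b \<otimes>\<^bsub>B\<^esub> p0 = b \<otimes>\<^bsub>B\<^esub> q0"
      by (auto simp: inj_on_def)
    have "le p0 q0 \<or> le q0 p0" using sD pq0 by (auto simp: Delta_iff)
    then obtain p q where pq: "p \<in> s" "q \<in> s" "p \<noteq> q" "b \<otimes>\<^bsub>B\<^esub> p = b \<otimes>\<^bsub>B\<^esub> q" "le p q"
      using pq0 by metis
    have drop: "act b (r - {x}) = act b r" if "x \<in> r" "y \<in> r" "x \<noteq> y" "b \<otimes>\<^bsub>B\<^esub> x = b \<otimes>\<^bsub>B\<^esub> y" for r x y
    proof
      show "act b r \<subseteq> act b (r - {x})"
      proof
        fix w assume "w \<in> act b r"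
        then obtain a where a: "a \<in> r" "w = b \<otimes>\<^bsub>B\<^esub> a" by (auto simp: act_def)
        show "w \<in> act b (r - {x})"
        proof (cases "a = x")
          case True
          then have "w = b \<otimes>\<^bsub>B\<^esub> y" using a that(4) by simp
          then show ?thesis unfolding act_def using that(2,3) by blast
        qed (use a in \<open>auto simp: act_def\<close>)
      qed
    qed (auto simp: act_def)
    \<comment> \<open>A face that still contains both \<open>p\<close> and \<open>q\<close> loses an
      element under \<open>b\<close> and is killed.\<close>
    have F0: "?F v = \<zero>\<^bsub>C m\<^esub>" if "v \<in> s - {p, q}" for v
    proof -
      have "p \<in> s - {v}" "q \<in> s - {v}" using pq that by auto
      then have *: "act b (s - {v} - {p}) = act b (s - {v})"
        by (rule drop[OF _ _ pq(3,4)])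
      have "s - {v} - {p} \<in> \<Delta>" by (rule Delta_subset[OF sD]) auto
      then have le: "card (act b (s - {v})) \<le> card (s - {v} - {p})"
        unfolding *[symmetric] by (rule act_card)
      have "card (s - {v}) = m" using face_chain[OF s, of v] that by simp
      moreover have "p \<in> s - {v}" using that pq(1) by auto
      ultimately have "card (s - {v} - {p}) < m"
        using card_Diff1_less[of "s - {v}" p] fs by simp
      then have "card (act b (s - {v})) \<noteq> m" using le by linarith
      then show ?thesis by (simp add: C.smult_r_null)
    qed
    have e: "act b (s - {p}) = act b s" "act b (s - {q}) = act b s"
      using drop[OF pq(1-4)] drop[OF pq(2,1) pq(3)[symmetric] pq(4)[symmetric]] by simp_all
    have "(\<Oplus>\<^bsub>C m\<^esub>v\<in>s. ?F v) = (\<Oplus>\<^bsub>C m\<^esub>v\<in>{p, q}. ?F v)"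
      using F0 Fc fs pq by (intro C.add.finprod_mono_neutral_cong_right) auto
    also have "\<dots> = ?F p \<oplus>\<^bsub>C m\<^esub> ?F q" using pq(3) Fc by simp
    also have "\<dots> = \<zero>\<^bsub>C m\<^esub>"
    \<comment> \<open>If the common image has even fewer than \<open>m\<close> elements, both
      remaining terms vanish by themselves; otherwise they differ in sign.\<close>
    proof (cases "card (act b s) = m")
      case True
      have "pos q s = Suc (pos p s)" by (rule bd_collapse[OF 3(1) sD sc pq True])
      then have "?F q = \<ominus>\<^bsub>C m\<^esub> ?F p"
        using dl_closed by (simp add: e True 3(1) sgn_Suc scal_minus C.smult_l_minus)
      then show ?thesis using Fc[of p] by (simp only: C.r_neg)
    qed (simp add: e C.smult_r_null)
    finally show ?thesis using 3(2) lhs by simp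
  qed
qed

lemma C_finsum_apply:
  assumes "finite T" "g \<in> T \<rightarrow> carrier (C m)" "s \<in> chains m"
  shows "(\<Oplus>\<^bsub>C m\<^esub>t\<in>T. g t) s = (\<Oplus>\<^bsub>K\<^esub>t\<in>T. g t s)"
  unfolding C_finsum using assms by (intro K.cochains_finsum_apply) (auto simp: C_simps)

lemma C_scal_apply:
  assumes "c \<in> carrier K" "q \<in> carrier (C m)" "s \<in> chains m"
  shows "(scal c \<odot>\<^bsub>C m\<^esub> q) s = c \<otimes>\<^bsub>K\<^esub> q s"
  using assms C_scal[of c q m] by (simp add: C_simps cochains_simps)

lemma pos_insert_self: "pos v (insert v t) = pos v t"
proof -
  have "{u \<in> insert v t. u \<noteq> v \<and> le u v} = {u \<in> t. u \<noteq> v \<and> le u v}" by blast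
  then show ?thesis by (simp only: pos_def)
qed

text \<open>The coefficient of the boundary at \<open>t\<close>, as a sum over the vertices that can
  be added to \<open>t\<close> rather than over the faces of a chain. The index set \<open>L\<close>
  is the same for all \<open>t\<close>, as double sums require.\<close>

lemma bd_apply:
  assumes q: "q \<in> carrier (C (Suc m))" and t: "t \<in> chains m"
  shows "bd m q t = (\<Oplus>\<^bsub>K\<^esub>v\<in>L. if v \<notin> t \<and> insert v t \<in> \<Delta> then sgn (pos v t) \<otimes>\<^bsub>K\<^esub> q (insert v t) else \<zero>\<^bsub>K\<^esub>)"
proof -
  interpret C: left_module A "C m" by (rule C_left_module)
  have qK: "q s \<in> carrier K" if "s \<in> chains (Suc m)" for s using C_apply[OF q] that by auto
  let ?\<phi> = "\<lambda>s. \<Oplus>\<^bsub>C m\<^esub>v\<in>s. scal (sgn (pos v s)) \<odot>\<^bsub>C m\<^esub> dl m (s - {v})"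
  have tD: "t \<in> \<Delta>" and tc: "card t = m" and ft: "finite t" using t Delta_finite by auto
  have "bd m q t = (\<Oplus>\<^bsub>K\<^esub>s\<in>chains (Suc m). (scal (q s) \<odot>\<^bsub>C m\<^esub> ?\<phi> s) t)"
    unfolding bd_def chain_ext_def
    by (rule C_finsum_apply[OF finite_chains _ t]) (use qK bd_face_closed in \<open>auto intro!: C.smult_closed\<close>)
  also have "\<dots> = (\<Oplus>\<^bsub>K\<^esub>s\<in>chains (Suc m). \<Oplus>\<^bsub>K\<^esub>v\<in>L. if s = insert v t then (if v \<notin> t then sgn (pos v t) \<otimes>\<^bsub>K\<^esub> q s else \<zero>\<^bsub>K\<^esub>) else \<zero>\<^bsub>K\<^esub>)"
  proof (intro K.finsum_cong' refl)
    fix s assume s: "s \<in> chains (Suc m)"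
    then have sD: "s \<in> \<Delta>" and fs: "finite s" using Delta_finite by auto
    have "(scal (q s) \<odot>\<^bsub>C m\<^esub> ?\<phi> s) t = q s \<otimes>\<^bsub>K\<^esub> ?\<phi> s t"
      by (rule C_scal_apply[OF qK[OF s] bd_face_closed t])
    also have "?\<phi> s t = (\<Oplus>\<^bsub>K\<^esub>v\<in>s. (scal (sgn (pos v s)) \<odot>\<^bsub>C m\<^esub> dl m (s - {v})) t)"
      by (rule C_finsum_apply[OF fs _ t]) (auto intro!: C.smult_closed dl_closed)
    also have "\<dots> = (\<Oplus>\<^bsub>K\<^esub>v\<in>s. if t = s - {v} then sgn (pos v s) else \<zero>\<^bsub>K\<^esub>)"
      using tD tc t by (intro K.finsum_cong') (auto simp: C_scal_apply[OF sgn_closed dl_closed t] dl_apply)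
    also have "q s \<otimes>\<^bsub>K\<^esub> \<dots> = (\<Oplus>\<^bsub>K\<^esub>v\<in>s. q s \<otimes>\<^bsub>K\<^esub> (if t = s - {v} then sgn (pos v s) else \<zero>\<^bsub>K\<^esub>))"
      using qK[OF s] fs by (intro K.finsum_rdistr) auto
    also have "\<dots> = (\<Oplus>\<^bsub>K\<^esub>v\<in>L. if s = insert v t then (if v \<notin> t then sgn (pos v t) \<otimes>\<^bsub>K\<^esub> q s else \<zero>\<^bsub>K\<^esub>) else \<zero>\<^bsub>K\<^esub>)"
    proof (rule K.add.finprod_mono_neutral_cong_left[OF finite_L])
      show "s \<subseteq> L" using sD by (simp add: Delta_iff)
      show "(if s = insert i t then if i \<notin> t then sgn (pos i t) \<otimes>\<^bsub>K\<^esub> q s else \<zero>\<^bsub>K\<^esub> else \<zero>\<^bsub>K\<^esub>) = \<zero>\<^bsub>K\<^esub>"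
        if "i \<in> L - s" for i
        using that by auto
      fix v assume v: "v \<in> s"
      have "t = s - {v} \<longleftrightarrow> s = insert v t \<and> v \<notin> t" using v by auto
      moreover have "pos v s = pos v t" if "s = insert v t" using that pos_insert_self by simp
      ultimately show "q s \<otimes>\<^bsub>K\<^esub> (if t = s - {v} then sgn (pos v s) else \<zero>\<^bsub>K\<^esub>)
          = (if s = insert v t then if v \<notin> t then sgn (pos v t) \<otimes>\<^bsub>K\<^esub> q s else \<zero>\<^bsub>K\<^esub> else \<zero>\<^bsub>K\<^esub>)"
        using K.m_comm[OF qK[OF s] sgn_closed] K.r_null[OF qK[OF s]] by (simp only: if_True if_False split: if_split) metis
    qed (use qK[OF s] in auto)
    finally show "(scal (q s) \<odot>\<^bsub>C m\<^esub> ?\<phi> s) t = \<dots>" .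
  qed (use qK in \<open>auto intro!: K.finsum_closed\<close>)
  also have "\<dots> = (\<Oplus>\<^bsub>K\<^esub>v\<in>L. \<Oplus>\<^bsub>K\<^esub>s\<in>chains (Suc m). if s = insert v t then (if v \<notin> t then sgn (pos v t) \<otimes>\<^bsub>K\<^esub> q s else \<zero>\<^bsub>K\<^esub>) else \<zero>\<^bsub>K\<^esub>)"
    by (rule K.finsum_swap[OF finite_chains finite_L]) (use qK in auto)
  also have "\<dots> = (\<Oplus>\<^bsub>K\<^esub>v\<in>L. if v \<notin> t \<and> insert v t \<in> \<Delta> then sgn (pos v t) \<otimes>\<^bsub>K\<^esub> q (insert v t) else \<zero>\<^bsub>K\<^esub>)"
  proof (intro K.finsum_cong' refl)
    fix v assume v: "v \<in> L"
    show "(\<Oplus>\<^bsub>K\<^esub>s\<in>chains (Suc m). if s = insert v t then (if v \<notin> t then sgn (pos v t) \<otimes>\<^bsub>K\<^esub> q s else \<zero>\<^bsub>K\<^esub>) else \<zero>\<^bsub>K\<^esub>)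
      = (if v \<notin> t \<and> insert v t \<in> \<Delta> then sgn (pos v t) \<otimes>\<^bsub>K\<^esub> q (insert v t) else \<zero>\<^bsub>K\<^esub>)"
    proof (cases "v \<notin> t \<and> insert v t \<in> \<Delta>")
      case True
      then have i: "insert v t \<in> chains (Suc m)" using tc ft by simp
      then have "(\<Oplus>\<^bsub>K\<^esub>s\<in>chains (Suc m). if s = insert v t then (if v \<notin> t then sgn (pos v t) \<otimes>\<^bsub>K\<^esub> q s else \<zero>\<^bsub>K\<^esub>) else \<zero>\<^bsub>K\<^esub>)
        = (if v \<notin> t then sgn (pos v t) \<otimes>\<^bsub>K\<^esub> q (insert v t) else \<zero>\<^bsub>K\<^esub>)"
        using qK by (intro K.finsum_delta finite_chains) auto
      then show ?thesis using True by simp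
    next
      case False
      have "(\<Oplus>\<^bsub>K\<^esub>s\<in>chains (Suc m). if s = insert v t then (if v \<notin> t then sgn (pos v t) \<otimes>\<^bsub>K\<^esub> q s else \<zero>\<^bsub>K\<^esub>) else \<zero>\<^bsub>K\<^esub>) = \<zero>\<^bsub>K\<^esub>"
        using False by (intro K.finsum_zero_eqI) auto
      then show ?thesis using False by (simp only: if_False)
    qed
  qed (use qK tc ft in auto)
  finally show ?thesis .
qed

lemma pos_insert:
  assumes "finite t" "v \<notin> t" "v \<noteq> w"
  shows "pos w (insert v t) = (if le v w then Suc (pos w t) else pos w t)"
proof -
  have "{u \<in> insert v t. u \<noteq> w \<and> le u w} = (if le v w then insert v {u \<in> t. u \<noteq> w \<and> le u w} else {u \<in> t. u \<noteq> w \<and> le u w})"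
    using assms by auto
  then show ?thesis using assms by (simp add: pos_def)
qed

lemma bd_bd:
  assumes q: "q \<in> carrier (C (Suc (Suc m)))"
  shows "bd m (bd (Suc m) q) = \<zero>\<^bsub>C m\<^esub>"
proof (rule K.cochains_eqI[where \<Delta> = \<Delta> and m = m])
  interpret C: left_module A "C m" by (rule C_left_module)
  note q1 = lin_map_closed[OF bd_lin q]
  show "bd m (bd (Suc m) q) \<in> carrier (V m)" "\<zero>\<^bsub>C m\<^esub> \<in> carrier (V m)"
    using lin_map_closed[OF bd_lin q1] C.zero_closed by (simp_all add: C_simps)
  fix t assume "t \<in> \<Delta>" "card t = m"
  then have t: "t \<in> chains m" and tD: "t \<in> \<Delta>" and ft: "finite t" using Delta_finite by auto
  have qK: "q s \<in> carrier K" if "s \<in> chains (Suc (Suc m))" for s using C_apply[OF q] that by auto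
  define c where "c v w \<longleftrightarrow> v \<notin> t \<and> w \<notin> t \<and> v \<noteq> w \<and> insert w (insert v t) \<in> \<Delta>" for v w
  \<comment> \<open>\<open>F v w\<close> is the contribution of adding first \<open>v\<close> and
    then \<open>w\<close> to \<open>t\<close>. The two lie in a common chain, so exactly one of the
    two orders of insertion shifts a position; this is the antisymmetry.\<close>
  define F where "F v w = (if c v w then sgn (pos v t) \<otimes>\<^bsub>K\<^esub> (sgn (pos w (insert v t)) \<otimes>\<^bsub>K\<^esub> q (insert w (insert v t))) else \<zero>\<^bsub>K\<^esub>)" for v w
  have cc: "insert w (insert v t) \<in> chains (Suc (Suc m))" if "c v w" for v w
    using that t ft by (auto simp: c_def)
  have Fc: "F v w \<in> carrier K" for v w using qK[OF cc] by (simp add: F_def)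
  have "bd m (bd (Suc m) q) t = (\<Oplus>\<^bsub>K\<^esub>v\<in>L. \<Oplus>\<^bsub>K\<^esub>w\<in>L. F v w)"
    unfolding bd_apply[OF q1 t]
  proof (intro K.finsum_cong' refl)
    fix v assume v: "v \<in> L"
    show "(if v \<notin> t \<and> insert v t \<in> \<Delta> then sgn (pos v t) \<otimes>\<^bsub>K\<^esub> bd (Suc m) q (insert v t) else \<zero>\<^bsub>K\<^esub>) = (\<Oplus>\<^bsub>K\<^esub>w\<in>L. F v w)"
    proof (cases "v \<notin> t \<and> insert v t \<in> \<Delta>")
      case True
      then have vt: "insert v t \<in> chains (Suc m)" using t ft by simp
      have "sgn (pos v t) \<otimes>\<^bsub>K\<^esub> bd (Suc m) q (insert v t) = (\<Oplus>\<^bsub>K\<^esub>w\<in>L. sgn (pos v t) \<otimes>\<^bsub>K\<^esub>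
          (if w \<notin> insert v t \<and> insert w (insert v t) \<in> \<Delta> then sgn (pos w (insert v t)) \<otimes>\<^bsub>K\<^esub> q (insert w (insert v t)) else \<zero>\<^bsub>K\<^esub>))"
        unfolding bd_apply[OF q vt]
      proof (intro K.finsum_rdistr finite_L)
        have "insert w (insert v t) \<in> chains (Suc (Suc m))"
          if "w \<notin> insert v t" "insert w (insert v t) \<in> \<Delta>" for w
          using that vt ft by (metis (mono_tags, lifting) card_insert_disjoint finite_insert mem_Collect_eq)
        then show "(\<lambda>w. if w \<notin> insert v t \<and> insert w (insert v t) \<in> \<Delta>
            then sgn (pos w (insert v t)) \<otimes>\<^bsub>K\<^esub> q (insert w (insert v t)) else \<zero>\<^bsub>K\<^esub>) \<in> L \<rightarrow> carrier K"
          using qK by simp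
      qed simp
      also have "\<dots> = (\<Oplus>\<^bsub>K\<^esub>w\<in>L. F v w)"
      proof (intro K.finsum_cong' refl)
        fix w
        show "sgn (pos v t) \<otimes>\<^bsub>K\<^esub> (if w \<notin> insert v t \<and> insert w (insert v t) \<in> \<Delta>
            then sgn (pos w (insert v t)) \<otimes>\<^bsub>K\<^esub> q (insert w (insert v t)) else \<zero>\<^bsub>K\<^esub>) = F v w"
          using True by (auto simp: F_def c_def)
      qed (use Fc in auto)
      finally show ?thesis using True by simp
    next
      case False
      have "\<not> c v w" for w using False Delta_subset[of "insert w (insert v t)" "insert v t"] by (auto simp: c_def)
      then have "(\<Oplus>\<^bsub>K\<^esub>w\<in>L. F v w) = \<zero>\<^bsub>K\<^esub>" by (intro K.finsum_zero_eqI) (simp add: F_def)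
      then show ?thesis using False by (simp only: if_False)
    qed
  qed (use Fc in \<open>auto intro!: K.finsum_closed\<close>)
  also have "\<dots> = \<zero>\<^bsub>K\<^esub>"
  proof (rule K.finsum_antisymmetric[OF finite_L Fc])
    show "F v v = \<zero>\<^bsub>K\<^esub>" for v by (simp add: F_def c_def)
    fix v w assume v: "v \<in> L" and w: "w \<in> L" and vw: "v \<noteq> w"
    have csym: "c w v \<longleftrightarrow> c v w" by (auto simp: c_def insert_commute)
    show "F v w = \<ominus>\<^bsub>K\<^esub> F w v"
    proof (cases "c v w")
      case True
      let ?q = "q (insert w (insert v t))"
      have qk: "?q \<in> carrier K" by (rule qK[OF cc[OF True]])
      have Fvw: "F v w = sgn (pos v t) \<otimes>\<^bsub>K\<^esub> (sgn (pos w (insert v t)) \<otimes>\<^bsub>K\<^esub> ?q)" using True by (simp add: F_def)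
      have Fwv: "F w v = sgn (pos w t) \<otimes>\<^bsub>K\<^esub> (sgn (pos v (insert w t)) \<otimes>\<^bsub>K\<^esub> ?q)"
        using True csym by (simp add: F_def insert_commute)
      have n: "v \<notin> t" "w \<notin> t" using True by (auto simp: c_def)
      have "le v w \<or> le w v" using True by (auto simp: c_def Delta_iff)
      moreover have "\<not> (le v w \<and> le w v)" using vw lrb_le_antisym L_carrier v w by blast
      ultimately consider "le v w" "\<not> le w v" | "le w v" "\<not> le v w" by blast
      then show ?thesis
      proof cases
        case 1
        show ?thesis unfolding Fvw Fwv
          using pos_insert[OF ft n(1) vw] pos_insert[OF ft n(2) vw[symmetric]] 1 qk
          by (simp add: sgn_Suc K.l_minus K.r_minus K.m_lcomm)
      next
        case 2
        show ?thesis unfolding Fvw Fwv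
          using pos_insert[OF ft n(1) vw] pos_insert[OF ft n(2) vw[symmetric]] 2 qk
          by (simp add: sgn_Suc K.l_minus K.r_minus K.m_lcomm)
      qed
    next
      case False
      then show ?thesis using csym by (simp add: F_def)
    qed
  qed
  finally show "bd m (bd (Suc m) q) t = \<zero>\<^bsub>C m\<^esub> t" using t by (simp add: C_simps cochains_simps)
qed

end

section \<open>Exactness by coning over the identity\<close>

context chain_resolution
begin

lemma le_one: "a \<in> L \<Longrightarrow> le a \<one>\<^bsub>B\<^esub>"
  using L_carrier by (simp add: lrb_le_def)

lemma one_le_iff: "a \<in> carrier B \<Longrightarrow> le \<one>\<^bsub>B\<^esub> a \<longleftrightarrow> a = \<one>\<^bsub>B\<^esub>"
  by (simp add: lrb_le_def)

lemma insert_one: "t \<in> \<Delta> \<Longrightarrow> insert \<one>\<^bsub>B\<^esub> t \<in> \<Delta>"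
  using one_L le_one lrb_le_refl[OF B.one_closed] unfolding Delta_iff by blast

lemma pos_one: assumes "t \<in> \<Delta>" "\<one>\<^bsub>B\<^esub> \<notin> t" shows "pos \<one>\<^bsub>B\<^esub> t = card t"
proof -
  have "{u \<in> t. u \<noteq> \<one>\<^bsub>B\<^esub> \<and> le u \<one>\<^bsub>B\<^esub>} = t" using assms le_one Delta_sub by blast
  then show ?thesis by (simp only: pos_def)
qed

text \<open>The identity lies above all of \<open>L\<close> and serves as apex: a chain is sent to
  itself with the identity added, and to zero if it already contains the identity.\<close>

definition cone :: "nat \<Rightarrow> ('b set \<Rightarrow> 'k) \<Rightarrow> 'b set \<Rightarrow> 'k" where
  "cone m q = (\<lambda>s\<in>chains (Suc m). if \<one>\<^bsub>B\<^esub> \<in> s then q (s - {\<one>\<^bsub>B\<^esub>}) else \<zero>\<^bsub>K\<^esub>)"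

lemma cone_closed: "q \<in> carrier (C m) \<Longrightarrow> cone m q \<in> carrier (C (Suc m))"
  using C_apply[of q m] face_chain[of _ m "\<one>\<^bsub>B\<^esub>"]
  by (auto simp: cone_def C_simps cochains_simps)

text \<open>The apex is last in its chain and has \<open>m\<close> elements before it, whence the
  sign. The premise \<open>cyc\<close> is vacuous for \<open>m = 0\<close>, where there is no lower
  module.\<close>

lemma bd_cone:
  assumes q: "q \<in> carrier (C m)" and cyc: "\<And>k. m = Suc k \<Longrightarrow> bd k q = \<zero>\<^bsub>C k\<^esub>" and t: "t \<in> chains m"
  shows "bd m (cone m q) t = sgn m \<otimes>\<^bsub>K\<^esub> q t"
proof -
  have tD: "t \<in> \<Delta>" and tc: "card t = m" and ft: "finite t" using t Delta_finite by auto
  have qK: "q s \<in> carrier K" if "s \<in> chains m" for s using C_apply[OF q] that by auto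
  let ?T = "\<lambda>v. if v \<notin> t \<and> insert v t \<in> \<Delta> then sgn (pos v t) \<otimes>\<^bsub>K\<^esub> cone m q (insert v t) else \<zero>\<^bsub>K\<^esub>"
  have bd: "bd m (cone m q) t = (\<Oplus>\<^bsub>K\<^esub>v\<in>L. ?T v)" by (rule bd_apply[OF cone_closed[OF q] t])
  have ins: "insert v t \<in> chains (Suc m)" if "v \<notin> t" "insert v t \<in> \<Delta>" for v using that tc ft by simp
  have cone: "cone m q (insert v t) = (if \<one>\<^bsub>B\<^esub> \<in> insert v t then q (insert v t - {\<one>\<^bsub>B\<^esub>}) else \<zero>\<^bsub>K\<^esub>)"
    if "v \<notin> t" "insert v t \<in> \<Delta>" for v using ins[OF that] by (simp add: cone_def)
  show ?thesis
  proof (cases "\<one>\<^bsub>B\<^esub> \<in> t")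
    \<comment> \<open>Chains in the support of the cone contain the identity, so for
      \<open>t\<close> without it only the identity can be the added vertex.\<close>
    case False
    have "(\<Oplus>\<^bsub>K\<^esub>v\<in>L. ?T v) = (\<Oplus>\<^bsub>K\<^esub>v\<in>L. if v = \<one>\<^bsub>B\<^esub> then sgn m \<otimes>\<^bsub>K\<^esub> q t else \<zero>\<^bsub>K\<^esub>)"
    proof (intro K.finsum_cong' refl)
      fix v assume v: "v \<in> L"
      show "?T v = (if v = \<one>\<^bsub>B\<^esub> then sgn m \<otimes>\<^bsub>K\<^esub> q t else \<zero>\<^bsub>K\<^esub>)"
      proof (cases "v = \<one>\<^bsub>B\<^esub>")
        case True
        have "insert v t - {\<one>\<^bsub>B\<^esub>} = t" using True False by auto
        then show ?thesis using True False insert_one[OF tD] cone[of v] pos_one[OF tD False] tc by simp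
      next
        case v1: False
        then show ?thesis using False cone[of v] by auto
      qed
    qed (use qK[OF t] in auto)
    also have "\<dots> = sgn m \<otimes>\<^bsub>K\<^esub> q t"
      using one_L finite_L qK[OF t] by (intro K.finsum_delta) auto
    finally show ?thesis unfolding bd .
  next
    case True
    let ?t = "t - {\<one>\<^bsub>B\<^esub>}"
    obtain k where k: "m = Suc k" using True tc ft by (cases m) auto
    have t': "?t \<in> chains k" using face_chain[of t k "\<one>\<^bsub>B\<^esub>"] t True k by simp
    then have t'D: "?t \<in> \<Delta>" and t'c: "card ?t = k" by auto
    have it: "insert \<one>\<^bsub>B\<^esub> ?t = t" using True by auto
    \<comment> \<open>These are the terms of \<open>bd k q\<close> at the chain \<open>?t\<close>,
      and their sum vanishes. The term of the identity is \<open>sgn k\<close> times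
      \<open>q t\<close>; the others are the terms of \<open>bd m (cone m q)\<close> at
      \<open>t\<close>. Moving the former to the other side turns \<open>sgn k\<close> into
      \<open>sgn m\<close>.\<close>
    define S where "S v = (if v \<notin> ?t \<and> insert v ?t \<in> \<Delta> then sgn (pos v ?t) \<otimes>\<^bsub>K\<^esub> q (insert v ?t) else \<zero>\<^bsub>K\<^esub>)" for v
    have Sc: "S v \<in> carrier K" for v using qK[of "insert v ?t"] t'c k ft by (simp add: S_def)
    have q': "q \<in> carrier (C (Suc k))" using q k by simp
    have "bd k q ?t = \<zero>\<^bsub>K\<^esub>" using cyc[OF k] t' by (simp add: C_simps cochains_simps)
    then have "(\<Oplus>\<^bsub>K\<^esub>v\<in>L. S v) = \<zero>\<^bsub>K\<^esub>" unfolding bd_apply[OF q' t'] S_def .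
    moreover have "L = insert \<one>\<^bsub>B\<^esub> (L - {\<one>\<^bsub>B\<^esub>})" using one_L by auto
    moreover have "(\<Oplus>\<^bsub>K\<^esub>v\<in>insert \<one>\<^bsub>B\<^esub> (L - {\<one>\<^bsub>B\<^esub>}). S v) = S \<one>\<^bsub>B\<^esub> \<oplus>\<^bsub>K\<^esub> (\<Oplus>\<^bsub>K\<^esub>v\<in>L - {\<one>\<^bsub>B\<^esub>}. S v)"
      using Sc finite_L by (intro K.finsum_insert) auto
    moreover have "S \<one>\<^bsub>B\<^esub> = sgn k \<otimes>\<^bsub>K\<^esub> q t"
      using tD pos_one[OF t'D] t'c by (simp add: S_def insert_absorb[OF True])
    ultimately have sum: "sgn k \<otimes>\<^bsub>K\<^esub> q t \<oplus>\<^bsub>K\<^esub> (\<Oplus>\<^bsub>K\<^esub>v\<in>L - {\<one>\<^bsub>B\<^esub>}. S v) = \<zero>\<^bsub>K\<^esub>" by argo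
    have Scl: "(\<Oplus>\<^bsub>K\<^esub>v\<in>L - {\<one>\<^bsub>B\<^esub>}. S v) \<in> carrier K" using Sc by (intro K.finsum_closed) auto
    have "\<ominus>\<^bsub>K\<^esub> (sgn k \<otimes>\<^bsub>K\<^esub> q t) = (\<Oplus>\<^bsub>K\<^esub>v\<in>L - {\<one>\<^bsub>B\<^esub>}. S v)"
      by (rule K.minus_equality) (use sum Scl qK[OF t] in \<open>simp_all add: K.a_comm\<close>)
    then have S_sum: "(\<Oplus>\<^bsub>K\<^esub>v\<in>L - {\<one>\<^bsub>B\<^esub>}. S v) = sgn m \<otimes>\<^bsub>K\<^esub> q t"
      using qK[OF t] k by (simp add: sgn_Suc K.l_minus)
    have "(\<Oplus>\<^bsub>K\<^esub>v\<in>L. ?T v) = (\<Oplus>\<^bsub>K\<^esub>v\<in>L - {\<one>\<^bsub>B\<^esub>}. S v)"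
    proof (rule K.add.finprod_mono_neutral_cong_right[OF finite_L])
      show "?T v = \<zero>\<^bsub>K\<^esub>" if "v \<in> L - (L - {\<one>\<^bsub>B\<^esub>})" for v using that True by auto
      show "?T v = S v" if v: "v \<in> L - {\<one>\<^bsub>B\<^esub>}" for v
      proof -
        have v1: "v \<noteq> \<one>\<^bsub>B\<^esub>" and vL: "v \<in> L" using v by auto
        have i: "insert v t - {\<one>\<^bsub>B\<^esub>} = insert v ?t" using v1 by auto
        have "insert v t = insert \<one>\<^bsub>B\<^esub> (insert v ?t)" using True by auto
        then have iff: "insert v t \<in> \<Delta> \<longleftrightarrow> insert v ?t \<in> \<Delta>"
          using insert_one[of "insert v ?t"] Delta_subset[of "insert v t" "insert v ?t"] by auto
        have "{u \<in> t. u \<noteq> v \<and> le u v} = {u \<in> ?t. u \<noteq> v \<and> le u v}"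
          using one_le_iff[OF L_carrier[OF vL]] v1 by auto
        then have p: "pos v t = pos v ?t" by (simp only: pos_def)
        have "v \<notin> ?t \<longleftrightarrow> v \<notin> t" using v1 by simp
        then show ?thesis using cone[of v] i iff p True by (simp add: S_def)
      qed
      show "?T \<in> L \<rightarrow> carrier K"
        using C_apply[OF cone_closed[OF q]] ins by auto
    qed auto
    then show ?thesis unfolding bd S_sum .
  qed
qed

text \<open>In general the cone does not commute with the action of \<open>B\<close>, but exactness
  asks for preimages only. The scalar \<open>sgn m\<close> undoes the sign in
  \<open>bd_cone\<close>.\<close>

lemma bd_exact:
  assumes q: "q \<in> carrier (C m)" and cyc: "\<And>k. m = Suc k \<Longrightarrow> bd k q = \<zero>\<^bsub>C k\<^esub>"
  shows "\<exists>r\<in>carrier (C (Suc m)). bd m r = q"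
proof
  interpret C1: left_module A "C (Suc m)" by (rule C_left_module)
  let ?r = "scal (sgn m) \<odot>\<^bsub>C (Suc m)\<^esub> cone m q"
  note cc = cone_closed[OF q]
  show r: "?r \<in> carrier (C (Suc m))" using cc by auto
  show "bd m ?r = q"
  proof (rule K.cochains_eqI[where \<Delta> = \<Delta> and m = m])
    show "bd m ?r \<in> carrier (V m)" "q \<in> carrier (V m)"
      using lin_map_closed[OF bd_lin r] q by (simp_all add: C_simps)
    fix t assume "t \<in> \<Delta>" "card t = m"
    then have t: "t \<in> chains m" by simp
    have "bd m ?r t = (scal (sgn m) \<odot>\<^bsub>C m\<^esub> bd m (cone m q)) t"
      using lin_map_smult[OF bd_lin scal_closed[OF sgn_closed] cc] by simp
    also have "\<dots> = sgn m \<otimes>\<^bsub>K\<^esub> (sgn m \<otimes>\<^bsub>K\<^esub> q t)"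
      using C_scal_apply[OF sgn_closed lin_map_closed[OF bd_lin cc] t] bd_cone[OF q cyc t] by simp
    also have "\<dots> = q t" using C_apply[OF q, of t] t by (simp add: K.m_assoc[symmetric] sgn_square)
    finally show "bd m ?r t = q t" .
  qed
qed

lemma chains_zero: "chains 0 = {{}}"
  using Delta_finite by (auto simp: Delta_iff)

end

section \<open>Action of scalars and band elements on the support modules\<close>

context lrb_algebra
begin

lemma support_module_simps:
  "carrier (support_module K B Z) = carrier K" "\<zero>\<^bsub>support_module K B Z\<^esub> = \<zero>\<^bsub>K\<^esub>"
  "(\<oplus>\<^bsub>support_module K B Z\<^esub>) = (\<oplus>\<^bsub>K\<^esub>)"
  by (simp_all add: support_module_def)

lemma support_module_finsum: "finsum (support_module K B Z) f S = finsum K f S"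
  by (simp add: finsum_def finprod_def support_module_simps)

lemma support_module_left: "Z \<in> \<Lambda> \<Longrightarrow> left_module A (support_module K B Z)"
  by (rule support_module_left_module[OF K.cring_axioms left_regular_band_axioms finite_B])

lemma support_bas:
  assumes "b \<in> carrier B" "x \<in> carrier K"
  shows "bas b \<odot>\<^bsub>support_module K B Z\<^esub> x = (if Z \<subseteq> supp b then x else \<zero>\<^bsub>K\<^esub>)"
proof -
  have "(\<Oplus>\<^bsub>K\<^esub>a\<in>carrier B. bas b a \<otimes>\<^bsub>K\<^esub> (if Z \<subseteq> supp a then x else \<zero>\<^bsub>K\<^esub>))
      = (\<Oplus>\<^bsub>K\<^esub>a\<in>carrier B. if a = b then (if Z \<subseteq> supp a then x else \<zero>\<^bsub>K\<^esub>) else \<zero>\<^bsub>K\<^esub>)"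
    using assms by (intro K.finsum_cong') (auto simp: bas_def)
  also have "\<dots> = (if Z \<subseteq> supp b then x else \<zero>\<^bsub>K\<^esub>)"
    using assms finite_B by (intro K.finsum_delta) auto
  finally show ?thesis by (simp add: support_module_def)
qed

lemma support_scal:
  assumes "Z \<in> \<Lambda>" "c \<in> carrier K" "x \<in> carrier K"
  shows "scal c \<odot>\<^bsub>support_module K B Z\<^esub> x = c \<otimes>\<^bsub>K\<^esub> x"
proof -
  have "(\<Oplus>\<^bsub>K\<^esub>a\<in>carrier B. scal c a \<otimes>\<^bsub>K\<^esub> (if Z \<subseteq> supp a then x else \<zero>\<^bsub>K\<^esub>))
      = (\<Oplus>\<^bsub>K\<^esub>a\<in>carrier B. if a = \<one>\<^bsub>B\<^esub> then c \<otimes>\<^bsub>K\<^esub> (if Z \<subseteq> supp a then x else \<zero>\<^bsub>K\<^esub>) else \<zero>\<^bsub>K\<^esub>)"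
    using assms by (intro K.finsum_cong') (auto simp: monoid_algebra_scalar_def)
  also have "\<dots> = c \<otimes>\<^bsub>K\<^esub> (if Z \<subseteq> supp \<one>\<^bsub>B\<^esub> then x else \<zero>\<^bsub>K\<^esub>)"
    using assms finite_B by (intro K.finsum_delta) auto
  finally show ?thesis using lattice_subset[OF assms(1)] by (simp add: support_module_def support_one)
qed

end

section \<open>The projective resolution assembled\<close>

context chain_resolution
begin

text \<open>The empty chain is the only basis element of \<open>C 0\<close>; it is fixed by
  \<open>L\<close> and killed by the rest of \<open>B\<close>. Evaluation there thus identifies
  \<open>C 0\<close> with the support module of \<open>X\<close>.\<close>

definition aug :: "('b set \<Rightarrow> 'k) \<Rightarrow> 'k" where "aug q = q {}"

lemma aug_lin: "lin_map A (C 0) (support_module K B X) aug"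
proof (rule lin_map_basI[OF C_left_module support_module_left[OF X]])
  have e: "{} \<in> chains 0" by (simp add: chains_zero)
  fix q assume q: "q \<in> carrier (C 0)"
  have qK: "q {} \<in> carrier K" using C_apply[OF q] e by auto
  then show "aug q \<in> carrier (support_module K B X)" by (simp add: aug_def support_module_simps)
  show "aug (p \<oplus>\<^bsub>C 0\<^esub> r) = aug p \<oplus>\<^bsub>support_module K B X\<^esub> aug r" for p r
    using e by (simp add: aug_def support_module_simps C_simps cochains_simps)
  show "aug (scal c \<odot>\<^bsub>C 0\<^esub> q) = scal c \<odot>\<^bsub>support_module K B X\<^esub> aug q" if "c \<in> carrier K" for c
    using C_scal_apply[OF that q e] support_scal[OF X that qK] by (simp add: aug_def)
  show "aug (bas b \<odot>\<^bsub>C 0\<^esub> q) = bas b \<odot>\<^bsub>support_module K B X\<^esub> aug q" if b: "b \<in> carrier B" for b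
  proof -
    have "(\<Oplus>\<^bsub>K\<^esub>s\<in>chains 0. if act b s = {} then q s else \<zero>\<^bsub>K\<^esub>) = q {}"
      unfolding chains_zero using qK by (simp add: act_def)
    then have "aug (bas b \<odot>\<^bsub>C 0\<^esub> q) = (if b \<in> L then q {} else \<zero>\<^bsub>K\<^esub>)"
      using C_bas[OF b, of q 0] q e by (simp add: C_simps aug_def \<rho>_def)
    then show ?thesis using support_bas[OF b qK] b by (simp add: aug_def L_iff)
  qed
qed

lemma aug_inj: "q \<in> carrier (C 0) \<Longrightarrow> aug q = \<zero>\<^bsub>K\<^esub> \<Longrightarrow> q = \<zero>\<^bsub>C 0\<^esub>"
  by (rule K.cochains_eqI[where \<Delta> = \<Delta> and m = 0])
    (use chains_zero in \<open>auto simp: C_simps cochains_simps aug_def\<close>)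

lemma aug_surj: "x \<in> carrier K \<Longrightarrow> \<exists>q\<in>carrier (C 0). aug q = x"
  by (rule bexI[of _ "\<lambda>s\<in>chains 0. x"]) (auto simp: aug_def C_simps cochains_simps chains_zero)

text \<open>The shift by one leaves out \<open>C 0\<close>, which is the module being resolved. In
  \<open>dQ\<close> and \<open>eQ\<close> the maps are restricted because \<open>lin_hom\<close>
  asks for extensional functions.\<close>

definition Q where "Q n = C (Suc n)"

definition dQ where "dQ n = restrict (bd (Suc n)) (carrier (Q (Suc n)))"

definition eQ where "eQ = restrict (\<lambda>q. aug (bd 0 q)) (carrier (Q 0))"

lemma chain_projective_resolution: "projective_resolution A Q dQ eQ (support_module K B X)"
  unfolding projective_resolution_def
proof (intro conjI allI)
  interpret C0: left_module A "C 0" by (rule C_left_module)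
  have e: "lin_map A (C (Suc 0)) (support_module K B X) (\<lambda>q. aug (bd 0 q))"
    by (rule lin_map_comp[OF bd_lin aug_lin])
  have aug0: "aug \<zero>\<^bsub>C 0\<^esub> = \<zero>\<^bsub>K\<^esub>"
    using lin_map_zero[OF C_left_module support_module_left[OF X] aug_lin] by (simp add: support_module_simps)
  show "left_module A (support_module K B X)" by (rule support_module_left[OF X])
  show "projective_module A (Q n)" for n unfolding Q_def by (rule C_projective)
  show "dQ n \<in> lin_hom A (Q (Suc n)) (Q n)" for n
    unfolding dQ_def Q_def by (rule lin_map_restrict[OF C_left_module bd_lin])
  show "eQ \<in> lin_hom A (Q 0) (support_module K B X)"
    unfolding eQ_def Q_def by (rule lin_map_restrict[OF C_left_module e])
  show "eQ ` carrier (Q 0) = carrier (support_module K B X)"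
  proof (intro equalityI subsetI)
    fix x assume "x \<in> carrier (support_module K B X)"
    then have "x \<in> carrier K" by (simp add: support_module_simps)
    then obtain q where q: "q \<in> carrier (C 0)" "aug q = x" using aug_surj by blast
    \<comment> \<open>At the bottom \<open>bd_exact\<close> has no cycle condition, so
      \<open>bd 0\<close> is onto.\<close>
    obtain r where "r \<in> carrier (C (Suc 0))" "bd 0 r = q" using bd_exact[OF q(1)] by blast
    then show "x \<in> eQ ` carrier (Q 0)" using q by (force simp: eQ_def Q_def)
  next
    fix x assume "x \<in> eQ ` carrier (Q 0)"
    then show "x \<in> carrier (support_module K B X)" using lin_map_closed[OF e] by (auto simp: eQ_def Q_def)
  qed
  show "dQ 0 ` carrier (Q 1) = {x \<in> carrier (Q 0). eQ x = \<zero>\<^bsub>support_module K B X\<^esub>}"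
  proof (intro equalityI subsetI)
    fix x assume "x \<in> dQ 0 ` carrier (Q 1)"
    then obtain r where r: "r \<in> carrier (C (Suc (Suc 0)))" "x = bd (Suc 0) r" by (auto simp: dQ_def Q_def)
    then show "x \<in> {x \<in> carrier (Q 0). eQ x = \<zero>\<^bsub>support_module K B X\<^esub>}"
      using lin_map_closed[OF bd_lin r(1)] by (simp add: eQ_def Q_def bd_bd aug0 support_module_simps)
  next
    fix x assume "x \<in> {x \<in> carrier (Q 0). eQ x = \<zero>\<^bsub>support_module K B X\<^esub>}"
    then have x: "x \<in> carrier (C (Suc 0))" and "aug (bd 0 x) = \<zero>\<^bsub>K\<^esub>"
      by (auto simp: eQ_def Q_def support_module_simps)
    \<comment> \<open>Injectivity of \<open>aug\<close> identifies the kernel of \<open>eQ\<close>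
      with that of \<open>bd 0\<close>.\<close>
    then have "bd 0 x = \<zero>\<^bsub>C 0\<^esub>" using aug_inj lin_map_closed[OF bd_lin x] by blast
    then obtain r where "r \<in> carrier (C (Suc (Suc 0)))" "bd (Suc 0) r = x" using bd_exact[OF x] by blast
    then show "x \<in> dQ 0 ` carrier (Q 1)" by (force simp: dQ_def Q_def)
  qed
  show "dQ (Suc n) ` carrier (Q (Suc (Suc n))) = {x \<in> carrier (Q (Suc n)). dQ n x = \<zero>\<^bsub>Q n\<^esub>}" for n
  proof (intro equalityI subsetI)
    fix x assume "x \<in> dQ (Suc n) ` carrier (Q (Suc (Suc n)))"
    then obtain r where r: "r \<in> carrier (C (Suc (Suc (Suc n))))" "x = bd (Suc (Suc n)) r"
      by (auto simp: dQ_def Q_def)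
    then show "x \<in> {x \<in> carrier (Q (Suc n)). dQ n x = \<zero>\<^bsub>Q n\<^esub>}"
      using lin_map_closed[OF bd_lin r(1)] by (simp add: dQ_def Q_def bd_bd)
  next
    fix x assume "x \<in> {x \<in> carrier (Q (Suc n)). dQ n x = \<zero>\<^bsub>Q n\<^esub>}"
    then have x: "x \<in> carrier (C (Suc (Suc n)))" and x0: "bd (Suc n) x = \<zero>\<^bsub>C (Suc n)\<^esub>"
      by (auto simp: dQ_def Q_def)
    have "\<exists>r\<in>carrier (C (Suc (Suc (Suc n)))). bd (Suc (Suc n)) r = x"
      by (rule bd_exact[OF x]) (use x0 in simp)
    then show "x \<in> dQ (Suc n) ` carrier (Q (Suc (Suc n)))" by (force simp: dQ_def Q_def)
  qed
qed

end

section \<open>Homomorphisms into the modules \<open>K\<^sub>Y\<close>\<close>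

text \<open>Linearity of \<open>\<delta>'\<close> and the vanishing of its square are carried over
  along the bijections \<open>\<Phi>\<close>. Thus the simplicial coboundary turns out to be a
  differential without a second computation of signs.\<close>

lemma cohomology_transport:
  assumes C: "cochain_complex K C \<delta>" and M: "\<And>n. left_module K (C' n)"
    and lin: "\<And>n. lin_map K (C n) (C' n) (\<Phi> n)" and bij: "\<And>n. bij_betw (\<Phi> n) (carrier (C n)) (carrier (C' n))"
    and comm: "\<And>n x. x \<in> carrier (C n) \<Longrightarrow> \<delta>' n (\<Phi> n x) = \<Phi> (Suc n) (\<delta> n x)"
  shows "cochain_complex K C' \<delta>'" "mod_iso K (cohomology C \<delta> n) (cohomology C' \<delta>' n)"
proof -
  interpret C: cochain_complex K C \<delta> by (rule C)
  note dc = lin_map_closed[OF C.lin] and pc = lin_map_closed[OF lin]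
  have surj: "\<exists>x\<in>carrier (C n). y = \<Phi> n x" if "y \<in> carrier (C' n)" for y n
    using bij[of n] that by (auto simp: bij_betw_def)
  have p0: "\<Phi> n \<zero>\<^bsub>C n\<^esub> = \<zero>\<^bsub>C' n\<^esub>" for n by (rule lin_map_zero[OF C.module M lin])
  have inj0: "x = \<zero>\<^bsub>C n\<^esub>" if "x \<in> carrier (C n)" "\<Phi> n x = \<zero>\<^bsub>C' n\<^esub>" for x n
  proof -
    interpret Cn: left_module K "C n" by (rule C.module)
    show ?thesis using bij[of n] that p0[of n] Cn.zero_closed by (metis bij_betw_def inj_onD)
  qed
  show C': "cochain_complex K C' \<delta>'"
  proof (rule cochain_complex.intro)
    show "left_module K (C' n)" for n by (rule M)
    show "lin_map K (C' n) (C' (Suc n)) (\<delta>' n)" for n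
    proof (rule lin_mapI)
      interpret Cn: left_module K "C n" by (rule C.module)
      fix y assume "y \<in> carrier (C' n)"
      then obtain x where x: "x \<in> carrier (C n)" "y = \<Phi> n x" using surj by blast
      show "\<delta>' n y \<in> carrier (C' (Suc n))" using x comm pc dc by simp
      show "\<delta>' n (a \<odot>\<^bsub>C' n\<^esub> y) = a \<odot>\<^bsub>C' (Suc n)\<^esub> \<delta>' n y" if a: "a \<in> carrier K" for a
      proof -
        have "\<delta>' n (a \<odot>\<^bsub>C' n\<^esub> y) = \<delta>' n (\<Phi> n (a \<odot>\<^bsub>C n\<^esub> x))"
          using x a by (simp add: lin_map_smult[OF lin])
        also have "\<dots> = \<Phi> (Suc n) (\<delta> n (a \<odot>\<^bsub>C n\<^esub> x))" using x a by (intro comm) auto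
        also have "\<dots> = a \<odot>\<^bsub>C' (Suc n)\<^esub> \<delta>' n y"
          using x a dc by (simp add: lin_map_smult[OF C.lin] lin_map_smult[OF lin] comm)
        finally show ?thesis .
      qed
      fix y' assume "y' \<in> carrier (C' n)"
      then obtain x' where x': "x' \<in> carrier (C n)" "y' = \<Phi> n x'" using surj by blast
      have "\<delta>' n (y \<oplus>\<^bsub>C' n\<^esub> y') = \<delta>' n (\<Phi> n (x \<oplus>\<^bsub>C n\<^esub> x'))"
        using x x' by (simp add: lin_map_add[OF lin])
      also have "\<dots> = \<Phi> (Suc n) (\<delta> n (x \<oplus>\<^bsub>C n\<^esub> x'))" using x x' by (intro comm) auto
      also have "\<dots> = \<delta>' n y \<oplus>\<^bsub>C' (Suc n)\<^esub> \<delta>' n y'"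
        using x x' dc by (simp add: lin_map_add[OF C.lin] lin_map_add[OF lin] comm)
      finally show "\<delta>' n (y \<oplus>\<^bsub>C' n\<^esub> y') = \<delta>' n y \<oplus>\<^bsub>C' (Suc n)\<^esub> \<delta>' n y'" .
    qed
    show "\<delta>' (Suc n) (\<delta>' n y) = \<zero>\<^bsub>C' (Suc (Suc n))\<^esub>" if y: "y \<in> carrier (C' n)" for y n
    proof -
      obtain x where x: "x \<in> carrier (C n)" "y = \<Phi> n x" using surj[OF y] by blast
      show ?thesis using x dc by (simp add: comm C.square_zero p0)
    qed
  qed
  interpret C': cochain_complex K C' \<delta>' by (rule C')
  show "mod_iso K (cohomology C \<delta> n) (cohomology C' \<delta>' n)"
  proof (rule cohomology_iso[OF C C' lin])
    fix x assume x: "x \<in> C.cocycles n"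
    then have xc: "x \<in> carrier (C n)" and x0: "\<delta> n x = \<zero>\<^bsub>C (Suc n)\<^esub>" by (auto simp: C.cocycles_def)
    show "\<Phi> n x \<in> C'.cocycles n" using xc x0 pc by (simp add: C'.cocycles_def comm p0)
    assume b: "\<Phi> n x \<in> C'.coboundaries n"
    show "x \<in> C.coboundaries n"
    proof (cases n)
      case 0
      then show ?thesis using b inj0[OF xc] by (simp add: C.coboundaries_def C'.coboundaries_def)
    next
      case (Suc m)
      then obtain y where "y \<in> carrier (C' m)" "\<Phi> n x = \<delta>' m y" using b by (auto simp: C'.coboundaries_def)
      moreover then obtain w where w: "w \<in> carrier (C m)" "y = \<Phi> m w" using surj by blast
      ultimately have "\<Phi> n x = \<Phi> n (\<delta> m w)" using Suc by (simp add: comm)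
      then have "x = \<delta> m w" using bij[of n] xc dc[OF w(1)] Suc by (auto simp: bij_betw_def dest: inj_onD)
      then show ?thesis using w Suc by (simp add: C.coboundaries_def)
    qed
  next
    fix x assume x: "x \<in> C.coboundaries n"
    show "\<Phi> n x \<in> C'.coboundaries n"
    proof (cases n)
      case 0
      then show ?thesis using x p0[of 0] by (simp add: C.coboundaries_def C'.coboundaries_def)
    next
      case (Suc m)
      then obtain w where w: "w \<in> carrier (C m)" "x = \<delta> m w" using x by (auto simp: C.coboundaries_def)
      then have "\<Phi> n x = \<delta>' m (\<Phi> m w)" using Suc by (simp add: comm)
      then show ?thesis using pc[OF w(1)] Suc by (simp add: C'.coboundaries_def)
    qed
  next
    fix z assume z: "z \<in> C'.cocycles n"
    interpret Cn: left_module K "C' n" by (rule M)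
    have zc: "z \<in> carrier (C' n)" and z0: "\<delta>' n z = \<zero>\<^bsub>C' (Suc n)\<^esub>" using z by (auto simp: C'.cocycles_def)
    obtain x where x: "x \<in> carrier (C n)" "z = \<Phi> n x" using surj[OF zc] by blast
    have "\<delta> n x = \<zero>\<^bsub>C (Suc n)\<^esub>" using inj0[OF dc[OF x(1)]] z0 x by (simp add: comm)
    then have "x \<in> C.cocycles n" using x by (simp add: C.cocycles_def)
    moreover have "\<zero>\<^bsub>C' n\<^esub> \<in> C'.coboundaries n"
      using C'.coboundaries_submodule by (simp add: is_submodule_def)
    moreover have "z = \<zero>\<^bsub>C' n\<^esub> \<oplus>\<^bsub>C' n\<^esub> \<Phi> n x" using x zc by simp
    ultimately show "\<exists>x\<in>C.cocycles n. \<exists>y\<in>C'.coboundaries n. z = y \<oplus>\<^bsub>C' n\<^esub> \<Phi> n x" by blast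
  qed
qed

lemma (in cochain_complex) cohomology_trivial:
  assumes "cocycles n \<subseteq> {\<zero>\<^bsub>C n\<^esub>}"
  shows "carrier (cohomology C \<delta> n) = {\<zero>\<^bsub>cohomology C \<delta> n\<^esub>}"
proof -
  have "carrier (cohomology C \<delta> n) \<subseteq> {coboundaries n +>\<^bsub>C n\<^esub> \<zero>\<^bsub>C n\<^esub>}"
    using assms by (auto simp: cohomology_eq subquotient_def)
  then show ?thesis using cohomology_closed(3)[of n] by blast
qed

text \<open>The inclusion is weak on purpose: the diagonal case and degree zero are read off from
  the same isomorphism as the main case.\<close>

locale support_hom = chain_resolution K B X for K :: "'k ring" and B :: "'b monoid" and X +
  fixes Y :: "'b set" and e :: 'b
  assumes XY: "X \<subseteq> Y" and e: "e \<in> carrier B" and supp_e: "lrb_support B e = Y"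
begin

abbreviation I where "I \<equiv> lrb_interval B X e"

abbreviation \<Delta>' where "\<Delta>' \<equiv> lrb_complex B X e"

abbreviation N where "N \<equiv> support_module K B Y"

lemma Y: "Y \<in> \<Lambda>"
  using e supp_e by (auto simp: lrb_lattice_def)

lemma N_left_module: "left_module A N"
  by (rule support_module_left[OF Y])

lemma e_L: "e \<in> L"
  using XY e supp_e by (simp add: L_iff)

lemma I_iff: "u \<in> I \<longleftrightarrow> u \<in> L \<and> e \<otimes>\<^bsub>B\<^esub> u = u \<and> u \<noteq> e"
proof
  assume "u \<in> I"
  then obtain b where b: "b \<in> L" "u = e \<otimes>\<^bsub>B\<^esub> b" "u \<noteq> e" by (auto simp: lrb_interval_def L_def)
  have "e \<otimes>\<^bsub>B\<^esub> u = (e \<otimes>\<^bsub>B\<^esub> e) \<otimes>\<^bsub>B\<^esub> b" unfolding b(2) using e L_carrier[OF b(1)] by (simp add: B.m_assoc)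
  then show "u \<in> L \<and> e \<otimes>\<^bsub>B\<^esub> u = u \<and> u \<noteq> e"
    using b e L_carrier[OF b(1)] L_mult_iff[OF e L_carrier[OF b(1)]] e_L by (simp add: idem)
next
  assume "u \<in> L \<and> e \<otimes>\<^bsub>B\<^esub> u = u \<and> u \<noteq> e"
  then show "u \<in> I" unfolding lrb_interval_def L_def by (metis DiffI image_eqI singletonD)
qed

text \<open>Otherwise \<open>e\<close> would absorb \<open>u\<close> on the right, whereas
  multiplication by \<open>e\<close> gives \<open>u\<close> itself. Consequently every vertex of the
  complex acts on \<open>N\<close> by zero.\<close>

lemma I_support: assumes "u \<in> I" shows "\<not> Y \<subseteq> supp u"
proof
  assume "Y \<subseteq> supp u"
  then have "e \<otimes>\<^bsub>B\<^esub> u = e" using support_le_iff[OF e, of u] supp_e assms L_carrier by (simp add: I_iff)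
  moreover have "e \<otimes>\<^bsub>B\<^esub> u = u" "u \<noteq> e" using assms by (simp_all add: I_iff)
  ultimately show False by simp
qed

lemma I_le: "u \<in> I \<Longrightarrow> le u e"
  by (simp add: I_iff lrb_le_def)

lemma e_not_le: "u \<in> I \<Longrightarrow> \<not> le e u"
  using I_le lrb_le_antisym[OF e, of u] L_carrier by (auto simp: I_iff)

lemma Delta'_iff: "t \<in> \<Delta>' \<longleftrightarrow> t \<in> \<Delta> \<and> t \<subseteq> I"
proof -
  have "finite t" if "t \<subseteq> I" using finite_subset[OF that] finite_subset[OF _ finite_L, of I] I_iff by blast
  moreover have "I \<subseteq> L" using I_iff by blast
  ultimately show ?thesis unfolding lrb_complex_def order_complex_def Delta_iff by blast
qed

lemma insert_e: assumes "t \<in> \<Delta>'" shows "insert e t \<in> \<Delta>" "e \<notin> t"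
proof -
  have t: "t \<in> \<Delta>" "t \<subseteq> I" using assms by (auto simp: Delta'_iff)
  then show "e \<notin> t" using I_iff by blast
  show "insert e t \<in> \<Delta>" using t e_L I_le lrb_le_refl[OF e] unfolding Delta_iff by blast
qed

lemma insert_e_chain: assumes "t \<in> \<Delta>'" "card t = n" shows "insert e t \<in> chains (Suc n)"
  using insert_e[OF assms(1)] assms(2) Delta_finite[of t] assms(1) by (simp add: Delta'_iff)

lemma act_e_insert: assumes "t \<in> \<Delta>'" shows "act e (insert e t) = insert e t"
proof -
  have "e \<otimes>\<^bsub>B\<^esub> u = u" if "u \<in> insert e t" for u
    using that assms by (auto simp: Delta'_iff I_iff idem[OF e])
  then show ?thesis by (simp add: act_def)
qed

lemma act_e_remove:
  assumes s: "s \<in> \<Delta>" shows "act e s - {e} \<in> \<Delta>'"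
proof -
  have D: "act e s \<in> \<Delta>" by (rule act_Delta[OF e_L s])
  have "u \<in> I" if "u \<in> act e s - {e}" for u
  proof -
    have "e \<otimes>\<^bsub>B\<^esub> u = u"
      using that Delta_carrier[OF s] e by (auto simp: act_def B.m_assoc[symmetric] idem)
    then show ?thesis using that Delta_sub[OF D] by (simp add: I_iff)
  qed
  then show ?thesis using Delta_subset[OF D] by (auto simp: Delta'_iff)
qed

text \<open>The largest element of \<open>s\<close> fixes the chain but acts on \<open>N\<close> by
  zero, because it belongs to the half-open interval.\<close>

lemma hom_supported_below:
  assumes f: "lin_map A (C n) N f" and s: "s \<in> chains n" and I: "s \<subseteq> I" and ne: "s \<noteq> {}"
  shows "f (dl n s) = \<zero>\<^bsub>K\<^esub>"
proof -
  have sD: "s \<in> \<Delta>" and sc: "card s = n" using s by auto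
  have a: "top s \<in> I" "top s \<in> L" using top(1)[OF sD ne] I Delta_sub[OF sD] by auto
  have "bas (top s) \<odot>\<^bsub>C n\<^esub> dl n s = dl n s"
    using bas_dl[OF L_carrier[OF a(2)] s] act_top[OF sD ne] a(2) sc by simp
  then have "f (dl n s) = bas (top s) \<odot>\<^bsub>N\<^esub> f (dl n s)"
    using lin_map_smult[OF f bas_closed dl_closed, of "top s" s] by simp
  also have "\<dots> = \<zero>\<^bsub>K\<^esub>"
    using support_bas[OF L_carrier[OF a(2)], of "f (dl n s)" Y] lin_map_closed[OF f dl_closed] I_support[OF a(1)]
    by (simp add: support_module_simps)
  finally show ?thesis .
qed

section \<open>The isomorphism between Hom and simplicial cochains\<close>

definition \<Phi> :: "nat \<Rightarrow> (('b set \<Rightarrow> 'k) \<Rightarrow> 'k) \<Rightarrow> 'b set \<Rightarrow> 'k" where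
  "\<Phi> n f = (\<lambda>t\<in>{t \<in> \<Delta>'. card t = n}. f (dl (Suc n) (insert e t)))"

text \<open>The value that linearity forces: \<open>e\<close> is the identity on \<open>N\<close>,
  so \<open>s\<close> must have the value of \<open>act e s\<close>, and this is zero if the chain
  has shrunk or, by \<open>hom_supported_below\<close>, if it omits \<open>e\<close>.\<close>

definition \<psi> :: "nat \<Rightarrow> ('b set \<Rightarrow> 'k) \<Rightarrow> 'b set \<Rightarrow> 'k" where
  "\<psi> n g s = (if e \<in> act e s \<and> card (act e s) = Suc n then g (act e s - {e}) else \<zero>\<^bsub>K\<^esub>)"

lemma \<psi>_closed:
  assumes g: "g \<in> carrier (cochains K \<Delta>' n)" and s: "s \<in> chains (Suc n)"
  shows "\<psi> n g s \<in> carrier K"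
proof -
  have D: "act e s - {e} \<in> \<Delta>'" using act_e_remove s by simp
  have "card (act e s - {e}) = n" if "e \<in> act e s" "card (act e s) = Suc n"
    using that Delta_finite[OF act_Delta[OF e_L]] s by simp
  then show ?thesis using K.cochains_apply[OF g D] by (simp add: \<psi>_def)
qed

lemma \<psi>_lin:
  assumes g: "g \<in> carrier (cochains K \<Delta>' n)"
  shows "lin_map A (C (Suc n)) N (chain_ext (Suc n) N (\<psi> n g))"
proof (rule chain_ext_lin[OF N_left_module])
  show cl: "\<psi> n g s \<in> carrier N" if "s \<in> chains (Suc n)" for s
    using \<psi>_closed[OF g that] by (simp add: support_module_simps)
  fix b s assume b: "b \<in> carrier B" and s: "s \<in> chains (Suc n)"
  then have sD: "s \<in> \<Delta>" and sc: "card s = Suc n" by auto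
  note sb = support_bas[OF b \<psi>_closed[OF g s], of Y]
  show "bas b \<odot>\<^bsub>N\<^esub> \<psi> n g s = (if b \<in> L \<and> card (act b s) = Suc n then \<psi> n g (act b s) else \<zero>\<^bsub>N\<^esub>)"
  proof (cases "Y \<subseteq> supp b")
    case True
    have bL: "b \<in> L" using True XY b by (auto simp: L_iff)
    \<comment> \<open>\<open>e\<close> absorbs \<open>b\<close>, so \<open>s\<close> and
      \<open>act b s\<close> have the same image under \<open>e\<close>.\<close>
    have "e \<otimes>\<^bsub>B\<^esub> b = e" using support_le_iff[OF e b] supp_e True by simp
    then have ac: "act e (act b s) = act e s" using act_mult[OF e b sD] by simp
    show ?thesis
    proof (cases "card (act b s) = Suc n")
      case True
      then show ?thesis using sb \<open>Y \<subseteq> supp b\<close> bL ac by (simp add: \<psi>_def)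
    next
      case False
      have "card (act e s) \<le> card (act b s)" "card (act b s) \<le> Suc n"
        using act_card[OF act_Delta[OF bL sD], of e] act_card[OF sD, of b] ac sc by simp_all
      then have "\<psi> n g s = \<zero>\<^bsub>K\<^esub>" using False by (simp add: \<psi>_def)
      then show ?thesis using sb False by (simp add: support_module_simps)
    qed
  next
    case False
    \<comment> \<open>If \<open>e\<close> occurred in the image of \<open>act b s\<close> under
      \<open>e\<close>, then \<open>Y\<close>, its support, would lie below the support of
      \<open>b\<close>.\<close>
    have "\<psi> n g (act b s) = \<zero>\<^bsub>K\<^esub>" if bL: "b \<in> L"
    proof -
      have "e \<notin> act e (act b s)"
      proof
        assume "e \<in> act e (act b s)"
        then obtain a where a: "a \<in> s" "e = e \<otimes>\<^bsub>B\<^esub> (b \<otimes>\<^bsub>B\<^esub> a)" by (auto simp: act_def)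
        have ac: "a \<in> carrier B" using Delta_carrier[OF sD a(1)] .
        have "supp e \<subseteq> supp (b \<otimes>\<^bsub>B\<^esub> a)" using support_le_iff[OF e, of "b \<otimes>\<^bsub>B\<^esub> a"] a(2) b ac by simp
        then show False using lrb_support_mult[OF b ac] False supp_e by auto
      qed
      then show ?thesis by (simp add: \<psi>_def)
    qed
    then show ?thesis using sb False by (simp add: support_module_simps)
  qed
qed

lemma \<Phi>_lin: "lin_map K (hom_module A scal (Q n) N) (cochains K \<Delta>' n) (\<Phi> n)"
proof (rule lin_mapI)
  fix f assume "f \<in> carrier (hom_module A scal (Q n) N)"
  then have f: "lin_map A (C (Suc n)) N f" by (simp add: hom_module_simps lin_hom_iff Q_def)
  have fK: "f (dl (Suc n) s) \<in> carrier K" for s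
    using lin_map_closed[OF f dl_closed] by (simp add: support_module_simps)
  show "\<Phi> n f \<in> carrier (cochains K \<Delta>' n)" using fK by (simp add: \<Phi>_def cochains_simps)
  show "\<Phi> n (c \<odot>\<^bsub>hom_module A scal (Q n) N\<^esub> f) = c \<odot>\<^bsub>cochains K \<Delta>' n\<^esub> \<Phi> n f" if "c \<in> carrier K" for c
    using support_scal[OF Y that fK] dl_closed
    by (auto simp: \<Phi>_def cochains_simps hom_module_simps Q_def fun_eq_iff)
  fix f' assume "f' \<in> carrier (hom_module A scal (Q n) N)"
  show "\<Phi> n (f \<oplus>\<^bsub>hom_module A scal (Q n) N\<^esub> f') = \<Phi> n f \<oplus>\<^bsub>cochains K \<Delta>' n\<^esub> \<Phi> n f'"
    using dl_closed by (auto simp: \<Phi>_def cochains_simps hom_module_simps Q_def support_module_simps fun_eq_iff)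
qed

lemma \<Phi>_bij: "bij_betw (\<Phi> n) (carrier (hom_module A scal (Q n) N)) (carrier (cochains K \<Delta>' n))"
proof (rule bij_betwI')
  fix f f' assume "f \<in> carrier (hom_module A scal (Q n) N)" "f' \<in> carrier (hom_module A scal (Q n) N)"
  then have f: "lin_map A (C (Suc n)) N f" "f \<in> extensional (carrier (C (Suc n)))"
    and f': "lin_map A (C (Suc n)) N f'" "f' \<in> extensional (carrier (C (Suc n)))"
    by (simp_all add: hom_module_simps lin_hom_iff Q_def)
  have eqI: "f = f'" if eq: "\<Phi> n f = \<Phi> n f'"
  proof (rule extensionalityI[OF f(2) f'(2)])
    fix q assume q: "q \<in> carrier (C (Suc n))"
    show "f q = f' q"
    proof (rule C_hom_eqI[OF N_left_module f(1) f'(1) _ q])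
      fix s assume s: "s \<in> \<Delta>" "card s = Suc n"
      then have sn: "s \<in> chains (Suc n)" by simp
      let ?r = "act e s"
      have rD: "?r \<in> \<Delta>" by (rule act_Delta[OF e_L s(1)])
      \<comment> \<open>As \<open>e\<close> is the identity on \<open>N\<close>, a homomorphism is
        determined by its values on the chains \<open>act e s\<close>; those omitting
        \<open>e\<close> lie in the half-open interval and give zero.\<close>
      have val: "h (dl (Suc n) s) = (if card ?r = Suc n then h (dl (Suc n) ?r) else \<zero>\<^bsub>K\<^esub>)"
        if h: "lin_map A (C (Suc n)) N h" for h
      proof -
        have "h (dl (Suc n) s) = bas e \<odot>\<^bsub>N\<^esub> h (dl (Suc n) s)"
          using support_bas[OF e, of "h (dl (Suc n) s)" Y] supp_e lin_map_closed[OF h dl_closed, of s]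
          by (simp add: support_module_simps)
        also have "\<dots> = h (bas e \<odot>\<^bsub>C (Suc n)\<^esub> dl (Suc n) s)"
          by (rule lin_map_smult[OF h bas_closed dl_closed, symmetric])
        also have "\<dots> = (if card ?r = Suc n then h (dl (Suc n) ?r) else \<zero>\<^bsub>K\<^esub>)"
          using bas_dl[OF e sn] e_L lin_map_zero[OF C_left_module N_left_module h]
          by (simp add: support_module_simps)
        finally show ?thesis .
      qed
      have "f (dl (Suc n) ?r) = f' (dl (Suc n) ?r)" if c: "card ?r = Suc n"
      proof (cases "e \<in> ?r")
        case True
        let ?t = "?r - {e}"
        have t: "?t \<in> \<Delta>'" by (rule act_e_remove[OF s(1)])
        have tc: "card ?t = n" using True c Delta_finite[OF rD] by simp
        have "insert e ?t = ?r" using True by auto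
        then show ?thesis using fun_cong[OF eq, of ?t] t tc by (simp add: \<Phi>_def)
      next
        case False
        then have rI: "?r \<subseteq> I" using act_e_remove[OF s(1)] by (auto simp: Delta'_iff)
        have r0: "?r \<noteq> {}" using c by auto
        have rn: "?r \<in> chains (Suc n)" using rD c by simp
        show ?thesis
          using hom_supported_below[OF f(1) rn rI r0] hom_supported_below[OF f'(1) rn rI r0] by simp
      qed
      then show "f (dl (Suc n) s) = f' (dl (Suc n) s)" using val[OF f(1)] val[OF f'(1)] by simp
    qed
  qed
  then show "(\<Phi> n f = \<Phi> n f') = (f = f')" by blast
next
  show "\<Phi> n f \<in> carrier (cochains K \<Delta>' n)" if "f \<in> carrier (hom_module A scal (Q n) N)" for f
    by (rule lin_map_closed[OF \<Phi>_lin that])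
next
  fix g assume g: "g \<in> carrier (cochains K \<Delta>' n)"
  let ?f = "restrict (chain_ext (Suc n) N (\<psi> n g)) (carrier (C (Suc n)))"
  have f: "?f \<in> carrier (hom_module A scal (Q n) N)"
    unfolding hom_module_simps Q_def by (rule lin_map_restrict[OF C_left_module \<psi>_lin[OF g]])
  have "g = \<Phi> n ?f"
  proof (rule K.cochains_eqI[OF g lin_map_closed[OF \<Phi>_lin f]])
    fix t assume t: "t \<in> \<Delta>'" "card t = n"
    note i = insert_e_chain[OF t]
    have "\<Phi> n ?f t = chain_ext (Suc n) N (\<psi> n g) (dl (Suc n) (insert e t))"
      using t dl_closed by (simp add: \<Phi>_def)
    also have "\<dots> = \<psi> n g (insert e t)"
      by (rule chain_ext_dl[OF N_left_module _ i]) (use \<psi>_closed[OF g] in \<open>simp add: support_module_simps\<close>)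
    also have "\<dots> = g t"
      using act_e_insert[OF t(1)] i insert_e(2)[OF t(1)] by (simp add: \<psi>_def)
    finally show "g t = \<Phi> n ?f t" by simp
  qed
  then show "\<exists>f\<in>carrier (hom_module A scal (Q n) N). g = \<Phi> n f" using f by blast
qed

lemma bd_dl: "s \<in> chains (Suc m) \<Longrightarrow>
  bd m (dl (Suc m) s) = (\<Oplus>\<^bsub>C m\<^esub>v\<in>s. scal (sgn (pos v s)) \<odot>\<^bsub>C m\<^esub> dl m (s - {v}))"
  unfolding bd_def by (rule chain_ext_dl[OF C_left_module bd_face_closed])

text \<open>The face of \<open>insert e t\<close> that omits \<open>e\<close> lies in the half-open
  interval and is killed by \<open>f\<close>. Being the largest vertex, \<open>e\<close> shifts no
  position, so the other faces carry the simplicial signs of \<open>t\<close>.\<close>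

lemma \<Phi>_coboundary:
  assumes "f \<in> carrier (hom_module A scal (Q n) N)"
  shows "coboundary K \<Delta>' le n (\<Phi> n f) = \<Phi> (Suc n) (compose (carrier (Q (Suc n))) f (dQ n))"
  unfolding coboundary_def \<Phi>_def[of "Suc n"]
proof (rule restrict_ext)
  interpret C1: left_module A "C (Suc n)" by (rule C_left_module)
  have f: "lin_map A (C (Suc n)) N f" using assms by (simp add: hom_module_simps lin_hom_iff Q_def)
  have fK: "f (dl (Suc n) s) \<in> carrier K" for s
    using lin_map_closed[OF f dl_closed] by (simp add: support_module_simps)
  fix t assume "t \<in> {t \<in> \<Delta>'. card t = Suc n}"
  then have t: "t \<in> \<Delta>'" "card t = Suc n" by auto
  note i = insert_e_chain[OF t] and et = insert_e(2)[OF t(1)]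
  have tD: "t \<in> \<Delta>" and tI: "t \<subseteq> I" and ft: "finite t" using t Delta_finite by (auto simp: Delta'_iff)
  let ?g = "\<lambda>v. sgn (pos v (insert e t)) \<otimes>\<^bsub>K\<^esub> f (dl (Suc n) (insert e t - {v}))"
  have "compose (carrier (Q (Suc n))) f (dQ n) (dl (Suc (Suc n)) (insert e t))
      = f (bd (Suc n) (dl (Suc (Suc n)) (insert e t)))"
    using dl_closed by (simp add: compose_def dQ_def Q_def)
  also have "\<dots> = f (\<Oplus>\<^bsub>C (Suc n)\<^esub>v\<in>insert e t. scal (sgn (pos v (insert e t))) \<odot>\<^bsub>C (Suc n)\<^esub> dl (Suc n) (insert e t - {v}))"
    using bd_dl[OF i] by simp
  also have "\<dots> = (\<Oplus>\<^bsub>N\<^esub>v\<in>insert e t. f (scal (sgn (pos v (insert e t))) \<odot>\<^bsub>C (Suc n)\<^esub> dl (Suc n) (insert e t - {v})))"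
    by (rule lin_map_finsum[OF C_left_module N_left_module f]) (auto intro!: C1.smult_closed dl_closed)
  also have "\<dots> = (\<Oplus>\<^bsub>K\<^esub>v\<in>insert e t. ?g v)"
    unfolding support_module_finsum using fK support_scal[OF Y sgn_closed fK]
    by (intro K.finsum_cong') (auto simp: lin_map_smult[OF f scal_closed[OF sgn_closed] dl_closed])
  also have "\<dots> = ?g e \<oplus>\<^bsub>K\<^esub> (\<Oplus>\<^bsub>K\<^esub>v\<in>t. ?g v)"
    using et ft fK by (intro K.finsum_insert) auto
  also have "?g e = \<zero>\<^bsub>K\<^esub>"
  proof -
    have "insert e t - {e} = t" using et by auto
    moreover have "f (dl (Suc n) t) = \<zero>\<^bsub>K\<^esub>"
      by (rule hom_supported_below[OF f _ tI]) (use tD t in auto)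
    ultimately show ?thesis by simp
  qed
  also have "\<zero>\<^bsub>K\<^esub> \<oplus>\<^bsub>K\<^esub> (\<Oplus>\<^bsub>K\<^esub>v\<in>t. ?g v) = (\<Oplus>\<^bsub>K\<^esub>v\<in>t. ?g v)"
    using fK by (intro K.l_zero K.finsum_closed) auto
  also have "\<dots> = (\<Oplus>\<^bsub>K\<^esub>v\<in>t. ((\<ominus>\<^bsub>K\<^esub> \<one>\<^bsub>K\<^esub>) [^]\<^bsub>K\<^esub> card {u \<in> t. u \<noteq> v \<and> le u v}) \<otimes>\<^bsub>K\<^esub> \<Phi> n f (t - {v}))"
  proof (intro K.finsum_cong' refl)
    fix v assume v: "v \<in> t"
    have ve: "v \<noteq> e" using v et by auto
    have "pos v (insert e t) = pos v t"
      using pos_insert[OF ft et, of v] ve e_not_le[of v] v tI by auto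
    moreover have "insert e t - {v} = insert e (t - {v})" using ve by auto
    moreover have "t - {v} \<in> \<Delta>'" "card (t - {v}) = n"
      using v t tI ft Delta_subset[OF tD] by (auto simp: Delta'_iff)
    ultimately show "?g v = ((\<ominus>\<^bsub>K\<^esub> \<one>\<^bsub>K\<^esub>) [^]\<^bsub>K\<^esub> card {u \<in> t. u \<noteq> v \<and> le u v}) \<otimes>\<^bsub>K\<^esub> \<Phi> n f (t - {v})"
      by (simp add: sgn_def pos_def \<Phi>_def)
  next
    have "\<Phi> n f (t - {v}) \<in> carrier K" if "v \<in> t" for v
      using that t tI ft fK Delta_subset[OF tD] by (simp add: \<Phi>_def Delta'_iff subset_iff)
    then show "(\<lambda>v. ((\<ominus>\<^bsub>K\<^esub> \<one>\<^bsub>K\<^esub>) [^]\<^bsub>K\<^esub> card {u \<in> t. u \<noteq> v \<and> le u v}) \<otimes>\<^bsub>K\<^esub> \<Phi> n f (t - {v})) \<in> t \<rightarrow> carrier K"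
      by auto
  qed
  finally show "(\<Oplus>\<^bsub>K\<^esub>v\<in>t. ((\<ominus>\<^bsub>K\<^esub> \<one>\<^bsub>K\<^esub>) [^]\<^bsub>K\<^esub> card {u \<in> t. u \<noteq> v \<and> le u v}) \<otimes>\<^bsub>K\<^esub> \<Phi> n f (t - {v}))
      = compose (carrier (Q (Suc n))) f (dQ n) (dl (Suc (Suc n)) (insert e t))" by simp
qed

text \<open>Cochains are graded by the number of vertices, so degree \<open>n\<close> on the right
  is reduced cohomology in dimension \<open>n - 1\<close>.\<close>

lemma Ext_chain_cohomology:
  "cochain_complex K (cochains K \<Delta>') (coboundary K \<Delta>' le)"
  "mod_iso K (Ext A scal Q dQ N n) (cohomology (cochains K \<Delta>') (coboundary K \<Delta>' le) n)"
proof -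
  note H = cohomology_transport[where C' = "cochains K \<Delta>'" and \<delta>' = "coboundary K \<Delta>' le" and \<Phi> = \<Phi>,
      OF central.Ext_complex[OF chain_projective_resolution N_left_module]
      K.cochains_left_module \<Phi>_lin \<Phi>_bij \<Phi>_coboundary]
  show "cochain_complex K (cochains K \<Delta>') (coboundary K \<Delta>' le)" by (rule H(1))
  show "mod_iso K (Ext A scal Q dQ N n) (cohomology (cochains K \<Delta>') (coboundary K \<Delta>' le) n)"
    unfolding Ext_def by (rule H(2))
qed

end

lemma mod_iso_trivial:
  assumes "mod_iso K M M'" "carrier M' = {z}" "\<zero>\<^bsub>M\<^esub> \<in> carrier M"
  shows "carrier M = {\<zero>\<^bsub>M\<^esub>}"
proof -
  obtain f where f: "bij_betw f (carrier M) (carrier M')" using assms(1) by (auto simp: mod_iso_def)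
  have "x = \<zero>\<^bsub>M\<^esub>" if "x \<in> carrier M" for x
    using f that assms(2,3) by (metis bij_betw_apply bij_betw_imp_inj_on inj_onD singletonD)
  then show ?thesis using assms(3) by blast
qed

section \<open>The diagonal and the lowest degree\<close>

context support_hom
begin

text \<open>On the diagonal every element of \<open>L\<close> has support above \<open>Y\<close>, so
  by \<open>I_support\<close> there are no vertices. Only the empty simplex is left, with one copy
  of the ground ring as its cochains.\<close>

lemma cohomology_degree_zero:
  assumes "X = Y"
  shows "mod_iso K (cohomology (cochains K \<Delta>') (coboundary K \<Delta>' le) 0) (self_module K)"
proof -
  interpret H: cochain_complex K "cochains K \<Delta>'" "coboundary K \<Delta>' le" by (rule Ext_chain_cohomology(1))
  let ?C = "cochains K \<Delta>' 0"
  interpret C: left_module K ?C by (rule K.cochains_left_module)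
  have I: "I = {}" using I_support L_iff I_iff assms by blast
  then have D: "\<Delta>' = {{}}" by (auto simp: Delta'_iff Delta_iff)
  have Z: "H.cocycles 0 = carrier ?C"
  proof -
    have "{s \<in> \<Delta>'. card s = Suc 0} = {}" using D by auto
    then have "coboundary K \<Delta>' le 0 x = \<zero>\<^bsub>cochains K \<Delta>' (Suc 0)\<^esub>" for x
      by (simp only: coboundary_def cochains_simps restrict_def empty_iff if_False)
    then show ?thesis unfolding H.cocycles_def by simp
  qed
  \<comment> \<open>The only coboundary in degree zero is zero, so classes are singletons and the
    isomorphism is evaluation at the empty simplex.\<close>
  have coset: "{\<zero>\<^bsub>?C\<^esub>} +>\<^bsub>?C\<^esub> x = {x}" if "x \<in> carrier ?C" for x
    using that by (auto simp: a_r_coset_def')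
  have car: "carrier (cohomology (cochains K \<Delta>') (coboundary K \<Delta>' le) 0) = (\<lambda>x. {x}) ` carrier ?C"
    unfolding H.cohomology_eq subquotient_def Z H.coboundaries_def using coset by (auto intro!: image_cong)
  have ops: "{x} \<oplus>\<^bsub>cohomology (cochains K \<Delta>') (coboundary K \<Delta>' le) 0\<^esub> {y} = {x \<oplus>\<^bsub>?C\<^esub> y}"
    "a \<odot>\<^bsub>cohomology (cochains K \<Delta>') (coboundary K \<Delta>' le) 0\<^esub> {x} = {a \<odot>\<^bsub>?C\<^esub> x}"
    if "x \<in> carrier ?C" "a \<in> carrier K" for x y a
    using that unfolding H.cohomology_eq subquotient_def H.coboundaries_def by (auto simp: set_add_def')
  let ?f = "\<lambda>A\<in>carrier (cohomology (cochains K \<Delta>') (coboundary K \<Delta>' le) 0). the_elem A {}"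
  have f: "?f {x} = x {}" if "x \<in> carrier ?C" for x using that by (simp add: car)
  have xK: "x {} \<in> carrier K" if "x \<in> carrier ?C" for x using that by (auto simp: cochains_simps D)
  have "?f \<in> lin_hom K (cohomology (cochains K \<Delta>') (coboundary K \<Delta>' le) 0) (self_module K)"
    unfolding lin_hom_def mem_Collect_eq
  proof (intro conjI ballI)
    let ?H = "cohomology (cochains K \<Delta>') (coboundary K \<Delta>' le) 0"
    show "?f \<in> carrier ?H \<rightarrow>\<^sub>E carrier (self_module K)"
      using xK by (auto simp: car self_module_def)
    fix S assume "S \<in> carrier ?H"
    then obtain x where x: "x \<in> carrier ?C" "S = {x}" by (auto simp: car)
    show "?f (a \<odot>\<^bsub>?H\<^esub> S) = a \<odot>\<^bsub>self_module K\<^esub> ?f S" if a: "a \<in> carrier K" for a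
    proof -
      have "?f (a \<odot>\<^bsub>?H\<^esub> S) = (a \<odot>\<^bsub>?C\<^esub> x) {}"
        using ops(2)[OF x(1) a] f[OF C.smult_closed[OF a x(1)]] x(2) by simp
      also have "\<dots> = a \<otimes>\<^bsub>K\<^esub> x {}" by (simp add: cochains_simps D)
      finally show ?thesis using f[OF x(1)] x(2) by (simp add: self_module_def)
    qed
    fix T assume "T \<in> carrier ?H"
    then obtain y where y: "y \<in> carrier ?C" "T = {y}" by (auto simp: car)
    have "?f (S \<oplus>\<^bsub>?H\<^esub> T) = (x \<oplus>\<^bsub>?C\<^esub> y) {}"
      using ops(1)[OF x(1) K.zero_closed] f[OF C.a_closed[OF x(1) y(1)]] x(2) y(2) by simp
    also have "\<dots> = x {} \<oplus>\<^bsub>K\<^esub> y {}" by (simp add: cochains_simps D)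
    finally show "?f (S \<oplus>\<^bsub>?H\<^esub> T) = ?f S \<oplus>\<^bsub>self_module K\<^esub> ?f T"
      using f[OF x(1)] f[OF y(1)] x(2) y(2) by (simp add: self_module_def)
  qed
  moreover have "bij_betw ?f (carrier (cohomology (cochains K \<Delta>') (coboundary K \<Delta>' le) 0)) (carrier (self_module K))"
  proof (rule bij_betwI')
    let ?H = "cohomology (cochains K \<Delta>') (coboundary K \<Delta>' le) 0"
    fix S T assume "S \<in> carrier ?H" "T \<in> carrier ?H"
    then obtain x y where x: "x \<in> carrier ?C" "S = {x}" and y: "y \<in> carrier ?C" "T = {y}" by (auto simp: car)
    have "x = y" if "x {} = y {}"
      by (rule K.cochains_eqI[OF x(1) y(1)]) (use that D in auto)
    then show "(?f S = ?f T) = (S = T)" using f[OF x(1)] f[OF y(1)] x(2) y(2) by auto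
  next
    show "?f S \<in> carrier (self_module K)" if "S \<in> carrier (cohomology (cochains K \<Delta>') (coboundary K \<Delta>' le) 0)" for S
      using that xK f by (auto simp: car self_module_def)
  next
    fix c assume "c \<in> carrier (self_module K)"
    then have "c \<in> carrier K" by (simp add: self_module_def)
    then have x: "(\<lambda>s\<in>{s \<in> \<Delta>'. card s = 0}. c) \<in> carrier ?C" by (simp add: cochains_simps)
    then have "{\<lambda>s\<in>{s \<in> \<Delta>'. card s = 0}. c} \<in> carrier (cohomology (cochains K \<Delta>') (coboundary K \<Delta>' le) 0)"
      by (simp add: car)
    moreover have "c = ?f {\<lambda>s\<in>{s \<in> \<Delta>'. card s = 0}. c}" using f[OF x] D by simp
    ultimately show "\<exists>S\<in>carrier (cohomology (cochains K \<Delta>') (coboundary K \<Delta>' le) 0). c = ?f S" by blast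
  qed
  ultimately show ?thesis unfolding mod_iso_def by blast
qed

text \<open>For \<open>X = Y\<close> no simplex has a positive number of vertices. For
  \<open>X \<subset> Y\<close> the complex has a vertex, where the coboundary of a cochain on the
  empty simplex takes that cochain's own value; hence a cocycle in degree zero vanishes.\<close>

lemma cohomology_vanishing:
  assumes "(X \<subset> Y \<and> n = 0) \<or> (X = Y \<and> n \<ge> 1)"
  shows "carrier (cohomology (cochains K \<Delta>') (coboundary K \<Delta>' le) n)
    = {\<zero>\<^bsub>cohomology (cochains K \<Delta>') (coboundary K \<Delta>' le) n\<^esub>}"
proof -
  interpret H: cochain_complex K "cochains K \<Delta>'" "coboundary K \<Delta>' le" by (rule Ext_chain_cohomology(1))
  interpret C: left_module K "cochains K \<Delta>' n" by (rule K.cochains_left_module)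
  show ?thesis
  proof (rule H.cohomology_trivial, rule subsetI)
    fix g assume "g \<in> H.cocycles n"
    then have g: "g \<in> carrier (cochains K \<Delta>' n)"
      and g0: "coboundary K \<Delta>' le n g = \<zero>\<^bsub>cochains K \<Delta>' (Suc n)\<^esub>" by (auto simp: H.cocycles_def)
    have "g s = \<zero>\<^bsub>cochains K \<Delta>' n\<^esub> s" if s: "s \<in> \<Delta>'" "card s = n" for s
    proof (cases "X = Y")
      case True
      then have "I = {}" using I_support L_iff I_iff by blast
      then have "s = {}" using s by (simp add: Delta'_iff)
      then show ?thesis using s(2) assms True by simp
    next
      case False
      then have n: "n = 0" and lt: "X \<subset> Y" using assms by auto
      have sf: "finite s" using s(1) Delta_finite by (simp add: Delta'_iff)
      then have s0: "s = {}" using s(2) n by simp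
      obtain x where x: "x \<in> carrier B" "supp x = X" using X by (auto simp: lrb_lattice_def)
      \<comment> \<open>The witness for a vertex: an element of support \<open>X\<close> multiplied
        by \<open>e\<close>, which moves it below \<open>e\<close> without changing the
        support.\<close>
      let ?v = "e \<otimes>\<^bsub>B\<^esub> x"
      have xL: "x \<in> L" using x by (simp add: L_iff)
      have vL: "?v \<in> L" using L_mult_iff[OF e x(1)] e_L xL by simp
      have "supp ?v = X" using lrb_support_mult[OF e x(1)] supp_e x(2) XY by auto
      then have "?v \<noteq> e" using supp_e lt by auto
      moreover have "e \<otimes>\<^bsub>B\<^esub> ?v = ?v" using e x(1) by (simp add: B.m_assoc[symmetric] idem)
      ultimately have v: "?v \<in> I" using vL by (simp add: I_iff)
      have vD: "{?v} \<in> \<Delta>'" using v vL lrb_le_refl[OF L_carrier[OF vL]] by (simp add: Delta'_iff Delta_iff)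
      have gK: "g {} \<in> carrier K" using K.cochains_apply[OF g s] s0 by simp
      have "coboundary K \<Delta>' le n g {?v} = g {}"
        using vD n gK by (simp add: coboundary_def cong: conj_cong)
      moreover have "coboundary K \<Delta>' le n g {?v} = \<zero>\<^bsub>K\<^esub>"
        using g0 vD n by (simp add: cochains_simps)
      ultimately show ?thesis using s s0 by (simp add: cochains_simps)
    qed
    then show "g \<in> {\<zero>\<^bsub>cochains K \<Delta>' n\<^esub>}" using K.cochains_eqI[OF g C.zero_closed] by simp
  qed
qed

end

text \<open>An element of support \<open>Y\<close> lies outside \<open>L\<close>, so it kills every
  chain while being the identity on the target. Already the Hom modules are zero in every
  degree.\<close>

lemma (in chain_resolution) Ext_not_le:
  assumes Y: "Y \<in> \<Lambda>" and XY: "\<not> X \<subseteq> Y"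
  shows "carrier (Ext A scal Q dQ (support_module K B Y) n) = {\<zero>\<^bsub>Ext A scal Q dQ (support_module K B Y) n\<^esub>}"
proof -
  let ?N = "support_module K B Y"
  note N = support_module_left[OF Y]
  interpret E: cochain_complex K "\<lambda>n. hom_module A scal (Q n) ?N" "\<lambda>n f. compose (carrier (Q (Suc n))) f (dQ n)"
    by (rule central.Ext_complex[OF chain_projective_resolution N])
  have eL: "sec Y \<notin> L" using sec[OF Y] XY by (simp add: L_iff)
  show ?thesis unfolding Ext_def
  proof (rule E.cohomology_trivial, rule subsetI)
    fix f assume "f \<in> E.cocycles n"
    then have "f \<in> lin_hom A (C (Suc n)) ?N" unfolding E.cocycles_def by (simp add: hom_module_simps Q_def)
    then have f: "lin_map A (C (Suc n)) ?N f" and fe: "f \<in> extensional (carrier (C (Suc n)))"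
      by (simp_all add: lin_hom_iff)
    interpret N: left_module A ?N by (rule N)
    have z: "lin_map A (C (Suc n)) ?N (\<lambda>x. \<zero>\<^bsub>?N\<^esub>)" by (rule lin_mapI) (simp_all add: N.smult_r_null)
    have "f q = \<zero>\<^bsub>?N\<^esub>" if q: "q \<in> carrier (C (Suc n))" for q
    proof (rule C_hom_eqI[OF N f z _ q])
      fix s assume "s \<in> \<Delta>" "card s = Suc n"
      then have s: "s \<in> chains (Suc n)" by simp
      have fK: "f (dl (Suc n) s) \<in> carrier K" using lin_map_closed[OF f dl_closed, of s] by (simp add: support_module_simps)
      have "f (dl (Suc n) s) = bas (sec Y) \<odot>\<^bsub>?N\<^esub> f (dl (Suc n) s)"
        using support_bas[OF sec(1)[OF Y] fK] sec(2)[OF Y] by simp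
      also have "\<dots> = f (bas (sec Y) \<odot>\<^bsub>C (Suc n)\<^esub> dl (Suc n) s)"
        by (rule lin_map_smult[OF f bas_closed dl_closed, symmetric])
      also have "\<dots> = \<zero>\<^bsub>?N\<^esub>"
        using bas_dl[OF sec(1)[OF Y] s] eL lin_map_zero[OF C_left_module N f] by simp
      finally show "f (dl (Suc n) s) = \<zero>\<^bsub>?N\<^esub>" .
    qed
    then have "f = (\<lambda>x\<in>carrier (C (Suc n)). \<zero>\<^bsub>?N\<^esub>)"
      by (intro extensionalityI[OF fe]) auto
    then show "f \<in> {\<zero>\<^bsub>hom_module A scal (Q n) ?N\<^esub>}" by (simp add: hom_module_simps Q_def)
  qed
qed

theorem theorem4p1:
  fixes K :: "'k ring" and B :: "'b monoid" and X Y :: "'b set" and n :: nat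
    and P :: "nat \<Rightarrow> ('b \<Rightarrow> 'k, 'p) module" and d :: "nat \<Rightarrow> 'p \<Rightarrow> 'p" and \<epsilon> :: "'p \<Rightarrow> 'k"
  assumes "cring K"
    and "left_regular_band B" and "finite (carrier B)"
    and "X \<in> lrb_lattice B" and "Y \<in> lrb_lattice B"
    and "projective_resolution (monoid_algebra K B) P d \<epsilon> (support_module K B X)"
  shows "let E = Ext (monoid_algebra K B) (monoid_algebra_scalar K B) P d (support_module K B Y) n in
         (X \<subset> Y \<and> n \<ge> 1 \<longrightarrow>
            (\<forall>e\<in>carrier B. lrb_support B e = Y \<longrightarrow>
               mod_iso K E (reduced_cohomology K (lrb_complex B X e) (lrb_le B) (n - 1)))) \<and>
         (X = Y \<and> n = 0 \<longrightarrow> mod_iso K E (self_module K)) \<and>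
         (\<not> (X \<subset> Y \<and> n \<ge> 1) \<and> \<not> (X = Y \<and> n = 0) \<longrightarrow> carrier E = {\<zero>\<^bsub>E\<^esub>})"
proof -
  interpret band: left_regular_band B by (rule assms(2))
  interpret chain_resolution K B X
    using assms(1-4) band.monoid_axioms
    by (simp add: chain_resolution_def chain_resolution_axioms_def lrb_algebra_def
        finite_monoid_algebra_def finite_monoid_algebra_axioms_def)
  let ?N = "support_module K B Y"
  note N = support_module_left[OF assms(5)]
  define E where "E = Ext A scal P d ?N n"
  interpret EC: cochain_complex K "\<lambda>n. hom_module A scal (P n) ?N" "\<lambda>n f. compose (carrier (P (Suc n))) f (d n)"
    by (rule central.Ext_complex[OF assms(6) N])
  have iso: "mod_iso K E (Ext A scal Q dQ ?N n)"
    unfolding E_def by (rule central.Ext_resolution_independent[OF assms(6) chain_projective_resolution N])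
  have add: "x \<oplus>\<^bsub>E\<^esub> y \<in> carrier E" if "x \<in> carrier E" "y \<in> carrier E" for x y
    using EC.cohomology_closed(1) that unfolding E_def Ext_def .
  have smult: "a \<odot>\<^bsub>E\<^esub> x \<in> carrier E" if "a \<in> carrier K" "x \<in> carrier E" for a x
    using EC.cohomology_closed(2) that unfolding E_def Ext_def .
  have zero: "\<zero>\<^bsub>E\<^esub> \<in> carrier E"
    using EC.cohomology_closed(3) unfolding E_def Ext_def .
  have hom: "support_hom K B X Y e" if "X \<subseteq> Y" "e \<in> carrier B" "lrb_support B e = Y" for e
    using that chain_resolution_axioms by (simp add: support_hom_def support_hom_axioms_def)
  have coh: "mod_iso K E (cohomology (cochains K (lrb_complex B X e)) (coboundary K (lrb_complex B X e) (lrb_le B)) n)"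
    if "X \<subseteq> Y" "e \<in> carrier B" "lrb_support B e = Y" for e
    by (rule mod_iso_trans[OF iso support_hom.Ext_chain_cohomology(2)[OF hom[OF that]] add smult])
  have main: "mod_iso K E (reduced_cohomology K (lrb_complex B X e) (lrb_le B) (n - 1))"
    if "X \<subset> Y" "n \<ge> 1" "e \<in> carrier B" "lrb_support B e = Y" for e
    \<comment> \<open>\<open>reduced_cohomology\<close> in dimension \<open>q\<close> is the
      cohomology on \<open>q + 1\<close> vertices, and \<open>n \<ge> 1\<close> makes
      \<open>Suc (n - 1)\<close> equal to \<open>n\<close>.\<close>
    using coh[of e] that by (simp add: reduced_cohomology_def)
  \<comment> \<open>The remaining cases mention no element of support \<open>Y\<close>, so the
    chosen one, \<open>sec Y\<close>, is used.\<close>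
  note e = sec[OF assms(5)]
  have diag: "mod_iso K E (self_module K)" if "X = Y" "n = 0"
  proof -
    have XY: "X \<subseteq> Y" using that by simp
    show ?thesis
      using mod_iso_trans[OF coh[OF XY e] _ add smult]
        support_hom.cohomology_degree_zero[OF hom[OF XY e] that(1)] that(2) by simp
  qed
  have vanish: "carrier E = {\<zero>\<^bsub>E\<^esub>}" if "\<not> (X \<subset> Y \<and> n \<ge> 1)" "\<not> (X = Y \<and> n = 0)"
  proof (cases "X \<subseteq> Y")
    case True
    then have "(X \<subset> Y \<and> n = 0) \<or> (X = Y \<and> n \<ge> 1)" using that by auto
    then show ?thesis
      using mod_iso_trivial[OF coh[OF True e] support_hom.cohomology_vanishing[OF hom[OF True e]] zero] by simp
  next
    case False
    then show ?thesis using mod_iso_trivial[OF iso Ext_not_le[OF assms(5)] zero] by simp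
  qed
  show ?thesis
    unfolding Let_def E_def[symmetric] using main diag vanish by blast
qed

end
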